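(* Let $n\ge 2$, and let $\mathfrak g$ be of type $D_n$ or $B_n$, with the numeration of positive roots and the monomial order on signatures specified in the context. Then the semigroup $\Sigma=\Sigma_{\mathfrak g}$ of essential signatures is saturated, i.e. $\Sigma=\Sigma_{\mathbb Q}\cap(\mathfrak t_{\mathbb Z}^*\oplus\mathbb Z^N)$, and it is generated by the essential signatures whose highest weights lie in the set $$\{\omega_1,\ldots,\omega_n,\,2\omega_{n-1},\,2\omega_n,\,\omega_{n-1}+\omega_n\}\quad\text{for } D_n,$$ and in the set $$\{\omega_1,\ldots,\omega_n,\,2\omega_n\}\quad\text{for } B_n.$$
   Context: General notions. Let $\mathfrak g$ be a complex semisimple Lie algebra with triangular decomposition $\mathfrak g=\mathfrak u^-\oplus\mathfrak t\oplus\mathfrak u$, positive roots $\Delta_+$, root vectors $e_{\pm\alpha}$ ($\alpha\in\Delta_+$), and fundamental weights $\omega_1,\dots,\omega_n$. $V(\lambda)$ is the irreducible module with highest weight $\lambda$ and $v_\lambda$ a highest weight vector. Fix a numeration $\Delta_+=\{\alpha_1,\dots,\alpha_N\}$ and a monomial order on $\mathbb Z_{\ge0}^N$ (a total order compatible with addition, with $0$ least). A signature is a tuple $\sigma=(\lambda;p_1,\dots,p_N)$ with $\lambda$ a dominant integral weight (the highest weight of $\sigma$) and $p_i\in\mathbb Z_{\ge 0}$ (the exponents of $\sigma$; $p_i$ is the exponent corresponding to $\alpha_i$). Put $v(\sigma)=\frac{e_{-\alpha_1}^{p_1}}{p_1!}\cdots\frac{e_{-\alpha_N}^{p_N}}{p_N!}v_\lambda\in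 V(\lambda)$. Signatures of the same highest weight are ordered by their exponent tuples via the monomial order. A signature $\sigma$ of highest weight $\lambda$ is essential if $v(\sigma)$ is not in the linear span of the $v(\tau)$ with $\tau<\sigma$ of highest weight $\lambda$. Signatures are added componentwise, and it is known that the essential signatures form a semigroup $\Sigma=\Sigma_{\mathfrak g}$ in $\mathfrak t_{\mathbb Z}^*\oplus\mathbb Z^N$, where $\mathfrak t_{\mathbb Z}\subset\mathfrak t$ is the coroot lattice (so $\mathfrak t_{\mathbb Z}^*$ is the weight lattice). $\Sigma_{\mathbb Q}$ is the rational cone spanned by $\Sigma$. Types. $\pm\varepsilon_1,\dots,\pm\varepsilon_n$ are the nonzero weights of the standard representation of $D_n$ ($\mathfrak{so}_{2n}$) or $B_n$ ($\mathfrak{so}_{2n+1}$). Positive roots of $D_n$: $\varepsilon_i\pm\varepsilon_j$, $i<j$; of $B_n$: these and $\varepsilon_1,\dots,\varepsilon_n$. Fundamental weights: for $B_n$, $\omega_i=\varepsilon_1+\dots+\varepsilon_i$ ($i<n$), $\omega_n=\frac12(\varepsilon_1+\dots+\varepsilon_n)$; for $D_n$, $\omega_i=\varepsilon_1+\dots+\varepsilon_i$ ($i\le n-2$), $\omega_{n-1}=\frac12(\varepsilon_1+\dots+\varepsilon_{n-1}-\varepsilon_n)$, $\omega_n=\frac12(\varepsilon_1+\dots+\varepsilon_n)$. $D_2=A_1+A_1$. Numeration of positive roots. For $D_n$: $\varepsilon_1-\varepsilon_2,\ \varepsilon_1+\varepsilon_2,\ \dots,\ \varepsilon_1-\varepsilon_n,\dots,\varepsilon_{n-1}-\varepsilon_n,\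 \varepsilon_1+\varepsilon_n,\dots,\varepsilon_{n-1}+\varepsilon_n$ (i.e. for $m=2,\dots,n$ successively, the roots $\varepsilon_1-\varepsilon_m,\dots,\varepsilon_{m-1}-\varepsilon_m$ followed by $\varepsilon_1+\varepsilon_m,\dots,\varepsilon_{m-1}+\varepsilon_m$). For $B_n$: the roots of $D_n$ in this order, followed by $\varepsilon_1,\dots,\varepsilon_n$. Monomial order. Degree lexicographic order compares the sums of entries first and then compares lexicographically. For two signatures of $D_n$ of the same highest weight: for $m=n,n-1,\dots,2$ successively, compare first the tuples of exponents corresponding to $\varepsilon_1+\varepsilon_m,\dots,\varepsilon_{m-1}+\varepsilon_m$ by the degree lexicographic order, then those corresponding to $\varepsilon_1-\varepsilon_m,\dots,\varepsilon_{m-1}-\varepsilon_m$ by the degree lexicographic order, moving to the next step only if all earlier tuples coincide. For $B_n$: first compare the tuples of exponents corresponding to $\varepsilon_1,\dots,\varepsilon_n$ by the degree lexicographic order; if they coincide, compare the exponents corresponding to the long roots by the rule for $D_n$. *)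

theory Defs
  imports
    "Jordan_Normal_Form.Matrix"
    "HOL-Library.Function_Algebras"
    "HOL-Library.Product_Plus"
begin

datatype lie_type = TypeB | TypeD


section \<open>Roots and weights\<close>

text \<open>
  A weight is given by its coordinates in the basis \<open>\<epsilon>\<^sub>1, \<dots>, \<epsilon>\<^sub>n\<close>: the value at \<open>i\<close>, for
  \<open>1 \<le> i \<le> n\<close>, is the coefficient of \<open>\<epsilon>\<^sub>i\<close>, and all other values are 0. Addition and negation
  are pointwise. All integral weights have rational coordinates.
\<close>

type_synonym weight = "nat \<Rightarrow> rat"

definition eps :: "nat \<Rightarrow> weight" where
  "eps i = (\<lambda>j. if j = i then 1 else 0)"

definition plus_block :: "nat \<Rightarrow> weight list" where
  "plus_block m = map (\<lambda>i. eps i + eps m) [1..<m]"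

definition minus_block :: "nat \<Rightarrow> weight list" where
  "minus_block m = map (\<lambda>i. eps i - eps m) [1..<m]"

definition short_block :: "nat \<Rightarrow> weight list" where
  "short_block n = map eps [1..<Suc n]"

text \<open>The positive roots, listed in their numeration \<open>\<alpha>\<^sub>1, \<dots>, \<alpha>\<^sub>N\<close>.\<close>

definition pos_root_list :: "lie_type \<Rightarrow> nat \<Rightarrow> weight list" where
  "pos_root_list X n =
     concat (map (\<lambda>m. minus_block m @ plus_block m) [2..<Suc n])
       @ (case X of TypeD \<Rightarrow> [] | TypeB \<Rightarrow> short_block n)"

definition pos_roots :: "lie_type \<Rightarrow> nat \<Rightarrow> weight set" where
  "pos_roots X n = set (pos_root_list X n)"

definition roots :: "lie_type \<Rightarrow> nat \<Rightarrow> weight set" where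
  "roots X n = pos_roots X n \<union> uminus ` pos_roots X n"

definition weight_inner :: "nat \<Rightarrow> weight \<Rightarrow> weight \<Rightarrow> rat" where
  "weight_inner n \<mu> \<nu> = (\<Sum>i = 1..n. \<mu> i * \<nu> i)"

text \<open>The value of \<open>\<mu>\<close> on the coroot of \<open>\<alpha>\<close>.\<close>

definition coroot_pairing :: "nat \<Rightarrow> weight \<Rightarrow> weight \<Rightarrow> rat" where
  "coroot_pairing n \<mu> \<alpha> = 2 * weight_inner n \<mu> \<alpha> / weight_inner n \<alpha> \<alpha>"

definition weight_lattice :: "lie_type \<Rightarrow> nat \<Rightarrow> weight set" where
  "weight_lattice X n =
     {\<mu>. (\<forall>i. i \<notin> {1..n} \<longrightarrow> \<mu> i = 0) \<and> (\<forall>\<alpha>\<in>roots X n. coroot_pairing n \<mu> \<alpha> \<in> \<int>)}"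

definition dominant_weights :: "lie_type \<Rightarrow> nat \<Rightarrow> weight set" where
  "dominant_weights X n =
     {\<mu> \<in> weight_lattice X n. \<forall>\<alpha>\<in>pos_roots X n. 0 \<le> coroot_pairing n \<mu> \<alpha>}"

definition fund_weight :: "lie_type \<Rightarrow> nat \<Rightarrow> nat \<Rightarrow> weight" where
  "fund_weight X n i = (\<lambda>j.
     if j \<notin> {1..n} then 0
     else case X of
       TypeB \<Rightarrow> (if i < n then (if j \<le> i then 1 else 0) else 1/2)
     | TypeD \<Rightarrow> (if i + 2 \<le> n then (if j \<le> i then 1 else 0)
                 else if i + 1 = n then (if j < n then 1/2 else - (1/2))
                 else 1/2))"

definition generator_weights :: "lie_type \<Rightarrow> nat \<Rightarrow> weight set" where
  "generator_weights X n =
     (let \<omega> = fund_weight X n in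
      \<omega> ` {1..n} \<union>
      (case X of
         TypeB \<Rightarrow> {\<omega> n + \<omega> n}
       | TypeD \<Rightarrow> {\<omega> (n - 1) + \<omega> (n - 1), \<omega> n + \<omega> n, \<omega> (n - 1) + \<omega> n}))"


section \<open>The Lie algebras of types B and D\<close>

text \<open>
  The Lie algebra of type \<open>B\<^sub>n\<close> is \<open>\<ss>\<oo>\<^bsub>2n+1\<^esub>(\<complex>)\<close>, that of type \<open>D\<^sub>n\<close> is \<open>\<ss>\<oo>\<^bsub>2n\<^esub>(\<complex>)\<close>. The
  invariant symmetric form has the antidiagonal matrix, so that the diagonal matrices in the Lie
  algebra form a Cartan subalgebra, and the upper and the lower triangular ones form opposite
  Borel subalgebras.
\<close>

definition so_dim :: "lie_type \<Rightarrow> nat \<Rightarrow> nat" where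
  "so_dim X n = (case X of TypeB \<Rightarrow> 2 * n + 1 | TypeD \<Rightarrow> 2 * n)"

definition antidiag_mat :: "nat \<Rightarrow> complex mat" where
  "antidiag_mat d = mat d d (\<lambda>(i, j). if i + j + 1 = d then 1 else 0)"

definition so_alg :: "lie_type \<Rightarrow> nat \<Rightarrow> complex mat set" where
  "so_alg X n = (let d = so_dim X n; J = antidiag_mat d in
     {A \<in> carrier_mat d d. transpose_mat A * J + J * A = 0\<^sub>m d d})"

definition lie_bracket :: "complex mat \<Rightarrow> complex mat \<Rightarrow> complex mat" where
  "lie_bracket A B = A * B - B * A"

definition cartan :: "lie_type \<Rightarrow> nat \<Rightarrow> complex mat set" where
  "cartan X n = {H \<in> so_alg X n. diagonal_mat H}"

text \<open>
  The functional \<open>\<epsilon>\<^sub>i\<close> on the Cartan subalgebra is the \<open>i\<close>-th diagonal entry; matrix indices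
  start at 0.
\<close>

definition weight_eval :: "nat \<Rightarrow> weight \<Rightarrow> complex mat \<Rightarrow> complex" where
  "weight_eval n \<mu> H = (\<Sum>i = 1..n. of_rat (\<mu> i) * H $$ (i - 1, i - 1))"

definition root_space :: "lie_type \<Rightarrow> nat \<Rightarrow> weight \<Rightarrow> complex mat set" where
  "root_space X n \<alpha> =
     {A \<in> so_alg X n. \<forall>H\<in>cartan X n. lie_bracket H A = weight_eval n \<alpha> H \<cdot>\<^sub>m A}"

definition root_vectors :: "lie_type \<Rightarrow> nat \<Rightarrow> (weight \<Rightarrow> complex mat) \<Rightarrow> bool" where
  "root_vectors X n e \<longleftrightarrow>
     (\<forall>\<alpha>\<in>roots X n. e \<alpha> \<in> root_space X n \<alpha> \<and> e \<alpha> \<noteq> 0\<^sub>m (so_dim X n) (so_dim X n))"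


section \<open>Modules\<close>

text \<open>
  The underlying space of a module is a subspace \<open>V\<close> of an ambient complex vector space with
  scalar multiplication \<open>sc\<close>; in this way modules of different dimensions live in one type.
  The action is only relevant for elements of the Lie algebra \<open>L\<close> and vectors of \<open>V\<close>.
\<close>

definition lie_module ::
  "complex mat set \<Rightarrow> (complex \<Rightarrow> 'v \<Rightarrow> 'v) \<Rightarrow> 'v set \<Rightarrow> (complex mat \<Rightarrow> 'v \<Rightarrow> 'v::ab_group_add) \<Rightarrow> bool"
where
  "lie_module L sc V act \<longleftrightarrow>
     module.subspace sc V \<and>
     (\<forall>x\<in>L. \<forall>u\<in>V. act x u \<in> V) \<and>
     (\<forall>x\<in>L. \<forall>u\<in>V. \<forall>w\<in>V. act x (u + w) = act x u + act x w) \<and>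
     (\<forall>x\<in>L. \<forall>c. \<forall>u\<in>V. act x (sc c u) = sc c (act x u)) \<and>
     (\<forall>x\<in>L. \<forall>y\<in>L. \<forall>u\<in>V. act (x + y) u = act x u + act y u) \<and>
     (\<forall>x\<in>L. \<forall>c. \<forall>u\<in>V. act (c \<cdot>\<^sub>m x) u = sc c (act x u)) \<and>
     (\<forall>x\<in>L. \<forall>y\<in>L. \<forall>u\<in>V. act (lie_bracket x y) u = act x (act y u) - act y (act x u))"

definition irreducible_module ::
  "complex mat set \<Rightarrow> (complex \<Rightarrow> 'v \<Rightarrow> 'v) \<Rightarrow> 'v set \<Rightarrow> (complex mat \<Rightarrow> 'v \<Rightarrow> 'v::ab_group_add) \<Rightarrow> bool"
where
  "irreducible_module L sc V act \<longleftrightarrow>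
     lie_module L sc V act \<and> V \<noteq> {0} \<and>
     (\<forall>W. module.subspace sc W \<and> W \<subseteq> V \<and> (\<forall>x\<in>L. \<forall>w\<in>W. act x w \<in> W) \<longrightarrow> W = {0} \<or> W = V)"

definition highest_weight_vector ::
  "lie_type \<Rightarrow> nat \<Rightarrow> (complex \<Rightarrow> 'v \<Rightarrow> 'v) \<Rightarrow> 'v set \<Rightarrow> (complex mat \<Rightarrow> 'v \<Rightarrow> 'v::ab_group_add)
    \<Rightarrow> weight \<Rightarrow> 'v \<Rightarrow> bool"
where
  "highest_weight_vector X n sc V act \<mu> v \<longleftrightarrow>
     v \<in> V \<and> v \<noteq> 0 \<and>
     (\<forall>\<alpha>\<in>pos_roots X n. \<forall>x\<in>root_space X n \<alpha>. act x v = 0) \<and>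
     (\<forall>H\<in>cartan X n. act H v = sc (weight_eval n \<mu> H) v)"

definition irreducible_highest_weight_module ::
  "lie_type \<Rightarrow> nat \<Rightarrow> (complex \<Rightarrow> 'v \<Rightarrow> 'v) \<Rightarrow> 'v set \<Rightarrow> (complex mat \<Rightarrow> 'v \<Rightarrow> 'v::ab_group_add)
    \<Rightarrow> weight \<Rightarrow> 'v \<Rightarrow> bool"
where
  "irreducible_highest_weight_module X n sc V act \<mu> v \<longleftrightarrow>
     irreducible_module (so_alg X n) sc V act \<and> highest_weight_vector X n sc V act \<mu> v"


section \<open>Essential signatures\<close>

text \<open>
  Exponents are indexed by the positive roots themselves: \<open>p \<alpha>\<^sub>i\<close> is the exponent \<open>p\<^sub>i\<close>.
\<close>

definition exponents :: "lie_type \<Rightarrow> nat \<Rightarrow> (weight \<Rightarrow> nat) set" where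
  "exponents X n = {p. \<forall>\<alpha>. \<alpha> \<notin> pos_roots X n \<longrightarrow> p \<alpha> = 0}"

definition deglex :: "(nat list \<times> nat list) set" where
  "deglex = {(xs, ys). sum_list xs < sum_list ys \<or>
                       sum_list xs = sum_list ys \<and> (xs, ys) \<in> lexord less_than}"

text \<open>The groups of positive roots in the order in which their exponents are compared.\<close>

definition order_blocks :: "lie_type \<Rightarrow> nat \<Rightarrow> weight list list" where
  "order_blocks X n =
     (case X of TypeD \<Rightarrow> [] | TypeB \<Rightarrow> [short_block n])
       @ concat (map (\<lambda>m. [plus_block m, minus_block m]) (rev [2..<Suc n]))"

definition exponents_less :: "lie_type \<Rightarrow> nat \<Rightarrow> (weight \<Rightarrow> nat) \<Rightarrow> (weight \<Rightarrow> nat) \<Rightarrow> bool" where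
  "exponents_less X n p q \<longleftrightarrow>
     (map (map p) (order_blocks X n), map (map q) (order_blocks X n)) \<in> lexord deglex"

definition signature_vector ::
  "lie_type \<Rightarrow> nat \<Rightarrow> (weight \<Rightarrow> complex mat) \<Rightarrow> (complex \<Rightarrow> 'v \<Rightarrow> 'v) \<Rightarrow>
     (complex mat \<Rightarrow> 'v \<Rightarrow> 'v::ab_group_add) \<Rightarrow> 'v \<Rightarrow> (weight \<Rightarrow> nat) \<Rightarrow> 'v"
where
  "signature_vector X n e sc act v p =
     foldr (\<lambda>\<alpha> u. sc (1 / fact (p \<alpha>)) ((act (e (- \<alpha>)) ^^ p \<alpha>) u)) (pos_root_list X n) v"

definition essential ::
  "lie_type \<Rightarrow> nat \<Rightarrow> (weight \<Rightarrow> complex mat) \<Rightarrow> (complex \<Rightarrow> 'v \<Rightarrow> 'v) \<Rightarrow>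
     (complex mat \<Rightarrow> 'v \<Rightarrow> 'v::ab_group_add) \<Rightarrow> 'v \<Rightarrow> (weight \<Rightarrow> nat) \<Rightarrow> bool"
where
  "essential X n e sc act v p \<longleftrightarrow>
     signature_vector X n e sc act v p \<notin>
       module.span sc {signature_vector X n e sc act v q | q.
                         q \<in> exponents X n \<and> exponents_less X n q p}"

text \<open>
  Signatures are regarded as elements of \<open>\<tt>\<^sub>\<rat>\<^sup>* \<oplus> \<rat>\<^sup>N\<close>, the factor \<open>\<rat>\<^sup>N\<close> being the functions on
  the positive roots, extended by 0. Addition is componentwise.
\<close>

type_synonym signature = "weight \<times> (weight \<Rightarrow> rat)"

definition essential_signatures ::
  "lie_type \<Rightarrow> nat \<Rightarrow> (weight \<Rightarrow> complex mat) \<Rightarrow> (complex \<Rightarrow> 'v \<Rightarrow> 'v) \<Rightarrow>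
     (weight \<Rightarrow> complex mat \<Rightarrow> 'v \<Rightarrow> 'v::ab_group_add) \<Rightarrow> (weight \<Rightarrow> 'v) \<Rightarrow> signature set"
where
  "essential_signatures X n e sc act v =
     {(\<mu>, \<lambda>\<alpha>. of_nat (p \<alpha>)) | \<mu> p. \<mu> \<in> dominant_weights X n \<and> p \<in> exponents X n \<and>
                                essential X n e sc (act \<mu>) (v \<mu>) p}"

definition signature_lattice :: "lie_type \<Rightarrow> nat \<Rightarrow> signature set" where
  "signature_lattice X n =
     {(\<mu>, p). \<mu> \<in> weight_lattice X n \<and> (\<forall>\<alpha>\<in>pos_roots X n. p \<alpha> \<in> \<int>) \<and>
              (\<forall>\<alpha>. \<alpha> \<notin> pos_roots X n \<longrightarrow> p \<alpha> = 0)}"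

definition signature_scale :: "rat \<Rightarrow> signature \<Rightarrow> signature" where
  "signature_scale c \<sigma> = (\<lambda>i. c * fst \<sigma> i, \<lambda>\<alpha>. c * snd \<sigma> \<alpha>)"

definition rational_cone :: "signature set \<Rightarrow> signature set" where
  "rational_cone S =
     {\<Sum>\<sigma>\<in>F. signature_scale (c \<sigma>) \<sigma> | F c. finite F \<and> F \<subseteq> S \<and> (\<forall>\<sigma>\<in>F. 0 \<le> c \<sigma>)}"

text \<open>The zero signature is essential, so semigroups have to contain 0, the empty sum.\<close>

definition generated_semigroup :: "signature set \<Rightarrow> signature set" where
  "generated_semigroup S = {sum_list \<sigma>s | \<sigma>s. set \<sigma>s \<subseteq> S}"

definition saturated :: "lie_type \<Rightarrow> nat \<Rightarrow> signature set \<Rightarrow> bool" where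
  "saturated X n S \<longleftrightarrow> S = rational_cone S \<inter> signature_lattice X n"

end

theory Submission
 imports Defs
begin

text \<open>
 For each type, \<open>patX\<close> describes a rational cone of signatures by linear inequalities of
 Gelfand-Tsetlin type, one set of inequalities for every block of roots. An essential signature
 satisfies them: if one fails, then a power of a simple lowering operator kills the vector obtained
 from the earlier blocks modulo smaller ones, and a suitable monomial applied to it expresses the
 monomial by smaller ones. Conversely, if the highest weight is a generator weight, then the row
 below it is again of this kind, there are few rows to compare, and weights together with an
 \<open>sl\<^sub>2\<close> calculation show by induction on the rank that all patterns are essential. Essential
 signatures may be added, since the tensor product of two highest weight vectors generates the
 module of the sum of the weights; the complete reducibility needed here is replaced by the
 Casimir operator. Finally, every integral pattern is a sum of integral patterns of generator weight,
 split off by clamping all rows to \<open>[-h, h]\<close> with \<open>h = 1\<close> or \<open>h = 1/2\<close>. Hence the essential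
 signatures are the integral points of the cone.
\<close>

section \<open>Actions of the orthogonal Lie algebras\<close>

text \<open>Signed indices make every root a difference \<open>ev i - ev j\<close>, so one bracket
  formula serves both types. The operators act on the whole ambient type, a module being extended by
  a linear projection; thus no membership conditions enter the calculations. The induction on the
  rank works because "highest weight vector" is always meant modulo a stable subspace
  \<open>W\<close> containing the smaller monomials. The operators \<open>F (- m) k\<close>, for all
  signed k, form the nilradical opposite to a parabolic of so(2m) with so(2m - 2) in its Levi part.
  A bracket with the parabolic stays in this nilradical or falls into the Levi part, which lowers
  the degree; hence an order by degree first. The obstacle in the lower bound: for the row 1^k 0...0
  the vector lowered by \<epsilon>_(k-1) - \<epsilon>_m and \<epsilon>_k + \<epsilon>_m has a weight
  that can also occur in the so(2m - 2)-module of the unlowered vector, so weights cannot separate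
  the two. The operator \<open>Phi\<close>, equivariant under so(2m - 2), does. For sums, the pair
  of the tensor and the third vector generates an irreducible module, so that a relation between
  monomials of the third vector lifts to the tensor.\<close>

definition idx0 :: "nat => int set" where
 "idx0 r = {i. i \<noteq> 0 \<and> \<bar>i\<bar> <= int r}"

definition idx :: "lie_type => nat => int set" where
 "idx X n = (case X of TypeB => insert 0 (idx0 n) | TypeD => idx0 n)"

lemma idx0_iff [simp]: "i \<in> idx0 r \<longleftrightarrow> i \<noteq> 0 \<and> \<bar>i\<bar> <= int r"
 by (simp add: idx0_def)

lemma finite_idx0 [simp]: "finite (idx0 r)"
 by (rule finite_subset[of _ "{- int r..int r}"]) auto

lemma idx0_idx: "idx0 n \<subseteq> idx X n"
 by (auto simp: idx_def split: lie_type.split)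

lemma idx_le: "i \<in> idx X n ==> \<bar>i\<bar> <= int n"
 by (auto simp: idx_def split: lie_type.splits)

lemma idx_nonzero: "i \<in> idx0 n ==> i \<in> idx X n"
 using idx0_idx by blast

lemma finite_idx [simp]: "finite (idx X n)"
 by (simp add: idx_def split: lie_type.split)

lemma idx_uminus [simp]: "- i \<in> idx X n \<longleftrightarrow> i \<in> idx X n"
 by (auto simp: idx_def split: lie_type.split)

text \<open>
 The indices are ordered as \<open>1, 2, \<dots>, n, 0, -n, \<dots>, -1\<close>; with the operators below, \<open>F i j\<close>
 raises weights if \<open>i\<close> comes before \<open>j\<close>.
\<close>

definition prec :: "int => int => bool" where
 "prec i j \<longleftrightarrow> (if i > 0 then j <= 0 \<or> i < j else j < 0 \<and> (i = 0 \<or> i < j))"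

lemma prec_total: "prec i j \<or> i = j \<or> prec j i"
 by (auto simp: prec_def)

lemma prec_asym: "prec i j ==> \<not> prec j i"
 by (auto simp: prec_def split: if_splits)

lemma prec_uminus [simp]: "prec (- j) (- i) = prec i j"
 by (auto simp: prec_def)

text \<open>The weights of the standard representation: \<epsilon>_k for positive k, its negative
  for negative k, and 0 for the index 0 of type B.\<close>

definition ev :: "int => weight" where
 "ev k = (%i. of_bool (int i = k) - of_bool (int i = - k))"

text \<open>The eigenvalue of \<open>F k k\<close> on a vector of weight \<mu>, that is, the odd
  extension of the coordinates to signed indices.\<close>

definition ext :: "weight => int => rat" where
 "ext \<mu> k = (if k > 0 then \<mu> (nat k) else if k < 0 then - \<mu> (nat (- k)) else 0)"

lemma ev_uminus [simp]: "ev (- k) = - ev k"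
 by (auto simp: ev_def fun_eq_iff)

lemma ev_0 [simp]: "ev 0 = 0"
 by (auto simp: ev_def fun_eq_iff)

lemma ev_pos: "i > 0 ==> ev (int i) = eps i"
 by (auto simp: ev_def eps_def fun_eq_iff)

lemma ext_uminus [simp]: "ext \<mu> (- k) = - ext \<mu> k"
 by (auto simp: ext_def)

lemma ext_int [simp]: "i > 0 ==> ext \<mu> (int i) = \<mu> i"
 by (auto simp: ext_def)

lemma ext_0 [simp]: "ext \<mu> 0 = 0"
 by (auto simp: ext_def)

lemma ext_add: "ext (\<mu> + \<nu>) k = ext \<mu> k + ext \<nu> k"
 and ext_diff: "ext (\<mu> - \<nu>) k = ext \<mu> k - ext \<nu> k"
 by (auto simp: ext_def)

lemma ext_ev: "ext (ev k) l = of_bool (k = l \<and> k \<noteq> 0) - of_bool (k = - l \<and> k \<noteq> 0)"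
 by (auto simp: ext_def ev_def)

text \<open>The torus only sees the coordinates 1 to n. Weights supported there are equal as
  functions as soon as their eigenvalues agree.\<close>

definition supp :: "nat => weight => bool" where
 "supp n \<mu> \<longleftrightarrow> (\<forall>i. i \<notin> {1..n} --> \<mu> i = 0)"

lemma supp_ev: "\<bar>k\<bar> <= int n ==> supp n (ev k)"
 by (auto simp: supp_def ev_def)

lemma supp_add: "supp n \<mu> ==> supp n \<nu> ==> supp n (\<mu> + \<nu>)"
 and supp_diff: "supp n \<mu> ==> supp n \<nu> ==> supp n (\<mu> - \<nu>)"
 by (auto simp: supp_def)

lemma supp_0: "supp n 0"
 by (auto simp: supp_def)

lemma supp_eqI: "supp n \<mu> ==> supp n \<nu> ==> (\<And>i. 1 <= i ==> i <= n ==> \<mu> i = \<nu> i) ==> \<mu> = \<nu>"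
 by (auto simp: supp_def fun_eq_iff) metis

text \<open>Sums of positive roots with indices in \<open>A\<close>. The pair i = - j is excluded:
  it would contribute \<open>2 * ev i\<close>, which is not a root, and \<open>F i (- i)\<close>
  vanishes.\<close>

inductive_set pos_cone :: "int set => weight set" for A where
 zero: "0 \<in> pos_cone A"
| add: "\<gamma> \<in> pos_cone A ==> i \<in> A ==> j \<in> A ==> prec i j ==> i \<noteq> - j ==> \<gamma> + (ev i - ev j) \<in> pos_cone A"

lemma supp_pos_cone: "\<gamma> \<in> pos_cone A ==> A \<subseteq> idx X n ==> supp n \<gamma>"
proof (induction rule: pos_cone.induct)
 case (add \<gamma> i j)
 hence "\<bar>i\<bar> <= int n" "\<bar>j\<bar> <= int n" using idx_le by blast+
 thus ?case using add by (intro supp_add supp_diff supp_ev) auto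
qed (simp add: supp_0)

text \<open>The relations of the matrices E(i,j) - E(-j,-i), imposed on operators that are linear on
  the whole type.\<close>

locale so_rep = vector_space sc
 for sc :: "complex => 'v::ab_group_add => 'v" +
 fixes X :: lie_type and n :: nat and F :: "int => int => 'v => 'v"
 assumes F_add: "i \<in> idx X n ==> j \<in> idx X n ==> F i j (u + w) = F i j u + F i j w"
  and F_scale: "i \<in> idx X n ==> j \<in> idx X n ==> F i j (sc c u) = sc c (F i j u)"
  and F_anti: "i \<in> idx X n ==> j \<in> idx X n ==> F (- j) (- i) u = - F i j u"
  and F_comm: "\<And>i j k l u. i \<in> idx X n ==> j \<in> idx X n ==> k \<in> idx X n ==> l \<in> idx X n ==>
   F i j (F k l u) - F k l (F i j u) =
    (if j = k then F i l u else 0) - (if i = l then F k j u else 0)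
    - (if i = - k then F (- j) l u else 0) + (if j = - l then F k (- i) u else 0)"
begin

abbreviation "I \<equiv> idx X n"

lemma F_0 [simp]: "i \<in> I ==> j \<in> I ==> F i j 0 = 0"
 using F_scale[of i j 0 0] by simp

lemma F_neg: "i \<in> I ==> j \<in> I ==> F i j (- u) = - F i j u"
 using F_scale[of i j "-1" u] by simp

lemma F_diff: "i \<in> I ==> j \<in> I ==> F i j (u - w) = F i j u - F i j w"
 using F_add[of i j u "- w"] F_neg[of i j w] by simp

lemma F_sum: "i \<in> I ==> j \<in> I ==> F i j (\<Sum>x\<in>S. f x) = (\<Sum>x\<in>S. F i j (f x))"
 by (induction S rule: infinite_finite_induct) (auto simp: F_add)

lemma double_zero: "u = - u ==> u = 0" for u :: 'v
proof -
 assume "u = - u"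
 hence "sc 2 u = 0" using scale_left_distrib[of 1 1 u] by (metis add.right_inverse one_add_one scale_one)
 thus ?thesis by simp
qed

lemma F_anti_diag [simp]: "i \<in> I ==> F i (- i) u = 0"
 using F_anti[of i "- i" u] double_zero by simp

lemma F_swap: "i \<in> I ==> j \<in> I ==> F i j u = - F (- j) (- i) u"
 using F_anti[of i j u] by simp

lemma F_F: "i \<in> I ==> j \<in> I ==> k \<in> I ==> l \<in> I ==>
   F i j (F k l u) = F k l (F i j u) +
    (if j = k then F i l u else 0) - (if i = l then F k j u else 0)
    - (if i = - k then F (- j) l u else 0) + (if j = - l then F k (- i) u else 0)"
 using F_comm[of i j k l u] by (simp add: algebra_simps)

subsection \<open>Stable subspaces\<close>

definition stab :: "(int \<times> int) set => 'v set => bool" where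
 "stab G W \<longleftrightarrow> subspace W \<and> (\<forall>(i, j)\<in>G. \<forall>u\<in>W. F i j u \<in> W)"

text \<open>The least \<open>G\<close>-stable subspace containing \<open>B\<close>. An inductive set
  gives rule induction over generated submodules, and \<open>G\<close> may be any set of index
  pairs, in particular one describing a subalgebra.\<close>

inductive_set clos :: "(int \<times> int) set => 'v set => 'v set" for G B where
 base: "u \<in> B ==> u \<in> clos G B"
| zero: "0 \<in> clos G B"
| add: "u \<in> clos G B ==> w \<in> clos G B ==> u + w \<in> clos G B"
| scale: "u \<in> clos G B ==> sc c u \<in> clos G B"
| op: "(i, j) \<in> G ==> u \<in> clos G B ==> F i j u \<in> clos G B"

lemma stab_subspace: "stab G W ==> subspace W"
 by (simp add: stab_def)

lemma stabD: "stab G W ==> (i, j) \<in> G ==> u \<in> W ==> F i j u \<in> W"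
 by (auto simp: stab_def)

lemma stab_mono: "stab G W ==> H \<subseteq> G ==> stab H W"
 unfolding stab_def by blast

lemma subspace_clos: "subspace (clos G B)"
 by (simp add: subspace_def clos.zero clos.add clos.scale)

lemma stab_clos: "stab G (clos G B)"
 by (auto simp: stab_def subspace_clos clos.op)

lemma clos_min: "x \<in> clos G B ==> B \<subseteq> W ==> stab G W ==> x \<in> W"
 by (induction rule: clos.induct)
   (auto simp: subspace_0 subspace_add subspace_scale stab_subspace dest: stabD)

lemma clos_least: "B \<subseteq> W ==> stab G W ==> clos G B \<subseteq> W"
 using clos_min by blast

lemma clos_mono: "B \<subseteq> C ==> G \<subseteq> H ==> clos G B \<subseteq> clos H C"
 by (rule clos_least) (use clos.base stab_clos stab_mono in blast)+

lemma stab_funpow: "stab G W ==> (i, j) \<in> G ==> u \<in> W ==> (F i j ^^ k) u \<in> W"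
 by (induction k) (auto dest: stabD)

subsection \<open>Weight vectors\<close>

definition wtv :: "weight => 'v => bool" where
 "wtv \<mu> u \<longleftrightarrow> (\<forall>i\<in>{1..n}. F (int i) (int i) u = sc (of_rat (\<mu> i)) u)"

lemma nat_idx: "i \<in> {1..n} ==> int i \<in> I"
 by (rule idx_nonzero) auto

lemma wtv_0 [simp]: "wtv \<mu> 0"
 unfolding wtv_def using nat_idx by (metis F_0 scale_zero_right)

lemma wtv_add: "wtv \<mu> u ==> wtv \<mu> w ==> wtv \<mu> (u + w)"
 unfolding wtv_def by (metis F_add nat_idx scale_right_distrib)

lemma wtv_scale: "wtv \<mu> u ==> wtv \<mu> (sc c u)"
 unfolding wtv_def by (metis F_scale nat_idx scale_left_commute)

lemma wtv_ext:
 assumes "wtv \<mu> u" "k \<in> I"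
 shows "F k k u = sc (of_rat (ext \<mu> k)) u"
proof -
 consider "k > 0" | "k = 0" | "k < 0" by linarith
 thus ?thesis
 proof cases
  case 1
  hence "nat k \<in> {1..n}" using idx_le[OF assms(2)] by auto
  hence "F (int (nat k)) (int (nat k)) u = sc (of_rat (\<mu> (nat k))) u"
   using assms(1) unfolding wtv_def by blast
  thus ?thesis using 1 by (simp add: ext_def)
 next
  case 2
  thus ?thesis using F_anti_diag[of 0 u] assms by simp
 next
  case 3
  hence "nat (- k) \<in> {1..n}" using idx_le[OF assms(2)] by auto
  hence "F (int (nat (- k))) (int (nat (- k))) u = sc (of_rat (\<mu> (nat (- k)))) u"
   using assms(1) unfolding wtv_def by blast
  hence "F (- k) (- k) u = sc (of_rat (\<mu> (nat (- k)))) u" using 3 by simp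
  thus ?thesis using F_swap[OF assms(2) assms(2)] 3
   by (simp add: ext_def of_rat_minus)
 qed
qed

lemma F_wtv:
 assumes "wtv \<mu> u" "k \<in> I" "l \<in> I"
 shows "wtv (\<mu> + (ev k - ev l)) (F k l u)"
 unfolding wtv_def
proof
 fix i assume i: "i \<in> {1..n}"
 hence ii: "int i \<in> I" by (rule nat_idx)
 have e: "F (int i) (int i) u = sc (of_rat (\<mu> i)) u" using assms(1) i by (auto simp: wtv_def)
 have "F (int i) (int i) (F k l u) = sc (of_rat (\<mu> i)) (F k l u) +
    (if int i = k then F k l u else 0) - (if int i = l then F k l u else 0)
    - (if int i = - k then F k l u else 0) + (if int i = - l then F k l u else 0)"
  using F_F[OF ii ii assms(2,3), of u] by (auto simp: e F_scale assms(2,3))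
 also have "\<dots> = sc (of_rat ((\<mu> + (ev k - ev l)) i)) (F k l u)"
  using i by (auto simp: ev_def of_rat_add of_rat_diff scale_left_distrib scale_left_diff_distrib
    of_rat_minus algebra_simps)
 finally show "F (int i) (int i) (F k l u) = sc (of_rat ((\<mu> + (ev k - ev l)) i)) (F k l u)" .
qed

lemma funpow_wtv:
 assumes "wtv \<mu> u" "k \<in> I" "l \<in> I"
 shows "wtv (\<mu> + (%i. of_nat N * (ev k i - ev l i))) ((F k l ^^ N) u)"
proof (induction N)
 case 0
 thus ?case using assms by (simp add: zero_fun_def[symmetric])
next
 case (Suc N)
 have "\<mu> + (%i. of_nat N * (ev k i - ev l i)) + (ev k - ev l) = \<mu> + (%i. of_nat (Suc N) * (ev k i - ev l i))"
  by (auto simp: fun_eq_iff algebra_simps)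
 thus ?case using F_wtv[OF Suc assms(2,3)] unfolding funpow.simps o_apply by metis
qed

text \<open>Weight components modulo a stable subspace: the usual separation of eigenvectors.\<close>

lemma weight_components:
 assumes W: "stab {(int i, int i) |i. i \<in> {1..n}} W"
  and "finite S" "\<And>\<mu>. \<mu> \<in> S ==> wtv \<mu> (x \<mu>)" "\<And>\<mu>. \<mu> \<in> S ==> supp n \<mu>"
  and "(\<Sum>\<mu>\<in>S. x \<mu>) \<in> W" "\<kappa> \<in> S"
 shows "x \<kappa> \<in> W"
 using assms(2-)
proof (induction "card S" arbitrary: S x \<kappa> rule: less_induct)
 case less
 note sub = stab_subspace[OF W]
 show ?case
 proof (cases "S = {\<kappa>}")
  case True
  thus ?thesis using less.prems by simp
 next
  case False
  then obtain \<mu> where mu: "\<mu> \<in> S" "\<mu> \<noteq> \<kappa>" using less.prems by blast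
  then obtain i where i: "i \<in> {1..n}" "\<mu> i \<noteq> \<kappa> i"
   using supp_eqI[of n \<mu> \<kappa>] less.prems(3,5) by fastforce
  have ii: "int i \<in> I" using i by (intro nat_idx)
  \<comment> \<open>Applying \<open>F i i\<close> minus its eigenvalue at \<mu> removes the
    component \<mu> and multiplies the component \<kappa> by a nonzero scalar.\<close>
  define y where "y = (%\<nu>. sc (of_rat (\<nu> i) - of_rat (\<mu> i)) (x \<nu>))"
  have "F (int i) (int i) (\<Sum>\<nu>\<in>S. x \<nu>) - sc (of_rat (\<mu> i)) (\<Sum>\<nu>\<in>S. x \<nu>) \<in> W"
   using less.prems(4) i by (intro subspace_diff[OF sub] subspace_scale[OF sub] stabD[OF W]) auto
  also have "F (int i) (int i) (\<Sum>\<nu>\<in>S. x \<nu>) - sc (of_rat (\<mu> i)) (\<Sum>\<nu>\<in>S. x \<nu>) = (\<Sum>\<nu>\<in>S. y \<nu>)"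
  proof -
   have "F (int i) (int i) (x \<nu>) = sc (of_rat (\<nu> i)) (x \<nu>)" if "\<nu> \<in> S" for \<nu>
    using less.prems(2)[OF that] i by (auto simp: wtv_def)
   thus ?thesis
    by (simp add: F_sum ii scale_sum_right y_def scale_left_diff_distrib sum_subtractf)
  qed
  also have "(\<Sum>\<nu>\<in>S. y \<nu>) = (\<Sum>\<nu>\<in>S - {\<mu>}. y \<nu>)"
   using less.prems(1) mu by (subst sum.remove[of S \<mu>]) (auto simp: y_def)
  finally have 1: "(\<Sum>\<nu>\<in>S - {\<mu>}. y \<nu>) \<in> W" .
  have "card (S - {\<mu>}) < card S" using less.prems(1) mu by (meson card_Diff1_less)
  hence "y \<kappa> \<in> W"
  proof (rule less.hyps)
   show "wtv \<nu> (y \<nu>)" if "\<nu> \<in> S - {\<mu>}" for \<nu>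
    unfolding y_def by (rule wtv_scale, rule less.prems(2)) (use that in simp)
   show "supp n \<nu>" if "\<nu> \<in> S - {\<mu>}" for \<nu>
    by (rule less.prems(3)) (use that in simp)
  qed (use less.prems(1,5) mu 1 in simp_all)
  moreover have "of_rat (\<kappa> i) - of_rat (\<mu> i) \<noteq> (0::complex)" using i by simp
  ultimately show ?thesis
   using subspace_scale[OF sub, of "y \<kappa>" "1 / (of_rat (\<kappa> i) - of_rat (\<mu> i))"]
   by (simp add: y_def)
 qed
qed

text \<open>Weight decompositions modulo \<open>W\<close>: the weights are those of representatives
  in the ambient space, so no quotient space is needed.\<close>

definition wspan :: "'v set => weight set => 'v set" where
 "wspan W L = {u. \<exists>S x. finite S \<and> S \<subseteq> L \<and> (\<forall>\<mu>\<in>S. wtv \<mu> (x \<mu>)) \<and> u - (\<Sum>\<mu>\<in>S. x \<mu>) \<in> W}"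

lemma subspace_wspan:
 assumes W: "subspace W"
 shows "subspace (wspan W L)"
 unfolding subspace_def
proof (intro conjI ballI allI)
 show "0 \<in> wspan W L"
  unfolding wspan_def using subspace_0[OF W] by (intro CollectI exI[of _ "{}"]) simp
next
 fix u w assume "u \<in> wspan W L" "w \<in> wspan W L"
 then obtain S x T y where
  S: "finite S" "S \<subseteq> L" "\<And>\<mu>. \<mu>\<in>S ==> wtv \<mu> (x \<mu>)" "u - (\<Sum>\<mu>\<in>S. x \<mu>) \<in> W" and
  T: "finite T" "T \<subseteq> L" "\<And>\<mu>. \<mu>\<in>T ==> wtv \<mu> (y \<mu>)" "w - (\<Sum>\<mu>\<in>T. y \<mu>) \<in> W"
  unfolding wspan_def by blast
 define z where "z = (%\<mu>. (if \<mu> \<in> S then x \<mu> else 0) + (if \<mu> \<in> T then y \<mu> else 0))"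
 have "(\<Sum>\<mu>\<in>S \<union> T. z \<mu>) = (\<Sum>\<mu>\<in>S \<union> T. if \<mu> \<in> S then x \<mu> else 0) + (\<Sum>\<mu>\<in>S \<union> T. if \<mu> \<in> T then y \<mu> else 0)"
  by (simp add: z_def sum.distrib)
 also have "(\<Sum>\<mu>\<in>S \<union> T. if \<mu> \<in> S then x \<mu> else 0) = (\<Sum>\<mu>\<in>S. x \<mu>)"
  using S(1) T(1) by (simp add: sum.inter_restrict[symmetric] Int_absorb1)
 also have "(\<Sum>\<mu>\<in>S \<union> T. if \<mu> \<in> T then y \<mu> else 0) = (\<Sum>\<mu>\<in>T. y \<mu>)"
  using S(1) T(1) by (simp add: sum.inter_restrict[symmetric] Int_absorb1)
 finally have "u + w - (\<Sum>\<mu>\<in>S \<union> T. z \<mu>) = (u - (\<Sum>\<mu>\<in>S. x \<mu>)) + (w - (\<Sum>\<mu>\<in>T. y \<mu>))"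
  by (simp add: algebra_simps)
 hence "u + w - (\<Sum>\<mu>\<in>S \<union> T. z \<mu>) \<in> W" using subspace_add[OF W S(4) T(4)] by metis
 moreover have "wtv \<mu> (z \<mu>)" if "\<mu> \<in> S \<union> T" for \<mu>
  using that S T by (auto simp: z_def intro!: wtv_add)
 ultimately show "u + w \<in> wspan W L"
  unfolding wspan_def using S T by (intro CollectI exI[of _ "S \<union> T"] exI[of _ z]) auto
next
 fix c u assume "u \<in> wspan W L"
 then obtain S x where
  S: "finite S" "S \<subseteq> L" "\<And>\<mu>. \<mu>\<in>S ==> wtv \<mu> (x \<mu>)" "u - (\<Sum>\<mu>\<in>S. x \<mu>) \<in> W"
  unfolding wspan_def by blast
 have "sc c u - (\<Sum>\<mu>\<in>S. sc c (x \<mu>)) = sc c (u - (\<Sum>\<mu>\<in>S. x \<mu>))"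
  by (simp add: scale_right_diff_distrib scale_sum_right)
 thus "sc c u \<in> wspan W L"
  unfolding wspan_def using S subspace_scale[OF W] wtv_scale
  by (intro CollectI exI[of _ S] exI[of _ "%\<mu>. sc c (x \<mu>)"]) auto
qed

lemma wspan_base: "subspace W ==> u \<in> W ==> u \<in> wspan W L"
 unfolding wspan_def by (intro CollectI exI[of _ "{}"]) simp

lemma wspan_wtv: "subspace W ==> wtv \<mu> u ==> \<mu> \<in> L ==> u \<in> wspan W L"
 unfolding wspan_def by (intro CollectI exI[of _ "{\<mu>}"] exI[of _ "%_. u"]) (simp add: subspace_0)

lemma wspan_F:
 assumes W: "stab G W" and G: "(k, l) \<in> G" and kl: "k \<in> I" "l \<in> I"
  and u: "u \<in> wspan W L" and L: "\<And>\<mu>. \<mu> \<in> L ==> \<mu> + (ev k - ev l) \<in> M"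
 shows "F k l u \<in> wspan W M"
proof -
 note sub = stab_subspace[OF W]
 obtain S x where
  S: "finite S" "S \<subseteq> L" "\<And>\<mu>. \<mu>\<in>S ==> wtv \<mu> (x \<mu>)" "u - (\<Sum>\<mu>\<in>S. x \<mu>) \<in> W"
  using u unfolding wspan_def by blast
 have "F k l u = F k l (u - (\<Sum>\<mu>\<in>S. x \<mu>)) + (\<Sum>\<mu>\<in>S. F k l (x \<mu>))"
  by (simp add: F_diff kl F_sum)
 moreover have "F k l (u - (\<Sum>\<mu>\<in>S. x \<mu>)) \<in> wspan W M"
  using S(4) stabD[OF W G] wspan_base[OF sub] by blast
 moreover have "(\<Sum>\<mu>\<in>S. F k l (x \<mu>)) \<in> wspan W M"
 proof (rule subspace_sum[OF subspace_wspan[OF sub]])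
  fix \<mu> assume "\<mu> \<in> S"
  thus "F k l (x \<mu>) \<in> wspan W M"
   using S L by (intro wspan_wtv[OF sub F_wtv[OF _ kl]]) auto
 qed
 ultimately show ?thesis using subspace_add[OF subspace_wspan[OF sub]] by simp
qed

text \<open>Bringing \<open>u\<close> to the other side gives a sum of weight vectors of distinct
  weights that lies in \<open>W\<close>; then every component lies in \<open>W\<close>.\<close>

lemma wspan_separate:
 assumes W: "stab {(int i, int i) |i. i \<in> {1..n}} W"
  and u: "u \<in> wspan W L" "wtv \<kappa> u" and s: "supp n \<kappa>" "\<And>\<mu>. \<mu> \<in> L ==> supp n \<mu>" and "\<kappa> \<notin> L"
 shows "u \<in> W"
proof -
 note sub = stab_subspace[OF W]
 obtain S x where
  S: "finite S" "S \<subseteq> L" "\<And>\<mu>. \<mu>\<in>S ==> wtv \<mu> (x \<mu>)" "u - (\<Sum>\<mu>\<in>S. x \<mu>) \<in> W"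
  using u unfolding wspan_def by blast
 define y where "y = (%\<mu>. if \<mu> = \<kappa> then - u else x \<mu>)"
 have "\<kappa> \<notin> S" using S assms by blast
 hence "(\<Sum>\<mu>\<in>insert \<kappa> S. y \<mu>) = - u + (\<Sum>\<mu>\<in>S. x \<mu>)"
  using S(1) by (subst sum.insert) (auto simp: y_def intro!: sum.cong)
 hence "(\<Sum>\<mu>\<in>insert \<kappa> S. y \<mu>) \<in> W" using subspace_neg[OF sub S(4)] by simp
 moreover have "wtv \<kappa> (- u)" using wtv_scale[OF u(2), of "-1"] by simp
 ultimately have "y \<kappa> \<in> W"
 proof (intro weight_components[OF W, of "insert \<kappa> S" y])
  show "supp n \<mu>" if "\<mu> \<in> insert \<kappa> S" for \<mu> using that s S(2) by blast
  show "wtv \<mu> (y \<mu>)" if "\<mu> \<in> insert \<kappa> S" for \<mu>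
   using that S(3) \<open>wtv \<kappa> (- u)\<close> by (cases "\<mu> = \<kappa>") (simp_all add: y_def)
 qed (use S(1) in simp_all)
 hence "- u \<in> W" by (simp add: y_def)
 from subspace_neg[OF sub this] show ?thesis by (simp only: minus_minus)
qed

lemma wspan_nonzero_component:
 assumes W: "stab {(int i, int i) |i. i \<in> {1..n}} W"
  and u: "u \<in> wspan {0} L" "u \<in> W" "u \<noteq> 0" and s: "\<And>\<mu>. \<mu> \<in> L ==> supp n \<mu>"
 shows "\<exists>\<mu>\<in>L. \<exists>w\<in>W. w \<noteq> 0 \<and> wtv \<mu> w"
proof -
 obtain S x where
  S: "finite S" "S \<subseteq> L" "\<And>\<mu>. \<mu>\<in>S ==> wtv \<mu> (x \<mu>)" "u = (\<Sum>\<mu>\<in>S. x \<mu>)"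
  using u(1) unfolding wspan_def by auto
 then obtain \<mu> where mu: "\<mu> \<in> S" "x \<mu> \<noteq> 0" using u(3) by (metis sum.neutral)
 have "x \<mu> \<in> W"
 proof (rule weight_components[OF W S(1,3)])
  show "supp n \<nu>" if "\<nu> \<in> S" for \<nu> using that s S(2) by blast
 qed (use u(2) S(4) mu in simp_all)
 thus ?thesis using mu S(3)[OF mu(1)] subsetD[OF S(2) mu(1)] by metis
qed

definition raises_into :: "int set => 'v set => 'v => bool" where
 "raises_into A W v \<longleftrightarrow> (\<forall>i\<in>A. \<forall>j\<in>A. prec i j --> F i j v \<in> W)"

text \<open>Raising operators are pushed to the right through a lowering word until they meet
  \<open>v\<close>, where they fall into \<open>W\<close>. So the lowering words already span a
  submodule modulo \<open>W\<close>.\<close>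

lemma highest_weight_lowering:
 assumes A: "A \<subseteq> I" "\<And>i. i \<in> A ==> - i \<in> A" and W: "stab (A \<times> A) W"
  and v: "wtv \<mu> v" "raises_into A W v"
 shows "clos (A \<times> A) (insert v W) \<subseteq> clos {(i, j). i \<in> A \<and> j \<in> A \<and> prec j i} (insert v W)"
proof -
 define Low where "Low = {(i, j). i \<in> A \<and> j \<in> A \<and> prec j i}"
 define Y where "Y = clos Low (insert v W)"
 have Low: "Low \<subseteq> A \<times> A" by (auto simp: Low_def)
 note subY = subspace_clos[of Low "insert v W", folded Y_def]
 have FY: "F i j y \<in> Y" if "y \<in> Y" "i \<in> A" "j \<in> A" for y i j
  using that unfolding Y_def
 proof (induction arbitrary: i j rule: clos.induct)
  case (base u)
  show ?case
  proof (cases "u \<in> W")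
   case True
   hence "F i j u \<in> W" using stabD[OF W] base by auto
   thus ?thesis by (auto intro: clos.base)
  next
   case False
   hence u: "u = v" using base by auto
   consider "prec i j" | "i = j" | "prec j i" using prec_total by blast
   thus ?thesis
   proof cases
    case 1
    hence "F i j u \<in> W" using v(2) base(2,3) unfolding u raises_into_def by blast
    thus ?thesis by (simp add: clos.base)
   next
    case 2
    have "i \<in> I" using A(1) base(2) by blast
    thus ?thesis using 2 unfolding u by (simp add: wtv_ext[OF v(1)] clos.scale clos.base)
   next
    case 3
    hence "(i, j) \<in> Low" using base by (simp add: Low_def)
    thus ?thesis by (rule clos.op) (rule clos.base[OF base(1)])
   qed
  qed
 next
  case zero
  hence "i \<in> I" "j \<in> I" using A(1) by blast+
  thus ?case by (simp add: clos.zero)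
 next
  case (add u w)
  hence "i \<in> I" "j \<in> I" using A(1) by blast+
  thus ?case using add.IH[OF add.prems] by (simp add: F_add clos.add)
 next
  case (scale u c)
  hence "i \<in> I" "j \<in> I" using A(1) by blast+
  thus ?case using scale.IH[OF scale.prems] by (simp add: F_scale clos.scale)
 next
  case (op k l u)
  hence kl: "k \<in> A" "l \<in> A" by (auto simp: Low_def)
  have c: "(if P then F a b u else 0) \<in> Y" if "a \<in> A" "b \<in> A" for P a b
   using op.IH[OF that] by (simp add: Y_def clos.zero)
  have 0: "F k l (F i j u) \<in> Y" unfolding Y_def by (rule clos.op[OF op.hyps(1) op.IH[OF op.prems]])
  have "F k l (F i j u) + (if j = k then F i l u else 0) - (if i = l then F k j u else 0)
    - (if i = - k then F (- j) l u else 0) + (if j = - l then F k (- i) u else 0) \<in> Y"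
   using op.prems kl A(2) by (intro subspace_add[OF subY] subspace_diff[OF subY] c 0) simp_all
  thus ?case
   using F_F[OF subsetD[OF A(1) op.prems(1)] subsetD[OF A(1) op.prems(2)]
    subsetD[OF A(1) kl(1)] subsetD[OF A(1) kl(2)], of u] by (simp only: Y_def)
 qed
 have "stab (A \<times> A) Y" unfolding stab_def using FY subY by blast
 hence "clos (A \<times> A) (insert v W) \<subseteq> Y"
  by (intro clos_least) (auto simp: Y_def intro: clos.base)
 thus ?thesis unfolding Y_def Low_def .
qed

lemma highest_weight_span:
 assumes A: "A \<subseteq> I" "\<And>i. i \<in> A ==> - i \<in> A" and W: "stab (A \<times> A) W"
  and v: "wtv \<mu> v" "raises_into A W v"
 shows "clos (A \<times> A) (insert v W) \<subseteq> wspan W {\<mu> - \<gamma> |\<gamma>. \<gamma> \<in> pos_cone A}" (is "_ \<subseteq> wspan W ?L")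
proof -
 define Low where "Low = {(i, j). i \<in> A \<and> j \<in> A \<and> prec j i}"
 have Low: "Low \<subseteq> A \<times> A" by (auto simp: Low_def)
 have "clos (A \<times> A) (insert v W) \<subseteq> clos Low (insert v W)"
  unfolding Low_def by (rule highest_weight_lowering[OF A W v])
 also have "\<dots> \<subseteq> wspan W ?L"
 proof (rule clos_least)
  note sub = stab_subspace[OF W]
  have "\<mu> \<in> ?L" by (rule CollectI, rule exI[of _ 0]) (simp add: pos_cone.zero)
  thus "insert v W \<subseteq> wspan W ?L"
   using wspan_base[OF sub] wspan_wtv[OF sub v(1)] by auto
  show "stab Low (wspan W ?L)"
   unfolding stab_def
  proof (intro conjI subspace_wspan sub ballI, clarify)
   fix i j u assume ij: "(i, j) \<in> Low" and u: "u \<in> wspan W ?L"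
   show "F i j u \<in> wspan W ?L"
   proof (cases "i = - j")
    case True
    have "j \<in> I" using ij A(1) unfolding Low_def by blast
    hence "F i j u = 0" using F_anti_diag[of i u] True by simp
    thus ?thesis using subspace_0[OF subspace_wspan[OF sub]] by simp
   next
    case False
    show ?thesis
    proof (rule wspan_F[OF W _ _ _ u])
     show "(i, j) \<in> A \<times> A" "i \<in> I" "j \<in> I" using ij Low A(1) by blast+
     fix \<nu> assume "\<nu> \<in> ?L"
     then obtain \<gamma> where g: "\<nu> = \<mu> - \<gamma>" "\<gamma> \<in> pos_cone A" by blast
     have "\<gamma> + (ev j - ev i) \<in> pos_cone A"
      using g(2) ij False by (intro pos_cone.add) (simp_all add: Low_def)
     moreover have "\<nu> + (ev i - ev j) = \<mu> - (\<gamma> + (ev j - ev i))"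
      using g(1) by (simp add: algebra_simps)
     ultimately show "\<nu> + (ev i - ev j) \<in> ?L" by blast
    qed
   qed
  qed
 qed
 finally show ?thesis .
qed

text \<open>Modulo \<open>W\<close>, all weights of the module generated by \<open>v\<close> lie
  below \<mu>; a weight vector whose weight does not is zero modulo \<open>W\<close>.\<close>

lemma highest_weight_separate:
 assumes A: "A \<subseteq> I" "\<And>i. i \<in> A ==> - i \<in> A" and W: "stab (A \<times> A) W"
  and T: "stab {(int i, int i) |i. i \<in> {1..n}} W"
  and v: "wtv \<mu> v" "raises_into A W v" "supp n \<mu>"
  and u: "u \<in> clos (A \<times> A) (insert v W)" "wtv \<kappa> u" "supp n \<kappa>" "\<mu> - \<kappa> \<notin> pos_cone A"
 shows "u \<in> W"
proof (rule wspan_separate[OF T subsetD[OF highest_weight_span[OF A W v(1,2)] u(1)] u(2,3)])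
 show "supp n \<nu>" if L: "\<nu> \<in> {\<mu> - \<gamma> |\<gamma>. \<gamma> \<in> pos_cone A}" for \<nu>
 proof -
  obtain \<gamma> where "\<nu> = \<mu> - \<gamma>" "\<gamma> \<in> pos_cone A" using L by auto
  thus ?thesis using supp_diff[OF v(3) supp_pos_cone[OF _ A(1)]] by simp
 qed
 show "\<kappa> \<notin> {\<mu> - \<gamma> |\<gamma>. \<gamma> \<in> pos_cone A}"
 proof
  assume "\<kappa> \<in> {\<mu> - \<gamma> |\<gamma>. \<gamma> \<in> pos_cone A}"
  then obtain \<gamma> where "\<kappa> = \<mu> - \<gamma>" "\<gamma> \<in> pos_cone A" by auto
  thus False using u(4) by simp
 qed
qed

end

context so_rep
begin

subsection \<open>Strings of a root subalgebra\<close>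

text \<open>The squared length of the root \<open>ev i - ev j\<close>. Hence
  \<open>2 * (ext \<mu> i - ext \<mu> j) / dbl i j\<close> is the value of \<mu> on its
  coroot.\<close>

definition dbl :: "int => int => rat" where
 "dbl i j = (if i = 0 \<or> j = 0 then 1 else 2)"

text \<open>The formula for e f^(k+1) v with e = \<open>F i j\<close> and f = \<open>F j i\<close>.
  The element \<open>F i i - F j j\<close> is not normalised: one step down lowers its eigenvalue by
  \<open>dbl i j\<close>, which is 1 for short roots.\<close>

lemma sl2_string:
 assumes ij: "i \<in> I" "j \<in> I" "i \<noteq> j" "i \<noteq> - j" and v: "wtv \<mu> v"
  and W: "stab {(i, j), (j, i)} W" "F i j v \<in> W"
 shows "F i j ((F j i ^^ Suc k) v)
  - sc (of_rat (of_nat (Suc k) * (ext \<mu> i - ext \<mu> j - dbl i j * of_nat k / 2))) ((F j i ^^ k) v) \<in> W"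
proof (induction k)
 note sub = stab_subspace[OF W(1)]
 have br: "F i j (F j i u) = F j i (F i j u) + (F i i u - F j j u)" for u
  using F_F[of i j j i u] ij by auto
 have h: "F i i u - F j j u = sc (of_rat (ext \<mu> i - ext \<mu> j - dbl i j * of_nat k)) u"
  if "u = (F j i ^^ k) v" for k u
 proof -
  let ?\<nu> = "\<mu> + (%a. of_nat k * (ev j a - ev i a))"
  have "wtv ?\<nu> u" using funpow_wtv[OF v ij(2,1)] that by simp
  hence "F i i u - F j j u = sc (of_rat (ext ?\<nu> i - ext ?\<nu> j)) u"
   using ij by (simp add: wtv_ext of_rat_diff scale_left_diff_distrib)
  moreover have "ext ?\<nu> i - ext ?\<nu> j = ext \<mu> i - ext \<mu> j - dbl i j * of_nat k"
  proof -
   have "ext (%a. of_nat k * (ev j a - ev i a)) l = of_nat k * (ext (ev j) l - ext (ev i) l)" for l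
    by (auto simp: ext_def algebra_simps)
   thus ?thesis using ij by (auto simp: ext_add ext_ev dbl_def)
  qed
  ultimately show ?thesis by simp
 qed
 {
  case 0
  have "F j i (F i j v) \<in> W" using W by (auto dest: stabD)
  thus ?case using br[of v] h[of v 0] by simp
 next
  case (Suc k)
  let ?c = "of_rat (of_nat (Suc k) * (ext \<mu> i - ext \<mu> j - dbl i j * of_nat k / 2))"
  let ?u = "(F j i ^^ Suc k) v"
  have "F j i (F i j ?u - sc ?c ((F j i ^^ k) v)) \<in> W"
   using Suc by (intro stabD[OF W(1)]) auto
  hence "F j i (F i j ?u) - sc ?c ?u \<in> W"
   using ij by (simp add: F_diff F_scale)
  moreover have "F i j ((F j i ^^ Suc (Suc k)) v) = F j i (F i j ?u)
    + sc (of_rat (ext \<mu> i - ext \<mu> j - dbl i j * of_nat (Suc k))) ?u"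
   using br[of ?u] h[of ?u "Suc k"] by simp
  moreover have "sc (of_rat (of_nat (Suc (Suc k)) * (ext \<mu> i - ext \<mu> j - dbl i j * of_nat (Suc k) / 2))) ?u
   = sc ?c ?u + sc (of_rat (ext \<mu> i - ext \<mu> j - dbl i j * of_nat (Suc k))) ?u"
   by (simp only: scale_left_distrib[symmetric] of_rat_add[symmetric])
     (rule arg_cong[where f = "%q. sc (of_rat q) ?u"], simp add: field_simps)
  ultimately show ?case by (simp add: algebra_simps)
 }
qed

text \<open>While the coefficient in \<open>sl2_string\<close> is nonzero, e leads from f^(k+1) v
  back to f^k v modulo \<open>W\<close>.\<close>

lemma sl2_alive:
 assumes ij: "i \<in> I" "j \<in> I" "i \<noteq> j" "i \<noteq> - j" and v: "wtv \<mu> v"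
  and W: "stab {(i, j), (j, i)} W" "F i j v \<in> W"
  and "v \<notin> W" "\<And>m. m < k ==> 2 * (ext \<mu> i - ext \<mu> j) \<noteq> dbl i j * of_nat m"
 shows "(F j i ^^ k) v \<notin> W"
 using assms(9)
proof (induction k)
 case (Suc k)
 note sub = stab_subspace[OF W(1)]
 let ?c = "of_nat (Suc k) * (ext \<mu> i - ext \<mu> j - dbl i j * of_nat k / 2)"
 show ?case
 proof
  assume "(F j i ^^ Suc k) v \<in> W"
  hence "F i j ((F j i ^^ Suc k) v) \<in> W" using stabD[OF W(1), of i j] by auto
  from subspace_diff[OF sub this sl2_string[OF ij v W, of k]]
  have *: "sc (of_rat ?c) ((F j i ^^ k) v) \<in> W" by simp
  have "ext \<mu> i - ext \<mu> j - dbl i j * of_nat k / 2 \<noteq> 0" using Suc.prems[of k] by (simp add: field_simps)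
  hence "?c \<noteq> 0" by (simp only: mult_eq_0_iff of_nat_eq_0_iff) simp
  hence "(F j i ^^ k) v \<in> W" using subspace_scale[OF sub *, of "1 / of_rat ?c"]
   by (simp only: scale_scale) (simp del: of_nat_Suc)
  moreover have "(F j i ^^ k) v \<notin> W" by (rule Suc.IH) (rule Suc.prems, simp)
  ultimately show False by simp
 qed
qed (use assms(8) in simp)

definition nilp :: "int => int => bool" where
 "nilp i j \<longleftrightarrow> (\<forall>u. \<exists>N. (F i j ^^ N) u = 0)"

text \<open>Consider the least power of f that sends \<open>v\<close> into \<open>W\<close>.
  Applying e shows that the coefficient in front of the preceding power vanishes, and this
  determines the pairing.\<close>

lemma sl2_dominant:
 assumes ij: "i \<in> I" "j \<in> I" "i \<noteq> j" "i \<noteq> - j" and v: "wtv \<mu> v"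
  and W: "stab {(i, j), (j, i)} W" "F i j v \<in> W" and nil: "\<exists>N. (F j i ^^ N) v \<in> W" and "v \<notin> W"
 shows "\<exists>N::nat. 2 * (ext \<mu> i - ext \<mu> j) = dbl i j * of_nat N \<and> (F j i ^^ Suc N) v \<in> W"
proof -
 define M where "M = (LEAST N. (F j i ^^ N) v \<in> W)"
 have M: "(F j i ^^ M) v \<in> W" using nil unfolding M_def by (rule LeastI_ex)
 then obtain N where N: "M = Suc N" using \<open>v \<notin> W\<close> by (cases M) auto
 have "(F j i ^^ m) v \<notin> W" if "m <= N" for m
  using that N not_less_Least[of m "%N. (F j i ^^ N) v \<in> W"] unfolding M_def by auto
 hence "\<exists>m. m < Suc N \<and> 2 * (ext \<mu> i - ext \<mu> j) = dbl i j * of_nat m"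
  using sl2_alive[OF ij v W \<open>v \<notin> W\<close>, of "Suc N"] M unfolding N by metis
 then obtain m where m: "m < Suc N" "2 * (ext \<mu> i - ext \<mu> j) = dbl i j * of_nat m" by blast
 have "(F j i ^^ Suc m) v \<in> W"
 proof -
  have "F i j ((F j i ^^ Suc N) v) \<in> W" using stabD[OF W(1), of i j] M N by auto
  hence *: "sc (of_rat (of_nat (Suc N) * (ext \<mu> i - ext \<mu> j - dbl i j * of_nat N / 2))) ((F j i ^^ N) v) \<in> W"
   using subspace_diff[OF stab_subspace[OF W(1)] _ sl2_string[OF ij v W, of N]] by fastforce
  have "N = m"
  proof (rule ccontr)
   assume "N \<noteq> m"
   let ?c = "of_nat (Suc N) * (ext \<mu> i - ext \<mu> j - dbl i j * of_nat N / 2)"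
   have "?c = of_nat (Suc N) * (dbl i j * (of_nat m - of_nat N) / 2)" using m(2) by (simp add: field_simps)
   hence "?c \<noteq> 0" using \<open>N \<noteq> m\<close> by (auto simp: dbl_def)
   hence "(F j i ^^ N) v \<in> W"
    using subspace_scale[OF stab_subspace[OF W(1)] *, of "1 / of_rat ?c"] by simp
   thus False using \<open>\<And>m. m <= N ==> (F j i ^^ m) v \<notin> W\<close> by simp
  qed
  thus ?thesis using M N by simp
 qed
 thus ?thesis using m by blast
qed

text \<open>For \<open>v\<close> outside \<open>W\<close> the pairing is the natural number found in
  \<open>sl2_dominant\<close>, and N exceeds it, so the string has ended.\<close>

lemma sl2_kill:
 assumes ij: "i \<in> I" "j \<in> I" "i \<noteq> j" "i \<noteq> - j" and v: "wtv \<mu> v"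
  and W: "stab {(i, j), (j, i)} W" "F i j v \<in> W" and nil: "nilp j i"
  and N: "2 * (ext \<mu> i - ext \<mu> j) < dbl i j * of_nat N"
 shows "(F j i ^^ N) v \<in> W"
proof (cases "v \<in> W")
 case True
 thus ?thesis using W by (intro stab_funpow[OF W(1)]) auto
next
 case False
 obtain K where "(F j i ^^ K) v = 0" using nil by (auto simp: nilp_def)
 hence "\<exists>K. (F j i ^^ K) v \<in> W" using subspace_0[OF stab_subspace[OF W(1)]] by metis
 from sl2_dominant[OF ij v W this False]
 obtain M where M: "2 * (ext \<mu> i - ext \<mu> j) = dbl i j * of_nat M" "(F j i ^^ Suc M) v \<in> W" by blast
 have "M < N" using M(1) N by (auto simp: dbl_def split: if_splits)
 then obtain d where "N = d + Suc M" using less_imp_Suc_add by (metis add.commute add_Suc_right)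
 hence "(F j i ^^ N) v = (F j i ^^ d) ((F j i ^^ Suc M) v)" by (simp only: funpow_add o_apply)
 thus ?thesis using M(2) stab_funpow[OF W(1), of j i _ d] by auto
qed

end

section \<open>Filtrations by a block of root vectors\<close>

definition deglt :: "nat => (nat => nat) => (nat => nat) => bool" where
 "deglt r b c \<longleftrightarrow> (map b [1..<Suc r], map c [1..<Suc r]) \<in> deglex"

text \<open>Effect on the exponents of replacing a letter i by j. The truncated difference at
  \<open>b i = 0\<close> is harmless, since in \<open>derivation_Yb\<close> the term carries the
  factor \<open>b i\<close>.\<close>

definition shift :: "nat => nat => (nat => nat) => nat => nat" where
 "shift i j b = (%k. if k = i then b i - 1 else if k = j then b j + 1 else b k)"

text \<open>Folding \<open>F s\<close> over this word from the right lets the operator of the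
  largest index act first, as in the numeration of the roots.\<close>

definition expo_word :: "nat => (nat => nat) => int list" where
 "expo_word r b = concat (map (%i. replicate (b i) (int i)) [1..<Suc r])"

lemma sum_list_map_upt: "sum_list (map b [1..<Suc r]) = (\<Sum>i = 1..r. b i)"
 for b :: "nat => nat"
proof -
 have "set [1..<Suc r] = {1..r}" by auto
 thus ?thesis by (subst interv_sum_list_conv_sum_set_nat) (rule arg_cong)
qed

lemma set_expo_word: "set (expo_word r b) \<subseteq> int ` {1..r}"
 by (auto simp: expo_word_def)

lemma length_expo_word: "length (expo_word r b) = (\<Sum>i = 1..r. b i)"
 using sum_list_map_upt[of b r] by (simp add: expo_word_def length_concat comp_def del: upt_Suc)

lemma count_expo_word:
 "count (mset (expo_word r b)) k = (if k > 0 \<and> k <= int r then b (nat k) else 0)"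
proof (induction r)
 case (Suc r)
 have "expo_word (Suc r) b = expo_word r b @ replicate (b (Suc r)) (int (Suc r))"
  by (simp add: expo_word_def)
 moreover have "nat (1 + int r) = Suc r" by simp
 ultimately show ?case using Suc by auto
qed (simp add: expo_word_def)

lemma deglt_degree: "(\<Sum>i = 1..r. b i) < (\<Sum>i = 1..r. c i) ==> deglt r b c"
 unfolding deglt_def deglex_def sum_list_map_upt[symmetric] by blast

lemma deglt_lex:
 assumes "(\<Sum>i = 1..r. b i) = (\<Sum>i = 1..r. c i)" "k \<in> {1..r}" "b k < c k"
  "\<And>i. 1 <= i ==> i < k ==> b i = c i"
 shows "deglt r b c"
proof -
 have s: "[1..<Suc r] = [1..<k] @ k # [Suc k..<Suc r]"
  using assms(2) upt_add_eq_append[of 1 k "Suc r - k"] upt_conv_Cons[of k "Suc r"] by (simp del: upt_Suc)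
 have p: "map b [1..<k] = map c [1..<k]" using assms(4) by auto
 have "(map b [1..<Suc r], map c [1..<Suc r]) \<in> lexord less_than"
  unfolding s map_append p by (rule lexord_append_leftI) (simp add: assms(3) del: upt_Suc)
 thus ?thesis using assms(1) unfolding deglt_def deglex_def sum_list_map_upt[symmetric] by blast
qed

lemma sum_shift:
 assumes "i \<in> {1..r}" "j \<in> {1..r}" "i \<noteq> j" "b i > 0"
 shows "(\<Sum>k = 1..r. shift i j b k) = (\<Sum>k = 1..r. b k)"
proof -
 have "(\<Sum>k\<in>{1..r}. shift i j b k) = shift i j b i + (shift i j b j + (\<Sum>k\<in>{1..r} - {i} - {j}. shift i j b k))"
  using assms sum.remove[of "{1..r}" i "shift i j b"] sum.remove[of "{1..r} - {i}" j "shift i j b"] by simp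
 also have "(\<Sum>k\<in>{1..r} - {i} - {j}. shift i j b k) = (\<Sum>k\<in>{1..r} - {i} - {j}. b k)"
  by (intro sum.cong) (auto simp: shift_def)
 also have "shift i j b i + (shift i j b j + (\<Sum>k\<in>{1..r} - {i} - {j}. b k)) = (\<Sum>k\<in>{1..r}. b k)"
  using assms sum.remove[of "{1..r}" i b] sum.remove[of "{1..r} - {i}" j b] by (simp add: shift_def)
 finally show ?thesis .
qed

lemma deglt_shift:
 assumes "i \<in> {1..r}" "j \<in> {1..r}" "i < j" "b i > 0"
 shows "deglt r (shift i j b) b"
proof (rule deglt_lex)
 show "(\<Sum>k = 1..r. shift i j b k) = (\<Sum>k = 1..r. b k)" using assms by (intro sum_shift) auto
qed (use assms in \<open>auto simp: shift_def\<close>)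

lemma mset_expo_shift:
 assumes "i \<in> {1..r}" "j \<in> {1..r}" "i \<noteq> j" "b i > 0"
 shows "mset (expo_word r (shift i j b)) = mset (expo_word r b) - {#int i#} + {#int j#}"
proof (rule multiset_eqI)
 fix k :: int
 show "count (mset (expo_word r (shift i j b))) k = count (mset (expo_word r b) - {#int i#} + {#int j#}) k"
 proof (cases "k > 0 \<and> k <= int r")
  case True
  then obtain m where "k = int m" using zero_less_imp_eq_int by blast
  thus ?thesis using assms True by (simp add: count_expo_word shift_def)
 next
  case False
  hence "k \<noteq> int i" "k \<noteq> int j" using assms by auto
  thus ?thesis using False by (auto simp add: count_expo_word)
 qed
qed

lemma deglt_trans: "deglt r a b ==> deglt r b c ==> deglt r a c"
proof -
 have t: "trans (lexord less_than)" by (intro lexord_transI transI) auto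
 show "deglt r a b ==> deglt r b c ==> deglt r a c"
  unfolding deglt_def deglex_def mem_Collect_eq prod.case
  using transD[OF t, of "map a [1..<Suc r]" "map b [1..<Suc r]" "map c [1..<Suc r]"] by linarith
qed

lemma deglt_total:
 "deglt r b c \<or> deglt r c b \<or> (\<forall>i\<in>{1..r}. b i = c i)"
proof -
 have "(map b [1..<Suc r], map c [1..<Suc r]) \<in> lexord less_than \<or> map b [1..<Suc r] = map c [1..<Suc r]
  \<or> (map c [1..<Suc r], map b [1..<Suc r]) \<in> lexord less_than"
  by (rule lexord_linear) auto
 moreover have "\<forall>i\<in>{1..r}. b i = c i" if "map b [1..<Suc r] = map c [1..<Suc r]"
  using that by (auto simp del: upt_Suc)
 ultimately show ?thesis unfolding deglt_def deglex_def mem_Collect_eq prod.case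
  using linorder_less_linear[of "sum_list (map b [1..<Suc r])" "sum_list (map c [1..<Suc r])"] by argo
qed

lemma deglt_irrefl: "\<not> deglt r b b"
 unfolding deglt_def deglex_def mem_Collect_eq prod.case
 using lexord_irreflexive[of less_than "map b [1..<Suc r]"] by simp

lemma deglt_cong: "(\<And>i. i \<in> {1..r} ==> b i = b' i) ==> (\<And>i. i \<in> {1..r} ==> c i = c' i) ==> deglt r b c = deglt r b' c'"
proof -
 assume "\<And>i. i \<in> {1..r} ==> b i = b' i" "\<And>i. i \<in> {1..r} ==> c i = c' i"
 hence "map b [1..<Suc r] = map b' [1..<Suc r]" "map c [1..<Suc r] = map c' [1..<Suc r]"
  by (auto simp del: upt_Suc)
 thus ?thesis unfolding deglt_def by (simp only:)
qed

lemma wf_deglt: "wf {(b, c). deglt r b c}"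
proof -
 have "wf (inv_image (less_than <*lex*> lex less_than) (%b. (sum_list (map b [1..<Suc r]), map b [1..<Suc r])))"
  by (intro wf_inv_image wf_lex_prod wf_less_than wf_lex)
 thus ?thesis
  by (rule wf_subset) (auto simp: deglt_def deglex_def lexord_lex simp del: upt_Suc)
qed

text \<open>
 One block \<open>F s 1, \<dots>, F s r\<close> of root vectors, together with a family \<open>G\<close> of operators that
 contains the action of \<open>\<ss>\<oo>\<^bsub>2r\<^esub>\<close> and normalises the span of the \<open>F s k\<close> up to lower degree.
 Everything happens modulo \<open>W\<close>. The layer \<open>K d\<close> contains the words of length less than \<open>d\<close>;
 modulo lower layers, the \<open>F s k\<close> commute.
\<close>

locale block = so_rep sc X n F
 for sc :: "complex => 'v::ab_group_add => 'v" and X n F +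
 fixes s :: int and r :: nat and G :: "(int \<times> int) set" and W :: "'v set" and v :: 'v
 assumes s: "s \<in> I" "s \<notin> idx0 r" and r: "r <= n"
  and G: "G \<subseteq> I \<times> I" "idx0 r \<times> idx0 r \<subseteq> G"
  and brG: "\<And>i j. (i, j) \<in> G ==> (i, j) \<notin> idx0 r \<times> idx0 r ==>
    \<exists>c. \<forall>k\<in>idx0 r. \<forall>N u. stab G N --> u \<in> N --> F i j (F s k u) - F s k (F i j u) - sc c (F s k u) \<in> N"
  and brU: "\<And>k l N u. k \<in> idx0 r ==> l \<in> idx0 r ==> stab G N ==> u \<in> N ==>
    F s k (F s l u) - F s l (F s k u) \<in> N"
  and W: "stab (G \<union> {s} \<times> idx0 r) W"
  and v: "\<And>k. k \<in> {1..r} ==> F s (- int k) v \<in> W"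
begin

lemma sub: "subspace W" and stabG: "stab G W"
 using W by (auto simp: stab_def)

lemma F_s_W: "k \<in> idx0 r ==> u \<in> W ==> F s k u \<in> W"
 using stabD[OF W] by blast

lemma idx_r: "k \<in> idx0 r ==> k \<in> I"
 using r by (intro idx_nonzero) auto

definition Y :: "int list => 'v => 'v" where
 "Y w u = foldr (F s) w u"

lemma Y_simps [simp]: "Y [] u = u" "Y (k # w) u = F s k (Y w u)" "Y (w @ w') u = Y w (Y w' u)"
 by (simp_all add: Y_def)

definition K :: "nat => 'v set" where
 "K d = clos G (W \<union> {Y w v |w. set w \<subseteq> idx0 r \<and> length w < d})"

lemma stab_K: "stab G (K d)"
 by (simp add: K_def stab_clos)

lemma subspace_K: "subspace (K d)"
 by (rule stab_subspace[OF stab_K])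

lemma W_K: "u \<in> W ==> u \<in> K d"
 by (simp add: K_def clos.base)

lemma Y_K: "set w \<subseteq> idx0 r ==> length w < d ==> Y w v \<in> K d"
 unfolding K_def by (rule clos.base) blast

lemma K_mono: "d <= e ==> K d \<subseteq> K e"
 unfolding K_def by (rule clos_mono) force+

lemma brG0:
 assumes "i \<in> idx0 r" "j \<in> idx0 r" "k \<in> idx0 r"
 shows "F i j (F s k u) = F s k (F i j u) - (if i = k then F s j u else 0) + (if j = - k then F s (- i) u else 0)"
proof -
 have "j \<noteq> s" "i \<noteq> - s" using assms s(2) by auto
 thus ?thesis using F_F[OF idx_r[OF assms(1)] idx_r[OF assms(2)] s(1) idx_r[OF assms(3)]] by simp
qed

text \<open>Induction over the closure. Passing \<open>F s k\<close> through an element of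
  \<open>G\<close> costs terms \<open>F s l u\<close> with the same \<open>u\<close>, covered by the
  induction hypothesis, and elements of \<open>K d\<close>.\<close>

lemma F_s_K:
 assumes "x \<in> K d" "k \<in> idx0 r"
 shows "F s k x \<in> K (Suc d)"
proof -
 have "x \<in> K d \<and> (\<forall>k\<in>idx0 r. F s k x \<in> K (Suc d))"
  using assms(1) unfolding K_def[of d]
 proof (induction rule: clos.induct)
  case (base u)
  show ?case
  proof (intro conjI ballI clos.base[OF base])
   fix k assume k: "k \<in> idx0 r"
   from base consider "u \<in> W" | w where "u = Y w v" "set w \<subseteq> idx0 r" "length w < d" by blast
   thus "F s k u \<in> K (Suc d)"
   proof cases
    case 1
    thus ?thesis using F_s_W[OF k] W_K by blast
   next
    case 2
    thus ?thesis using Y_K[of "k # w" "Suc d"] k by simp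
   qed
  qed
 next
  case zero
  show ?case using subspace_0[OF subspace_K[of "Suc d"]] by (auto simp: clos.zero s idx_r)
 next
  case (add u w)
  thus ?case using subspace_add[OF subspace_K[of "Suc d"]] by (auto simp: clos.add F_add s idx_r)
 next
  case (scale u c)
  thus ?case using subspace_scale[OF subspace_K[of "Suc d"]] by (auto simp: clos.scale F_scale s idx_r)
 next
  case (op i j u)
  note subK = subspace_K[of "Suc d"]
  have u: "u \<in> K d" "u \<in> K (Suc d)" using op.IH K_mono[of d "Suc d"] by (auto simp: K_def[of d, symmetric])
  have ij: "i \<in> I" "j \<in> I" using op.hyps(1) G by auto
  show ?case
  proof (intro conjI ballI clos.op[OF op.hyps])
   fix k assume k: "k \<in> idx0 r"
   have IH: "F s l u \<in> K (Suc d)" if "l \<in> idx0 r" for l using op.IH that by blast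
   have 1: "F i j (F s k u) \<in> K (Suc d)" using stabD[OF stab_K op.hyps(1)] IH[OF k] by blast
   show "F s k (F i j u) \<in> K (Suc d)"
   proof (cases "(i, j) \<in> idx0 r \<times> idx0 r")
    case True
    have "F s k (F i j u) = F i j (F s k u) + (if i = k then F s j u else 0) - (if j = - k then F s (- i) u else 0)"
     using brG0[of i j k u] True k by auto
    moreover have "(if i = k then F s j u else 0) \<in> K (Suc d)" "(if j = - k then F s (- i) u else 0) \<in> K (Suc d)"
     using IH[of j] IH[of "- i"] True subspace_0[OF subK] by auto
    ultimately show ?thesis using 1 subspace_add[OF subK] subspace_diff[OF subK] by simp
   next
    case False
    then obtain c where "F i j (F s k u) - F s k (F i j u) - sc c (F s k u) \<in> K d"
     using brG[OF op.hyps(1)] k u(1) stab_K by blast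
    hence "F i j (F s k u) - F s k (F i j u) - sc c (F s k u) \<in> K (Suc d)"
     using K_mono[of d "Suc d"] by auto
    from subspace_diff[OF subK subspace_diff[OF subK 1 subspace_scale[OF subK IH[OF k], of c]] this]
    show ?thesis by (simp add: algebra_simps)
   qed
  qed
 qed
 thus ?thesis using assms(2) by blast
qed

lemma Y_in_K: "x \<in> K d ==> set w \<subseteq> idx0 r ==> Y w x \<in> K (d + length w)"
 by (induction w) (auto intro: F_s_K)

lemma F_s_comm_K:
 assumes "x \<in> K (Suc e)" "k \<in> idx0 r" "set w \<subseteq> idx0 r"
 shows "Y (k # w) x - Y (w @ [k]) x \<in> K (e + length w + 1)"
 using assms(3)
proof (induction w)
 case Nil
 thus ?case using subspace_0[OF subspace_K] by simp
next
 case (Cons l w)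
 have l: "l \<in> idx0 r" and w: "set w \<subseteq> idx0 r" using Cons.prems by auto
 have "Y w x \<in> K (e + length w + 2 - 1)" using Y_in_K[OF assms(1) w] by simp
 hence 1: "F s k (F s l (Y w x)) - F s l (F s k (Y w x)) \<in> K (e + length (l # w) + 1)"
  using brU[OF assms(2) l stab_K] K_mono[of "e + length w + 2 - 1" "e + length (l # w) + 1"] by fastforce
 have 2: "F s l (Y (k # w) x - Y (w @ [k]) x) \<in> K (e + length (l # w) + 1)"
  using F_s_K[OF Cons.IH[OF w] l] by simp
 show ?case using subspace_add[OF subspace_K 1 2] by (simp add: F_diff s idx_r[OF l])
qed

text \<open>The first letter of \<open>w\<close> is located in \<open>w'\<close> and moved to the
  front; by \<open>F_s_comm_K\<close> each such move only costs a lower layer.\<close>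

lemma Y_mset:
 assumes "mset w = mset w'" "set w \<subseteq> idx0 r" "x \<in> K (Suc 0)"
 shows "Y w x - Y w' x \<in> K (length w)"
 using assms(1,2)
proof (induction w arbitrary: w')
 case Nil
 thus ?case using subspace_0[OF subspace_K] by simp
next
 case (Cons k w)
 have k: "k \<in> idx0 r" and w: "set w \<subseteq> idx0 r" using Cons.prems by auto
 have "k \<in> set w'" using Cons.prems(1) by (metis list.set_intros(1) set_mset_mset)
 then obtain xs ys where w': "w' = xs @ k # ys" by (meson split_list)
 have eq: "mset w = mset (xs @ ys)" using Cons.prems(1) w' by simp
 have sets: "set xs \<subseteq> idx0 r" "set ys \<subseteq> idx0 r"
  using Cons.prems set_mset_mset[of w] eq w by (metis Un_subset_iff set_append set_mset_mset)+
 have len: "length w = length xs + length ys" using eq by (metis length_append size_mset)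
 have 1: "F s k (Y w x - Y (xs @ ys) x) \<in> K (length (k # w))"
  using F_s_K[OF Cons.IH[OF eq w] k] by simp
 have "Y ys x \<in> K (Suc (length ys))" using Y_in_K[OF assms(3) sets(2)] by simp
 from F_s_comm_K[OF this k sets(1)]
 have 2: "Y (k # xs) (Y ys x) - Y (xs @ [k]) (Y ys x) \<in> K (length (k # w))"
  using len by (simp add: algebra_simps)
 show ?case using subspace_add[OF subspace_K 1 2] by (simp add: w' F_diff s idx_r[OF k])
qed

text \<open>Modulo lower layers the negative letter may be moved to the right end of the word, where
  it sends \<open>v\<close> into \<open>W\<close>.\<close>

lemma Y_negative:
 assumes "set w \<subseteq> idx0 r" "k \<in> set w" "k < 0"
 shows "Y w v \<in> K (length w)"
proof -
 obtain xs ys where w: "w = xs @ k # ys" using assms(2) by (meson split_list)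
 have "v \<in> K (Suc 0)" using Y_K[of "[]" "Suc 0"] by simp
 from Y_mset[OF _ assms(1) this, of "xs @ ys @ [k]"]
 have 1: "Y w v - Y (xs @ ys @ [k]) v \<in> K (length w)" by (simp add: w)
 have "nat (- k) \<in> {1..r}" using assms by auto
 hence "F s k v \<in> W" using v[of "nat (- k)"] assms(3) by simp
 hence z: "Y z (F s k v) \<in> W" if "set z \<subseteq> idx0 r" for z
  using that by (induction z) (auto intro: F_s_W)
 have "set (xs @ ys) \<subseteq> idx0 r" using assms(1) w by auto
 from W_K[OF z[OF this]] have 2: "Y (xs @ ys @ [k]) v \<in> K (length w)" by simp
 show ?thesis using subspace_add[OF subspace_K 1 2] by simp
qed

definition Yb :: "(nat => nat) => 'v => 'v" where
 "Yb b = Y (expo_word r b)"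

text \<open>A \<open>G\<close>-closure rather than a span of monomials, because the operators of the
  following blocks still have to act on it.\<close>

definition lower :: "(nat => nat) => 'v set" where
 "lower b = clos G (W \<union> {Yb b' v |b'. deglt r b' b})"

lemma stab_lower: "stab G (lower b)"
 by (simp add: lower_def stab_clos)

lemma subspace_lower: "subspace (lower b)"
 by (rule stab_subspace[OF stab_lower])

lemma W_lower: "u \<in> W ==> u \<in> lower b"
 by (simp add: lower_def clos.base)

lemma Yb_lower: "deglt r b' b ==> Yb b' v \<in> lower b"
 unfolding lower_def by (rule clos.base) blast

lemma lower_mono: "deglt r b c ==> lower b \<subseteq> lower c"
 unfolding lower_def by (rule clos_mono) (use deglt_trans in blast)+

lemma expo_word_pos: "k \<in> set (expo_word r b) ==> 0 < k \<and> k <= int r"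
 using set_expo_word[of r b] by auto

lemma expo_word_idx: "set (expo_word r b) \<subseteq> idx0 r"
 using set_expo_word[of r b] by auto

lemma expo_word_count:
 assumes "\<And>k. k \<in> set w ==> 0 < k \<and> k <= int r"
 shows "mset (expo_word r (%i. count (mset w) (int i))) = mset w"
proof (rule multiset_eqI)
 fix k
 show "count (mset (expo_word r (%i. count (mset w) (int i)))) k = count (mset w) k"
  using assms[of k] by (cases "k \<in> set w") (auto simp: count_expo_word count_mset_0_iff)
qed

text \<open>Induction on the layer: a word with a negative letter drops to a lower layer, every
  other word can be sorted modulo a lower layer.\<close>

lemma K_Yb: "K d \<subseteq> clos G (W \<union> {Yb b v |b. (\<Sum>i = 1..r. b i) < d})"
proof (induction d)
 case 0
 thus ?case by (simp add: K_def)
next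
 case (Suc d)
 let ?C = "%d. clos G (W \<union> {Yb b v |b. (\<Sum>i = 1..r. b i) < d})"
 have Kd: "K d \<subseteq> ?C (Suc d)"
  by (rule order_trans[OF Suc clos_mono]) force+
 have "Y w v \<in> ?C (Suc d)" if w: "set w \<subseteq> idx0 r" "length w < Suc d" for w
 proof (cases "length w < d \<or> (\<exists>k\<in>set w. k < 0)")
  case True
  hence "Y w v \<in> K d"
  proof
   assume "\<exists>k\<in>set w. k < 0"
   hence "Y w v \<in> K (length w)" using Y_negative[OF w(1)] by blast
   thus ?thesis using K_mono[of "length w" d] w(2) by auto
  qed (rule Y_K[OF w(1)])
  thus ?thesis using Kd by blast
 next
  case False
  define b where "b = (%i. count (mset w) (int i))"
  have "0 < k \<and> k <= int r" if "k \<in> set w" for k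
   using subsetD[OF w(1) that] False that by auto
  hence m: "mset (expo_word r b) = mset w" unfolding b_def by (rule expo_word_count)
  have len: "length w = d" using False w by simp
  have "(\<Sum>i = 1..r. b i) = d"
   using length_expo_word[of r b] m len by (metis size_mset)
  hence 1: "Yb b v \<in> ?C (Suc d)" by (intro clos.base UnI2 CollectI exI[of _ b]) simp
  have "v \<in> K (Suc 0)" using Y_K[of "[]" "Suc 0"] by simp
  from Y_mset[OF m[symmetric] w(1) this] have "Y w v - Yb b v \<in> K d" by (simp add: len Yb_def)
  hence 2: "Y w v - Yb b v \<in> ?C (Suc d)" using Kd by blast
  show ?thesis using subspace_add[OF subspace_clos 2 1] by simp
 qed
 moreover have "W \<subseteq> ?C (Suc d)" by (auto intro: clos.base)
 ultimately show ?case unfolding K_def[of "Suc d"] by (intro clos_least stab_clos) blast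
qed

text \<open>This is where the order compares degrees first: a drop in degree alone makes a monomial
  smaller.\<close>

lemma K_lower: "K (\<Sum>i = 1..r. b i) \<subseteq> lower b"
 unfolding lower_def by (rule order_trans[OF K_Yb clos_mono]) (use deglt_degree in blast)+

text \<open>An element of \<open>\<ss>\<oo>\<^bsub>2r\<^esub>\<close> that moves \<open>F s i\<close> to \<open>- F s j\<close> acts as a derivation.\<close>

lemma derivation:
 assumes ij: "i \<in> {1..r}" "j \<in> {1..r}" "i \<noteq> j" and u: "u \<in> K (Suc 0)"
  and w: "\<And>k. k \<in> set w ==> 0 < k \<and> k <= int r"
  and w0: "int i \<in> set w ==> mset w0 = mset w - {#int i#} + {#int j#}"
 shows "F (int i) (int j) (Y w u) - Y w (F (int i) (int j) u)
  + sc (of_nat (count (mset w) (int i))) (Y w0 u) \<in> K (length w)"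
 using w w0
proof (induction w arbitrary: w0)
 case Nil
 thus ?case using subspace_0[OF subspace_K] by simp
next
 case (Cons k w)
 let ?f = "F (int i) (int j)"
 have k: "0 < k" "k <= int r" "k \<in> idx0 r" and w: "\<And>k. k \<in> set w ==> 0 < k \<and> k <= int r"
  using Cons.prems(1) by force+
 have kI: "k \<in> I" by (rule idx_r[OF k(3)])
 have wi: "set w \<subseteq> idx0 r" using w by force
 have iji: "int i \<in> idx0 r" "int j \<in> idx0 r" using ij by auto
 \<comment> \<open>A word with one letter i replaced by j. Only its multiset of letters matters,
   since a different order changes the result by a lower layer.\<close>
 define w1 where "w1 = remove1 (int i) w @ [int j]"
 have w1: "mset w1 = mset w - {#int i#} + {#int j#}" by (simp add: w1_def)
 have w1i: "set w1 \<subseteq> idx0 r" using wi iji by (auto simp: w1_def dest: notin_set_remove1 intro: in_set_remove1)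
 note IH = Cons.IH[OF w w1]
 have br: "?f (F s k (Y w u)) = F s k (?f (Y w u)) - (if int i = k then F s (int j) (Y w u) else 0)"
  using brG0[OF iji k(3)] k(1) by auto
 have 1: "F s k (?f (Y w u) - Y w (?f u) + sc (of_nat (count (mset w) (int i))) (Y w1 u)) \<in> K (length (k # w))"
  using F_s_K[OF IH k(3)] by simp
 have e1: "F s k (?f (Y w u) - Y w (?f u) + sc (of_nat (count (mset w) (int i))) (Y w1 u))
   = F s k (?f (Y w u)) - F s k (Y w (?f u)) + sc (of_nat (count (mset w) (int i))) (Y (k # w1) u)"
  by (simp add: F_diff F_add F_scale s kI)
 show ?case
 proof (cases "int i \<in> set (k # w)")
  case False
  hence c: "count (mset w) (int i) = 0" "count (mset (k # w)) (int i) = 0" and "int i \<noteq> k"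
   by (auto simp: count_mset_0_iff)
  hence "?f (Y (k # w) u) = F s k (?f (Y w u))" using br by simp
  thus ?thesis using 1 unfolding e1 c by (simp add: F_diff s kI)
 next
  case True
  note w0 = Cons.prems(2)[OF True]
  have 2: "sc (of_nat (count (mset w) (int i))) (Y w0 u - Y (k # w1) u) \<in> K (length (k # w))"
  proof (cases "int i \<in> set w")
   case True
   hence "mset w0 = mset (k # w1)"
    using w0 w1 by (auto simp: multiset_eq_iff)
   moreover have "length w0 = length (k # w)" using w0 \<open>int i \<in> set (k # w)\<close>
    by (metis add.commute insert_DiffM2 set_mset_mset size_mset size_single size_union)
   moreover have "set w0 \<subseteq> idx0 r"
    using \<open>mset w0 = mset (k # w1)\<close> w1i k(3) by (metis insert_subset list.simps(15) set_mset_mset)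
   ultimately have "Y w0 u - Y (k # w1) u \<in> K (length (k # w))"
    using Y_mset[OF _ _ u, of w0 "k # w1"] by simp
   thus ?thesis by (rule subspace_scale[OF subspace_K])
  next
   case False
   thus ?thesis using subspace_0[OF subspace_K] by (simp add: count_mset_0_iff[THEN iffD2])
  qed
  have 3: "(if int i = k then Y w0 u - F s (int j) (Y w u) else 0) \<in> K (length (k # w))"
  proof (cases "int i = k")
   case True
   hence m: "mset (int j # w) = mset w0" using w0 by simp
   have "Y (int j # w) u - Y w0 u \<in> K (length (k # w))"
    using Y_mset[OF m _ u] wi iji by simp
   from subspace_neg[OF subspace_K this] show ?thesis using True by simp
  qed (simp add: subspace_0[OF subspace_K])
  have c: "count (mset (k # w)) (int i) = count (mset w) (int i) + (if int i = k then 1 else 0)" by simp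
  have e: "?f (Y (k # w) u) - Y (k # w) (?f u) + sc (of_nat (count (mset (k # w)) (int i))) (Y w0 u)
   = (F s k (?f (Y w u)) - F s k (Y w (?f u)) + sc (of_nat (count (mset w) (int i))) (Y (k # w1) u))
   + sc (of_nat (count (mset w) (int i))) (Y w0 u - Y (k # w1) u)
   + (if int i = k then Y w0 u - F s (int j) (Y w u) else 0)"
   unfolding c using br by (simp add: scale_right_diff_distrib scale_left_distrib)
  from subspace_add[OF subspace_K subspace_add[OF subspace_K 1[unfolded e1] 2] 3]
  show ?thesis by (simp only: e)
 qed
qed

lemma derivation_Yb:
 assumes ij: "i \<in> {1..r}" "j \<in> {1..r}" "i \<noteq> j" and u: "u \<in> K (Suc 0)"
 shows "F (int i) (int j) (Yb b u) - Yb b (F (int i) (int j) u)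
  + sc (of_nat (b i)) (Yb (shift i j b) u) \<in> K (\<Sum>k = 1..r. b k)"
proof -
 have c: "count (mset (expo_word r b)) (int i) = b i" using ij by (simp add: count_expo_word)
 have "F (int i) (int j) (Y (expo_word r b) u) - Y (expo_word r b) (F (int i) (int j) u)
  + sc (of_nat (count (mset (expo_word r b)) (int i))) (Y (expo_word r (shift i j b)) u)
   \<in> K (length (expo_word r b))"
 proof (rule derivation[OF ij u])
  show "0 < k \<and> k <= int r" if "k \<in> set (expo_word r b)" for k
   using set_expo_word[of r b] that by auto
  assume "int i \<in> set (expo_word r b)"
  hence "b i > 0" using c by (metis count_mset_0_iff gr0I)
  thus "mset (expo_word r (shift i j b)) = mset (expo_word r b) - {#int i#} + {#int j#}"
   using mset_expo_shift[OF ij] by simp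
 qed
 thus ?thesis unfolding c length_expo_word Yb_def .
qed

lemma Y_W: "set w \<subseteq> idx0 r ==> u \<in> W ==> Y w u \<in> W"
 by (induction w) (auto intro: F_s_W)

lemma Yb_W: "u \<in> W ==> Yb b u \<in> W"
 unfolding Yb_def by (rule Y_W[OF expo_word_idx])

lemma v_K: "v \<in> K (Suc 0)"
 using Y_K[of "[]" "Suc 0"] by simp

text \<open>The derivation moves a unit from the exponent of i to that of the larger index j, which
  is smaller in the lexicographic order.\<close>

lemma raise_short:
 assumes ij: "i \<in> {1..r}" "j \<in> {1..r}" "i < j" and fv: "F (int i) (int j) v \<in> W"
 shows "F (int i) (int j) (Yb b v) \<in> lower b"
proof -
 let ?f = "F (int i) (int j)"
 have 1: "?f (Yb b v) - Yb b (?f v) + sc (of_nat (b i)) (Yb (shift i j b) v) \<in> lower b"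
  using derivation_Yb[OF ij(1,2) _ v_K, of b] ij(3) K_lower by auto
 have 2: "Yb b (?f v) \<in> lower b" by (rule W_lower[OF Yb_W[OF fv]])
 have 3: "sc (of_nat (b i)) (Yb (shift i j b) v) \<in> lower b"
 proof (cases "b i = 0")
  case False
  thus ?thesis
   using Yb_lower[OF deglt_shift[OF ij]] subspace_scale[OF subspace_lower] by blast
 qed (simp add: subspace_0[OF subspace_lower])
 from subspace_diff[OF subspace_lower subspace_add[OF subspace_lower 1 2] 3] show ?thesis by simp
qed

text \<open>Every commutator produces a negative letter, so it drops to a lower layer by
  \<open>Y_negative\<close>.\<close>

lemma raise_long:
 assumes ij: "i \<in> {1..r}" "j \<in> {1..r}" and fv: "F (int i) (- int j) v \<in> W"
 shows "F (int i) (- int j) (Yb b v) \<in> lower b"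
proof -
 let ?f = "F (int i) (- int j)"
 have iji: "int i \<in> idx0 r" "- int j \<in> idx0 r" using ij by auto
 have "?f (Y w v) - Y w (?f v) \<in> K (length w)" if "\<And>k. k \<in> set w ==> 0 < k \<and> k <= int r" for w
  using that
 proof (induction w)
  case Nil
  thus ?case using subspace_0[OF subspace_K] by simp
 next
  case (Cons k w)
  have k: "0 < k" "k \<in> idx0 r" and w: "\<And>k. k \<in> set w ==> 0 < k \<and> k <= int r"
   using Cons.prems by force+
  have wi: "set w \<subseteq> idx0 r" using w by force
  have kI: "k \<in> I" by (rule idx_r[OF k(2)])
  have z: "(if P then F s (- int l) (Y w v) else 0) \<in> K (length (k # w))" if "l \<in> {1..r}" for P l
   using Y_negative[of "- int l # w" "- int l"] wi that subspace_0[OF subspace_K] by auto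
  have 1: "F s k (?f (Y w v) - Y w (?f v)) \<in> K (length (k # w))"
   using F_s_K[OF Cons.IH[OF w] k(2)] by simp
  have e: "?f (Y (k # w) v) - Y (k # w) (?f v) = F s k (?f (Y w v) - Y w (?f v))
   - (if int i = k then F s (- int j) (Y w v) else 0) + (if - int j = - k then F s (- int i) (Y w v) else 0)"
   using brG0[OF iji k(2), of "Y w v"] by (simp add: F_diff s kI)
  from subspace_add[OF subspace_K subspace_diff[OF subspace_K 1 z[OF ij(2)]] z[OF ij(1)]]
  show ?case unfolding e .
 qed
 from this[of "expo_word r b", OF expo_word_pos] have "?f (Yb b v) - Yb b (?f v) \<in> K (\<Sum>i = 1..r. b i)"
  unfolding Yb_def length_expo_word .
 hence 1: "?f (Yb b v) - Yb b (?f v) \<in> lower b" using K_lower by blast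
 have 2: "Yb b (?f v) \<in> lower b" by (rule W_lower[OF Yb_W[OF fv]])
 from subspace_add[OF subspace_lower 1 2] show ?thesis by simp
qed

text \<open>Thus being a highest weight vector of so(2r) survives the block, with \<open>W\<close>
  replaced by \<open>lower b\<close>. Pairs of negative indices are reduced to positive ones by
  \<open>F_swap\<close>.\<close>

lemma raises_into_lower:
 assumes "raises_into (idx0 r) W v"
 shows "raises_into (idx0 r) (lower b) (Yb b v)"
 unfolding raises_into_def
proof (intro ballI impI)
 fix i j assume ij: "i \<in> idx0 r" "j \<in> idx0 r" "prec i j"
 note I = idx_r[OF ij(1)] idx_r[OF ij(2)]
 have fv: "F i j v \<in> W" "F (- j) (- i) v \<in> W"
  using assms ij unfolding raises_into_def by auto
 have neg: "F i j (Yb b v) \<in> lower b" if "F (- j) (- i) (Yb b v) \<in> lower b"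
  using F_swap[OF I] subspace_neg[OF subspace_lower that] by simp
 have *: "F (int a) (int c) (Yb b v) \<in> lower b"
  if "int a = i \<and> int c = j \<or> int a = - j \<and> int c = - i" for a c
  using that fv ij by (intro raise_short) (auto simp: prec_def split: if_splits)
 show "F i j (Yb b v) \<in> lower b"
 proof (cases "i > 0")
  case True
  show ?thesis
  proof (cases "j > 0")
   case True
   thus ?thesis using *[of "nat i" "nat j"] \<open>i > 0\<close> by simp
  next
   case False
   have "nat i \<in> {1..r}" "nat (- j) \<in> {1..r}" using ij \<open>i > 0\<close> False by auto
   thus ?thesis using raise_long[of "nat i" "nat (- j)" b] \<open>i > 0\<close> fv False by simp
  qed
 next
  case False
  hence "i < 0" "j < 0" using ij by (auto simp: prec_def split: if_splits)
  thus ?thesis using neg *[of "nat (- j)" "nat (- i)"] by simp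
 qed
qed

text \<open>
 If \<open>f ^ t\<close> kills \<open>u\<close>, where \<open>f = F (k+1) k\<close>, then applying the monomial in which the exponent of
 \<open>F s k\<close> has been moved to \<open>F s (k+1)\<close> to \<open>f ^ t u = 0\<close> expresses the original monomial by
 lower ones.
\<close>

lemma move_exponent:
 assumes k: "k \<ge> 1" "Suc k <= r" and u: "u \<in> K (Suc 0)"
  and low: "\<And>b'. deglt r b' b ==> Yb b' u \<in> lower b"
  and t: "t <= b k" and fu: "(F (int (Suc k)) (int k) ^^ t) u \<in> W"
 shows "Yb b u \<in> lower b"
proof -
 let ?f = "F (int (Suc k)) (int k)"
 have fG: "(int (Suc k), int k) \<in> G" using G(2) k by auto
 \<comment> \<open>The exponents after m units have been moved from k to k + 1. As a derivation,
   \<open>?f\<close> leads from \<open>c (Suc m)\<close> back to \<open>c m\<close>.\<close>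
 define c where "c = (%m i. if i = k then b k - m else if i = Suc k then b (Suc k) + m else b i)"
 have sh: "shift (Suc k) k (c (Suc m)) = c m" if "m < t" for m
  using that t by (auto simp: c_def shift_def fun_eq_iff)
 have c0: "c 0 = b" by (auto simp: c_def fun_eq_iff)
 have deg: "(\<Sum>i = 1..r. c m i) = (\<Sum>i = 1..r. b i)" if "m <= t" for m
  using that
 proof (induction m)
  case (Suc m)
  have "(\<Sum>i = 1..r. shift (Suc k) k (c (Suc m)) i) = (\<Sum>i = 1..r. c (Suc m) i)"
   using k by (intro sum_shift) (auto simp: c_def)
  thus ?case using sh[of m] Suc by simp
 qed (simp add: c0)
 have fu': "(?f ^^ m) u \<in> K (Suc 0)" for m by (rule stab_funpow[OF stab_K fG u])
 have lt: "deglt r (c (Suc m)) b" if "m < t" for m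
  using deg[of "Suc m"] k t that by (intro deglt_lex[where k = k]) (auto simp: c_def)
 have Kl: "x \<in> lower b" if "x \<in> K (\<Sum>i = 1..r. c m i)" "m <= t" for x m
  using that deg[of m] K_lower[of b] by auto
 have dv: "?f (Yb (c (Suc m)) ((?f ^^ l) u)) - Yb (c (Suc m)) ((?f ^^ Suc l) u)
   + sc (of_nat (b (Suc k) + Suc m)) (Yb (c m) ((?f ^^ l) u)) \<in> lower b" if "m < t" for m l
 proof -
  have "?f (Yb (c (Suc m)) ((?f ^^ l) u)) - Yb (c (Suc m)) (?f ((?f ^^ l) u))
   + sc (of_nat (c (Suc m) (Suc k))) (Yb (shift (Suc k) k (c (Suc m))) ((?f ^^ l) u)) \<in> K (\<Sum>i = 1..r. c (Suc m) i)"
   using k by (intro derivation_Yb fu') auto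
  from Kl[OF this] that have "?f (Yb (c (Suc m)) ((?f ^^ l) u)) - Yb (c (Suc m)) (?f ((?f ^^ l) u))
   + sc (of_nat (c (Suc m) (Suc k))) (Yb (c m) ((?f ^^ l) u)) \<in> lower b"
   by (simp only: sh[OF that] Suc_le_eq)
  moreover have "c (Suc m) (Suc k) = b (Suc k) + Suc m" by (simp add: c_def)
  ultimately show ?thesis unfolding funpow.simps o_apply by metis
 qed
 \<comment> \<open>If more units have been moved than powers of \<open>?f\<close> applied, all
   resulting monomials precede \<open>b\<close>.\<close>
 have S1: "Yb (c (l + m)) ((?f ^^ m) u) \<in> lower b" if "l \<ge> 1" "l + m <= t" for l m
  using that
 proof (induction m arbitrary: l)
  case 0
  thus ?case using lt[of "l - 1"] low by simp
 next
  case (Suc m)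
  have 1: "?f (Yb (c (Suc (l + m))) ((?f ^^ m) u)) \<in> lower b"
   using stabD[OF stab_lower fG Suc.IH[of "Suc l"]] Suc.prems by simp
  have 2: "sc (of_nat (b (Suc k) + Suc (l + m))) (Yb (c (l + m)) ((?f ^^ m) u)) \<in> lower b"
   using subspace_scale[OF subspace_lower Suc.IH[of l]] Suc.prems by simp
  from subspace_diff[OF subspace_lower subspace_add[OF subspace_lower 1 2] dv[of "l + m" m]]
  show ?case using Suc.prems by (simp add: algebra_simps)
 qed
 \<comment> \<open>If the two numbers agree, the original monomial returns. Its coefficient is the
   product of the numbers from \<open>b (Suc k) + 1\<close> to \<open>b (Suc k) + m\<close>, hence
   nonzero.\<close>
 have S2: "\<exists>a. a \<noteq> 0 \<and> Yb (c m) ((?f ^^ m) u) - sc a (Yb b u) \<in> lower b" if "m <= t" for m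
  using that
 proof (induction m)
  case 0
  thus ?case using subspace_0[OF subspace_lower] by (intro exI[of _ 1]) (simp add: c0)
 next
  case (Suc m)
  then obtain a where a: "a \<noteq> 0" "Yb (c m) ((?f ^^ m) u) - sc a (Yb b u) \<in> lower b" by auto
  let ?q = "of_nat (b (Suc k) + Suc m) :: complex"
  have 1: "?f (Yb (c (Suc m)) ((?f ^^ m) u)) \<in> lower b"
   using stabD[OF stab_lower fG S1[of 1 m]] Suc.prems by simp
  have 2: "sc ?q (Yb (c m) ((?f ^^ m) u) - sc a (Yb b u)) \<in> lower b"
   by (rule subspace_scale[OF subspace_lower a(2)])
  have 3: "?f (Yb (c (Suc m)) ((?f ^^ m) u)) - Yb (c (Suc m)) ((?f ^^ Suc m) u)
   + sc ?q (Yb (c m) ((?f ^^ m) u)) \<in> lower b"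
   by (rule dv) (use Suc.prems in simp)
  from subspace_diff[OF subspace_lower subspace_add[OF subspace_lower 1 2] 3]
  have "Yb (c (Suc m)) ((?f ^^ Suc m) u) - sc (?q * a) (Yb b u) \<in> lower b"
   by (simp only: scale_right_diff_distrib scale_scale) (simp add: algebra_simps)
  moreover have "?q * a \<noteq> 0" using a(1) by (simp del: of_nat_Suc of_nat_add)
  ultimately show ?case by blast
 qed
 obtain a where a: "a \<noteq> 0" "Yb (c t) ((?f ^^ t) u) - sc a (Yb b u) \<in> lower b" using S2 by blast
 have "Yb (c t) ((?f ^^ t) u) \<in> lower b" by (rule W_lower[OF Yb_W[OF fu]])
 from subspace_diff[OF subspace_lower this a(2)] have "sc a (Yb b u) \<in> lower b" by simp
 from subspace_scale[OF subspace_lower this, of "1 / a"] a(1) show ?thesis by simp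
qed

end

declare of_nat_Suc [simp del]

context block
begin

text \<open>Meant for operators of \<open>G\<close> whose bracket with the block has no term of full
  degree. The operators \<open>F m j\<close> meet the plus block in this way.\<close>

lemma commute_G:
 assumes ij: "(i, j) \<in> G" and u: "u \<in> K (Suc 0)"
  and br: "\<And>k N x. k \<in> idx0 r ==> stab G N ==> x \<in> N ==> F i j (F s k x) - F s k (F i j x) \<in> N"
 shows "F i j (Yb b u) - Yb b (F i j u) \<in> lower b"
proof -
 have "F i j (Y w u) - Y w (F i j u) \<in> K (length w)" if "set w \<subseteq> idx0 r" for w
  using that
 proof (induction w)
  case Nil
  thus ?case using subspace_0[OF subspace_K] by simp
 next
  case (Cons k w)
  hence k: "k \<in> idx0 r" and w: "set w \<subseteq> idx0 r" by auto
  have "Y w u \<in> K (length (k # w))" using Y_in_K[OF u w] by simp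
  hence 1: "F i j (F s k (Y w u)) - F s k (F i j (Y w u)) \<in> K (length (k # w))"
   by (rule br[OF k stab_K])
  have 2: "F s k (F i j (Y w u) - Y w (F i j u)) \<in> K (length (k # w))"
   using F_s_K[OF Cons.IH[OF w] k] by simp
  have e: "F i j (Y (k # w) u) - Y (k # w) (F i j u) =
   (F i j (F s k (Y w u)) - F s k (F i j (Y w u))) + F s k (F i j (Y w u) - Y w (F i j u))"
   by (simp add: F_diff s idx_r[OF k])
  show ?case unfolding e by (rule subspace_add[OF subspace_K 1 2])
 qed
 from this[OF expo_word_idx] show ?thesis
  using K_lower[of b] unfolding Yb_def length_expo_word by blast
qed

lemma commute_G_funpow:
 assumes ij: "(i, j) \<in> G" and u: "u \<in> K (Suc 0)"
  and br: "\<And>k N x. k \<in> idx0 r ==> stab G N ==> x \<in> N ==> F i j (F s k x) - F s k (F i j x) \<in> N"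
 shows "(F i j ^^ t) (Yb b u) - Yb b ((F i j ^^ t) u) \<in> lower b"
proof (induction t)
 case 0
 thus ?case using subspace_0[OF subspace_lower] by simp
next
 case (Suc t)
 have IJ: "i \<in> I" "j \<in> I" using ij G by auto
 have 1: "F i j ((F i j ^^ t) (Yb b u) - Yb b ((F i j ^^ t) u)) \<in> lower b"
  by (rule stabD[OF stab_lower ij Suc])
 have 2: "F i j (Yb b ((F i j ^^ t) u)) - Yb b (F i j ((F i j ^^ t) u)) \<in> lower b"
  by (rule commute_G[OF ij stab_funpow[OF stab_K ij u] br])
 show ?case using subspace_add[OF subspace_lower 1 2] by (simp add: F_diff IJ)
qed

text \<open>The power of \<open>F s r\<close> acts first, and the remaining factors preserve
  \<open>W\<close>.\<close>

lemma Yb_last: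
 assumes "r \<ge> 1" "(F s (int r) ^^ b r) u \<in> W"
 shows "Yb b u \<in> W"
proof -
 obtain r' where r': "r = Suc r'" using assms(1) by (cases r) auto
 have e: "expo_word r b = expo_word r' b @ replicate (b r) (int r)" by (simp add: expo_word_def r')
 have "Y (replicate m (int r)) u = (F s (int r) ^^ m) u" for m by (induction m) auto
 moreover have "set (expo_word r' b) \<subseteq> idx0 r" using set_expo_word[of r' b] r' by auto
 ultimately show ?thesis using assms(2) Y_W unfolding Yb_def e by simp
qed

lemma Yb_last2:
 assumes "r \<ge> 2" "(F s (int (r - 1)) ^^ b (r - 1)) ((F s (int r) ^^ b r) u) \<in> W"
 shows "Yb b u \<in> W"
proof -
 obtain r' where r': "r = Suc (Suc r')" using assms(1) by (metis One_nat_def Suc_1 Suc_le_D Suc_le_mono)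
 have e: "expo_word r b = expo_word r' b @ replicate (b (r - 1)) (int (r - 1)) @ replicate (b r) (int r)"
  by (simp add: expo_word_def r')
 have "Y (replicate m k) u = (F s k ^^ m) u" for m k u by (induction m) auto
 moreover have "set (expo_word r' b) \<subseteq> idx0 r" using set_expo_word[of r' b] r' by auto
 ultimately show ?thesis using assms(2) Y_W unfolding Yb_def e by simp
qed

end

section \<open>Rows: a plus block followed by a minus block\<close>

definition wsh :: "int => nat => (nat => nat) => weight => weight" where
 "wsh s r b \<mu> = \<mu> + (%j. \<Sum>i = 1..r. of_nat (b i) * (ev s j - ev (int i) j))"

lemma wsh_eq:
 "wsh s r b \<mu> j = \<mu> j + of_nat (\<Sum>i = 1..r. b i) * ev s j - (if j \<in> {1..r} then of_nat (b j) else 0)"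
proof -
 have "(\<Sum>i = 1..r. of_nat (b i) * ev (int i) j) = (\<Sum>i = 1..r. if i = j then of_nat (b j) else (0::rat))"
  by (intro sum.cong) (auto simp: ev_def)
 also have "\<dots> = (if j \<in> {1..r} then of_nat (b j) else 0)" by (simp add: sum.delta)
 finally show ?thesis
  by (simp add: wsh_def right_diff_distrib sum_subtractf sum_distrib_right[symmetric])
qed

lemma supp_wsh: "supp n \<mu> ==> \<bar>s\<bar> <= int n ==> r <= n ==> supp n (wsh s r b \<mu>)"
 using supp_ev[of s n] by (auto simp: supp_def wsh_eq)

text \<open>Weight after the plus block with exponents \<open>b\<close> and then the minus block
  with exponents \<open>a\<close>. Its coordinates 1 to r form the next row.\<close>

definition wrow :: "nat => (nat => nat) => (nat => nat) => weight => weight" where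
 "wrow r a b \<mu> = wsh (int (Suc r)) r a (wsh (- int (Suc r)) r b \<mu>)"

context so_rep
begin

abbreviation "torus \<equiv> {(int i, int i) |i. i \<in> {1..n}}"

abbreviation D :: "nat => (int \<times> int) set" where
 "D r \<equiv> idx0 r \<times> idx0 r"

text \<open>The parabolic of so(2r + 2) with Levi part so(2r) plus \<open>F m m\<close> and with
  nilradical of weights \<epsilon>_m - \<epsilon>_k and \<epsilon>_m + \<epsilon>_k, where m = r +
  1. It contains the minus block.\<close>

definition Pa :: "nat => (int \<times> int) set" where
 "Pa r = D r \<union> {int (Suc r)} \<times> idx0 r \<union> {(int (Suc r), int (Suc r))}"

text \<open>Highest weight vectors of so(2r) modulo \<open>W\<close>. Stability under the torus of
  full rank keeps the coordinates above r available for separating weights.\<close>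

definition hw :: "nat => weight => 'v set => 'v => bool" where
 "hw r \<mu> W v \<longleftrightarrow> r <= n \<and> stab (D r \<union> torus) W \<and> wtv \<mu> v \<and> supp n \<mu> \<and> raises_into (idx0 r) W v"

lemma stab_torus_clos:
 assumes "G \<subseteq> I \<times> I" "\<And>i u. i \<in> {1..n} ==> u \<in> B ==> F (int i) (int i) u \<in> clos G B"
 shows "stab torus (clos G B)"
proof -
 have "F (int i) (int i) x \<in> clos G B" if "x \<in> clos G B" "i \<in> {1..n}" for x i
  using that
 proof (induction rule: clos.induct)
  case (op k l u)
  have I: "int i \<in> I" "k \<in> I" "l \<in> I" using op assms(1) nat_idx by auto
  have "F k l u \<in> clos G B" "F k l (F (int i) (int i) u) \<in> clos G B"
   using op by (auto intro: clos.op)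
  thus ?case
   using F_F[OF I(1,1,2,3), of u] subspace_0[OF subspace_clos, of G B]
   by (auto intro!: subspace_add[OF subspace_clos] subspace_diff[OF subspace_clos])
 qed (use assms(2) nat_idx in \<open>auto intro: clos.zero clos.add clos.scale simp: F_add F_scale\<close>)
 thus ?thesis unfolding stab_def using subspace_clos by blast
qed

lemma stab_torus_clos_weights:
 assumes "G \<subseteq> I \<times> I" "stab torus W" "\<And>u. u \<in> B ==> \<exists>\<mu>. wtv \<mu> u"
 shows "stab torus (clos G (W \<union> B))"
proof (rule stab_torus_clos[OF assms(1)])
 fix i u assume i: "i \<in> {1..n}" and "u \<in> W \<union> B"
 then consider "u \<in> W" | \<mu> where "wtv \<mu> u" "u \<in> B" using assms(3) by blast
 thus "F (int i) (int i) u \<in> clos G (W \<union> B)"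
 proof cases
  case 1
  thus ?thesis using stabD[OF assms(2), of "int i" "int i"] i by (auto intro: clos.base)
 next
  case 2
  thus ?thesis using i clos.scale[OF clos.base[of u "W \<union> B" G]] by (auto simp: wtv_def)
 qed
qed

lemma wtv_expo_word:
 assumes "wtv \<mu> u" "s \<in> I" "r <= n"
 shows "wtv (wsh s r b \<mu>) (foldr (F s) (expo_word r b) u)"
 using assms(1,3)
proof (induction r arbitrary: \<mu> u)
 case 0
 thus ?case by (simp add: expo_word_def wsh_def zero_fun_def[symmetric])
next
 case (Suc r)
 have e: "expo_word (Suc r) b = expo_word r b @ replicate (b (Suc r)) (int (Suc r))"
  by (simp add: expo_word_def)
 have "int (Suc r) \<in> I" using Suc.prems by (intro nat_idx) auto
 from funpow_wtv[OF Suc.prems(1) assms(2) this, of "b (Suc r)"]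
 have "wtv (\<mu> + (%i. of_nat (b (Suc r)) * (ev s i - ev (int (Suc r)) i)))
   (foldr (F s) (replicate (b (Suc r)) (int (Suc r))) u)"
  unfolding foldr_replicate .
 from Suc.IH[OF this Suc_leD[OF Suc.prems(2)]]
 have "wtv (wsh s r b (\<mu> + (%i. of_nat (b (Suc r)) * (ev s i - ev (int (Suc r)) i))))
   (foldr (F s) (expo_word (Suc r) b) u)"
  unfolding e foldr_append o_apply .
 moreover have "wsh s r b (\<mu> + (%i. of_nat (b (Suc r)) * (ev s i - ev (int (Suc r)) i))) = wsh s (Suc r) b \<mu>"
  unfolding wsh_def by (auto simp: fun_eq_iff)
 ultimately show ?case by simp
qed

text \<open>\<open>F i j\<close> turns \<open>F k l\<close> into a multiple of \<open>F p q\<close>,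
  which commutes with both. Applying \<open>F i j\<close> repeatedly to the relation for the power
  of \<open>F k l\<close> trades m of its factors for \<open>F p q\<close>.\<close>

lemma transfer:
 assumes ij: "i \<in> I" "j \<in> I" "k \<in> I" "l \<in> I" "p \<in> I" "q \<in> I" and W: "stab {(i, j), (k, l), (p, q)} W"
  and br: "\<And>u. F i j (F k l u) = F k l (F i j u) + sc c (F p q u)" "c \<noteq> 0"
   "\<And>u. F i j (F p q u) = F p q (F i j u)" "\<And>u. F p q (F k l u) = F k l (F p q u)"
  and x: "F i j x \<in> W" "(F k l ^^ N) x \<in> W" and "m <= N"
 shows "(F p q ^^ m) ((F k l ^^ (N - m)) x) \<in> W"
 using \<open>m <= N\<close>
proof (induction m)
 case 0
 thus ?case using x(2) by simp
next
 case (Suc m)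
 note sub = stab_subspace[OF W]
 obtain a where a: "N - m = Suc a" "N - Suc m = a" using Suc.prems by (metis Suc_diff_Suc Suc_le_eq)
 have c1: "F i j ((F p q ^^ m) u) = (F p q ^^ m) (F i j u)" for m u
  by (induction m) (auto simp: br(3))
 have c2: "F p q ((F k l ^^ m) u) = (F k l ^^ m) (F p q u)" for m u
  by (induction m) (auto simp: br(4))
 have c3: "F i j ((F k l ^^ Suc b) x) = (F k l ^^ Suc b) (F i j x) + sc (of_nat (Suc b) * c) (F p q ((F k l ^^ b) x))" for b
 proof (induction b)
  case (Suc b)
  have "F i j ((F k l ^^ Suc (Suc b)) x) = F k l (F i j ((F k l ^^ Suc b) x)) + sc c (F p q ((F k l ^^ Suc b) x))"
   using br(1)[of "(F k l ^^ Suc b) x"] by simp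
  also have "F k l (F i j ((F k l ^^ Suc b) x)) = (F k l ^^ Suc (Suc b)) (F i j x)
    + sc (of_nat (Suc b) * c) (F p q ((F k l ^^ Suc b) x))"
   unfolding Suc.IH by (simp add: F_add F_scale ij br(4))
  moreover have "of_nat (Suc (Suc b)) * c = of_nat (Suc b) * c + c"
   by (simp only: of_nat_Suc[of "Suc b"] ring_distribs) (simp add: ring_distribs)
  ultimately show ?case by (simp only: scale_left_distrib add.assoc)
 qed (use br(1)[of x] in simp)
 have "F i j ((F p q ^^ m) ((F k l ^^ Suc a) x)) \<in> W"
  using stabD[OF W, of i j] Suc a by simp
 hence "(F p q ^^ m) ((F k l ^^ Suc a) (F i j x) + sc (of_nat (Suc a) * c) (F p q ((F k l ^^ a) x))) \<in> W"
  unfolding c1 c3 .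
 moreover have "(F p q ^^ m) (u + sc d w) = (F p q ^^ m) u + sc d ((F p q ^^ m) w)" for u w d
  by (induction m) (auto simp: F_add F_scale ij)
 moreover have "(F p q ^^ m) ((F k l ^^ Suc a) (F i j x)) \<in> W"
  by (intro stab_funpow[OF W] x) auto
 ultimately have "sc (of_nat (Suc a) * c) ((F p q ^^ Suc m) ((F k l ^^ a) x)) \<in> W"
  using subspace_diff[OF sub] by (fastforce simp: funpow_swap1)
 from subspace_scale[OF sub this, of "1 / (of_nat (Suc a) * c)"] br(2)
 show ?case unfolding a(2) by (simp del: of_nat_Suc funpow.simps)
qed

text \<open>The bracket of the two opposite nilradicals lies in the Levi part, so it preserves
  \<open>N\<close> instead of producing a new factor.\<close>

lemma Pa_bracket:
 assumes r: "Suc r <= n" and j: "j \<in> idx0 r" "k \<in> idx0 r" and N: "stab (Pa r) N" "u \<in> N"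
 shows "F (int (Suc r)) j (F (- int (Suc r)) k u) - F (- int (Suc r)) k (F (int (Suc r)) j u) \<in> N"
proof -
 let ?m = "int (Suc r)"
 have mI: "?m \<in> I" by (rule nat_idx) (use r in auto)
 have Ir: "k \<in> I" if "k \<in> idx0 r" for k by (rule idx_nonzero) (use that r in auto)
 note sub = stab_subspace[OF N(1)]
 have "F ?m j (F (- ?m) k u) - F (- ?m) k (F ?m j u) = - F (- j) k u + (if j = - k then F (- ?m) (- ?m) u else 0)"
  using F_comm[of ?m j "- ?m" k u] j mI Ir by auto
 moreover have "F (- j) k u \<in> N" using N j by (intro stabD[OF N(1)]) (auto simp: Pa_def)
 moreover have "F (- ?m) (- ?m) u \<in> N"
  using F_anti[OF mI mI, of u] subspace_neg[OF sub stabD[OF N(1), of ?m ?m u]] N by (simp add: Pa_def)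
 ultimately show ?thesis
  using subspace_0[OF sub] by (auto intro!: subspace_diff[OF sub] subspace_neg[OF sub])
qed

lemma block_plus:
 assumes "hw (Suc r) \<mu> W v"
 shows "block sc X n F (- int (Suc r)) r (Pa r) W v"
proof
 let ?m = "int (Suc r)"
 have r: "Suc r <= n" and W: "stab (D (Suc r)) W" and rv: "raises_into (idx0 (Suc r)) W v"
  using assms by (auto simp: hw_def stab_def)
 have mI: "?m \<in> I" by (rule nat_idx) (use r in auto)
 thus "- ?m \<in> I" by simp
 show "- ?m \<notin> idx0 r" "r <= n" using r by auto
 have Ir: "k \<in> I" if "k \<in> idx0 r" for k by (rule idx_nonzero) (use that r in auto)
 show "Pa r \<subseteq> I \<times> I" using Ir mI by (auto simp: Pa_def)
 show "D r \<subseteq> Pa r" by (auto simp: Pa_def)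
 show "stab (Pa r \<union> {- ?m} \<times> idx0 r) W"
  by (rule stab_mono[OF W]) (auto simp: Pa_def)
 show "F (- ?m) (- int k) v \<in> W" if "k \<in> {1..r}" for k
  using rv that unfolding raises_into_def by (auto simp: prec_def)
 show "F (- ?m) k (F (- ?m) l u) - F (- ?m) l (F (- ?m) k u) \<in> N"
  if "k \<in> idx0 r" "l \<in> idx0 r" "stab (Pa r) N" "u \<in> N" for k l N u
 proof -
  have "k \<noteq> - ?m" "l \<noteq> - ?m" using that by auto
  hence "F (- ?m) k (F (- ?m) l u) - F (- ?m) l (F (- ?m) k u) = 0"
   using F_comm[of "- ?m" k "- ?m" l u] mI Ir that F_anti_diag[of "- ?m" u] by auto
  thus ?thesis using subspace_0[OF stab_subspace[OF that(3)]] by simp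
 qed
 fix i j assume ij: "(i, j) \<in> Pa r" "(i, j) \<notin> D r"
 then consider "i = ?m" "j \<in> idx0 r" | "i = ?m" "j = ?m" by (auto simp: Pa_def)
 thus "\<exists>c. \<forall>k\<in>idx0 r. \<forall>N u. stab (Pa r) N --> u \<in> N -->
   F i j (F (- ?m) k u) - F (- ?m) k (F i j u) - sc c (F (- ?m) k u) \<in> N"
 proof cases
  case 1
  show ?thesis
  proof (intro exI[of _ 0] ballI allI impI)
   fix k N u assume k: "k \<in> idx0 r" and N: "stab (Pa r) N" "u \<in> N"
   show "F i j (F (- ?m) k u) - F (- ?m) k (F i j u) - sc 0 (F (- ?m) k u) \<in> N"
    using Pa_bracket[OF r 1(2) k N] by (simp add: 1(1))
  qed
 next
  case 2
  show ?thesis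
  \<comment> \<open>The torus element \<open>F ?m ?m\<close> acts on each \<open>F (- ?m) k\<close>
    by the scalar -1.\<close>
  proof (intro exI[of _ "-1"] ballI allI impI)
   fix k N u assume k: "k \<in> idx0 r" and N: "stab (Pa r) N" "u \<in> N"
   have "k \<noteq> ?m" "k \<noteq> - ?m" using k by auto
   hence "F i j (F (- ?m) k u) - F (- ?m) k (F i j u) - sc (- 1) (F (- ?m) k u) = 0"
    using F_comm[of i j "- ?m" k u] 2 k mI Ir by auto
   thus "F i j (F (- ?m) k u) - F (- ?m) k (F i j u) - sc (- 1) (F (- ?m) k u) \<in> N"
    using subspace_0[OF stab_subspace[OF N(1)]] by simp
  qed
 qed
qed

abbreviation "Yp r b u \<equiv> foldr (F (- int (Suc r))) (expo_word r b) u"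
abbreviation "Ym r a u \<equiv> foldr (F (int (Suc r))) (expo_word r a) u"

text \<open>Stable under the whole parabolic, hence under the minus block, which acts next.
  \<open>Wm\<close> below is only stable under so(2r), the algebra of the next row.\<close>

definition Wp :: "nat => 'v set => 'v => (nat => nat) => 'v set" where
 "Wp r W v b = clos (Pa r) (W \<union> {Yp r b' v |b'. deglt r b' b})"

definition Wm :: "nat => 'v set => 'v => (nat => nat) => (nat => nat) => 'v set" where
 "Wm r W v b a = clos (D r) (Wp r W v b \<union> {Ym r a' (Yp r b v) |a'. deglt r a' a})"

lemma block_plus_defs:
 assumes "block sc X n F (- int (Suc r)) r (Pa r) W v"
 shows "block.Yb F (- int (Suc r)) r b u = Yp r b u"
  and "block.lower sc F (- int (Suc r)) r (Pa r) W v b = Wp r W v b"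
proof -
 interpret block sc X n F "- int (Suc r)" r "Pa r" W v by fact
 show Y: "Yb b u = Yp r b u" for b u by (simp add: Yb_def Y_def)
 show "lower b = Wp r W v b" unfolding lower_def Wp_def Y ..
qed

lemma block_minus:
 assumes hw: "hw (Suc r) \<mu> W v"
 shows "block sc X n F (int (Suc r)) r (D r) (Wp r W v b) (Yp r b v)"
proof -
 interpret b1: block sc X n F "- int (Suc r)" r "Pa r" W v by (rule block_plus[OF hw])
 note d = block_plus_defs[OF b1.block_axioms]
 let ?m = "int (Suc r)"
 have r: "Suc r <= n" and rv: "raises_into (idx0 (Suc r)) W v"
  using hw by (auto simp: hw_def)
 have mI: "?m \<in> I" by (rule nat_idx) (use r in auto)
 have Ir: "k \<in> I" if "k \<in> idx0 r" for k by (rule idx_nonzero) (use that r in auto)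
 show ?thesis
 proof
  show "?m \<in> I" by (rule mI)
  show "?m \<notin> idx0 r" "r <= n" using r by auto
  show "D r \<subseteq> I \<times> I" using Ir by auto
  show "stab (D r \<union> {?m} \<times> idx0 r) (Wp r W v b)"
   by (rule stab_mono[OF b1.stab_lower[of b, unfolded d]]) (auto simp: Pa_def)
  show "F ?m k (F ?m l u) - F ?m l (F ?m k u) \<in> N"
   if "k \<in> idx0 r" "l \<in> idx0 r" "stab (D r) N" "u \<in> N" for k l N u
  proof -
   have "k \<noteq> ?m" "l \<noteq> ?m" using that by auto
   hence "F ?m k (F ?m l u) - F ?m l (F ?m k u) = 0"
    using F_comm[of ?m k ?m l u] mI Ir that F_anti_diag[of ?m u] by auto
   thus ?thesis using subspace_0[OF stab_subspace[OF that(3)]] by simp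
  qed
  \<comment> \<open>The negative letters of the minus block raise by \<epsilon>_k + \<epsilon>_m.
    They belong to \<open>Pa r\<close>, pass the plus block modulo smaller terms and then fall into
    \<open>W\<close>.\<close>
  show "F ?m (- int k) (Yp r b v) \<in> Wp r W v b" if "k \<in> {1..r}" for k
  proof -
   have "- int k \<in> idx0 r" using that by auto
   hence 1: "F ?m (- int k) (Yp r b v) - Yp r b (F ?m (- int k) v) \<in> Wp r W v b"
    using b1.commute_G[OF _ b1.v_K Pa_bracket[OF r], of "- int k" b]
    unfolding d by (auto simp: Pa_def)
   have "F ?m (- int k) v \<in> W"
    using rv that unfolding raises_into_def by (auto simp: prec_def)
   hence 2: "Yp r b (F ?m (- int k) v) \<in> Wp r W v b"
    using b1.W_lower[OF b1.Yb_W, unfolded d] by blast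
   show ?thesis using subspace_add[OF b1.subspace_lower[of b, unfolded d] 1 2] by simp
  qed
 qed auto
qed

lemma block_minus_defs:
 assumes "block sc X n F (int (Suc r)) r (D r) (Wp r W v b) (Yp r b v)"
 shows "block.Yb F (int (Suc r)) r a u = Ym r a u"
  and "block.lower sc F (int (Suc r)) r (D r) (Wp r W v b) (Yp r b v) a = Wm r W v b a"
proof -
 interpret block sc X n F "int (Suc r)" r "D r" "Wp r W v b" "Yp r b v" by fact
 show Y: "Yb a u = Ym r a u" for a u by (simp add: Yb_def Y_def)
 show "lower a = Wm r W v b a" unfolding lower_def Wm_def Y ..
qed

lemma wtv_row:
 assumes "wtv \<mu> v" "Suc r <= n"
 shows "wtv (wrow r a b \<mu>) (Ym r a (Yp r b v))"
proof -
 have "int (Suc r) \<in> I" by (rule nat_idx) (use assms in auto)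
 thus ?thesis unfolding wrow_def
  using wtv_expo_word[OF wtv_expo_word[OF assms(1), of "- int (Suc r)" r b], of "int (Suc r)" r a] assms by simp
qed

text \<open>The inductive step of the construction: both blocks of a row lead from a highest weight
  vector of so(2r + 2) to one of so(2r), modulo everything smaller.\<close>

lemma hw_row:
 assumes hw: "hw (Suc r) \<mu> W v"
 shows "hw r (wrow r a b \<mu>) (Wm r W v b a) (Ym r a (Yp r b v))"
proof -
 interpret b1: block sc X n F "- int (Suc r)" r "Pa r" W v by (rule block_plus[OF hw])
 note d1 = block_plus_defs[OF b1.block_axioms]
 interpret b2: block sc X n F "int (Suc r)" r "D r" "Wp r W v b" "Yp r b v" by (rule block_minus[OF hw])
 note d2 = block_minus_defs[OF b2.block_axioms]
 have r: "Suc r <= n" and rv: "raises_into (idx0 (Suc r)) W v" and W: "stab torus W" and wt: "wtv \<mu> v"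
  and su: "supp n \<mu>"
  using hw by (auto simp: hw_def stab_def)
 have mI: "int (Suc r) \<in> I" "- int (Suc r) \<in> I" using nat_idx[of "Suc r"] r by auto
 have T1: "stab torus (Wp r W v b)"
  unfolding Wp_def
 proof (rule stab_torus_clos_weights[OF b1.G(1) W])
  fix u assume "u \<in> {Yp r b' v |b'. deglt r b' b}"
  thus "\<exists>\<nu>. wtv \<nu> u" using wtv_expo_word[OF wt mI(2) Suc_leD[OF r]] by auto
 qed
 have T2: "stab torus (Wm r W v b a)"
  unfolding Wm_def
 proof (rule stab_torus_clos_weights[OF b2.G(1) T1])
  fix u assume "u \<in> {Ym r a' (Yp r b v) |a'. deglt r a' a}"
  thus "\<exists>\<nu>. wtv \<nu> u" using wtv_row[OF wt r] by auto
 qed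
 have rv': "raises_into (idx0 r) W v" using rv unfolding raises_into_def by auto
 have "stab (D r \<union> torus) (Wm r W v b a)"
  using T2 b2.stab_lower[of a, unfolded d2] unfolding stab_def by blast
 moreover have "raises_into (idx0 r) (Wm r W v b a) (Ym r a (Yp r b v))"
  using b2.raises_into_lower[OF b1.raises_into_lower[OF rv', of b, unfolded d1], of a] unfolding d2 .
 moreover have "supp n (wrow r a b \<mu>)"
  unfolding wrow_def using su r by (intro supp_wsh) auto
 ultimately show ?thesis unfolding hw_def using wtv_row[OF wt r] r by auto
qed

end

text \<open>
 The inequalities for a row \<open>\<mu>\<close> and the exponents \<open>a\<close>, \<open>b\<close> of the roots \<open>\<epsilon>\<^sub>i - \<epsilon>\<^sub>m\<close>, \<open>\<epsilon>\<^sub>i + \<epsilon>\<^sub>m\<close>,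
 where \<open>m = r + 1\<close>. The next row is \<open>\<mu> - a - b\<close>.
\<close>

definition relD :: "nat => weight => (nat => rat) => (nat => rat) => bool" where
 "relD r \<mu> a b \<longleftrightarrow>
   (\<forall>k. 1 <= k \<and> k <= r --> 0 <= a k \<and> 0 <= b k) \<and>
   (\<forall>k. 1 <= k \<and> k < r --> b k <= \<mu> k - \<mu> (Suc k) \<and> a k + b k <= \<mu> k - \<mu> (Suc k) + b (Suc k)) \<and>
   (1 <= r --> b r <= \<mu> r + \<mu> (Suc r) \<and> a r <= \<mu> r - \<mu> (Suc r)) \<and>
   (2 <= r --> a (r - 1) + a r + b (r - 1) <= \<mu> (r - 1) - \<mu> (Suc r))"

abbreviation "relDn r \<mu> a b \<equiv> relD r \<mu> (%i. of_nat (a i)) (%i. of_nat (b i))"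

text \<open>\<open>q m False i\<close> and \<open>q m True i\<close> are the exponents of
  \<epsilon>_i - \<epsilon>_m and \<epsilon>_i + \<epsilon>_m. Rational values are allowed, since
  the same inequalities have to describe the cone.\<close>

fun patD :: "nat => weight => (nat => bool => nat => rat) => bool" where
 "patD 0 \<mu> q \<longleftrightarrow> True"
| "patD (Suc r) \<mu> q \<longleftrightarrow> relD r \<mu> (q (Suc r) False) (q (Suc r) True) \<and>
   patD r (%j. \<mu> j - q (Suc r) False j - q (Suc r) True j) q"

text \<open>Exponents are functions on all numbers, so equality of two tuples is expressed by
  agreement on 1 to r.\<close>

fun qlt :: "nat => (nat => bool => nat => nat) => (nat => bool => nat => nat) => bool" where
 "qlt 0 p q \<longleftrightarrow> False"
| "qlt (Suc r) p q \<longleftrightarrow> deglt r (p (Suc r) True) (q (Suc r) True) \<or>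
   (\<forall>i\<in>{1..r}. p (Suc r) True i = q (Suc r) True i) \<and>
   (deglt r (p (Suc r) False) (q (Suc r) False) \<or>
    (\<forall>i\<in>{1..r}. p (Suc r) False i = q (Suc r) False i) \<and> qlt r p q)"

abbreviation rats :: "(nat => bool => nat => nat) => nat => bool => nat => rat" where
 "rats q \<equiv> %m s i. of_nat (q m s i)"

lemma relD_cong:
 assumes "\<And>k. 1 <= k ==> k <= Suc r ==> \<mu> k = \<mu>' k"
  "\<And>k. 1 <= k ==> k <= r ==> a k = a' k" "\<And>k. 1 <= k ==> k <= r ==> b k = b' k"
 shows "relD r \<mu> a b = relD r \<mu>' a' b'"
 unfolding relD_def using assms by (simp cong: conj_cong imp_cong)

lemma patD_cong:
 assumes "\<And>k. 1 <= k ==> k <= r ==> \<mu> k = \<mu>' k" "\<And>m s i. 1 <= i ==> i < m ==> m <= r ==> q m s i = q' m s i"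
 shows "patD r \<mu> q = patD r \<mu>' q'"
 using assms
proof (induction r arbitrary: \<mu> \<mu>')
 case (Suc r)
 have "relD r \<mu> (q (Suc r) False) (q (Suc r) True) = relD r \<mu>' (q' (Suc r) False) (q' (Suc r) True)"
  by (rule relD_cong) (use Suc.prems in auto)
 moreover have "patD r (%j. \<mu> j - q (Suc r) False j - q (Suc r) True j) q = patD r (%j. \<mu>' j - q' (Suc r) False j - q' (Suc r) True j) q'"
  by (rule Suc.IH) (use Suc.prems in auto)
 ultimately show ?case by simp
qed simp

lemma row_eq: "j \<in> {1..r} ==> wrow r a b \<mu> j = \<mu> j - of_nat (a j) - of_nat (b j)"
 by (auto simp: wrow_def wsh_eq ev_def)

lemma patD_row:
 "patD (Suc r) \<mu> (rats q) \<longleftrightarrow>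
  relD r \<mu> (%i. of_nat (q (Suc r) False i)) (%i. of_nat (q (Suc r) True i)) \<and>
  patD r (wrow r (q (Suc r) False) (q (Suc r) True) \<mu>) (rats q)"
 using patD_cong[of r "wrow r (q (Suc r) False) (q (Suc r) True) \<mu>"] row_eq by auto

lemma qlt_cong: "(\<And>m. m <= r ==> p m = p' m) ==> (\<And>m. m <= r ==> q m = q' m) ==> qlt r p q = qlt r p' q'"
 by (induction r) auto

context block
begin

text \<open>The closure of all monomials is the union of the layers, and \<open>F s k\<close> maps
  each layer into the next one.\<close>

lemma K_limit:
 "stab (G \<union> {s} \<times> idx0 r) (clos G (W \<union> {Yb b v |b. True}))" (is "stab _ ?C")
proof -
 have K: "K d \<subseteq> ?C" for d
  by (rule order_trans[OF K_Yb clos_mono]) auto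
 have "?C \<subseteq> (\<Union>d. K d)"
 proof (rule clos_least)
  have "Yb b v \<in> K (Suc (length (expo_word r b)))" for b
   unfolding Yb_def by (rule Y_K[OF expo_word_idx]) simp
  thus "W \<union> {Yb b v |b. True} \<subseteq> (\<Union>d. K d)" using W_K[of _ 0] by blast
  show "stab G (\<Union>d. K d)"
   unfolding stab_def subspace_def
  proof (intro conjI ballI allI)
   show "0 \<in> (\<Union>d. K d)" using subspace_0[OF subspace_K] by blast
   show "x + y \<in> (\<Union>d. K d)" if xy: "x \<in> (\<Union>d. K d)" "y \<in> (\<Union>d. K d)" for x y
   proof -
    obtain d e where "x \<in> K d" "y \<in> K e" using xy by blast
    hence "x \<in> K (max d e)" "y \<in> K (max d e)"
     using K_mono[of d "max d e"] K_mono[of e "max d e"] by auto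
    thus ?thesis using subspace_add[OF subspace_K] by blast
   qed
   show "sc c x \<in> (\<Union>d. K d)" if "x \<in> (\<Union>d. K d)" for x c
    using that subspace_scale[OF subspace_K] by blast
   show "case p of (i, j) => \<forall>u\<in>(\<Union>d. K d). F i j u \<in> (\<Union>d. K d)" if "p \<in> G" for p
    using that stabD[OF stab_K] by (cases p) blast
  qed
 qed
 hence "F s k x \<in> ?C" if "k \<in> idx0 r" "x \<in> ?C" for k x
  using that F_s_K K by blast
 thus ?thesis using stab_clos[of G "W \<union> {Yb b v |b. True}"] unfolding stab_def by blast
qed

end

section \<open>Spanning by monomials\<close>

context so_rep
begin

lemma stab_span_Union:
 assumes G: "G \<subseteq> I \<times> I" and C: "\<And>A. A \<in> C ==> stab G A"
 shows "stab G (span (\<Union>C))"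
 unfolding stab_def
proof (intro conjI subspace_span ballI, clarify)
 fix i j u assume ij: "(i, j) \<in> G" and "u \<in> span (\<Union>C)"
 have I: "i \<in> I" "j \<in> I" using ij G by auto
 from \<open>u \<in> span (\<Union>C)\<close> show "F i j u \<in> span (\<Union>C)"
 proof (induction rule: span_induct_alt)
  case base
  show ?case using span_zero by (simp add: I)
 next
  case (step c x y)
  then obtain A where "A \<in> C" "x \<in> A" by blast
  hence "F i j x \<in> span (\<Union>C)" using stabD[OF C ij] span_base by blast
  thus ?case using step by (simp add: F_add F_scale I span_add span_scale)
 qed
qed

text \<open>Well-founded recursion along \<open>R\<close>: what \<open>y b\<close> adds to its
  predecessors is spanned by \<open>Z b\<close>, and \<open>L b\<close> consists of predecessors. So
  the \<open>Z b\<close> together span the filtered module over \<open>W\<close>.\<close>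

lemma filtered_span:
 assumes G: "G \<subseteq> I \<times> I" and R: "wf R" "trans R" and W: "stab G W"
  and L: "\<And>b. L b = clos G (W \<union> {y b' |b'. (b', b) \<in> R})"
  and Z: "\<And>b. clos G (insert (y b) (L b)) \<subseteq> span (L b \<union> Z b)"
 shows "L b \<subseteq> span (W \<union> (\<Union>b'\<in>{b'. (b', b) \<in> R}. Z b'))"
  and "clos G (W \<union> range y) \<subseteq> span (W \<union> (\<Union>b. Z b))"
proof -
 have main: "clos G (W \<union> y ` B) \<subseteq> span (W \<union> (\<Union>b'\<in>B. Z b'))"
  if B: "\<And>b. b \<in> B ==> L b \<subseteq> span (W \<union> (\<Union>b'\<in>B. Z b'))" for B
 proof -
  let ?M = "span (W \<union> (\<Union>b'\<in>B. Z b'))"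
  let ?C = "insert W ((%b. clos G (insert (y b) (L b))) ` B)"
  have "clos G (W \<union> y ` B) \<subseteq> span (\<Union>?C)"
  proof (rule clos_least)
   show "stab G (span (\<Union>?C))" by (rule stab_span_Union[OF G]) (use W stab_clos in auto)
   show "W \<union> y ` B \<subseteq> span (\<Union>?C)"
    by (rule order_trans[OF _ span_superset]) (auto intro: clos.base)
  qed
  also have "\<dots> \<subseteq> ?M"
  proof (rule span_minimal)
   have "clos G (insert (y b) (L b)) \<subseteq> ?M" if b: "b \<in> B" for b
   proof (rule order_trans[OF Z], rule span_minimal)
    show "L b \<union> Z b \<subseteq> ?M" using B[OF b] span_superset[of "W \<union> (\<Union>b'\<in>B. Z b')"] b by auto
   qed (rule subspace_span)
   thus "\<Union>?C \<subseteq> ?M" using span_superset[of "W \<union> (\<Union>b'\<in>B. Z b')"] by auto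
  qed (rule subspace_span)
  finally show ?thesis .
 qed
 have *: "L b \<subseteq> span (W \<union> (\<Union>b'\<in>{b'. (b', b) \<in> R}. Z b'))" for b
  using R(1)
 proof (induction b rule: wf_induct_rule)
  case (less b)
  let ?B = "{b'. (b', b) \<in> R}"
  have "clos G (W \<union> y ` ?B) \<subseteq> span (W \<union> (\<Union>b'\<in>?B. Z b'))"
  proof (rule main)
   fix c assume c: "c \<in> ?B"
   have "{b'. (b', c) \<in> R} \<subseteq> ?B" using c transD[OF R(2)] by blast
   thus "L c \<subseteq> span (W \<union> (\<Union>b'\<in>?B. Z b'))"
    using less[of c] c by (intro order_trans[OF less[of c] span_mono]) auto
  qed
  moreover have "{y b' |b'. (b', b) \<in> R} = y ` ?B" by blast
  ultimately show ?case unfolding L by simp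
 qed
 thus "L b \<subseteq> span (W \<union> (\<Union>b'\<in>{b'. (b', b) \<in> R}. Z b'))" .
 show "clos G (W \<union> range y) \<subseteq> span (W \<union> (\<Union>b. Z b))"
  using main[of UNIV] * by (meson UN_mono Un_mono order_refl order_trans span_mono subset_UNIV)
qed

text \<open>The signature vector of type D without the factors 1 / p!, which do not influence spans.
  The blocks of the largest m act first, and of these the plus block.\<close>

fun sv :: "nat => (nat => bool => nat => nat) => 'v => 'v" where
 "sv 0 q u = u"
| "sv (Suc r) q u = sv r q (Ym r (q (Suc r) False) (Yp r (q (Suc r) True) u))"

lemma expo_word_cong: "(\<And>i. i \<in> {1..r} ==> b i = c i) ==> expo_word r b = expo_word r c"
 unfolding expo_word_def by (intro arg_cong[of _ _ concat] map_cong) auto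

lemma sv_cong: "(\<And>m s. m <= r ==> q m s = q' m s) ==> sv r q u = sv r q' u"
 by (induction r arbitrary: u) auto

lemma stab_foldr:
 assumes "stab G N" "{s} \<times> idx0 r \<subseteq> G" "u \<in> N"
 shows "foldr (F s) (expo_word r b) u \<in> N"
proof -
 have "foldr (F s) w u \<in> N" if "set w \<subseteq> idx0 r" for w
  using that by (induction w) (use assms in \<open>auto intro!: stabD[OF assms(1)]\<close>)
 thus ?thesis using set_expo_word[of r b] by force
qed

lemma stab_sv: "stab (D r) N ==> u \<in> N ==> sv r q u \<in> N"
proof (induction r arbitrary: u)
 case (Suc r)
 have "stab (D r) N" by (rule stab_mono[OF Suc.prems(1)]) auto
 moreover have "Ym r a (Yp r b u) \<in> N" for a b
  by (intro stab_foldr[OF Suc.prems(1)] Suc.prems) auto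
 ultimately show ?case using Suc.IH by simp
qed simp

lemma trans_deglt: "trans {(b, c). deglt r b c}"
 by (rule transI) (auto intro: deglt_trans)

lemma Wp_stab: "stab (Pa r) (Wp r W v b)" and Wm_stab: "stab (D r) (Wm r W v b a)"
 by (simp_all add: Wp_def Wm_def stab_clos)

lemma Wp_Wm: "Wp r W v b \<subseteq> Wm r W v b a"
 unfolding Wm_def by (auto intro: clos.base)

lemma W_Wp: "W \<subseteq> Wp r W v b"
 unfolding Wp_def by (auto intro: clos.base)

text \<open>The filtration by plus exponents is refined by minus exponents, and \<open>Sp\<close>,
  the statement for so(2r), spans each piece of the refinement.\<close>

lemma row_span:
 assumes hw: "hw (Suc r) \<mu> W v"
  and Sp: "\<And>W v \<mu>. hw r \<mu> W v ==> clos (D r) (insert v W) \<subseteq> span (W \<union> {sv r q v |q. True})"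
 shows "Wm r W v b a \<subseteq> span (Wp r W v b \<union> {sv r q (Ym r a' (Yp r b v)) |q a'. deglt r a' a})" (is ?A)
  and "Wp r W v b \<subseteq> span (W \<union> {sv r q (Ym r a' (Yp r b' v)) |q a' b'. deglt r b' b})" (is ?B)
  and "clos (D (Suc r)) (insert v W) \<subseteq> span (W \<union> {sv (Suc r) q v |q. True})" (is ?C)
proof -
 interpret b1: block sc X n F "- int (Suc r)" r "Pa r" W v by (rule block_plus[OF hw])
 note d1 = block_plus_defs[OF b1.block_axioms]
 let ?R = "{(b, c). deglt r b c}"
 have r: "Suc r <= n" and T: "stab torus W"
  using hw by (auto simp: hw_def stab_def)
 let ?m = "int (Suc r)"
 have mI: "?m \<in> I" "- ?m \<in> I" using nat_idx[of "Suc r"] r by auto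
 let ?x = "%b a. Ym r a (Yp r b v)"
 {
  fix b
  interpret b2: block sc X n F "int (Suc r)" r "D r" "Wp r W v b" "Yp r b v" by (rule block_minus[OF hw])
  note d2 = block_minus_defs[OF b2.block_axioms]
  have Z: "clos (D r) (insert (?x b a) (Wm r W v b a)) \<subseteq> span (Wm r W v b a \<union> {sv r q (?x b a) |q. True})" for a
   by (rule Sp[OF hw_row[OF hw]])
  have L: "Wm r W v b a = clos (D r) (Wp r W v b \<union> {?x b a' |a'. (a', a) \<in> ?R})" for a
   by (simp add: Wm_def)
  note fs = filtered_span[OF b2.G(1) wf_deglt trans_deglt b2.stabG L Z]
  have "(\<Union>a'\<in>{a'. (a', a) \<in> ?R}. {sv r q (?x b a') |q. True}) = {sv r q (?x b a') |q a'. deglt r a' a}" for a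
   by auto
  with fs(1)
  have A: "Wm r W v b a \<subseteq> span (Wp r W v b \<union> {sv r q (?x b a') |q a'. deglt r a' a})" for a by simp
  have "(\<Union>a'. {sv r q (?x b a') |q. True}) = {sv r q (?x b a') |q a'. True}" by auto
  with fs(2) have A2: "clos (D r) (Wp r W v b \<union> {?x b a |a. True}) \<subseteq> span (Wp r W v b \<union> {sv r q (?x b a') |q a'. True})"
   by (simp add: full_SetCompr_eq)
  let ?N = "clos (D r) (Wp r W v b \<union> {?x b a |a. True})"
  have "stab torus ?N"
  proof (rule stab_torus_clos_weights[OF b2.G(1)])
   show "stab torus (Wp r W v b)" unfolding Wp_def
   proof (rule stab_torus_clos_weights[OF b1.G(1) T])
    fix u assume "u \<in> {Yp r b' v |b'. deglt r b' b}"
    thus "\<exists>\<nu>. wtv \<nu> u" using wtv_expo_word[OF _ mI(2) Suc_leD[OF r]] hw unfolding hw_def by blast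
   qed
   fix u assume "u \<in> {?x b a |a. True}"
   thus "\<exists>\<nu>. wtv \<nu> u" using wtv_row[OF _ r] hw unfolding hw_def by blast
  qed
  \<comment> \<open>\<open>K_limit\<close> accounts for so(2r) and the operators
    \<open>F ?m k\<close>; the remaining element of the parabolic comes from the torus.\<close>
  hence mm: "F ?m ?m u \<in> ?N" if "u \<in> ?N" for u
   using stabD[of torus ?N ?m ?m u] that r by fastforce
  have "stab (Pa r) ?N"
   using b2.K_limit[unfolded d2] mm unfolding stab_def Pa_def by blast
  moreover have "insert (Yp r b v) (Wp r W v b) \<subseteq> ?N"
  proof -
   have "expo_word r (%_. 0) = []" by (simp add: expo_word_def concat_eq_Nil_conv)
   hence "?x b (%_. 0) = Yp r b v" by simp
   thus ?thesis by (auto intro!: clos.base) (metis foldr.simps(1) id_apply)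
  qed
  ultimately have "clos (Pa r) (insert (Yp r b v) (Wp r W v b)) \<subseteq> ?N" by (rule clos_least[rotated])
  note A and order_trans[OF this A2]
 }
 note A = this
 show ?A by (rule A(1))
 have L: "Wp r W v b = clos (Pa r) (W \<union> {Yp r b' v |b'. (b', b) \<in> ?R})" for b
  by (simp add: Wp_def)
 note fs = filtered_span[OF b1.G(1) wf_deglt trans_deglt b1.stabG L A(2)]
 have e: "(\<Union>b'\<in>{b'. (b', b) \<in> ?R}. {sv r q (?x b' a') |q a'. True}) = {sv r q (?x b' a') |q a' b'. deglt r b' b}"
  by auto
 show ?B using fs(1)[of b] unfolding e .
 let ?N = "clos (Pa r) (W \<union> {Yp r b v |b. True})"
 have N: "stab (Pa r \<union> {- ?m} \<times> idx0 r) ?N" using b1.K_limit[unfolded d1] .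
 note subN = stab_subspace[OF N]
 have "F i j u \<in> ?N" if ij: "(i, j) \<in> D (Suc r)" and u: "u \<in> ?N" for i j u
 proof -
  have I: "i \<in> I" "j \<in> I" using ij r by (auto intro: idx_nonzero)
  have p: "F i j u \<in> ?N" if "(i, j) \<in> Pa r \<union> {- ?m} \<times> idx0 r" for i j
   by (rule stabD[OF N that u])
  have neg: "F i j u \<in> ?N" if "F (- j) (- i) u \<in> ?N"
   using F_swap[OF I] subspace_neg[OF subN that] by simp
  have "i \<in> idx0 r \<or> i = ?m \<or> i = - ?m" "j \<in> idx0 r \<or> j = ?m \<or> j = - ?m" using ij by auto
  hence "(i, j) \<in> Pa r \<union> {- ?m} \<times> idx0 r \<or> (- j, - i) \<in> Pa r \<union> {- ?m} \<times> idx0 r \<or> j = - i"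
   by (elim disjE) (simp_all add: Pa_def)
  then consider "(i, j) \<in> Pa r \<union> {- ?m} \<times> idx0 r" | "(- j, - i) \<in> Pa r \<union> {- ?m} \<times> idx0 r" | "j = - i"
   by blast
  thus ?thesis
  proof cases
   case 3
   thus ?thesis using F_anti_diag[OF I(1)] subspace_0[OF subN] by simp
  qed (use p neg in auto)
 qed
 hence "stab (D (Suc r)) ?N" using subN unfolding stab_def by blast
 moreover have "insert v W \<subseteq> ?N"
 proof -
  have "expo_word r (%_. 0) = []" by (simp add: expo_word_def concat_eq_Nil_conv)
  hence "Yp r (%_. 0) v = v" by simp
  thus ?thesis by (auto intro!: clos.base) metis
 qed
 ultimately have "clos (D (Suc r)) (insert v W) \<subseteq> ?N" by (rule clos_least[rotated])
 also have "?N \<subseteq> span (W \<union> (\<Union>b. {sv r q (?x b a') |q a'. True}))"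
  using fs(2) by (simp add: full_SetCompr_eq)
 also have "(\<Union>b. {sv r q (?x b a') |q a'. True}) \<subseteq> {sv (Suc r) q v |q. True}"
 proof clarify
  fix b q a
  let ?q = "q(Suc r := (%s. if s then b else a)) :: nat => bool => nat => nat"
  have "sv r q (?x b a) = sv (Suc r) ?q v" using sv_cong[of r q ?q] by simp
  thus "\<exists>q'. sv r q (?x b a) = sv (Suc r) q' v \<and> True" by blast
 qed
 hence "span (W \<union> (\<Union>b. {sv r q (?x b a') |q a'. True})) \<subseteq> span (W \<union> {sv (Suc r) q v |q. True})"
  by (rule span_mono[OF Un_mono[OF order_refl]])
 finally show ?C .
qed

text \<open>The spanning half of the Poincare-Birkhoff-Witt theorem, modulo \<open>W\<close>, by
  induction on the rank.\<close>

lemma sv_span: "hw r \<mu> W v ==> clos (D r) (insert v W) \<subseteq> span (W \<union> {sv r q v |q. True})"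
proof (induction r arbitrary: \<mu> W v)
 case 0
 have "D 0 = {}" by auto
 hence "stab (D 0) (span (insert v W))" by (simp add: stab_def)
 hence "clos (D 0) (insert v W) \<subseteq> span (insert v W)" by (intro clos_least span_superset)
 thus ?case by simp
next
 case (Suc r)
 show ?case by (rule row_span(3)[OF Suc.prems Suc.IH])
qed

lemma Wm_span:
 assumes hw: "hw (Suc r) \<mu> W v"
 shows "Wm r W v (q (Suc r) True) (q (Suc r) False) \<subseteq> span (W \<union> {sv (Suc r) q' v |q'. qlt (Suc r) q' q})"
  (is "_ \<subseteq> span ?M")
proof -
 let ?b = "q (Suc r) True" and ?a = "q (Suc r) False"
 note rs = row_span[OF hw sv_span]
 have g: "sv r p (Ym r a (Yp r b v)) \<in> span ?M" if "deglt r b ?b \<or> b = ?b \<and> deglt r a ?a" for p a b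
 proof -
  let ?q = "p(Suc r := (%s. if s then b else a))"
  have "sv r p (Ym r a (Yp r b v)) = sv (Suc r) ?q v" using sv_cong[of r p ?q] by simp
  moreover have "qlt (Suc r) ?q q" using that by auto
  ultimately show ?thesis by (intro span_base UnI2 CollectI exI[of _ ?q]) simp
 qed
 have "W \<union> {sv r p (Ym r a (Yp r b v)) |p a b. deglt r b ?b} \<subseteq> span ?M"
 proof
  fix x assume "x \<in> W \<union> {sv r p (Ym r a (Yp r b v)) |p a b. deglt r b ?b}"
  then consider "x \<in> W" | p a b where "x = sv r p (Ym r a (Yp r b v))" "deglt r b ?b" by blast
  thus "x \<in> span ?M"
  proof cases
   case 1
   thus ?thesis by (intro span_base UnI1)
  next
   case 2
   thus ?thesis using g[of b a p] by blast
  qed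
 qed
 hence "Wp r W v ?b \<subseteq> span ?M"
  by (intro order_trans[OF rs(2) span_minimal] subspace_span)
 moreover have "{sv r p (Ym r a (Yp r ?b v)) |p a. deglt r a ?a} \<subseteq> span ?M"
 proof clarify
  fix p a assume "deglt r a ?a"
  thus "sv r p (Ym r a (Yp r ?b v)) \<in> span ?M" by (intro g) simp
 qed
 ultimately have "span (Wp r W v ?b \<union> {sv r p (Ym r a (Yp r ?b v)) |p a. deglt r a ?a}) \<subseteq> span ?M"
  by (intro span_minimal subspace_span) auto
 thus ?thesis using rs(1) by (rule order_trans[rotated])
qed

end

section \<open>Upper bound\<close>

text \<open>Nilpotency is required on the whole type, not only on a module. It can be arranged
  because the extended operators map every vector into the module.\<close>

locale int_rep = so_rep sc X n F
 for sc :: "complex => 'v::ab_group_add => 'v" and X n F +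
 assumes nilp: "\<And>i j. i \<in> I ==> j \<in> I ==> i \<noteq> j ==> i \<noteq> - j ==> nilp i j"
begin

text \<open>Each of the five inequalities bounds the length of a root string. If it fails, a power
  of a root operator sends the relevant vector into the smaller subspace, and this is carried over
  to the monomial.\<close>

lemma step_upper:
 assumes hw: "hw (Suc r) \<mu> W v" and rel: "\<not> relDn r \<mu> a b"
 shows "Ym r a (Yp r b v) \<in> Wm r W v b a"
proof -
 interpret b1: block sc X n F "- int (Suc r)" r "Pa r" W v by (rule block_plus[OF hw])
 note d1 = block_plus_defs[OF b1.block_axioms]
 interpret b2: block sc X n F "int (Suc r)" r "D r" "Wp r W v b" "Yp r b v" by (rule block_minus[OF hw])
 note d2 = block_minus_defs[OF b2.block_axioms]
 let ?m = "int (Suc r)"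
 let ?v1 = "Yp r b v"
 have r: "Suc r <= n" and rv: "raises_into (idx0 (Suc r)) W v" and W: "stab (D (Suc r)) W"
  and wt: "wtv \<mu> v"
  using hw by (auto simp: hw_def stab_def)
 have mI: "?m \<in> I" "- ?m \<in> I" using nat_idx[of "Suc r"] r by auto
 have Ir: "k \<in> I" if "k \<in> idx0 (Suc r)" for k by (rule idx_nonzero) (use that r in auto)
 have kI: "int k \<in> I" if "k \<in> {1..Suc r}" for k using Ir[of "int k"] that by auto
 have up: "F (int i) j v \<in> W" if "i \<in> {1..Suc r}" "j \<in> idx0 (Suc r)" "prec (int i) j" for i j
  using rv that unfolding raises_into_def by auto
 have kill: "(F j (int i) ^^ N) v \<in> W"
  if "i \<in> {1..Suc r}" "j \<in> idx0 (Suc r)" "prec (int i) j" "int i \<noteq> j" "int i \<noteq> - j" "ext \<mu> (int i) - ext \<mu> j < of_nat N" for i j N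
 proof (rule sl2_kill[OF kI Ir _ _ wt])
  show "stab {(int i, j), (j, int i)} W" by (rule stab_mono[OF W]) (use that in auto)
  show "nilp j (int i)" using that kI Ir by (intro nilp) auto
  show "2 * (ext \<mu> (int i) - ext \<mu> j) < dbl (int i) j * of_nat N" using that by (auto simp: dbl_def)
 qed (use that up in auto)
 have v1_done: ?thesis if "?v1 \<in> Wp r W v b"
  using b2.W_lower[OF b2.Yb_W[OF that], unfolded d2] .
 \<comment> \<open>The string of \<epsilon>_k - \<epsilon>_(k+1) through \<open>v\<close> is too
   short; \<open>move_exponent\<close> carries this to the plus block.\<close>
 have c1: ?thesis if 1: "1 <= k" "k < r" "of_nat (b k) > \<mu> k - \<mu> (Suc k)" for k
 proof -
  have "(F (int (Suc k)) (int k) ^^ b k) v \<in> W"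
   by (rule kill) (use 1 in \<open>auto simp: prec_def\<close>)
  from b1.move_exponent[OF 1(1) _ b1.v_K b1.Yb_lower _ this] 1
  show ?thesis unfolding d1 by (intro v1_done) auto
 qed
 \<comment> \<open>The operator of \<epsilon>_r + \<epsilon>_(r+1) acts first in the plus
   monomial.\<close>
 have c2: ?thesis if 2: "r \<ge> 1" "of_nat (b r) > \<mu> r + \<mu> (Suc r)"
 proof -
  have "(F (- ?m) (int r) ^^ b r) v \<in> W"
   by (rule kill) (use 2 in \<open>auto simp: prec_def\<close>)
  from b1.W_lower[OF b1.Yb_last[where b = b, OF 2(1) this]]
  show ?thesis unfolding d1 by (rule v1_done)
 qed
 \<comment> \<open>The argument of \<open>c1\<close> for the minus block. It starts from
   \<open>?v1\<close>, whose pairing has changed by \<open>b (Suc k) - b k\<close>.\<close>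
 have c3: ?thesis if 3: "1 <= k" "k < r" "of_nat (a k) + of_nat (b k) > \<mu> k - \<mu> (Suc k) + of_nat (b (Suc k))" for k
 proof -
  let ?\<nu> = "wsh (- ?m) r b \<mu>"
  have wt1: "wtv ?\<nu> ?v1" by (rule wtv_expo_word[OF wt mI(2) b1.r])
  have rv1: "raises_into (idx0 r) (Wp r W v b) ?v1"
   using b1.raises_into_lower[of b] rv unfolding d1 raises_into_def by auto
  have "(F (int (Suc k)) (int k) ^^ a k) ?v1 \<in> Wp r W v b"
  proof (rule sl2_kill[OF _ _ _ _ wt1])
   show "int k \<in> I" "int (Suc k) \<in> I" using 3 kI by auto
   thus "nilp (int (Suc k)) (int k)" by (intro nilp) auto
   show "stab {(int k, int (Suc k)), (int (Suc k), int k)} (Wp r W v b)"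
    by (rule stab_mono[OF Wp_stab]) (use 3 in \<open>auto simp: Pa_def\<close>)
   show "F (int k) (int (Suc k)) ?v1 \<in> Wp r W v b"
    using rv1 3 unfolding raises_into_def by (auto simp: prec_def)
   have "ev (- ?m) k = 0" "ev (- ?m) (Suc k) = 0" using 3 by (auto simp: ev_def)
   thus "2 * (ext ?\<nu> (int k) - ext ?\<nu> (int (Suc k))) < dbl (int k) (int (Suc k)) * of_nat (a k)"
    using 3 by (simp add: dbl_def wsh_eq)
  qed auto
  from b2.move_exponent[OF 3(1) _ b2.v_K b2.Yb_lower _ this] 3
  show ?thesis unfolding d2 by auto
 qed
 \<comment> \<open>The power of \<open>F ?m r\<close> already kills \<open>v\<close> modulo
   \<open>W\<close>, and it can be pulled through the plus block.\<close>
 have c4: ?thesis if 4: "r \<ge> 1" "of_nat (a r) > \<mu> r - \<mu> (Suc r)"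
 proof -
  have "(F ?m (int r) ^^ a r) v \<in> W"
   by (rule kill) (use 4 in \<open>auto simp: prec_def\<close>)
  hence 1: "Yp r b ((F ?m (int r) ^^ a r) v) \<in> Wp r W v b"
   using b1.W_lower[OF b1.Yb_W] unfolding d1 by blast
  have 2: "(F ?m (int r) ^^ a r) ?v1 - Yp r b ((F ?m (int r) ^^ a r) v) \<in> Wp r W v b"
   using b1.commute_G_funpow[OF _ b1.v_K Pa_bracket[OF r]] 4 unfolding d1 by (auto simp: Pa_def)
  have "(F ?m (int r) ^^ a r) ?v1 \<in> Wp r W v b"
   using subspace_add[OF stab_subspace[OF Wp_stab] 1 2] by simp
  from b2.W_lower[OF b2.Yb_last[where b = a, OF 4(1) this]]
  show ?thesis unfolding d2 .
 qed
 \<comment> \<open>The string of \<epsilon>_(r-1) - \<epsilon>_(r+1) through \<open>v\<close>, with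
   \<open>?t + ?p\<close> factors. \<open>F ?r ?m\<close> trades \<open>?t\<close> of them for
   \<open>F ?r ?s\<close>, so that \<open>move_exponent\<close> applies to the plus block;
   afterwards \<open>F ?s ?r\<close> trades \<open>a r\<close> of the remaining \<open>?p\<close>
   for \<open>F ?m ?r\<close>, which yields the minus monomial.\<close>
 have c5: ?thesis if 5: "r \<ge> 2" "of_nat (a (r - 1)) + of_nat (a r) + of_nat (b (r - 1)) > \<mu> (r - 1) - \<mu> (Suc r)"
 proof -
  define s where "s = r - 1"
  have rs: "r = Suc s" "s \<ge> 1" using 5 by (auto simp: s_def)
  let ?r = "int r" and ?s = "int s"
  have I: "?r \<in> I" "?s \<in> I" using rs kI by auto
  have ne: "?r \<noteq> ?s" "?r \<noteq> ?m" "?s \<noteq> ?m" "?r \<noteq> - ?s" "?r \<noteq> - ?m" "?s \<noteq> - ?m" "?m \<noteq> - ?m" "?r \<noteq> - ?r" "?s \<noteq> - ?s"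
   using rs by auto
  let ?t = "b s" and ?p = "a s + a r"
  have "(F ?m ?s ^^ (?t + ?p)) v \<in> W"
   by (rule kill) (use 5 rs in \<open>auto simp: prec_def\<close>)
  hence "(F ?r ?s ^^ ?t) ((F ?m ?s ^^ (?t + ?p - ?t)) v) \<in> W"
  proof (rule transfer[of ?r ?m ?m ?s ?r ?s W 1, rotated -2])
   show "stab {(?r, ?m), (?m, ?s), (?r, ?s)} W"
    by (rule stab_mono[OF W]) (use rs in auto)
   show "F ?r ?m v \<in> W" using up[of r ?m] rs by (auto simp: prec_def)
  qed (use I mI ne F_F[of ?r ?m ?m ?s] F_F[of ?r ?m ?r ?s] F_F[of ?r ?s ?m ?s] in auto)
  hence t: "(F (int (Suc s)) ?s ^^ ?t) ((F ?m ?s ^^ ?p) v) \<in> W" by (simp add: rs)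
  have msG: "(?m, ?s) \<in> Pa r" using rs by (auto simp: Pa_def)
  have com: "(F ?m ?s ^^ ?p) (Yp r c v) - Yp r c ((F ?m ?s ^^ ?p) v) \<in> Wp r W v c" for c
   using b1.commute_G_funpow[OF msG b1.v_K Pa_bracket[OF r]] rs unfolding d1 by auto
  note subW = stab_subspace[OF Wp_stab]
  \<comment> \<open>\<open>F ?m ?s\<close> commutes with the plus block modulo smaller terms and
    preserves \<open>Wp\<close>, so smaller monomials stay small on the new starting vector.\<close>
  have low: "Yp r c ((F ?m ?s ^^ ?p) v) \<in> Wp r W v b" if "deglt r c b" for c
  proof -
   have 1: "(F ?m ?s ^^ ?p) (Yp r c v) - Yp r c ((F ?m ?s ^^ ?p) v) \<in> Wp r W v b"
    using com b1.lower_mono[OF that] unfolding d1 by blast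
   have 2: "(F ?m ?s ^^ ?p) (Yp r c v) \<in> Wp r W v b"
    using b1.Yb_lower[OF that] unfolding d1 by (rule stab_funpow[OF Wp_stab msG])
   show ?thesis using subspace_diff[OF subW 2 1] by simp
  qed
  have "Yp r b ((F ?m ?s ^^ ?p) v) \<in> Wp r W v b"
   using b1.move_exponent[OF rs(2) _ stab_funpow[OF b1.stab_K msG b1.v_K] _ _ t, of b] low rs
   unfolding d1 by auto
  from subspace_add[OF subW com[of b] this]
  have p: "(F ?m ?s ^^ ?p) ?v1 \<in> Wp r W v b" by simp
  have e: "F ?s ?r ?v1 \<in> Wp r W v b"
   using b1.raises_into_lower[of b] rv rs unfolding d1 raises_into_def by (auto simp: prec_def)
  have "(F ?m ?r ^^ a r) ((F ?m ?s ^^ (?p - a r)) ?v1) \<in> Wp r W v b"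
  proof (rule transfer[of ?s ?r ?m ?s ?m ?r "Wp r W v b" "-1"])
   show "stab {(?s, ?r), (?m, ?s), (?m, ?r)} (Wp r W v b)"
    by (rule stab_mono[OF Wp_stab]) (use rs in \<open>auto simp: Pa_def\<close>)
  qed (use I mI ne p e F_F[of ?s ?r ?m ?s] F_F[of ?s ?r ?m ?r] F_F[of ?m ?r ?m ?s] F_anti_diag[OF mI(1)] in auto)
  hence "(F ?m ?r ^^ a r) ((F ?m ?s ^^ a s) ?v1) \<in> Wp r W v b" by simp
  moreover have "(F ?m ?r ^^ i) ((F ?m ?s ^^ j) u) = (F ?m ?s ^^ j) ((F ?m ?r ^^ i) u)" for i j u
  proof -
   have 1: "F ?m ?r (F ?m ?s u) = F ?m ?s (F ?m ?r u)" for u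
    using F_F[of ?m ?r ?m ?s u] I mI ne by simp
   have 2: "F ?m ?r ((F ?m ?s ^^ j) u) = (F ?m ?s ^^ j) (F ?m ?r u)" for u by (induction j) (auto simp: 1)
   show ?thesis by (induction i) (auto simp: 2)
  qed
  ultimately have "(F ?m (int (r - 1)) ^^ a (r - 1)) ((F ?m ?r ^^ a r) ?v1) \<in> Wp r W v b"
   by (simp add: s_def)
  from b2.W_lower[OF b2.Yb_last2[where b = a, OF 5(1) this]]
  show ?thesis unfolding d2 .
 qed
 show ?thesis
 proof (rule ccontr)
  assume nt: "\<not> ?thesis"
  have "relDn r \<mu> a b"
   unfolding relD_def
  proof (intro conjI allI impI)
   fix k assume k: "1 <= k \<and> k < r"
   show "of_nat (b k) <= \<mu> k - \<mu> (Suc k)" using c1[of k] k nt by (meson not_le)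
   show "of_nat (a k) + of_nat (b k) <= \<mu> k - \<mu> (Suc k) + of_nat (b (Suc k))"
    using c3[of k] k nt by (meson not_le)
  qed (use c2 c4 c5 nt in \<open>meson not_le of_nat_0_le_iff\<close>)+
  with rel show False by simp
 qed
qed

text \<open>Either the first row violates its inequalities and \<open>step_upper\<close> applies, or
  the violation occurs in the pattern of the next row.\<close>

lemma sv_upper:
 assumes "hw r \<mu> W v" "\<not> patD r \<mu> (rats q)"
 shows "sv r q v \<in> span (W \<union> {sv r q' v |q'. qlt r q' q})"
 using assms
proof (induction r arbitrary: \<mu> W v)
 case (Suc r)
 let ?b = "q (Suc r) True" and ?a = "q (Suc r) False"
 let ?v = "Ym r ?a (Yp r ?b v)" and ?W = "Wm r W v ?b ?a"
 let ?S = "W \<union> {sv (Suc r) q' v |q'. qlt (Suc r) q' q}"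
 note Wm = Wm_span[OF Suc.prems(1), of q]
 show ?case
 proof (cases "relDn r \<mu> ?a ?b")
  case False
  have "sv r q ?v \<in> ?W" by (rule stab_sv[OF Wm_stab step_upper[OF Suc.prems(1) False]])
  thus ?thesis using Wm by auto
 next
  case True
  have "sv r q ?v \<in> span (?W \<union> {sv r q' ?v |q'. qlt r q' q})"
   by (rule Suc.IH[OF hw_row[OF Suc.prems(1)]]) (use Suc.prems(2) True patD_row in blast)
  also have "\<dots> \<subseteq> span ?S"
  proof (rule span_minimal[OF _ subspace_span], rule Un_least[OF Wm], clarify)
   fix q' assume "qlt r q' q"
   define p where "p = q'(Suc r := q (Suc r))"
   have "sv r q' ?v = sv (Suc r) p v" using sv_cong[of r q' p] by (simp add: p_def)
   moreover have "qlt (Suc r) p q"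
    using \<open>qlt r q' q\<close> qlt_cong[of r q' p q q] by (simp add: p_def)
   ultimately show "sv r q' ?v \<in> span ?S" by (intro span_base UnI2 CollectI exI[of _ p]) simp
  qed
  finally show ?thesis by simp
 qed
qed simp

end

section \<open>Lower bound for generator weights\<close>

text \<open>The coefficients n, ..., 1 make \<open>ht n (ev k)\<close> strictly decreasing along
  \<open>prec\<close>, with value 0 at the index 0. Every raising operator therefore raises the
  height by at least 1.\<close>

definition ht :: "nat => weight => rat" where
 "ht n \<gamma> = (\<Sum>i = 1..n. of_nat (Suc n - i) * \<gamma> i)"

lemma ht_ev: "\<bar>k\<bar> <= int n ==> ht n (ev k) = (if k = 0 then 0 else of_int (sgn k * (int n + 1 - \<bar>k\<bar>)))"
proof -
 assume k: "\<bar>k\<bar> <= int n"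
 have pos: "ht n (ev (int j)) = of_nat (Suc n - j)" if "j \<in> {1..n}" for j
 proof -
  have "ht n (ev (int j)) = (\<Sum>i = 1..n. if i = j then of_nat (Suc n - j) else 0)"
   unfolding ht_def using that by (intro sum.cong) (auto simp: ev_def)
  also have "\<dots> = of_nat (Suc n - j)" using that by (subst sum.delta) auto
  finally show ?thesis .
 qed
 have neg: "ht n (- \<gamma>) = - ht n \<gamma>" for \<gamma> by (simp add: ht_def sum_negf)
 have "ht n 0 = 0" by (simp add: ht_def)
 consider "k = 0" | "k > 0" | "k < 0" by linarith
 thus ?thesis
 proof cases
  case 2
  hence "k = int (nat k)" "nat k \<in> {1..n}" using k by auto
  thus ?thesis using pos[of "nat k"] 2 by (simp add: of_nat_diff)
 next
  case 3
  hence e: "ev k = - ev (int (nat (- k)))" "nat (- k) \<in> {1..n}"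
   using k ev_uminus[of "- k"] by auto
  show ?thesis unfolding e(1) neg pos[OF e(2)] using 3 e(2) by (simp add: of_nat_diff)
 qed (use \<open>ht n 0 = 0\<close> in simp)
qed

lemma ht_prec: "\<bar>i\<bar> <= int n ==> \<bar>j\<bar> <= int n ==> prec i j ==> ht n (ev j) + 1 <= ht n (ev i)"
 by (auto simp: ht_ev prec_def sgn_if split: if_splits)

lemma pos_cone_functional:
 assumes "\<gamma> \<in> pos_cone A" and "\<phi> 0 = (0::rat)" "\<And>x y. \<phi> (x + y) = \<phi> x + \<phi> y" "\<And>x y. \<phi> (x - y) = \<phi> x - \<phi> y"
  and "\<And>i j. i \<in> A ==> j \<in> A ==> prec i j ==> i \<noteq> - j ==> \<phi> (ev j) <= \<phi> (ev i)"
 shows "\<phi> \<gamma> \<ge> 0"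
 using assms(1)
proof (induction rule: pos_cone.induct)
 case (add \<gamma> i j)
 hence "\<phi> (ev j) <= \<phi> (ev i)" using assms(5) by blast
 thus ?case using add.IH by (simp add: assms(3,4) del: plus_fun_apply)
qed (simp only: assms(2) order_refl)

lemma ht_linear: "ht n 0 = 0" "ht n (x + y) = ht n x + ht n y" "ht n (x - y) = ht n x - ht n y"
 by (simp_all add: ht_def sum.distrib sum_subtractf algebra_simps)

lemma ht_pos_cone: "\<gamma> \<in> pos_cone A ==> A \<subseteq> {i. \<bar>i\<bar> <= int n} ==> 0 <= ht n \<gamma>"
proof (rule pos_cone_functional[where \<phi> = "ht n", OF _ ht_linear])
 fix i j assume "A \<subseteq> {i. \<bar>i\<bar> <= int n}" "i \<in> A" "j \<in> A" "prec i j"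
 thus "ht n (ev j) <= ht n (ev i)" using ht_prec[of i n j] by fastforce
qed

lemma partial_sum_pos_cone:
 assumes "\<gamma> \<in> pos_cone (idx0 r)" "t <= r"
 shows "0 <= (\<Sum>i = 1..t. \<gamma> i)"
proof (rule pos_cone_functional[where \<phi> = "%\<gamma>. \<Sum>i = 1..t. \<gamma> i", OF assms(1)])
 have e: "(\<Sum>i = 1..t. ev k i) = (if \<bar>k\<bar> <= int t then of_int (sgn k) else 0)" for k
 proof -
  have "(\<Sum>i = 1..t. ev k i) = (\<Sum>i = 1..t. if i = nat \<bar>k\<bar> then of_int (sgn k) else 0)"
   by (intro sum.cong) (auto simp: ev_def sgn_if)
  also have "\<dots> = (if \<bar>k\<bar> <= int t then of_int (sgn k) else 0)"
   by (cases "k = 0") (subst sum.delta, auto)+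
  finally show ?thesis .
 qed
 show "(\<Sum>k = 1..t. ev j k) <= (\<Sum>k = 1..t. ev i k)" if "prec i j" for i j
  unfolding e using that by (auto simp: prec_def sgn_if split: if_splits)
qed (auto simp: sum.distrib sum_subtractf)

text \<open>A multiple of the half-spin weight with a minus sign at r. It is nonnegative on the
  roots of type D, whereas on 2 \<epsilon>_r, excluded by the condition on i and - j, it is
  negative.\<close>

lemma partial_sum_pos_cone':
 assumes "\<gamma> \<in> pos_cone (idx0 r)" "r \<ge> 1"
 shows "0 <= (\<Sum>i = 1..<r. \<gamma> i) - \<gamma> r"
proof (rule pos_cone_functional[where \<phi> = "%\<gamma>. (\<Sum>i = 1..<r. \<gamma> i) - \<gamma> r", OF assms(1)])
 have e: "(\<Sum>i = 1..<r. ev k i) - ev k r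
  = (if \<bar>k\<bar> < int r then of_int (sgn k) else if \<bar>k\<bar> = int r then - of_int (sgn k) else 0)" for k
 proof -
  have "(\<Sum>i = 1..<r. ev k i) = (\<Sum>i = 1..<r. if i = nat \<bar>k\<bar> then of_int (sgn k) else 0)"
   by (intro sum.cong) (auto simp: ev_def sgn_if)
  also have "\<dots> = (if \<bar>k\<bar> < int r then of_int (sgn k) else 0)"
   by (cases "k = 0") (subst sum.delta, auto)+
  finally have s: "(\<Sum>i = 1..<r. ev k i) = (if \<bar>k\<bar> < int r then of_int (sgn k) else 0)" .
  show ?thesis unfolding s using assms(2) by (auto simp: ev_def sgn_if)
 qed
 show "(\<Sum>k = 1..<r. ev j k) - ev j r <= (\<Sum>k = 1..<r. ev i k) - ev i r"
  if "i \<in> idx0 r" "j \<in> idx0 r" "prec i j" "i \<noteq> - j" for i j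
  unfolding e using that by (auto simp: prec_def sgn_if split: if_splits)
qed (auto simp: sum.distrib sum_subtractf)

lemma supp_pos_cone0: "\<gamma> \<in> pos_cone (idx0 r) ==> supp r \<gamma>"
 using supp_pos_cone[of \<gamma> "idx0 r" TypeD r] by (simp add: idx_def)

abbreviation ones :: "nat => nat => weight => bool" where
 "ones m k \<mu> \<equiv> \<forall>j. 1 <= j \<and> j <= m --> \<mu> j = of_bool (j <= k)"

text \<open>The rows 1^k 0...0 with a zero at the end, and c ... c followed by c or - c. These are
  the shapes of the generator weights, and they persist from row to row.\<close>

definition gtype :: "nat => weight => bool" where
 "gtype m \<mu> \<longleftrightarrow> (\<exists>k<m. ones m k \<mu>) \<or>
   (\<exists>c\<in>{1, 1/2}. \<exists>e\<in>{c, - c}. \<forall>j. 1 <= j \<and> j <= m --> \<mu> j = (if j < m then c else e))"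

text \<open>Also used with t = 0, where it says that all entries vanish, whatever k is.\<close>

definition only :: "nat => nat => nat => (nat => nat) => bool" where
 "only r k t a \<longleftrightarrow> (\<forall>i. 1 <= i \<and> i <= r --> a i = (if i = k then t else 0))"

text \<open>The next rows are 1^k, 1^(k-1) in two ways, 1^(k-2), each filled up with zeros, and for
  k = r also 1 ... 1 followed by -1.\<close>

lemma relD_ones:
 assumes rel: "relDn r \<mu> a b" and k: "k <= r" and r: "r \<ge> 1"
  and "ones (Suc r) k \<mu>"
 shows "only r k 0 a \<and> only r k 0 b \<or> k \<ge> 1 \<and> only r k 0 a \<and> only r k 1 b \<or> k \<ge> 1 \<and> only r k 1 a \<and> only r k 0 b \<or>
  k \<ge> 2 \<and> only r (k - 1) 1 a \<and> only r k 1 b \<or> k = r \<and> only r r 1 a \<and> only r r 1 b"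
proof -
 have mu: "\<mu> j = of_bool (j <= k)" if "1 <= j" "j <= Suc r" for j using assms(4) that by blast
 have b: "b i <= of_bool (i = k)" if "1 <= i" "i <= r" for i
 proof (cases "i < r")
  case True
  hence "of_nat (b i) <= \<mu> i - \<mu> (Suc i)" using rel that unfolding relD_def by blast
  hence "of_nat (b i) <= (of_nat (of_bool (i = k)) :: rat)"
   using mu[of i] mu[of "Suc i"] that True by (cases "i = k") (auto simp: of_bool_def split: if_splits)
  thus ?thesis by (simp only: of_nat_le_iff)
 next
  case False
  hence i: "i = r" using that by simp
  moreover have "of_nat (b r) <= \<mu> r + \<mu> (Suc r)" using rel r unfolding relD_def by blast
  ultimately have "of_nat (b i) <= (of_nat (of_bool (i = k)) :: rat)"
   using mu[of r] mu[of "Suc r"] k r by (cases "i = k") (auto simp: of_bool_def split: if_splits)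
  thus ?thesis by (simp only: of_nat_le_iff)
 qed
 have a: "of_nat (a i) + of_nat (b i) <= (of_bool (i = k) + of_nat (b (Suc i)) :: rat)" if "1 <= i" "i < r" for i
 proof -
  have "of_nat (a i) + of_nat (b i) <= \<mu> i - \<mu> (Suc i) + of_nat (b (Suc i))"
   using rel that unfolding relD_def by blast
  moreover have "\<mu> i - \<mu> (Suc i) = of_bool (i = k)" using mu[of i] mu[of "Suc i"] that by auto
  ultimately show ?thesis by simp
 qed
 hence a: "a i + b i <= of_bool (i = k) + b (Suc i)" if "1 <= i" "i < r" for i
 proof -
  have "of_nat (a i + b i) <= (of_nat (of_bool (i = k) + b (Suc i)) :: rat)" using a[OF that] by simp
  thus ?thesis by (simp only: of_nat_le_iff)
 qed
 have "of_nat (a r) <= \<mu> r - \<mu> (Suc r)" using rel r unfolding relD_def by blast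
 hence "of_nat (a r) <= (of_nat (of_bool (r = k)) :: rat)"
  using mu[of r] mu[of "Suc r"] r k by (cases "r = k") (auto simp: of_bool_def split: if_splits)
 hence ar: "a r <= of_bool (r = k)" by (simp only: of_nat_le_iff)
 have art: "a (r - 1) + a r <= 1" if "r \<ge> 2"
 proof -
  have "of_nat (a (r - 1)) + of_nat (a r) + of_nat (b (r - 1)) <= \<mu> (r - 1) - \<mu> (Suc r)"
   using rel that unfolding relD_def by blast
  also have "\<dots> <= 1" using mu[of "r - 1"] mu[of "Suc r"] that k by auto
  finally have "of_nat (a (r - 1) + a r + b (r - 1)) <= (of_nat 1 :: rat)" by simp
  thus ?thesis unfolding of_nat_le_iff by simp
 qed
 show ?thesis
 proof (cases "k \<ge> 1 \<and> b k = 1")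
  case False
  hence b0: "b i = 0" if "1 <= i" "i <= r" for i using b[OF that] that by (cases "i = k") auto
  have ai: "a i <= of_bool (i = k)" if "1 <= i" "i <= r" for i
   using a[of i] ar b0[of i] b0[of "Suc i"] that by (cases "i < r") auto
  have a0: "a i = 0" if "1 <= i" "i <= r" "i \<noteq> k" for i using ai[OF that(1,2)] that(3) by simp
  have "only r k 0 b" using b0 by (auto simp: only_def)
  moreover have "only r k 0 a \<or> k \<ge> 1 \<and> only r k 1 a"
  proof (cases "k \<ge> 1 \<and> a k = 1")
   case True
   thus ?thesis using a0 unfolding only_def by simp
  next
   case False
   hence "a k = 0" if "1 <= k" using ai[OF that k] that by (cases "a k") auto
   hence "only r k 0 a" using a0 unfolding only_def by metis
   thus ?thesis by blast
  qed
  ultimately show ?thesis by blast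
 next
  case True
  have bi: "b i = (if i = k then 1 else 0)" if "1 <= i" "i <= r" for i
   using b[OF that] True by (cases "i = k") auto
  hence bk: "only r k 1 b" unfolding only_def by blast
  show ?thesis
  proof (cases "k = r")
   case False
   have ai: "a i <= of_bool (Suc i = k)" if "1 <= i" "i <= r" for i
   proof (cases "i < r")
    case True
    thus ?thesis using a[of i] bi[of i] bi[of "Suc i"] that by (auto split: if_splits)
   next
    case F: False
    thus ?thesis using ar that False by auto
   qed
   have "only r k 0 a \<or> k \<ge> 2 \<and> only r (k - 1) 1 a"
   proof (cases "k \<ge> 2 \<and> a (k - 1) = 1")
    case True
    have "a i = (if i = k - 1 then 1 else 0)" if "1 <= i" "i <= r" for i
     using ai[OF that] True by (cases "Suc i = k") auto
    thus ?thesis using True unfolding only_def by blast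
   next
    case F: False
    have "a i = 0" if "1 <= i" "i <= r" for i
     using ai[OF that] F that by (cases "Suc i = k") auto
    thus ?thesis unfolding only_def by simp
   qed
   thus ?thesis using bk True by blast
  next
   case kr: True
   have a1: "a i <= of_bool (Suc i = r)" if "1 <= i" "i < r" for i
    using a[OF that] bi[of i] bi[of "Suc i"] that kr by (cases "Suc i = r") simp_all
   have "only r k 0 a \<or> k \<ge> 2 \<and> only r (k - 1) 1 a \<or> only r r 1 a"
   proof (cases "a r = 0")
    case ar0: True
    show ?thesis
    proof (cases "r \<ge> 2 \<and> a (r - 1) = 1")
     case True
     have "a i = (if i = r - 1 then 1 else 0)" if "1 <= i" "i <= r" for i
      using a1[of i] ar0 True that by (cases "Suc i = r"; cases "i = r") auto
     thus ?thesis using True kr unfolding only_def by blast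
    next
     case F: False
     have "a i = 0" if "1 <= i" "i <= r" for i
      using a1[of i] ar0 F that by (cases "i = r"; cases "Suc i = r") auto
     thus ?thesis unfolding only_def by simp
    qed
   next
    case False
    hence "a r = 1" using ar kr by auto
    moreover have "a i = 0" if "1 <= i" "i < r" for i
     using a1[OF that] art \<open>a r = 1\<close> that by (cases "Suc i = r") auto
    ultimately show ?thesis unfolding only_def by (auto simp: le_less)
   qed
   thus ?thesis using bk True kr by blast
  qed
 qed
qed

text \<open>Only the last exponent can be nonzero, and the sign of the last entry decides in which
  block.\<close>

lemma relD_full:
 assumes rel: "relDn r \<mu> a b" and r: "r \<ge> 1"
  and "\<forall>j. 1 <= j \<and> j <= Suc r --> \<mu> j = (if j < Suc r then c else e)" and e: "e = c \<or> e = - c"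
 shows "\<exists>t. of_nat t <= 2 * c \<and> (e = c \<and> only r r 0 a \<and> only r r t b \<or> e = - c \<and> only r r t a \<and> only r r 0 b)"
proof -
 have mu: "\<mu> j = (if j < Suc r then c else e)" if "1 <= j" "j <= Suc r" for j using assms(3) that by blast
 have b: "b i = 0" if "1 <= i" "i < r" for i
 proof -
  have "of_nat (b i) <= \<mu> i - \<mu> (Suc i)" using rel that unfolding relD_def by blast
  thus ?thesis using mu[of i] mu[of "Suc i"] that by auto
 qed
 have rr: "of_nat (b r) <= c + e" "of_nat (a r) <= c - e"
  using rel r mu[of r] mu[of "Suc r"] unfolding relD_def by auto
 have a: "of_nat (a i) <= (of_nat (b (Suc i)) :: rat)" if "1 <= i" "i < r" for i
 proof -
  have "of_nat (a i) + of_nat (b i) <= \<mu> i - \<mu> (Suc i) + of_nat (b (Suc i))"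
   using rel that unfolding relD_def by blast
  thus ?thesis using mu[of i] mu[of "Suc i"] that b[OF that] by auto
 qed
 have art: "of_nat (a (r - 1)) <= c - e" if "r \<ge> 2"
 proof -
  have "of_nat (a (r - 1)) + of_nat (a r) + of_nat (b (r - 1)) <= \<mu> (r - 1) - \<mu> (Suc r)"
   using rel that unfolding relD_def by blast
  moreover have "\<mu> (r - 1) - \<mu> (Suc r) = c - e" using mu[of "r - 1"] mu[of "Suc r"] that by auto
  moreover have "(0::rat) <= of_nat (a r)" "(0::rat) <= of_nat (b (r - 1))" by simp_all
  ultimately show ?thesis by linarith
 qed
 show ?thesis
 proof (cases "e = c")
  case True
  have a0: "a i = 0" if i: "1 <= i" "i <= r" for i
  proof -
   consider "i = r" | "Suc i = r" | "Suc i < r" using i by linarith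
   thus ?thesis
   proof cases
    case 2
    thus ?thesis using art i True by auto
   qed (use rr True a[of i] b[of "Suc i"] i in auto)
  qed
  show ?thesis using a0 b rr True unfolding only_def by (intro exI[of _ "b r"]) (auto simp: le_less)
 next
  case False
  hence ec: "e = - c" using e by simp
  have b0: "b i = 0" if "1 <= i" "i <= r" for i using b[of i] rr ec that by (cases "i = r") auto
  have "a i = 0" if "1 <= i" "i < r" for i using a[OF that] b0[of "Suc i"] that by auto
  thus ?thesis using b0 rr ec unfolding only_def by (intro exI[of _ "a r"]) (auto simp: le_less)
 qed
qed

lemma only_sum: "only r k t a ==> 1 <= k ==> k <= r ==> (\<Sum>i = 1..r. a i) = t"
proof -
 assume a: "only r k t a" and k: "1 <= k" "k <= r"
 have "(\<Sum>i = 1..r. a i) = (\<Sum>i = 1..r. if i = k then t else 0)"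
  using a by (intro sum.cong) (auto simp: only_def)
 thus ?thesis using k by simp
qed

lemma only_sum0: "only r k 0 a ==> (\<Sum>i = 1..r. a i) = 0"
 by (auto simp: only_def)

lemma only_deglt: "only r k t a ==> only r k t b ==> \<not> deglt r a b"
 using deglt_cong[of r a b b b] deglt_irrefl[of r b] by (auto simp: only_def)

lemma only_not_deglt: "only r k 0 b ==> \<not> deglt r a b"
proof
 assume b: "only r k 0 b" and ab: "deglt r a b"
 from ab have "(\<Sum>i = 1..r. a i) <= (\<Sum>i = 1..r. b i)"
  unfolding deglt_def deglex_def mem_Collect_eq prod.case sum_list_map_upt by linarith
 hence "\<forall>i\<in>{1..r}. a i = 0" using only_sum0[OF b] by simp
 hence "only r k 0 a" by (auto simp: only_def)
 thus False using only_deglt[OF _ b] ab by blast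
qed

lemma expo_word_only: "only r k t a ==> 1 <= k ==> k <= r ==> expo_word r a = replicate t (int k)"
proof (induction r)
 case (Suc r)
 have e: "expo_word (Suc r) a = expo_word r a @ replicate (a (Suc r)) (int (Suc r))"
  by (simp add: expo_word_def)
 have zero: "expo_word r a = []" if "\<And>i. 1 <= i ==> i <= r ==> a i = 0"
  using that by (auto simp: expo_word_def)
 show ?case
 proof (cases "k = Suc r")
  case True
  thus ?thesis using e zero Suc.prems(1) by (simp add: only_def)
 next
  case False
  hence "expo_word r a = replicate t (int k)" using Suc by (auto simp: only_def)
  moreover have "a (Suc r) = 0" using Suc.prems(1) False by (auto simp: only_def)
  ultimately show ?thesis unfolding e by simp
 qed
qed simp

lemma expo_word_only0: "only r k 0 a ==> expo_word r a = []"
 by (auto simp: only_def expo_word_def)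

lemma ev_sum_zero: "ev p + ev q = 0 ==> p \<noteq> 0 ==> q \<noteq> 0 ==> q = - p"
proof -
 assume e: "ev p + ev q = 0" and "p \<noteq> 0" "q \<noteq> 0"
 moreover have "ev p (nat \<bar>p\<bar>) + ev q (nat \<bar>p\<bar>) = 0"
  using fun_cong[OF e, of "nat \<bar>p\<bar>"] by (simp only: plus_fun_apply zero_fun_apply)
 ultimately show ?thesis
  by (cases "p > 0"; cases "q = p"; cases "q = - p") (simp_all add: ev_def)
qed

lemma ev_sum_double:
 "ev p + ev q = ev r + ev r ==> r > 0 ==> p = r \<and> q = r"
proof -
 assume e: "ev p + ev q = ev r + ev r" and "r > 0"
 hence r: "int (nat r) = r" "r \<noteq> 0" by simp_all
 have "ev p (nat r) + ev q (nat r) = ev r (nat r) + ev r (nat r)"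
  using fun_cong[OF e, of "nat r"] by (simp only: plus_fun_apply)
 thus ?thesis unfolding ev_def r(1) using r(2)
  by (cases "p = r"; cases "p = - r"; cases "q = r"; cases "q = - r") simp_all
qed

definition plt :: "nat => (((nat => nat) \<times> (nat => nat)) \<times> ((nat => nat) \<times> (nat => nat))) set" where
 "plt r = {(b, c). deglt r b c} <*lex*> {(b, c). deglt r b c}"

lemma wf_plt: "wf (plt r)"
 unfolding plt_def by (intro wf_lex_prod wf_deglt)

lemma trans_plt: "trans (plt r)"
proof -
 have "trans {(b, c). deglt r b c}" by (rule transI) (auto intro: deglt_trans)
 thus ?thesis unfolding plt_def by (intro trans_lex_prod)
qed

lemma row_last: "wrow r a b \<mu> (Suc r) = \<mu> (Suc r) - of_nat (\<Sum>i = 1..r. b i) + of_nat (\<Sum>i = 1..r. a i)"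
 by (simp add: wrow_def wsh_eq ev_def)

section \<open>Lowering words and the operator that separates equal weights\<close>

context so_rep
begin

text \<open>Vectors obtained from \<open>x\<close> by a word in lowering operators of so(2r), with
  their weights. Keeping the word permits the induction in \<open>phi_kill\<close>.\<close>

inductive lw :: "nat => 'v => weight => 'v => weight => bool" for r x \<mu> where
 base: "lw r x \<mu> x \<mu>"
| step: "lw r x \<mu> g \<kappa> ==> i \<in> idx0 r ==> j \<in> idx0 r ==> prec j i ==> i \<noteq> - j ==>
  lw r x \<mu> (F i j g) (\<kappa> + (ev i - ev j))"

lemma lw_wtv: "lw r x \<mu> g \<kappa> ==> wtv \<mu> x ==> r <= n ==> wtv \<kappa> g"
proof (induction rule: lw.induct)
 case (step g \<kappa> i j)
 thus ?case by (intro F_wtv idx_nonzero) auto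
qed

lemma lw_cone: "lw r x \<mu> g \<kappa> ==> \<mu> - \<kappa> \<in> pos_cone (idx0 r)"
proof (induction rule: lw.induct)
 case base
 show ?case unfolding diff_self by (rule pos_cone.zero)
next
 case (step g \<kappa> i j)
 have "(\<mu> - \<kappa>) + (ev j - ev i) \<in> pos_cone (idx0 r)"
  by (rule pos_cone.add[OF step.IH step.hyps(3,2,4)]) (use step.hyps(5) in linarith)
 moreover have "(\<mu> - \<kappa>) + (ev j - ev i) = \<mu> - (\<kappa> + (ev i - ev j))" by (simp add: algebra_simps)
 ultimately show ?case by metis
qed

lemma lw_foldr:
 assumes "lw r x \<mu> g \<kappa>" "s \<in> idx0 r" "\<And>k. k \<in> set w ==> k \<in> idx0 r \<and> prec k s \<and> s \<noteq> - k"
 shows "\<exists>\<kappa>. lw r x \<mu> (foldr (F s) w g) \<kappa>"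
 using assms(3)
proof (induction w)
 case (Cons k w)
 then obtain \<kappa> where "lw r x \<mu> (foldr (F s) w g) \<kappa>" by auto
 from lw.step[OF this assms(2)] show ?case using Cons.prems by auto
qed (use assms(1) in auto)

lemma lw_sv: "lw R x \<mu> g \<kappa> ==> r <= R ==> \<exists>\<kappa>. lw R x \<mu> (sv r q g) \<kappa>"
proof (induction r arbitrary: g \<kappa>)
 case (Suc r)
 have w: "k \<in> idx0 R \<and> prec k (int (Suc r)) \<and> int (Suc r) \<noteq> - k \<and> prec k (- int (Suc r)) \<and> - int (Suc r) \<noteq> - k"
  if "k \<in> set (expo_word r b)" for k b
  using that set_expo_word[of r b] Suc.prems(2) by (auto simp: prec_def)
 obtain \<kappa>1 where 1: "lw R x \<mu> (Yp r (q (Suc r) True) g) \<kappa>1"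
  using lw_foldr[OF Suc.prems(1), of "- int (Suc r)"] w Suc.prems(2) by fastforce
 obtain \<kappa>2 where "lw R x \<mu> (Ym r (q (Suc r) False) (Yp r (q (Suc r) True) g)) \<kappa>2"
  using lw_foldr[OF 1, of "int (Suc r)"] w Suc.prems(2) by fastforce
 thus ?case using Suc.IH Suc.prems(2) by auto
qed auto

text \<open>Raises the weight by \<open>ev p + ev q\<close> and keeps the coordinate m. The
  antisymmetrisation in m and - m makes the torus terms cancel on \<open>v\<close>.\<close>

definition Phi :: "int => int => int => 'v => 'v" where
 "Phi m p q u = F p (- m) (F q m u) - F p m (F q (- m) u)"

text \<open>Under so(2r) the operators \<open>Phi m p q\<close> transform like the tensor square of
  the standard representation, in the indices p and q.\<close>

lemma F_Phi:
 assumes m: "m \<in> I" "m \<notin> idx0 r" "- m \<notin> idx0 r" "m \<noteq> 0" and r: "r <= n"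
  and ij: "i \<in> idx0 r" "j \<in> idx0 r" "p \<in> idx0 r" "q \<in> idx0 r"
 shows "F i j (Phi m p q u) = Phi m p q (F i j u) + (if j = p then Phi m i q u else 0) - (if i = - p then Phi m (- j) q u else 0)
  + (if j = q then Phi m p i u else 0) - (if i = - q then Phi m p (- j) u else 0)"
proof -
 have I: "i \<in> I" "j \<in> I" "p \<in> I" "q \<in> I" "- m \<in> I" "- i \<in> I" "- j \<in> I"
  using ij r m by (auto intro!: idx_nonzero)
 have ne: "i \<noteq> m" "i \<noteq> - m" "j \<noteq> m" "j \<noteq> - m" using ij m by auto
 have 1: "F i j (F k m w) = F k m (F i j w) + (if j = k then F i m w else 0) - (if i = - k then F (- j) m w else 0)"
  if "k \<in> I" for k w using F_F[OF I(1,2) that m(1), of w] ne by auto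
 have 2: "F i j (F k (- m) w) = F k (- m) (F i j w) + (if j = k then F i (- m) w else 0) - (if i = - k then F (- j) (- m) w else 0)"
  if "k \<in> I" for k w using F_F[OF I(1,2) that I(5), of w] ne by auto
 show ?thesis
  unfolding Phi_def F_diff[OF I(1,2)] 1[OF I(3)] 2[OF I(3)] 1[OF I(4)] 2[OF I(4)]
  by (auto simp: F_add F_diff I m(1))
qed

lemma Phi_wtv: "wtv \<kappa> u ==> p \<in> I ==> q \<in> I ==> m \<in> I ==> wtv (\<kappa> + ev p + ev q) (Phi m p q u)"
proof -
 assume u: "wtv \<kappa> u" and I: "p \<in> I" "q \<in> I" "m \<in> I"
 hence I': "- m \<in> I" by simp
 have "\<kappa> + (ev q - ev m) + (ev p - ev (- m)) = \<kappa> + ev p + ev q" "\<kappa> + (ev q - ev (- m)) + (ev p - ev m) = \<kappa> + ev p + ev q"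
  by (simp_all add: algebra_simps)
 hence 1: "wtv (\<kappa> + ev p + ev q) (F p (- m) (F q m u))" "wtv (\<kappa> + ev p + ev q) (F p m (F q (- m) u))"
  using F_wtv[OF F_wtv[OF u I(2,3)] I(1) I'] F_wtv[OF F_wtv[OF u I(2) I'] I(1,3)] by metis+
 show ?thesis unfolding Phi_def using wtv_add[OF 1(1) wtv_scale[OF 1(2), of "-1"]] by simp
qed

text \<open>Equivariance: moving \<open>Phi\<close> past the lowering operators of the word leads to
  other instances of \<open>Phi\<close> of the same total weight, and finally to the starting vector
  \<open>x\<close>, where \<open>base\<close> applies.\<close>

lemma phi_kill:
 assumes hw: "hw (Suc r) \<mu> W v" and x: "wtv \<mu>0 x" "x \<in> clos (D (Suc r)) (insert v W)"
  and base: "\<And>p q. p \<in> idx0 r ==> q \<in> idx0 r ==> \<mu>0 + ev p + ev q = \<mu> ==> Phi (int (Suc r)) p q x \<in> W"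
  and g: "lw r x \<mu>0 g \<kappa>" and pq: "p \<in> idx0 r" "q \<in> idx0 r" "\<kappa> + ev p + ev q = \<mu>"
 shows "Phi (int (Suc r)) p q g \<in> W"
proof -
 let ?m = "int (Suc r)"
 have r: "Suc r <= n" and rv: "raises_into (idx0 (Suc r)) W v" and W: "stab (D (Suc r)) W" "stab torus W"
  and wt: "wtv \<mu> v" "supp n \<mu>"
  using hw by (auto simp: hw_def stab_def)
 have mI: "?m \<in> I" "- ?m \<in> I" using nat_idx[of "Suc r"] r by auto
 have Ir: "k \<in> I" if "k \<in> idx0 (Suc r)" for k by (rule idx_nonzero) (use that r in auto)
 note sub = stab_subspace[OF W(1)]
 note subC = subspace_clos[of "D (Suc r)" "insert v W"]
 have "g \<in> clos (D (Suc r)) (insert v W) \<and>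
  (\<forall>p\<in>idx0 r. \<forall>q\<in>idx0 r. \<kappa> + ev p + ev q = \<mu> --> Phi ?m p q g \<in> W)"
  using g
 proof (induction rule: lw.induct)
  case base
  thus ?case using assms(4) x by blast
 next
  case (step g \<kappa> i j)
  have g: "g \<in> clos (D (Suc r)) (insert v W)" using step.IH by blast
  have IH: "Phi ?m p q g \<in> W" if "p \<in> idx0 r" "q \<in> idx0 r" "\<kappa> + ev p + ev q = \<mu>" for p q
   using step.IH that by blast
  have ij: "i \<in> I" "j \<in> I" "(i, j) \<in> D (Suc r)" using step.hyps Ir by auto
  show ?case
  proof (intro conjI clos.op[OF ij(3) g] ballI impI)
   fix p q assume pq: "p \<in> idx0 r" "q \<in> idx0 r" and eq: "\<kappa> + (ev i - ev j) + ev p + ev q = \<mu>"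
   have pqI: "p \<in> I" "q \<in> I" using pq Ir by auto
   have t: "(if P then Phi ?m a b g else 0) \<in> W"
    if "P ==> a \<in> idx0 r" "P ==> b \<in> idx0 r" "P ==> \<kappa> + ev a + ev b = \<mu>" for P a b
    using IH[of a b] that subspace_0[OF sub] by simp
   have t1: "(if j = p then Phi ?m i q g else 0) \<in> W"
    by (rule t) (use step.hyps pq eq in \<open>auto simp: algebra_simps\<close>)
   have t2: "(if i = - p then Phi ?m (- j) q g else 0) \<in> W"
    by (rule t) (use step.hyps pq eq in \<open>auto simp: algebra_simps\<close>)
   have t3: "(if j = q then Phi ?m p i g else 0) \<in> W"
    by (rule t) (use step.hyps pq eq in \<open>auto simp: algebra_simps\<close>)
   have t4: "(if i = - q then Phi ?m p (- j) g else 0) \<in> W"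
    by (rule t) (use step.hyps pq eq in \<open>auto simp: algebra_simps\<close>)
   \<comment> \<open>Its weight exceeds \<mu> by the positive root \<open>ev j - ev i\<close>, so it
     does not occur modulo \<open>W\<close>.\<close>
   have "Phi ?m p q g \<in> W"
   proof (rule highest_weight_separate[OF _ _ W(1,2) wt(1) rv wt(2)])
    show "idx0 (Suc r) \<subseteq> I" using Ir by blast
    show "Phi ?m p q g \<in> clos (D (Suc r)) (insert v W)"
     unfolding Phi_def using pq by (intro subspace_diff[OF subC] clos.op g) auto
    have wg: "wtv \<kappa> g" using lw_wtv[OF step.hyps(1) x(1)] r by simp
    show "wtv (\<kappa> + ev p + ev q) (Phi ?m p q g)"
     by (rule Phi_wtv[OF wg pqI mI(1)])
    have e: "\<kappa> + ev p + ev q = \<mu> - (ev i - ev j)" using eq by (simp add: algebra_simps)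
    show "supp n (\<kappa> + ev p + ev q)"
     unfolding e using wt(2) ij idx_le by (intro supp_diff supp_ev) blast+
    have "\<mu> - (\<kappa> + ev p + ev q) = ev i - ev j" unfolding e by simp
    moreover have "ev i - ev j \<notin> pos_cone (idx0 (Suc r))"
    proof
     assume "ev i - ev j \<in> pos_cone (idx0 (Suc r))"
     hence "0 <= ht n (ev i - ev j)" by (rule ht_pos_cone) (use r in auto)
     moreover have "ht n (ev i) + 1 <= ht n (ev j)"
      using ht_prec[of j n i] step.hyps idx_le ij by blast
     ultimately show False unfolding ht_linear by simp
    qed
    ultimately show "\<mu> - (\<kappa> + ev p + ev q) \<notin> pos_cone (idx0 (Suc r))" by simp
   qed simp
   hence F: "F i j (Phi ?m p q g) \<in> W" by (rule stabD[OF W(1) ij(3)])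
   have "Phi ?m p q (F i j g) = F i j (Phi ?m p q g) - (if j = p then Phi ?m i q g else 0)
    + (if i = - p then Phi ?m (- j) q g else 0) - (if j = q then Phi ?m p i g else 0)
    + (if i = - q then Phi ?m p (- j) g else 0)"
    using F_Phi[of ?m r i j p q g] step.hyps pq mI r by (simp add: algebra_simps)
   also have "\<dots> \<in> W"
    by (intro subspace_add[OF sub] subspace_diff[OF sub] F t1 t2 t3 t4)
   finally show "Phi ?m p q (F i j g) \<in> W" .
  qed
 qed
 thus ?thesis using pq by blast
qed

end

section \<open>One row of a generator weight\<close>

context int_rep
begin

text \<open>A predecessor violating the inequalities lies, by \<open>step_upper\<close>, in the
  subspace of its own predecessors. Well-founded induction leaves only the few that satisfy
  them.\<close>

lemma Wm_relD_span:
 assumes hw: "hw (Suc r) \<mu> W v"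
 shows "Wm r W v b a \<subseteq> span (W \<union> {sv r q (Ym r a' (Yp r b' v)) |q a' b'.
   ((b', a'), (b, a)) \<in> plt r \<and> relDn r \<mu> a' b'})"
proof -
 define M where "M = (%c. span (W \<union> {sv r q (Ym r a' (Yp r b' v)) |q a' b'.
   ((b', a'), c) \<in> plt r \<and> relDn r \<mu> a' b'}))"
 have WM: "W \<subseteq> M c" for c unfolding M_def by (rule order_trans[OF _ span_superset]) simp
 have mono: "M c \<subseteq> M d" if "(c, d) \<in> plt r" for c d
  unfolding M_def by (rule span_mono, rule Un_mono, simp) (use transD[OF trans_plt _ that] in blast)
 have "Wm r W v (fst c) (snd c) \<subseteq> M c" for c
  using wf_plt[of r]
 proof (induction c rule: wf_induct_rule)
  case (less c)
  obtain b a where c: "c = (b, a)" by (cases c)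
  have g: "sv r q (Ym r a' (Yp r b' v)) \<in> M c" if p: "((b', a'), (b, a)) \<in> plt r" for q a' b'
  proof (cases "relDn r \<mu> a' b'")
   case True
   thus ?thesis unfolding M_def c using p by (intro span_base UnI2 CollectI exI conjI) auto
  next
   case False
   have "sv r q (Ym r a' (Yp r b' v)) \<in> Wm r W v b' a'"
    by (rule stab_sv[OF Wm_stab step_upper[OF hw False]])
   thus ?thesis using less[of "(b', a')"] mono[of "(b', a')" c] p c by auto
  qed
  have sM: "subspace (M c)" unfolding M_def by (rule subspace_span)
  have "{sv r q (Ym r a' (Yp r b' v)) |q a' b'. deglt r b' b} \<subseteq> M c"
   using g by (auto simp: plt_def)
  hence Wp: "Wp r W v b \<subseteq> M c"
   using WM[of c] by (intro order_trans[OF row_span(2)[OF hw sv_span] span_minimal[OF _ sM]]) auto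
  have "{sv r q (Ym r a' (Yp r b v)) |q a'. deglt r a' a} \<subseteq> M c"
   using g by (auto simp: plt_def)
  thus ?case
   unfolding c using Wp
   by (intro order_trans[OF row_span(1)[OF hw sv_span] span_minimal[OF _ sM[unfolded c]]]) (auto simp: c)
 qed
 from this[of "(b, a)"] show ?thesis by (simp add: M_def)
qed

text \<open>A pure weight argument; \<open>sep\<close> has to exclude that the weight of the vector
  lies below that of an admissible predecessor. Lowering in so(2r) does not change the coordinate r
  + 1, which gives the equation between the sums.\<close>

lemma step_separate:
 assumes hw: "hw (Suc r) \<mu> W v" and mem: "Ym r a (Yp r b v) \<in> Wm r W v b a"
  and sep: "\<And>a' b' \<gamma>. ((b', a'), (b, a)) \<in> plt r ==> relDn r \<mu> a' b' ==>
   \<gamma> \<in> pos_cone (idx0 r) ==> sum a {1..r} + sum b' {1..r} = sum a' {1..r} + sum b {1..r} ==>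
   (\<And>j. j \<in> {1..r} ==> \<gamma> j = of_nat (a j) + of_nat (b j) - of_nat (a' j) - of_nat (b' j)) ==> False"
 shows "Ym r a (Yp r b v) \<in> W"
proof -
 have r: "Suc r <= n" and W: "stab torus W" and wt: "wtv \<mu> v" "supp n \<mu>"
  using hw by (auto simp: hw_def stab_def)
 define L where "L = {\<kappa>. supp n \<kappa> \<and> \<kappa> \<noteq> wrow r a b \<mu>}"
 note sub = stab_subspace[OF W]
 have supp: "supp n (wrow r a b \<mu>)" for a b
  using hw_row[OF hw] by (simp add: hw_def)
 have "Wm r W v b a \<subseteq> wspan W L"
 proof (rule order_trans[OF Wm_relD_span[OF hw] span_minimal[OF _ subspace_wspan[OF sub]]], rule Un_least)
  show "W \<subseteq> wspan W L" using wspan_base[OF sub] by blast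
  show "{sv r q (Ym r a' (Yp r b' v)) |q a' b'. ((b', a'), (b, a)) \<in> plt r \<and>
    relDn r \<mu> a' b'} \<subseteq> wspan W L"
  proof clarify
   fix q a' b' assume p: "((b', a'), (b, a)) \<in> plt r" and rel: "relDn r \<mu> a' b'"
   let ?x = "Ym r a' (Yp r b' v)"
   obtain \<kappa> where l: "lw r ?x (wrow r a' b' \<mu>) (sv r q ?x) \<kappa>"
    using lw_sv[OF lw.base order_refl] by blast
   have wx: "wtv (wrow r a' b' \<mu>) ?x" by (rule wtv_row[OF wt(1) r])
   have wk: "wtv \<kappa> (sv r q ?x)" using lw_wtv[OF l wx] r by simp
   have c: "wrow r a' b' \<mu> - \<kappa> \<in> pos_cone (idx0 r)" by (rule lw_cone[OF l])
   have eq: "wrow r a' b' \<mu> - (wrow r a' b' \<mu> - \<kappa>) = \<kappa>" by simp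
   have "\<kappa> \<noteq> wrow r a b \<mu>"
   proof
    assume k: "\<kappa> = wrow r a b \<mu>"
    have "(wrow r a' b' \<mu> - \<kappa>) (Suc r) = 0" using supp_pos_cone0[OF c] by (simp add: supp_def)
    hence "(of_nat (sum a {1..r} + sum b' {1..r}) :: rat) = of_nat (sum a' {1..r} + sum b {1..r})"
     unfolding k minus_apply row_last of_nat_add by linarith
    thus False
     by (intro sep[OF p rel c]; (simp only: k minus_apply row_eq)?; linarith)
   qed
   moreover have "supp n \<kappa>"
   proof -
    have "idx0 r \<subseteq> I" using idx_nonzero r by fastforce
    from supp_diff[OF supp[of a' b'] supp_pos_cone[OF c this]] show ?thesis unfolding eq .
   qed
   ultimately show "sv r q ?x \<in> wspan W L" using wspan_wtv[OF sub wk] by (simp add: L_def)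
  qed
 qed
 thus ?thesis
  using mem supp by (intro wspan_separate[OF W _ wtv_row[OF wt(1) r, of a b]]) (auto simp: L_def)
qed

end

lemma plt_only:
 assumes "((b', a'), (b, a)) \<in> plt r" "only r k t b'" "only r k t b" "only r l u a'" "only r l u a"
 shows False
 using assms(1) only_deglt[OF assms(2,3)] only_deglt[OF assms(4,5)] by (simp add: plt_def)

context int_rep
begin

text \<open>There is a single free exponent t. The coordinate r + 1 determines it, so no predecessor
  has a matching weight, and t <= 2 c keeps the root string nonzero modulo \<open>W\<close>.\<close>

lemma step_lower_full:
 assumes hw: "hw (Suc r) \<mu> W v" and v: "v \<notin> W" and r1: "r \<ge> 1"
  and rel: "relDn r \<mu> a b"
  and mu: "\<forall>j. 1 <= j \<and> j <= Suc r --> \<mu> j = (if j < Suc r then c else e)" "e = c \<or> e = - c" "c > 0"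
 shows "Ym r a (Yp r b v) \<notin> Wm r W v b a"
proof
 assume mem: "Ym r a (Yp r b v) \<in> Wm r W v b a"
 let ?m = "int (Suc r)"
 have r: "Suc r <= n" and rv: "raises_into (idx0 (Suc r)) W v" and W: "stab (D (Suc r)) W"
  and wt: "wtv \<mu> v"
  using hw by (auto simp: hw_def stab_def)
 have mI: "?m \<in> I" "- ?m \<in> I" using nat_idx[of "Suc r"] r by auto
 have rI: "int r \<in> I" using nat_idx[of r] r1 r by auto
 note mu1 = mu(1)[rule_format]
 note cases = relD_full[OF _ r1 mu(1,2)]
 have "Ym r a (Yp r b v) \<in> W"
 proof (rule step_separate[OF hw mem])
  fix a' b'
  assume p: "((b', a'), (b, a)) \<in> plt r" and rel': "relDn r \<mu> a' b'"
   and s: "sum a {1..r} + sum b' {1..r} = sum a' {1..r} + sum b {1..r}"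
  obtain t where t: "e = c \<and> only r r 0 a \<and> only r r t b \<or> e = - c \<and> only r r t a \<and> only r r 0 b"
   using cases[OF rel] by blast
  obtain t' where t': "e = c \<and> only r r 0 a' \<and> only r r t' b' \<or> e = - c \<and> only r r t' a' \<and> only r r 0 b'"
   using cases[OF rel'] by blast
  have ne: "c \<noteq> - c" using mu(3) by simp
  from t t' ne have "only r r 0 a \<and> only r r t b \<and> only r r 0 a' \<and> only r r t' b' \<or> only r r t a \<and> only r r 0 b \<and> only r r t' a' \<and> only r r 0 b'"
   by metis
  thus False
  proof (elim disjE conjE)
   assume h: "only r r 0 a" "only r r t b" "only r r 0 a'" "only r r t' b'"
   have "t = t'"
    using s unfolding only_sum[OF h(2) r1 order_refl] only_sum[OF h(4) r1 order_refl] only_sum0[OF h(1)] only_sum0[OF h(3)] by simp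
   thus False using plt_only[OF p] h by blast
  next
   assume h: "only r r t a" "only r r 0 b" "only r r t' a'" "only r r 0 b'"
   have "t = t'"
    using s unfolding only_sum[OF h(1) r1 order_refl] only_sum[OF h(3) r1 order_refl] only_sum0[OF h(2)] only_sum0[OF h(4)] by simp
   thus False using plt_only[OF p] h by blast
  qed
 qed
 moreover obtain t where tc: "of_nat t <= 2 * c" and t: "e = c \<and> only r r 0 a \<and> only r r t b \<or> e = - c \<and> only r r t a \<and> only r r 0 b"
  using cases[OF rel] by blast
 have alive: "(F j (int r) ^^ t) v \<notin> W" if j: "j = ?m \<and> e = - c \<or> j = - ?m \<and> e = c" for j
 proof (rule sl2_alive[OF rI _ _ _ wt _ _ v])
  have j': "j = ?m \<or> j = - ?m" using j by blast
  show "j \<in> I" using j' mI by auto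
  show "int r \<noteq> j" "int r \<noteq> - j" using j' r1 by auto
  show "stab {(int r, j), (j, int r)} W" by (rule stab_mono[OF W]) (use j' r1 in auto)
  show "F (int r) j v \<in> W" using rv j' r1 unfolding raises_into_def by (auto simp: prec_def)
  have "ext \<mu> j = - c" using j mu1[of "Suc r"] by auto
  thus "2 * (ext \<mu> (int r) - ext \<mu> j) \<noteq> dbl (int r) j * of_nat l" if "l < t" for l
   using mu1[of r] r1 tc that j' by (auto simp: dbl_def)
 qed
 from t have "Ym r a (Yp r b v) \<notin> W"
 proof (elim disjE conjE)
  assume h: "e = c" "only r r 0 a" "only r r t b"
  thus ?thesis
   using alive[of "- ?m"] expo_word_only[OF h(3)] expo_word_only0[OF h(2)] r1 by simp
 next
  assume h: "e = - c" "only r r t a" "only r r 0 b"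
  thus ?thesis
   using alive[of ?m] expo_word_only[OF h(2)] expo_word_only0[OF h(3)] r1 by simp
 qed
 ultimately show False by blast
qed

text \<open>Weights exclude the predecessors in all shapes except \<open>P3\<close>, where
  \<open>Phi\<close> is needed.\<close>

lemma step_lower_ones:
 assumes hw: "hw (Suc r) \<mu> W v" and v: "v \<notin> W" and r1: "r \<ge> 1"
  and rel: "relDn r \<mu> a b"
  and k: "k <= r" and mu: "ones (Suc r) k \<mu>"
 shows "Ym r a (Yp r b v) \<notin> Wm r W v b a"
proof
 assume mem: "Ym r a (Yp r b v) \<in> Wm r W v b a"
 let ?m = "int (Suc r)" and ?k = "int k"
 have r: "Suc r <= n" and rv: "raises_into (idx0 (Suc r)) W v" and W: "stab (D (Suc r)) W" "stab torus W"
  and wt: "wtv \<mu> v" "supp n \<mu>"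
  using hw by (auto simp: hw_def stab_def)
 note sub = stab_subspace[OF W(1)]
 have mI: "?m \<in> I" "- ?m \<in> I" using nat_idx[of "Suc r"] r by auto
 have Ir: "i \<in> I" if "i \<in> idx0 (Suc r)" for i by (rule idx_nonzero) (use that r in auto)
 have up: "F i j v \<in> W" if "i \<in> idx0 (Suc r)" "j \<in> idx0 (Suc r)" "prec i j" for i j
  using rv that unfolding raises_into_def by auto
 have W1: "stab {(i, j), (j, i)} W" if "i \<in> idx0 (Suc r)" "j \<in> idx0 (Suc r)" for i j
  by (rule stab_mono[OF W(1)]) (use that in auto)
 note mu' = mu[rule_format]
 have em: "ext \<mu> ?m = 0" using mu'[of "Suc r"] k by auto
 have al: "F x ?k v \<notin> W" if "x = ?m \<or> x = - ?m" "k \<ge> 1" for x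
 proof -
  have "(F x ?k ^^ 1) v \<notin> W"
  proof (rule sl2_alive[OF _ _ _ _ wt(1) W1 up v])
   show "2 * (ext \<mu> ?k - ext \<mu> x) \<noteq> dbl ?k x * of_nat l" if "l < 1" for l
    using that \<open>x = ?m \<or> x = - ?m\<close> em mu'[of k] \<open>k \<ge> 1\<close> k by auto
  qed (use that k Ir mI in \<open>auto simp: prec_def\<close>)
  thus ?thesis by simp
 qed
 have cls: "only r k 0 a \<and> only r k 0 b \<and> sum a {1..r} = sum b {1..r} \<or>
   k \<ge> 1 \<and> only r k 0 a \<and> only r k 1 b \<and> sum b {1..r} = Suc (sum a {1..r}) \<or>
   k \<ge> 1 \<and> only r k 1 a \<and> only r k 0 b \<and> sum a {1..r} = Suc (sum b {1..r}) \<or>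
   k \<ge> 2 \<and> only r (k - 1) 1 a \<and> only r k 1 b \<and> sum a {1..r} = sum b {1..r} \<or>
   k = r \<and> only r r 1 a \<and> only r r 1 b \<and> sum a {1..r} = sum b {1..r}"
  if "relDn r \<mu> a b" for a b
  using relD_ones[OF that k r1 mu]
 proof (elim disjE conjE, goal_cases)
  case 1 thus ?case using only_sum0[OF 1(1)] only_sum0[OF 1(2)] by simp
 next
  case 2 thus ?case using only_sum0[OF 2(2)] only_sum[OF 2(3,1) k] by simp
 next
  case 3 thus ?case using only_sum[OF 3(2,1) k] only_sum0[OF 3(3)] by simp
 next
  case 4 thus ?case using only_sum[OF 4(2)] only_sum[OF 4(3) _ k] k by simp
 next
  case 5 thus ?case using only_sum[OF 5(2) r1] only_sum[OF 5(3) r1] by simp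
 qed
 consider (P0) "only r k 0 a" "only r k 0 b" | (P1) "k \<ge> 1" "only r k 0 a" "only r k 1 b" "sum b {1..r} = Suc (sum a {1..r})"
  | (P2) "k \<ge> 1" "only r k 1 a" "only r k 0 b" "sum a {1..r} = Suc (sum b {1..r})" | (P3) "k \<ge> 2" "only r (k - 1) 1 a" "only r k 1 b"
  | (P4) "k = r" "only r r 1 a" "only r r 1 b" "sum a {1..r} = sum b {1..r}"
  using cls[OF rel] by blast
 thus False
 proof cases
  \<comment> \<open>Zero exponents have no predecessors.\<close>
  case P0
  have "Ym r a (Yp r b v) \<in> W"
  proof (rule step_separate[OF hw mem])
   fix a' b' assume "((b', a'), (b, a)) \<in> plt r"
   thus False using only_not_deglt[OF P0(1)] only_not_deglt[OF P0(2)] unfolding plt_def by auto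
  qed
  thus False using v expo_word_only0[OF P0(1)] expo_word_only0[OF P0(2)] by simp
 next
  case P1
  have "Ym r a (Yp r b v) \<in> W"
  proof (rule step_separate[OF hw mem])
   fix a' b'
   assume p: "((b', a'), (b, a)) \<in> plt r" and rel': "relDn r \<mu> a' b'"
    and s: "sum a {1..r} + sum b' {1..r} = sum a' {1..r} + sum b {1..r}"
   show False using cls[OF rel'] P1(4) s plt_only[OF p _ P1(3) _ P1(2)] by auto
  qed
  thus False using al[of "- ?m"] P1(1) expo_word_only[OF P1(3,1) k] expo_word_only0[OF P1(2)] by simp
 next
  case P2
  have "Ym r a (Yp r b v) \<in> W"
  proof (rule step_separate[OF hw mem])
   fix a' b'
   assume p: "((b', a'), (b, a)) \<in> plt r" and rel': "relDn r \<mu> a' b'"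
    and s: "sum a {1..r} + sum b' {1..r} = sum a' {1..r} + sum b {1..r}"
   show False using cls[OF rel'] P2(4) s plt_only[OF p _ P2(3) _ P2(2)] by auto
  qed
  thus False using al[of ?m] P2(1) expo_word_only[OF P2(2,1) k] expo_word_only0[OF P2(3)] by simp
 next
  case P4
  note rr = order_refl[of r]
  have memW: "Ym r a (Yp r b v) \<in> W"
  proof (rule step_separate[OF hw mem])
   fix a' b' \<gamma>
   assume p: "((b', a'), (b, a)) \<in> plt r" and rel': "relDn r \<mu> a' b'"
    and g: "\<gamma> \<in> pos_cone (idx0 r)" and s: "sum a {1..r} + sum b' {1..r} = sum a' {1..r} + sum b {1..r}"
    and gj: "\<And>j. j \<in> {1..r} ==> \<gamma> j = of_nat (a j) + of_nat (b j) - of_nat (a' j) - of_nat (b' j)"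
   have ab: "a j = (if j = r then 1 else 0)" "b j = (if j = r then 1 else 0)" if "j \<in> {1..r}" for j
    using P4 that by (auto simp: only_def)
   from cls[OF rel'] show False
   proof (elim disjE conjE)
    assume h: "only r k 0 a'" "only r k 0 b'"
    \<comment> \<open>The weights differ by 2 \<epsilon>_r, on which the half-spin functional is
      negative.\<close>
    hence "(\<Sum>i = 1..<r. \<gamma> i) - \<gamma> r = (\<Sum>i = 1..<r. 0) - 2"
     using gj ab r1 by (intro arg_cong2[of _ _ _ _ "(-)"] sum.cong) (auto simp: only_def)
    thus False using partial_sum_pos_cone'[OF g r1] by simp
   next
    assume h: "2 <= k" "only r (k - 1) 1 a'" "only r k 1 b'"
    \<comment> \<open>Here the difference is \<epsilon>_r - \<epsilon>_(r-1), a negative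
      root.\<close>
    have "(\<Sum>i = 1..r - 1. \<gamma> i) = (\<Sum>i = 1..r - 1. if i = r - 1 then - 1 else 0)"
    proof (rule sum.cong)
     fix i assume i: "i \<in> {1..r - 1}"
     thus "\<gamma> i = (if i = r - 1 then - 1 else 0)"
      using gj[of i] ab[of i] h P4(1) by (auto simp: only_def)
    qed simp
    also have "\<dots> = - 1" using h(1) P4(1) by (subst sum.delta) auto
    finally show False using partial_sum_pos_cone[OF g, of "r - 1"] by simp
   qed (use s P4(4) plt_only[OF p _ P4(3) _ P4(2)] in auto)
  qed
  \<comment> \<open>The factor \<open>F (- ?m) ?r\<close> changes the coordinates r and m from 1 and
    0 to 0 and -1. The pairing with \<epsilon>_r - \<epsilon>_m is still 1, so
    \<open>F ?m ?r\<close> does not send \<open>?u\<close> into \<open>W\<close>.\<close>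
  let ?r = "int r" and ?u = "F (- ?m) (int r) v"
  have ri: "?r \<in> idx0 (Suc r)" using r1 by auto
  have rI: "?r \<in> I" using Ir[OF ri] .
  have u: "?u \<notin> W" using al[of "- ?m"] P4(1) r1 by simp
  have wu: "wtv (\<mu> + (ev (- ?m) - ev ?r)) ?u" by (rule F_wtv[OF wt(1) mI(2) rI])
  have "F ?r ?m ?u = F (- ?m) ?r (F ?r ?m v)"
   using F_F[OF rI mI(1) mI(2) rI, of v] F_anti_diag[OF mI(2), of v] r1 by simp
  moreover have "F (- ?m) ?r (F ?r ?m v) \<in> W"
   by (rule stabD[OF W(1) _ up]) (use r1 in \<open>auto simp: prec_def\<close>)
  ultimately have eu: "F ?r ?m ?u \<in> W" by simp
  have "(F ?m ?r ^^ 1) ?u \<notin> W"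
  proof (rule sl2_alive[OF rI mI(1) _ _ wu W1 eu u])
   show "2 * (ext (\<mu> + (ev (- ?m) - ev ?r)) ?r - ext (\<mu> + (ev (- ?m) - ev ?r)) ?m) \<noteq> dbl ?r ?m * of_nat l" if "l < 1" for l
    using that em mu'[of r] r1 P4(1) by (simp add: ext_add ext_diff ext_ev ev_def)
  qed (use r1 in auto)
  hence "F ?m ?r ?u \<notin> W" by simp
  with memW show False
   using expo_word_only[OF P4(2) r1 rr] expo_word_only[OF P4(3) r1 rr] by simp
 next
  \<comment> \<open>The weight is \<mu> - \<epsilon>_(k-1) - \<epsilon>_k, which may also occur in
    the so(2r)-module of \<open>v\<close>. \<open>Phi ?m S ?k\<close> maps \<open>?z\<close> to -2 v
    modulo \<open>W\<close>; in weight \<mu> it sends the predecessors into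
    \<open>W\<close>.\<close>
  case P3
  define s where "s = k - 1"
  have s: "k = Suc s" "s \<ge> 1" "s <= r" and as: "only r s 1 a" using P3 k by (auto simp: s_def)
  have k1: "1 <= k" using P3 by simp
  define S where "S = int s"
  let ?z = "F ?m S (F (- ?m) ?k v)"
  have z: "Ym r a (Yp r b v) = ?z"
   using expo_word_only[OF as s(2,3)] expo_word_only[OF P3(3) k1 k] by (simp add: S_def)
  have SK: "S \<in> idx0 r" "?k \<in> idx0 r" "S > 0" "S < ?k" "?k < ?m" "S < ?m" using s k by (auto simp: S_def)
  have SK': "S \<in> idx0 (Suc r)" "?k \<in> idx0 (Suc r)" "?m \<in> idx0 (Suc r)" "- ?m \<in> idx0 (Suc r)" using SK by auto
  have I: "S \<in> I" "?k \<in> I" using Ir SK' by auto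
  have ext1: "ext \<mu> S = 1" "ext \<mu> ?k = 1" using mu'[of s] mu'[of k] s k by (auto simp: S_def)
  have diag: "F S S v = v" "F ?k ?k v = v" "F ?m ?m v = 0" "F (- ?m) (- ?m) v = 0"
   using wtv_ext[OF wt(1)] I mI ext1 em by simp_all
  have neq: "S \<noteq> ?k" "S \<noteq> - ?k" "S \<noteq> ?m" "S \<noteq> - ?m" "?k \<noteq> ?m" "?k \<noteq> - ?m" "?m \<noteq> - ?m" "?m \<noteq> - S" "?m \<noteq> - ?k"
   using SK by auto
  have inW: "F i j w \<in> W" if "w \<in> W" "i \<in> idx0 (Suc r)" "j \<in> idx0 (Suc r)" for i j w
   using stabD[OF W(1), of i j w] that by simp
  have "(F ?k S ^^ 1) v \<in> W"
   by (rule sl2_kill[OF I neq(1,2) wt(1) W1[OF SK'(1,2)] up[OF SK'(1,2)]])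
     (use SK ext1 I neq in \<open>auto simp: prec_def dbl_def intro!: nilp\<close>)
  hence fv: "F ?k S v \<in> W" by simp
  have uv: "F S ?m v \<in> W" "F S (- ?m) v \<in> W" "F ?k ?m v \<in> W" "F ?k (- ?m) v \<in> W"
   by (rule up; use SK in \<open>auto simp: prec_def\<close>)+
  \<comment> \<open>The error terms: in each of them a raising operator acts on \<open>v\<close>, or
    \<open>F ?k S\<close>, which sends \<open>v\<close> into \<open>W\<close> because the entries of
    \<mu> at S and k are equal.\<close>
  define w1 where "w1 = F ?m S (F (- ?m) ?k (F ?k ?m v)) + F (- ?m) ?k (F ?k S v)"
  define w2 where "w2 = F (- ?m) S (F S (- ?m) v)"
  define w3 where "w3 = F (- ?m) ?k (F ?k (- ?m) v)"
  define w4 where "w4 = F ?m S (F S ?m v)"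
  have wW: "w1 \<in> W" "w2 \<in> W" "w3 \<in> W" "w4 \<in> W"
   unfolding w1_def w2_def w3_def w4_def by (intro subspace_add[OF sub] inW fv uv SK')+
  have 1: "F ?k ?m ?z = w1 - F (- ?m) S v"
   unfolding w1_def using I mI neq F_F[OF I(2) mI(1) mI(1) I(1)] F_F[OF I(2) mI(1) mI(2) I(2)] F_F[OF I(2,1) mI(2) I(2)]
    F_anti_diag[OF mI(2)] by (simp add: F_diff F_add)
  have 2: "F S (- ?m) (F (- ?m) S v) = w2 + v"
   unfolding w2_def using I mI neq F_F[OF I(1) mI(2) mI(2) I(1)] by (simp add: diag)
  have 3: "F ?k (- ?m) ?z = F ?m S w3 + F ?m S v"
   unfolding w3_def using I mI neq F_F[OF I(2) mI(2) mI(1) I(1)] F_F[OF I(2) mI(2) mI(2) I(2)] by (simp add: diag F_add)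
  have 4: "F S ?m (F ?m S v) = w4 + v"
   unfolding w4_def using I mI neq F_F[OF I(1) mI(1) mI(1) I(1)] by (simp add: diag)
  \<comment> \<open>Both products in \<open>Phi\<close> contribute - v.\<close>
  have Phi_z: "Phi ?m S ?k ?z = (F S (- ?m) w1 - w2 - F S ?m (F ?m S w3) - w4) - sc 2 v"
   using 2 4 scale_left_distrib[of 1 1 v] unfolding Phi_def 1 3
   by (simp add: F_diff F_add I mI algebra_simps)
  have low: "F S (- ?m) w1 - w2 - F S ?m (F ?m S w3) - w4 \<in> W"
   by (intro subspace_diff[OF sub] inW wW SK')
  define L where "L = {\<kappa>. supp n \<kappa> \<and> \<kappa> \<noteq> \<mu>}"
  let ?Phi = "Phi ?m S ?k"
  have Phi_lin: "?Phi (u + w) = ?Phi u + ?Phi w" "?Phi (sc c u) = sc c (?Phi u)" for u w c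
   by (simp_all add: Phi_def F_add F_scale I mI scale_right_diff_distrib)
  have subL: "subspace (wspan W L)" by (rule subspace_wspan[OF sub])
  let ?G = "{sv r q (Ym r a' (Yp r b' v)) |q a' b'.
   ((b', a'), (b, a)) \<in> plt r \<and> relDn r \<mu> a' b'}"
  \<comment> \<open>Only generators that \<open>?Phi\<close> lifts to weight \<mu> matter. For
    these, \<open>phi_kill\<close> reduces the claim to the possible rows with equally many plus and
    minus factors.\<close>
  have gen: "?Phi g \<in> wspan W L" if "g \<in> ?G" for g
  proof -
   obtain q a' b' where g: "g = sv r q (Ym r a' (Yp r b' v))" and p: "((b', a'), (b, a)) \<in> plt r"
    and rel': "relDn r \<mu> a' b'" using \<open>g \<in> ?G\<close> by blast
   let ?x = "Ym r a' (Yp r b' v)" and ?\<nu> = "wrow r a' b' \<mu>"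
   have wx: "wtv ?\<nu> ?x" by (rule wtv_row[OF wt(1) r])
   obtain \<kappa> where l: "lw r ?x ?\<nu> g \<kappa>" unfolding g using lw_sv[OF lw.base order_refl] by blast
   have wk: "wtv \<kappa> g" using lw_wtv[OF l wx] r by simp
   have c: "?\<nu> - \<kappa> \<in> pos_cone (idx0 r)" by (rule lw_cone[OF l])
   have e: "?\<nu> - (?\<nu> - \<kappa>) = \<kappa>" by simp
   have "supp n ?\<nu>" using hw_row[OF hw] by (simp add: hw_def)
   moreover have "idx0 r \<subseteq> I" using Ir by auto
   ultimately have "supp n \<kappa>" using supp_diff[OF _ supp_pos_cone[OF c]] e by metis
   hence sk: "supp n (\<kappa> + ev S + ev ?k)"
    using SK r by (intro supp_add supp_ev) auto
   have wP: "wtv (\<kappa> + ev S + ev ?k) (?Phi g)" by (rule Phi_wtv[OF wk I mI(1)])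
   show ?thesis
   proof (cases "\<kappa> + ev S + ev ?k = \<mu>")
    case False
    thus ?thesis using sk by (intro wspan_wtv[OF sub wP]) (simp add: L_def)
   next
    case True
    have xC: "?x \<in> clos (D (Suc r)) (insert v W)"
     by (intro stab_foldr[OF stab_clos] clos.base) auto
    have "\<kappa> (Suc r) = \<mu> (Suc r)"
     using fun_cong[OF True, of "Suc r"] SK by (simp add: ev_def)
    moreover have "(?\<nu> - \<kappa>) (Suc r) = 0" using supp_pos_cone0[OF c] by (simp only: supp_def) simp
    ultimately have "?\<nu> (Suc r) = \<mu> (Suc r)" by simp
    hence "(of_nat (\<Sum>i = 1..r. a' i) :: rat) = of_nat (\<Sum>i = 1..r. b' i)"
     unfolding row_last by linarith
    hence sum: "sum a' {1..r} = sum b' {1..r}" unfolding of_nat_eq_iff .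
    have "?Phi g \<in> W"
    proof (rule phi_kill[OF hw wx xC _ l SK(1,2) True])
     fix p q assume pq: "p \<in> idx0 r" "q \<in> idx0 r" and eq: "?\<nu> + ev p + ev q = \<mu>"
     have pqI: "p \<in> I" "q \<in> I" "- p \<in> I" using pq Ir by auto
     have pm: "p \<noteq> ?m" "p \<noteq> - ?m" "?m \<noteq> - p" using pq by auto
     have d: "ev p j + ev q j = of_nat (a' j) + of_nat (b' j)" if "j \<in> {1..r}" for j
      using fun_cong[OF eq, of j] row_eq[OF that] by simp
     have ev_out: "ev p j = 0" "ev q j = 0" if "j \<notin> {1..r}" for j
      using that pq by (auto simp: ev_def)
     from cls[OF rel'] show "Phi ?m p q ?x \<in> W"
     proof (elim disjE conjE)
      assume h: "only r k 0 a'" "only r k 0 b'"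
      have "ev p + ev q = 0"
      proof
       fix j show "(ev p + ev q) j = 0 j"
        using d[of j] ev_out[of j] h by (cases "j \<in> {1..r}") (auto simp: only_def)
      qed
      hence q: "q = - p" using ev_sum_zero pq by auto
      have x: "?x = v" using expo_word_only0[OF h(1)] expo_word_only0[OF h(2)] by simp
      show ?thesis
      proof (cases "p > 0")
       case True
       have a1: "F (- p) ?m u = - F (- ?m) p u" "F (- p) (- ?m) u = - F ?m p u" for u
        using F_swap[OF pqI(3) mI(1)] F_swap[OF pqI(3) mI(2)] by simp_all
       have upv: "F p ?m v \<in> W" "F p (- ?m) v \<in> W"
        by (rule up; use pq True in \<open>auto simp: prec_def\<close>)+
       \<comment> \<open>Both products contain the same torus term \<open>F p p v\<close>, which
         cancels in the difference defining \<open>Phi\<close>.\<close>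
       have "F p (- ?m) (F (- ?m) p v) = F (- ?m) p (F p (- ?m) v) + F p p v"
        using F_F[OF pqI(1) mI(2) mI(2) pqI(1), of v] pm by (simp add: diag)
       moreover have "F p ?m (F ?m p v) = F ?m p (F p ?m v) + F p p v"
        using F_F[OF pqI(1) mI(1) mI(1) pqI(1), of v] pm by (simp add: diag)
       ultimately have "Phi ?m p q v = F ?m p (F p ?m v) - F (- ?m) p (F p (- ?m) v)"
        unfolding Phi_def q a1 by (simp add: F_neg pqI mI)
       moreover have "F ?m p (F p ?m v) - F (- ?m) p (F p (- ?m) v) \<in> W"
        using pq by (intro subspace_diff[OF sub] inW upv SK') auto
       ultimately show ?thesis unfolding x by simp
      next
       case False
       hence "q > 0" using q pq by auto
       have qv: "F q ?m v \<in> W" "F q (- ?m) v \<in> W"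
        by (rule up; use pq \<open>q > 0\<close> in \<open>auto simp: prec_def\<close>)+
       have "p \<in> idx0 (Suc r)" using pq by auto
       thus ?thesis unfolding x Phi_def
        by (intro subspace_diff[OF sub] inW[OF qv(1) _ SK'(4)] inW[OF qv(2) _ SK'(3)])
      qed
     next
      assume h: "2 <= k" "only r (k - 1) 1 a'" "only r k 1 b'"
      show ?thesis using plt_only[OF p h(3) P3(3) h(2) P3(2)] by blast
     next
      assume h: "k = r" "only r r 1 a'" "only r r 1 b'"
      \<comment> \<open>The weight forces p = q = r, and then \<open>Phi\<close> is the commutator
        of \<open>F r (- m)\<close> and \<open>F r m\<close>, which vanishes together with
        \<open>F r (- r)\<close>.\<close>
      have "ev p + ev q = ev (int r) + ev (int r)"
      proof
       fix j show "(ev p + ev q) j = (ev (int r) + ev (int r)) j"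
        using d[of j] ev_out[of j] h r1 by (cases "j \<in> {1..r}") (auto simp: only_def ev_def[of "int r"])
      qed
      hence "p = int r" "q = int r" using ev_sum_double[of p q "int r"] r1 by auto
      hence "Phi ?m p q u = 0" for u
       using F_F[OF pqI(1) mI(2) pqI(1) mI(1), of u] pm r1 F_anti_diag[OF pqI(1), of u] unfolding Phi_def by simp
      thus ?thesis using subspace_0[OF sub] by simp
     qed (use sum in simp_all)
    qed
    thus ?thesis by (rule wspan_base[OF sub])
   qed
  qed
  have "?Phi y \<in> wspan W L" if "y \<in> span (W \<union> ?G)" for y
   using that
  proof (induction rule: span_induct_alt)
   case base
   have "?Phi 0 = 0" using Phi_lin(2)[of 0 0] by simp
   thus ?case using subspace_0[OF subL] by simp
  next
   case (step c x y)
   have "?Phi x \<in> wspan W L"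
   proof (cases "x \<in> W")
    case True
    hence "?Phi x \<in> W" unfolding Phi_def by (intro subspace_diff[OF sub] inW SK')
    thus ?thesis by (rule wspan_base[OF sub])
   next
    case False
    thus ?thesis using step.hyps gen by blast
   qed
   thus ?case using step.IH subspace_add[OF subL] subspace_scale[OF subL] by (simp add: Phi_lin)
  qed
  hence zL: "?Phi ?z \<in> wspan W L" using Wm_relD_span[OF hw] mem unfolding z by blast
  have e: "\<mu> + (ev (- ?m) - ev ?k) + (ev ?m - ev S) + ev S + ev ?k = \<mu>" by (simp add: algebra_simps)
  have "wtv (\<mu> + (ev (- ?m) - ev ?k) + (ev ?m - ev S) + ev S + ev ?k) (?Phi ?z)"
   by (intro Phi_wtv F_wtv wt(1) I mI)
  hence "wtv \<mu> (?Phi ?z)" unfolding e .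
  hence "?Phi ?z \<in> W"
   using wspan_separate[OF W(2) zL _ wt(2)] by (simp add: L_def)
  from subspace_diff[OF sub low this] have "sc 2 v \<in> W" unfolding Phi_z by simp
  from subspace_scale[OF sub this, of "1/2"] v show False by simp
 qed
qed

end

section \<open>Generator rows lead to generator rows\<close>

lemma gtype_ones: "ones r k \<mu> ==> k <= r ==> gtype r \<mu>"
proof (cases "k < r")
 case False
 assume "ones r k \<mu>" "k <= r"
 hence "\<forall>j. 1 <= j \<and> j <= r --> \<mu> j = (if j < r then 1 else 1)" using False by auto
 thus ?thesis unfolding gtype_def by blast
qed (auto simp: gtype_def)

lemma gtype_last:
 assumes c: "c \<in> {1, 1/2}" and t: "of_nat t <= 2 * c" and r: "r \<ge> 1"
  and mu: "\<forall>j. 1 <= j \<and> j <= r --> \<mu> j = (if j < r then c else c - of_nat t)"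
 shows "gtype r \<mu>"
proof (cases "t = 1 \<and> c = 1")
 case True
 thus ?thesis using mu r by (intro gtype_ones[where k = "r - 1"]) auto
next
 case False
 have "of_nat t <= (of_nat (if c = 1 then 2 else 1) :: rat)" using t c by auto
 hence "t <= (if c = 1 then 2 else 1)" unfolding of_nat_le_iff .
 hence "t = 0 \<or> t = 1 \<and> c \<noteq> 1 \<or> t = 2 \<and> c = 1" using False by (auto split: if_splits)
 hence "c - of_nat t \<in> {c, - c}" using c by auto
 thus ?thesis using mu c unfolding gtype_def by blast
qed

lemma gtype_row:
 assumes "gtype (Suc r) \<mu>" "r \<ge> 1" and rel: "relDn r \<mu> a b"
 shows "gtype r (wrow r a b \<mu>)"
 using assms(1) unfolding gtype_def[of "Suc r"]
proof (elim disjE exE conjE bexE)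
 fix k assume k: "k < Suc r" and mu: "ones (Suc r) k \<mu>"
 hence k': "k <= r" by simp
 from relD_ones[OF rel k' assms(2) mu] show ?thesis
 proof (elim disjE conjE)
  assume h: "only r k 0 a" "only r k 0 b"
  show ?thesis by (rule gtype_ones[where k = k]) (use h mu k' in \<open>auto simp: only_def row_eq\<close>)
 next
  assume h: "1 <= k" "only r k 0 a" "only r k 1 b"
  show ?thesis by (rule gtype_ones[where k = "k - 1"]) (use h mu k' in \<open>auto simp: only_def row_eq\<close>)
 next
  assume h: "1 <= k" "only r k 1 a" "only r k 0 b"
  show ?thesis by (rule gtype_ones[where k = "k - 1"]) (use h mu k' in \<open>auto simp: only_def row_eq\<close>)
 next
  assume h: "2 <= k" "only r (k - 1) 1 a" "only r k 1 b"
  show ?thesis by (rule gtype_ones[where k = "k - 2"]) (use h mu k' in \<open>auto simp: only_def row_eq\<close>)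
 next
  assume h: "k = r" "only r r 1 a" "only r r 1 b"
  hence "\<forall>j. 1 <= j \<and> j <= r --> wrow r a b \<mu> j = (if j < r then 1 else - 1)"
   using mu by (auto simp: only_def row_eq)
  thus ?thesis unfolding gtype_def by blast
 qed
next
 fix c e :: rat assume c: "c \<in> {1, 1/2}" and e: "e \<in> {c, - c}"
  and mu: "\<forall>j. 1 <= j \<and> j <= Suc r --> \<mu> j = (if j < Suc r then c else e)"
 obtain t where t: "of_nat t <= 2 * c"
  "e = c \<and> only r r 0 a \<and> only r r t b \<or> e = - c \<and> only r r t a \<and> only r r 0 b"
  using relD_full[OF rel assms(2) mu] e by blast
 thus ?thesis using mu by (intro gtype_last[OF c t(1) assms(2)]) (auto simp: only_def row_eq)
qed

text \<open>Every root of type D has coordinate sum 0, 2 or -2. This keeps weights apart that differ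
  by a short root of type B.\<close>

lemma pos_cone_parity:
 assumes "\<gamma> \<in> pos_cone (idx0 r)"
 shows "\<exists>z::int. (\<Sum>i = 1..r. \<gamma> i) = 2 * of_int z"
 using assms
proof (induction rule: pos_cone.induct)
 case zero
 show ?case by (rule exI[of _ 0]) simp
next
 case (add \<gamma> i j)
 have e: "(\<Sum>l = 1..r. ev k l) = of_int (sgn k)" if "k \<in> idx0 r" for k
 proof -
  have "(\<Sum>i = 1..r. ev k i) = (\<Sum>i = 1..r. if i = nat \<bar>k\<bar> then of_int (sgn k) else 0)"
   by (intro sum.cong) (auto simp: ev_def sgn_if)
  also have "\<dots> = of_int (sgn k)" using that by (subst sum.delta) auto
  finally show ?thesis .
 qed
 obtain z :: int where z: "(\<Sum>i = 1..r. \<gamma> i) = 2 * of_int z" using add.IH by blast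
 have "(\<Sum>l = 1..r. (\<gamma> + (ev i - ev j)) l) = 2 * of_int z + (of_int (sgn i) - of_int (sgn j))"
  unfolding plus_fun_apply minus_apply sum.distrib sum_subtractf e[OF add.hyps(2)] e[OF add.hyps(3)] z ..
 moreover have "\<exists>y. (of_int (sgn i) - of_int (sgn j) :: rat) = 2 * of_int y"
  by (rule exI[of _ "(sgn i - sgn j) div 2"]) (use add.hyps in \<open>auto simp: sgn_if\<close>)
 ultimately show ?case by (metis distrib_left of_int_add)
qed

context int_rep
begin

lemma step_lower:
 assumes hw: "hw (Suc r) \<mu> W v" and v: "v \<notin> W" and g: "r \<ge> 1 ==> gtype (Suc r) \<mu>"
  and rel: "relDn r \<mu> a b"
 shows "Ym r a (Yp r b v) \<notin> Wm r W v b a"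
proof (cases "r = 0")
 case True
 have "\<not> deglt 0 x y" for x y by (simp add: deglt_def deglex_def)
 hence "((b', a'), (b, a)) \<notin> plt r" for a' b' using True by (simp add: plt_def)
 hence "Ym r a (Yp r b v) \<in> Wm r W v b a ==> Ym r a (Yp r b v) \<in> W"
  using step_separate[OF hw] by blast
 moreover have "Ym r a (Yp r b v) = v" using True by (simp add: expo_word_def)
 ultimately show ?thesis using v by auto
next
 case False
 hence r1: "r \<ge> 1" by simp
 from g[OF r1] show ?thesis unfolding gtype_def
 proof (elim disjE exE conjE bexE)
  fix k assume "k < Suc r" "ones (Suc r) k \<mu>"
  thus ?thesis by (intro step_lower_ones[OF hw v r1 rel, of k]) auto
 next
  fix c e :: rat assume "c \<in> {1, 1/2}" "e \<in> {c, - c}"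
   "\<forall>j. 1 <= j \<and> j <= Suc r --> \<mu> j = (if j < Suc r then c else e)"
  thus ?thesis by (intro step_lower_full[OF hw v r1 rel, of c e]) auto
 qed
qed

text \<open>Predecessors that differ from \<open>q\<close> in the top row lie in the new
  \<open>W\<close>; those that agree there are predecessors in the next row.\<close>

lemma sv_lower:
 assumes "hw r \<mu> W v" "v \<notin> W" "r \<ge> 2 ==> gtype r \<mu>" "patD r \<mu> (rats q)"
 shows "sv r q v \<notin> span (W \<union> {sv r q' v |q'. qlt r q' q})"
 using assms
proof (induction r arbitrary: \<mu> W v)
 case 0
 hence "subspace W" by (auto simp: hw_def stab_def)
 hence s: "span W = W" by (simp only: span_eq_iff)
 have e: "W \<union> {sv 0 q' v |q'. qlt 0 q' q} = W" by simp
 show ?case unfolding e s using 0 by simp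
next
 case (Suc r)
 let ?b = "q (Suc r) True" and ?a = "q (Suc r) False"
 let ?v = "Ym r ?a (Yp r ?b v)" and ?W = "Wm r W v ?b ?a"
 note rel = Suc.prems(4)[unfolded patD_row]
 have "sv r q ?v \<notin> span (?W \<union> {sv r q' ?v |q'. qlt r q' q})"
 proof (rule Suc.IH[OF hw_row[OF Suc.prems(1)]])
  show "?v \<notin> ?W" using step_lower[OF Suc.prems(1,2)] Suc.prems(3) rel by simp
  show "gtype r (wrow r ?a ?b \<mu>)" if "2 <= r"
   using gtype_row[OF Suc.prems(3)] rel that by simp
 qed (use rel in blast)
 moreover have "W \<union> {sv (Suc r) q' v |q'. qlt (Suc r) q' q} \<subseteq> span (?W \<union> {sv r q' ?v |q'. qlt r q' q})"
 proof -
  have w: "?W \<subseteq> span (?W \<union> {sv r q' ?v |q'. qlt r q' q})" by (rule order_trans[OF _ span_superset]) simp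
  have A: "sv (Suc r) q' v \<in> span (?W \<union> {sv r q' ?v |q'. qlt r q' q})" if lt: "qlt (Suc r) q' q" for q'
  proof -
   let ?x = "Ym r (q' (Suc r) False) (Yp r (q' (Suc r) True) v)"
   consider "deglt r (q' (Suc r) True) ?b"
    | "\<And>i. i \<in> {1..r} ==> q' (Suc r) True i = ?b i" "deglt r (q' (Suc r) False) ?a"
    | "\<And>i. i \<in> {1..r} ==> q' (Suc r) True i = ?b i" "\<And>i. i \<in> {1..r} ==> q' (Suc r) False i = ?a i" "qlt r q' q"
    using lt by auto
   thus ?thesis
   proof cases
    case 1
    have "Yp r (q' (Suc r) True) v \<in> Wp r W v ?b"
     unfolding Wp_def using 1 by (intro clos.base) blast
    hence "?x \<in> Wp r W v ?b" by (rule stab_foldr[OF Wp_stab, rotated]) (auto simp: Pa_def)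
    hence "?x \<in> ?W" using Wp_Wm by blast
    hence "sv r q' ?x \<in> ?W" by (rule stab_sv[OF Wm_stab])
    thus ?thesis using w by auto
   next
    case 2
    have "Yp r (q' (Suc r) True) v = Yp r ?b v" using expo_word_cong[OF 2(1)] by simp
    hence "?x \<in> ?W" unfolding Wm_def using 2(2) by (intro clos.base) auto
    hence "sv r q' ?x \<in> ?W" by (rule stab_sv[OF Wm_stab])
    thus ?thesis using w by auto
   next
    case 3
    have "?x = ?v" using expo_word_cong[OF 3(1)] expo_word_cong[OF 3(2)] by simp
    thus ?thesis using 3(3) by (intro span_base) auto
   qed
  qed
  have "W \<subseteq> ?W" using W_Wp Wp_Wm by blast
  from Un_least[OF order_trans[OF this w]] show ?thesis using A by blast
 qed
 hence "span (W \<union> {sv (Suc r) q' v |q'. qlt (Suc r) q' q}) \<subseteq> span (?W \<union> {sv r q' ?v |q'. qlt r q' q})"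
  by (rule span_minimal[OF _ subspace_span])
 ultimately show ?case unfolding sv.simps(2)[of r q v] by (rule contra_subsetD[rotated])
qed

end

section \<open>From type B to type D\<close>

text \<open>Interlacing between types B and D: with \<kappa> = \<mu> - c it says that \<kappa>_k
  lies between \<mu>_(k+1) and \<mu>_k, and \<kappa>_n between - \<mu>_n and \<mu>_n.\<close>

definition relB :: "nat => weight => (nat => rat) => bool" where
 "relB n \<mu> c \<longleftrightarrow> (\<forall>k. 1 <= k \<and> k <= n --> 0 <= c k) \<and>
   (\<forall>k. 1 <= k \<and> k < n --> c k <= \<mu> k - \<mu> (Suc k)) \<and> c n <= 2 * \<mu> n"

lemma ev_wsh0: "j \<in> {1..n} ==> wsh 0 n c \<mu> j = \<mu> j - of_nat (c j)"
 by (simp add: wsh_eq)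

abbreviation "relBn n \<mu> c \<equiv> relB n \<mu> (%i. of_nat (c i))"

lemma relB_ones:
 assumes rel: "relBn n \<mu> c" and k: "k < n" and mu: "ones n k \<mu>"
 shows "only n k 0 c \<or> k \<ge> 1 \<and> only n k 1 c"
proof -
 have c: "c j <= of_bool (j = k)" if "1 <= j" "j <= n" for j
 proof (cases "j < n")
  case True
  hence "of_nat (c j) <= \<mu> j - \<mu> (Suc j)" using rel that unfolding relB_def by blast
  also have "\<dots> = of_nat (of_bool (j = k))" using mu that True by (cases "j = k") auto
  finally show ?thesis by (simp only: of_nat_le_iff)
 next
  case False
  hence "of_nat (c j) <= 2 * \<mu> j" using rel that unfolding relB_def by (cases "j = n") auto
  moreover have "\<mu> j = 0" using mu that k False by auto
  ultimately show ?thesis by simp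
 qed
 show ?thesis
 proof (cases "k \<ge> 1 \<and> c k = 1")
  case True
  have "c j = (if j = k then 1 else 0)" if "1 <= j" "j <= n" for j
   using c[OF that] True by (cases "j = k") auto
  thus ?thesis using True unfolding only_def by blast
 next
  case False
  have "c j = 0" if "1 <= j" "j <= n" for j
   using c[OF that] False that by (cases "j = k") auto
  thus ?thesis unfolding only_def by simp
 qed
qed

lemma relB_full:
 assumes rel: "relBn n \<mu> c" and n: "n \<ge> 1" and d: "d \<in> {1, 1/2}" "e \<in> {d, - d}"
  and mu: "\<forall>j. 1 <= j \<and> j <= n --> \<mu> j = (if j < n then d else e)"
 shows "e = d" "\<exists>t. only n n t c \<and> of_nat t <= 2 * d"
proof -
 have cn: "of_nat (c n) <= 2 * e" using rel mu n unfolding relB_def by auto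
 hence "0 <= e" using of_nat_0_le_iff[of "c n", where 'a = rat] by linarith
 thus ed: "e = d" using d by auto
 have "c j = 0" if "1 <= j" "j < n" for j
 proof -
  have "of_nat (c j) <= \<mu> j - \<mu> (Suc j)" using rel that unfolding relB_def by blast
  thus ?thesis using mu that ed by auto
 qed
 hence "only n n (c n) c" by (auto simp: only_def le_less)
 thus "\<exists>t. only n n t c \<and> of_nat t <= 2 * d" using cn ed by blast
qed

context so_rep
begin

abbreviation "Ys c u \<equiv> foldr (F 0) (expo_word n c) u"

definition Ws :: "'v set => 'v => (nat => nat) => 'v set" where
 "Ws W v c = clos (D n) (W \<union> {Ys c' v |c'. deglt n c' c})"

definition hwX :: "weight => 'v set => 'v => bool" where
 "hwX \<mu> W v \<longleftrightarrow> stab (I \<times> I) W \<and> wtv \<mu> v \<and> supp n \<mu> \<and> raises_into I W v"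

lemma torus_sub: "torus \<subseteq> I \<times> I"
 using nat_idx by auto

lemma D_sub: "D n \<subseteq> I \<times> I"
 using idx0_idx by auto

lemma hwX_hw:
 assumes "hwX \<mu> W v"
 shows "hw n \<mu> W v"
proof -
 have "stab (D n \<union> torus) W" by (rule stab_mono[of "I \<times> I"]) (use assms D_sub torus_sub in \<open>auto simp: hwX_def\<close>)
 thus ?thesis using assms idx0_idx unfolding hw_def hwX_def raises_into_def by blast
qed

context
 assumes B: "X = TypeB"
begin

lemma zero_I: "0 \<in> I"
 by (simp add: B idx_def)

text \<open>The operators \<open>F 0 k\<close> do not commute, but their brackets lie in so(2n). For
  this block the commutation in the locale is only required modulo stable subspaces.\<close>

lemma block_short:
 assumes hw: "hwX \<mu> W v"
 shows "block sc X n F 0 n (D n) W v"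
proof
 have Ir: "k \<in> I" if "k \<in> idx0 n" for k using that by (rule idx_nonzero)
 show "0 \<in> I" "0 \<notin> idx0 n" "n <= n" "D n \<subseteq> I \<times> I" "D n \<subseteq> D n" using zero_I D_sub by auto
 show "stab (D n \<union> {0} \<times> idx0 n) W"
  by (rule stab_mono[of "I \<times> I"]) (use hw Ir zero_I in \<open>auto simp: hwX_def\<close>)
 show "F 0 (- int k) v \<in> W" if "k \<in> {1..n}" for k
  using hw that zero_I Ir[of "- int k"] unfolding hwX_def raises_into_def by (auto simp: prec_def)
 show "F 0 k (F 0 l u) - F 0 l (F 0 k u) \<in> N"
  if "k \<in> idx0 n" "l \<in> idx0 n" "stab (D n) N" "u \<in> N" for k l N u
 proof -
  have "F 0 k (F 0 l u) - F 0 l (F 0 k u) = - F (- k) l u"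
   using F_comm[OF zero_I Ir[OF that(1)] zero_I Ir[OF that(2)], of u] that F_anti_diag[OF zero_I, of u] by auto
  moreover have "F (- k) l u \<in> N" using that by (intro stabD[OF that(3)]) auto
  ultimately show ?thesis using subspace_neg[OF stab_subspace[OF that(3)]] by simp
 qed
qed auto

lemma block_short_defs:
 assumes "block sc X n F 0 n (D n) W v"
 shows "block.Yb F 0 n c u = Ys c u" and "block.lower sc F 0 n (D n) W v c = Ws W v c"
proof -
 interpret block sc X n F 0 n "D n" W v by fact
 show Y: "Yb c u = Ys c u" for c u by (simp add: Yb_def Y_def)
 show "lower c = Ws W v c" unfolding lower_def Ws_def Y ..
qed

lemma wtv_Ys: "wtv \<mu> v ==> wtv (wsh 0 n c \<mu>) (Ys c v)"
 by (rule wtv_expo_word[OF _ zero_I order_refl])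

lemma hw_short:
 assumes hw: "hwX \<mu> W v"
 shows "hw n (wsh 0 n c \<mu>) (Ws W v c) (Ys c v)"
proof -
 interpret b: block sc X n F 0 n "D n" W v by (rule block_short[OF hw])
 note d = block_short_defs[OF b.block_axioms]
 have W: "stab torus W" and wt: "wtv \<mu> v" "supp n \<mu>" and rv: "raises_into (idx0 n) W v"
  using hwX_hw[OF hw] by (auto simp: hw_def stab_def)
 have "stab torus (Ws W v c)"
  unfolding Ws_def
 proof (rule stab_torus_clos_weights[OF b.G(1) W])
  fix u assume "u \<in> {Ys c' v |c'. deglt n c' c}"
  thus "\<exists>\<nu>. wtv \<nu> u" using wtv_Ys[OF wt(1)] by auto
 qed
 hence "stab (D n \<union> torus) (Ws W v c)"
  using b.stab_lower[of c, unfolded d] unfolding stab_def by blast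
 moreover have "supp n (wsh 0 n c \<mu>)" by (rule supp_wsh[OF wt(2)]) auto
 ultimately show ?thesis
  using b.raises_into_lower[OF rv, of c] wtv_Ys[OF wt(1)] unfolding d hw_def by simp
qed

lemma short_span:
 assumes hw: "hwX \<mu> W v"
 shows "Ws W v c \<subseteq> span (W \<union> {sv n q (Ys c' v) |q c'. deglt n c' c})" (is ?A)
  and "clos (I \<times> I) (insert v W) \<subseteq> span (W \<union> {sv n q (Ys c v) |q c. True})" (is ?B)
proof -
 interpret b: block sc X n F 0 n "D n" W v by (rule block_short[OF hw])
 note d = block_short_defs[OF b.block_axioms]
 let ?R = "{(b, c). deglt n b c}"
 have Z: "clos (D n) (insert (Ys c v) (Ws W v c)) \<subseteq> span (Ws W v c \<union> {sv n q (Ys c v) |q. True})" for c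
  by (rule sv_span[OF hw_short[OF hw]])
 have L: "Ws W v c = clos (D n) (W \<union> {Ys c' v |c'. (c', c) \<in> ?R})" for c
  by (simp add: Ws_def)
 note fs = filtered_span[OF b.G(1) wf_deglt trans_deglt b.stabG L Z]
 have e: "(\<Union>c'\<in>{c'. (c', c) \<in> ?R}. {sv n q (Ys c' v) |q. True}) = {sv n q (Ys c' v) |q c'. deglt n c' c}"
  by auto
 show ?A using fs(1)[of c] unfolding e .
 have e2: "(\<Union>c. {sv n q (Ys c v) |q. True}) = {sv n q (Ys c v) |q c. True}" by auto
 let ?N = "clos (D n) (W \<union> {Ys c v |c. True})"
 have N: "stab (D n \<union> {0} \<times> idx0 n) ?N" using b.K_limit[unfolded d] .
 note subN = stab_subspace[OF N]
 have "F i j u \<in> ?N" if ij: "i \<in> I" "j \<in> I" and u: "u \<in> ?N" for i j u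
 proof -
  have p: "F i j u \<in> ?N" if "(i, j) \<in> D n \<union> {0} \<times> idx0 n" for i j
   by (rule stabD[OF N that u])
  have neg: "F i j u \<in> ?N" if "F (- j) (- i) u \<in> ?N"
   using F_swap[OF ij] subspace_neg[OF subN that] by simp
  have "i \<in> idx0 n \<or> i = 0" "j \<in> idx0 n \<or> j = 0" using ij by (auto simp: B idx_def)
  hence "(i, j) \<in> D n \<union> {0} \<times> idx0 n \<or> (- j, - i) \<in> D n \<union> {0} \<times> idx0 n \<or> j = - i"
   by (elim disjE) simp_all
  then consider "(i, j) \<in> D n \<union> {0} \<times> idx0 n" | "(- j, - i) \<in> D n \<union> {0} \<times> idx0 n" | "j = - i" by blast
  thus ?thesis
  proof cases
   case 3
   thus ?thesis using F_anti_diag[OF ij(1)] subspace_0[OF subN] by simp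
  qed (use p neg in auto)
 qed
 hence "stab (I \<times> I) ?N" using subN unfolding stab_def by blast
 moreover have "insert v W \<subseteq> ?N"
 proof -
  have "expo_word n (%_. 0) = []" by (simp add: expo_word_def concat_eq_Nil_conv)
  hence "Ys (%_. 0) v = v" by simp
  thus ?thesis by (auto intro!: clos.base) metis
 qed
 ultimately have "clos (I \<times> I) (insert v W) \<subseteq> ?N" by (rule clos_least[rotated])
 also have "?N \<subseteq> span (W \<union> {sv n q (Ys c v) |q c. True})"
  using fs(2) unfolding e2 by (simp add: full_SetCompr_eq)
 finally show ?B .
qed

end

text \<open>The exponents of the short roots are kept in the slot \<open>q 0 True\<close>, which is
  free because the rows of type D only use the slots from 1 on.\<close>

definition svX :: "(nat => bool => nat => nat) => 'v => 'v" where
 "svX q v = sv n q (if X = TypeB then Ys (q 0 True) v else v)"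

end

fun ltX :: "lie_type => nat => (nat => bool => nat => nat) => (nat => bool => nat => nat) => bool" where
 "ltX TypeD n p q \<longleftrightarrow> qlt n p q"
| "ltX TypeB n p q \<longleftrightarrow> deglt n (p 0 True) (q 0 True) \<or> (\<forall>i\<in>{1..n}. p 0 True i = q 0 True i) \<and> qlt n p q"

fun patX :: "lie_type => nat => weight => (nat => bool => nat => rat) => bool" where
 "patX TypeD n \<mu> q \<longleftrightarrow> patD n \<mu> q"
| "patX TypeB n \<mu> q \<longleftrightarrow> relB n \<mu> (q 0 True) \<and> patD n (%j. \<mu> j - q 0 True j) q"

context int_rep
begin

lemma sv_cong1: "(\<And>m s. 1 <= m ==> m <= r ==> q m s = q' m s) ==> sv r q u = sv r q' u"
 by (induction r arbitrary: u) auto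

lemma qlt_cong1: "(\<And>m. 1 <= m ==> m <= r ==> p m = p' m) ==> (\<And>m. 1 <= m ==> m <= r ==> q m = q' m) ==> qlt r p q = qlt r p' q'"
 by (induction r) auto

context
 assumes B: "X = TypeB" and n1: "n \<ge> 1"
begin

lemma Ws_span:
 assumes hw: "hwX \<mu> W v"
 shows "Ws W v (q 0 True) \<subseteq> span (W \<union> {svX q' v |q'. ltX X n q' q})" (is "_ \<subseteq> span ?M")
proof (rule order_trans[OF short_span(1)[OF B hw] span_mono[OF Un_mono[OF order_refl]]], clarify)
 fix p :: "nat => bool => nat => nat" and c assume c: "deglt n c (q 0 True)"
 define p' where "p' = p(0 := %_. c)"
 have "sv n p (Ys c v) = sv n p' (Ys c v)" by (rule sv_cong1) (simp add: p'_def)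
 hence "sv n p (Ys c v) = svX p' v" unfolding svX_def if_P[OF B] by (simp add: p'_def)
 moreover have "ltX X n p' q" unfolding B ltX.simps using c by (simp add: p'_def)
 ultimately show "\<exists>q'. sv n p (Ys c v) = svX q' v \<and> ltX X n q' q" by blast
qed

lemma short_upper:
 assumes hw: "hwX \<mu> W v" and rel: "\<not> relBn n \<mu> c"
 shows "Ys c v \<in> Ws W v c"
proof -
 interpret b: block sc X n F 0 n "D n" W v by (rule block_short[OF B hw])
 note d = block_short_defs[OF B b.block_axioms]
 have W: "stab (I \<times> I) W" and wt: "wtv \<mu> v" and rv: "raises_into I W v"
  using hw by (auto simp: hwX_def)
 have kill: "(F j (int i) ^^ N) v \<in> W"
  if "i \<in> {1..n}" "j \<in> I" "prec (int i) j" "int i \<noteq> j" "int i \<noteq> - j" "2 * (ext \<mu> (int i) - ext \<mu> j) < dbl (int i) j * of_nat N" for i j N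
 proof (rule sl2_kill[OF nat_idx[OF that(1)] that(2,4,5) wt _ _ _ that(6)])
  show "stab {(int i, j), (j, int i)} W" by (rule stab_mono[OF W]) (use that nat_idx[of i] in auto)
  show "nilp j (int i)" using that nat_idx by (intro nilp) auto
  show "F (int i) j v \<in> W" using rv that nat_idx[of i] unfolding raises_into_def by auto
 qed
 have c1: ?thesis if k: "1 <= k" "k < n" "of_nat (c k) > \<mu> k - \<mu> (Suc k)" for k
 proof -
  have "(F (int (Suc k)) (int k) ^^ c k) v \<in> W"
   by (rule kill) (use k nat_idx[of "Suc k"] in \<open>auto simp: prec_def dbl_def\<close>)
  from b.move_exponent[OF k(1) _ b.v_K b.Yb_lower _ this] k
  show ?thesis unfolding d by auto
 qed
 have c2: ?thesis if "of_nat (c n) > 2 * \<mu> n"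
 proof -
  have "(F 0 (int n) ^^ c n) v \<in> W"
   by (rule kill) (use n1 that zero_I[OF B] in \<open>auto simp: prec_def dbl_def\<close>)
  from b.W_lower[OF b.Yb_last[where b = c, OF n1 this]] show ?thesis unfolding d .
 qed
 show ?thesis
 proof (rule ccontr)
  assume nt: "\<not> ?thesis"
  have "relBn n \<mu> c"
   unfolding relB_def using c1 c2 nt by (meson not_le of_nat_0_le_iff)
  with rel show False by simp
 qed
qed

text \<open>For 1^k 0...0 the parity of roots of type D excludes the predecessors, for c ... c the
  half-spin functional does.\<close>

lemma short_lower:
 assumes hw: "hwX \<mu> W v" and v: "v \<notin> W" and g: "gtype n \<mu>" and rel: "relBn n \<mu> c"
 shows "Ys c v \<notin> Ws W v c"
proof
 assume mem: "Ys c v \<in> Ws W v c"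
 have W: "stab (I \<times> I) W" and WT: "stab torus W" and wt: "wtv \<mu> v" "supp n \<mu>" and rv: "raises_into I W v"
  using hw stab_mono[OF _ torus_sub] by (auto simp: hwX_def)
 note sub = stab_subspace[OF W]
 define L where "L = {\<kappa>. supp n \<kappa> \<and> \<kappa> \<noteq> wsh 0 n c \<mu>}"
 have suppw: "supp n (wsh 0 n c \<mu>)" for c by (rule supp_wsh[OF wt(2)]) auto
 have subL: "subspace (wspan W L)" by (rule subspace_wspan[OF sub])
 have sep: False if c': "deglt n c' c" "relBn n \<mu> c'" and gm: "\<gamma> \<in> pos_cone (idx0 n)"
  and eq: "wsh 0 n c \<mu> = wsh 0 n c' \<mu> - \<gamma>" for c' \<gamma>
 proof -
  have gj: "\<gamma> j = of_nat (c j) - of_nat (c' j)" if "j \<in> {1..n}" for j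
   using fun_cong[OF eq, of j] unfolding minus_apply ev_wsh0[OF that] by linarith
  have gsum: "(\<Sum>i = 1..n. \<gamma> i) = of_nat (\<Sum>i = 1..n. c i) - of_nat (\<Sum>i = 1..n. c' i)"
   using gj by (simp add: sum_subtractf)
  from g show False
   unfolding gtype_def
  proof (elim disjE exE conjE bexE)
   fix k assume k: "k < n" and mu: "ones n k \<mu>"
   have oc: "1 <= k" "only n k 1 c" using relB_ones[OF rel k mu] only_not_deglt c'(1) by blast+
   from relB_ones[OF c'(2) k mu] show False
   proof
    assume z: "only n k 0 c'"
    \<comment> \<open>The weights differ by \<epsilon>_k, whose coordinate sum is odd.\<close>
    have "(\<Sum>i = 1..n. \<gamma> i) = 1"
     unfolding gsum only_sum[OF oc(2,1) less_imp_le[OF k]] only_sum0[OF z] by simp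
    thus False using pos_cone_parity[OF gm] by (metis even_mult_iff even_numeral odd_one of_int_eq_1_iff of_int_mult of_int_numeral)
   qed (use only_deglt[OF _ oc(2)] c'(1) in blast)
  next
   fix d e :: rat assume d: "d \<in> {1, 1/2}" "e \<in> {d, - d}" and mu: "\<forall>j. 1 <= j \<and> j <= n --> \<mu> j = (if j < n then d else e)"
   obtain t t' where oc: "only n n t c" and oc': "only n n t' c'"
    using relB_full(2)[OF rel n1 d mu] relB_full(2)[OF c'(2) n1 d mu] by blast
   \<comment> \<open>The functional yields t <= t', whereas the degree part of the order yields t'
     <= t.\<close>
   have "(\<Sum>i = 1..<n. \<gamma> i) - \<gamma> n = (\<Sum>i = 1..<n. 0) - (of_nat t - of_nat t')"
    using gj oc oc' n1 by (intro arg_cong2[of _ _ _ _ "(-)"] sum.cong) (auto simp: only_def)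
   hence "of_nat t <= (of_nat t' :: rat)" using partial_sum_pos_cone'[OF gm n1] by simp
   hence le: "t <= t'" by simp
   have "(\<Sum>i = 1..n. c' i) <= (\<Sum>i = 1..n. c i)"
    using c'(1) unfolding deglt_def deglex_def mem_Collect_eq prod.case sum_list_map_upt by linarith
   hence "t' = t" using le unfolding only_sum[OF oc n1 order_refl] only_sum[OF oc' n1 order_refl] by simp
   thus False using only_deglt[OF oc', of c] oc c'(1) by simp
  qed
 qed
 have gen: "sv n q (Ys c' v) \<in> wspan W L"
  if c': "deglt n c' c" "relBn n \<mu> c'" for q c'
 proof -
  obtain \<kappa> where l: "lw n (Ys c' v) (wsh 0 n c' \<mu>) (sv n q (Ys c' v)) \<kappa>"
   using lw_sv[OF lw.base order_refl] by blast
  have wk: "wtv \<kappa> (sv n q (Ys c' v))" using lw_wtv[OF l wtv_Ys[OF B wt(1)]] by simp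
  have cn: "wsh 0 n c' \<mu> - \<kappa> \<in> pos_cone (idx0 n)" by (rule lw_cone[OF l])
  have e: "wsh 0 n c' \<mu> - (wsh 0 n c' \<mu> - \<kappa>) = \<kappa>" by simp
  have "\<kappa> \<noteq> wsh 0 n c \<mu>" using sep[OF c' cn] unfolding e by metis
  moreover have "supp n \<kappa>" using supp_diff[OF suppw[of c'] supp_pos_cone[OF cn idx0_idx]] unfolding e .
  ultimately show ?thesis by (intro wspan_wtv[OF sub wk]) (simp add: L_def)
 qed
 \<comment> \<open>Inadmissible predecessors are expressed by still smaller ones, so that
   \<open>gen\<close> suffices.\<close>
 have all: "deglt n c' c ==> sv n q (Ys c' v) \<in> wspan W L" for q c'
  using wf_deglt[of n]
 proof (induction c' arbitrary: q rule: wf_induct_rule)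
  case (less c')
  show ?case
  proof (cases "relBn n \<mu> c'")
   case True
   thus ?thesis using gen less.prems by blast
  next
   case False
   have "stab (D n) (Ws W v c')" by (simp add: Ws_def stab_clos)
   hence "sv n q (Ys c' v) \<in> Ws W v c'"
    by (rule stab_sv[OF _ short_upper[OF hw False]])
   also have "\<dots> \<subseteq> wspan W L"
   proof (rule order_trans[OF short_span(1)[OF B hw] span_minimal[OF _ subL]], rule Un_least)
    show "W \<subseteq> wspan W L" using wspan_base[OF sub] by blast
    show "{sv n q (Ys c'' v) |q c''. deglt n c'' c'} \<subseteq> wspan W L"
     using less.IH deglt_trans[OF _ less.prems] by auto
   qed
   finally show ?thesis by simp
  qed
 qed
 have "Ws W v c \<subseteq> wspan W L"
 proof (rule order_trans[OF short_span(1)[OF B hw] span_minimal[OF _ subL]], rule Un_least)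
  show "W \<subseteq> wspan W L" using wspan_base[OF sub] by blast
  show "{sv n q (Ys c' v) |q c'. deglt n c' c} \<subseteq> wspan W L" using all by auto
 qed
 hence inW: "Ys c v \<in> W"
  using mem suppw by (intro wspan_separate[OF WT _ wtv_Ys[OF B wt(1), of c]]) (auto simp: L_def)
 have alive: "(F 0 (int k) ^^ t) v \<notin> W" if k: "k \<in> {1..n}" and t: "of_nat t <= 2 * \<mu> k" for k t
 proof (rule sl2_alive[OF nat_idx[OF k] zero_I[OF B] _ _ wt(1) _ _ v])
  show "stab {(int k, 0), (0, int k)} W" by (rule stab_mono[OF W]) (use k nat_idx[of k] zero_I[OF B] in auto)
  show "F (int k) 0 v \<in> W" using rv k nat_idx[of k] zero_I[OF B] unfolding raises_into_def by (auto simp: prec_def)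
  show "2 * (ext \<mu> (int k) - ext \<mu> 0) \<noteq> dbl (int k) 0 * of_nat m" if "m < t" for m
  proof -
   have "(of_nat m :: rat) < of_nat t" using that by simp
   thus ?thesis using t k by (simp add: dbl_def)
  qed
 qed (use k in auto)
 from g have "\<exists>k\<in>{1..n}. \<exists>t. only n k t c \<and> of_nat t <= 2 * \<mu> k"
  unfolding gtype_def
 proof (elim disjE exE conjE bexE)
  fix k assume k: "k < n" and mu: "ones n k \<mu>"
  from relB_ones[OF rel this] show ?thesis
  proof
   assume "only n k 0 c"
   thus ?thesis using mu n1 by (intro bexI[of _ n] exI[of _ 0]) (auto simp: only_def)
  qed (use mu k in \<open>intro bexI[of _ k] exI[of _ 1], auto\<close>)
 next
  fix d e :: rat assume "d \<in> {1, 1/2}" "e \<in> {d, - d}" "\<forall>j. 1 <= j \<and> j <= n --> \<mu> j = (if j < n then d else e)"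
  with relB_full[OF rel n1 this] show ?thesis using n1 by (intro bexI[of _ n]) auto
 qed
 then obtain k t where k: "k \<in> {1..n}" and o: "only n k t c" and t: "of_nat t <= 2 * \<mu> k" by blast
 have "Ys c v = (F 0 (int k) ^^ t) v" using expo_word_only[OF o] k by simp
 thus False using alive[OF k t] inW by simp
qed

end

lemma upperX:
 assumes hw: "hwX \<mu> W v" and n: "n \<ge> 1" and p: "\<not> patX X n \<mu> (rats q)"
 shows "svX q v \<in> span (W \<union> {svX q' v |q'. ltX X n q' q})"
proof (cases X)
 case TypeB
 let ?c = "q 0 True" and ?M = "W \<union> {svX q' v |q'. ltX X n q' q}"
 have sx: "svX q v = sv n q (Ys ?c v)" unfolding svX_def if_P[OF TypeB] ..
 have WM: "Ws W v ?c \<subseteq> span ?M" by (rule Ws_span[OF TypeB n hw])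
 show ?thesis
 proof (cases "relBn n \<mu> ?c")
  case False
  have "stab (D n) (Ws W v ?c)" by (simp add: Ws_def stab_clos)
  hence "sv n q (Ys ?c v) \<in> Ws W v ?c" by (rule stab_sv[OF _ short_upper[OF TypeB n hw False]])
  thus ?thesis unfolding sx using WM by blast
 next
  case True
  have eq: "patD n (wsh 0 n ?c \<mu>) (rats q) = patD n (%j. \<mu> j - rats q 0 True j) (rats q)"
   by (rule patD_cong) (simp_all add: ev_wsh0)
  have np: "\<not> patD n (wsh 0 n ?c \<mu>) (rats q)"
   using p True unfolding eq TypeB patX.simps by simp
  have "sv n q (Ys ?c v) \<in> span (Ws W v ?c \<union> {sv n q' (Ys ?c v) |q'. qlt n q' q})"
   by (rule sv_upper[OF hw_short[OF TypeB hw] np])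
  also have "\<dots> \<subseteq> span ?M"
  proof (rule span_minimal[OF Un_least[OF WM] subspace_span], clarify)
   fix p :: "nat => bool => nat => nat" assume l: "qlt n p q"
   define p' where "p' = p(0 := q 0)"
   have "sv n p (Ys ?c v) = sv n p' (Ys ?c v)" by (rule sv_cong1) (simp add: p'_def)
   hence "sv n p (Ys ?c v) = svX p' v" unfolding svX_def if_P[OF TypeB] by (simp add: p'_def)
   moreover have "qlt n p' q = qlt n p q" by (rule qlt_cong1) (simp_all add: p'_def)
   hence "ltX X n p' q" unfolding TypeB ltX.simps using l by (simp add: p'_def)
   ultimately show "sv n p (Ys ?c v) \<in> span ?M"
    by (intro span_base UnI2 CollectI exI[of _ p'] conjI)
  qed
  finally show ?thesis unfolding sx .
 qed
next
 case TypeD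
 hence nB: "X \<noteq> TypeB" by simp
 have np: "\<not> patD n \<mu> (rats q)" using p unfolding TypeD by simp
 have l: "ltX X n q' q = qlt n q' q" for q' unfolding TypeD by simp
 show ?thesis unfolding l svX_def if_not_P[OF nB] by (rule sv_upper[OF hwX_hw[OF hw] np])
qed

lemma gtype_wsh0:
 assumes rel: "relBn n \<mu> c" and n: "n \<ge> 1" and g: "gtype n \<mu>"
 shows "gtype n (wsh 0 n c \<mu>)"
 using g unfolding gtype_def[of n \<mu>]
proof (elim disjE exE conjE bexE)
 fix k assume k: "k < n" and mu: "ones n k \<mu>"
 from relB_ones[OF rel k mu] show ?thesis
 proof
  assume "only n k 0 c"
  thus ?thesis using mu k by (intro gtype_ones[where k = k]) (auto simp: ev_wsh0 only_def)
 next
  assume "1 <= k \<and> only n k 1 c"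
  thus ?thesis using mu k by (intro gtype_ones[where k = "k - 1"]) (auto simp: ev_wsh0 only_def)
 qed
next
 fix d e :: rat assume d: "d \<in> {1, 1/2}" "e \<in> {d, - d}" and mu: "\<forall>j. 1 <= j \<and> j <= n --> \<mu> j = (if j < n then d else e)"
 obtain t where o: "only n n t c" and t: "of_nat t <= 2 * d" using relB_full(2)[OF rel n d mu] by blast
 show ?thesis
  by (rule gtype_last[OF d(1) t n]) (use mu o relB_full(1)[OF rel n d mu] in \<open>auto simp: ev_wsh0 only_def\<close>)
qed

lemma lowerX:
 assumes hw: "hwX \<mu> W v" and n: "n \<ge> 1" and v: "v \<notin> W" and g: "gtype n \<mu>" and p: "patX X n \<mu> (rats q)"
 shows "svX q v \<notin> span (W \<union> {svX q' v |q'. ltX X n q' q})"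
proof (cases X)
 case TypeB
 let ?c = "q 0 True"
 have sx: "svX q v = sv n q (Ys ?c v)" unfolding svX_def if_P[OF TypeB] ..
 have rel: "relBn n \<mu> ?c" and pD: "patD n (%j. \<mu> j - rats q 0 True j) (rats q)"
  using p unfolding TypeB patX.simps by simp_all
 have eq: "patD n (wsh 0 n ?c \<mu>) (rats q) = patD n (%j. \<mu> j - rats q 0 True j) (rats q)"
  by (rule patD_cong) (simp_all add: ev_wsh0)
 have "{svX q' v |q'. ltX X n q' q} \<subseteq> span (Ws W v ?c \<union> {sv n q' (Ys ?c v) |q'. qlt n q' q})"
 proof clarify
  fix p assume "ltX X n p q"
  hence "deglt n (p 0 True) ?c \<or> (\<forall>i\<in>{1..n}. p 0 True i = ?c i) \<and> qlt n p q" unfolding TypeB ltX.simps .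
  thus "svX p v \<in> span (Ws W v ?c \<union> {sv n q' (Ys ?c v) |q'. qlt n q' q})"
  proof (elim disjE conjE)
   assume d: "deglt n (p 0 True) ?c"
   have st: "stab (D n) (Ws W v ?c)" by (simp add: Ws_def stab_clos)
   have "Ys (p 0 True) v \<in> Ws W v ?c" unfolding Ws_def using d by (intro clos.base) blast
   hence "sv n p (Ys (p 0 True) v) \<in> Ws W v ?c" by (rule stab_sv[OF st])
   thus ?thesis unfolding svX_def if_P[OF TypeB] by (intro span_base) blast
  next
   assume e: "\<forall>i\<in>{1..n}. p 0 True i = ?c i" and l: "qlt n p q"
   have "expo_word n (p 0 True) = expo_word n ?c"
    unfolding expo_word_def using e by (intro arg_cong[where f = concat] map_cong) auto
   thus ?thesis unfolding svX_def if_P[OF TypeB] using l by (intro span_base) auto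
  qed
 qed
 moreover have "W \<subseteq> span (Ws W v ?c \<union> {sv n q' (Ys ?c v) |q'. qlt n q' q})"
  unfolding Ws_def using clos.base span_base by blast
 ultimately have sub: "span (W \<union> {svX q' v |q'. ltX X n q' q}) \<subseteq> span (Ws W v ?c \<union> {sv n q' (Ys ?c v) |q'. qlt n q' q})"
  by (intro span_minimal[OF _ subspace_span]) blast
 have "svX q v \<notin> span (Ws W v ?c \<union> {sv n q' (Ys ?c v) |q'. qlt n q' q})"
  unfolding sx
  by (rule sv_lower[OF hw_short[OF TypeB hw] short_lower[OF TypeB n hw v g rel]])
   (use gtype_wsh0[OF rel n g] pD in \<open>simp_all only: eq\<close>)
 thus ?thesis using sub by blast
next
 case TypeD
 hence nB: "X \<noteq> TypeB" by simp
 have np: "patD n \<mu> (rats q)" using p unfolding TypeD by simp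
 have l: "ltX X n q' q = qlt n q' q" for q' unfolding TypeD by simp
 show ?thesis unfolding l svX_def if_not_P[OF nB] by (rule sv_lower[OF hwX_hw[OF hw] v _ np]) (use g in simp)
qed

end

section \<open>The Casimir operator\<close>

lemma sum_idx:
 fixes f :: "int => 'b::comm_monoid_add"
 shows "(\<Sum>i\<in>idx X n. f i) = (if X = TypeB then f 0 else 0) + (\<Sum>k = 1..n. f (int k) + f (- int k))"
proof -
 have e: "idx0 n = int ` {1..n} \<union> (%k. - int k) ` {1..n}"
 proof safe
  fix i assume "i \<in> idx0 n" "i \<notin> (%k. - int k) ` {1..n}"
  hence "i > 0" by (cases "i < 0") (auto simp: image_iff dest!: bspec[of _ _ "nat (- i)"])
  thus "i \<in> int ` {1..n}" using \<open>i \<in> idx0 n\<close> by (intro image_eqI[of _ _ "nat i"]) auto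
 qed auto
 have "(\<Sum>i\<in>idx0 n. f i) = (\<Sum>k = 1..n. f (int k)) + (\<Sum>k = 1..n. f (- int k))"
  unfolding e by (subst sum.union_disjoint) (auto simp: sum.reindex inj_on_def)
 thus ?thesis by (cases X) (simp_all add: idx_def sum.distrib)
qed

text \<open>The sum of all positive roots, that is, 2 \<rho>.\<close>

definition delta :: "lie_type => nat => weight" where
 "delta X n = (%i. if i \<in> {1..n} then of_nat (2 * (n - i) + of_bool (X = TypeB)) else 0)"

text \<open>The Casimir eigenvalue 2 (\<mu>, \<mu> + 2 \<rho>). The factor 2 comes from summing over
  all index pairs, which counts each operator twice up to sign.\<close>

definition quad :: "lie_type => nat => weight => rat" where
 "quad X n \<mu> = 2 * (\<Sum>k = 1..n. \<mu> k * (\<mu> k + delta X n k))"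

lemma delta_prec:
 assumes "i \<in> idx X n" "j \<in> idx X n" "prec i j" "i \<noteq> - j"
 shows "ext (delta X n) j < ext (delta X n) i"
proof -
 have b: "\<bar>i\<bar> <= int n" "\<bar>j\<bar> <= int n" using assms idx_le by blast+
 have e: "ext (delta X n) k = of_int (sgn k * (2 * (int n - \<bar>k\<bar>) + of_bool (X = TypeB)))" if "\<bar>k\<bar> <= int n" for k
  using that by (auto simp: ext_def delta_def of_nat_diff nat_le_iff sgn_if)
 have "0 \<notin> idx X n" if "X \<noteq> TypeB" using that by (cases X) (auto simp: idx_def)
 hence "sgn j * (2 * (int n - \<bar>j\<bar>) + of_bool (X = TypeB)) < sgn i * (2 * (int n - \<bar>i\<bar>) + of_bool (X = TypeB))"
  using assms b by (auto simp: prec_def sgn_if split: if_splits)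
 thus ?thesis unfolding e[OF b(1)] e[OF b(2)] of_int_less_iff .
qed

lemma int_index_cases:
 assumes "\<bar>k\<bar> <= int n"
 shows "k = 0 \<or> (\<exists>m\<in>{1..n}. k = int m \<or> k = - int m)"
proof (cases "k = 0")
 case False
 hence "nat \<bar>k\<bar> \<in> {1..n}" "k = int (nat \<bar>k\<bar>) \<or> k = - int (nat \<bar>k\<bar>)" using assms by auto
 thus ?thesis by blast
qed simp

lemma sum_ev: "\<bar>k\<bar> <= int n ==> (\<Sum>i = 1..n. w i * ev k i) = ext w k"
proof -
 assume k: "\<bar>k\<bar> <= int n"
 have p: "(\<Sum>i = 1..n. w i * ev (int m) i) = w m" if "m \<in> {1..n}" for m
 proof -
  have "(\<Sum>i = 1..n. w i * ev (int m) i) = (\<Sum>i = 1..n. if m = i then w i else 0)"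
   using that by (intro sum.cong) (auto simp: ev_def)
  thus ?thesis using that by simp
 qed
 consider "k = 0" | m where "m \<in> {1..n}" "k = int m" | m where "m \<in> {1..n}" "k = - int m"
  using int_index_cases[OF k] by blast
 thus ?thesis
 proof cases
  case (2 m)
  thus ?thesis using p by (simp add: ext_def)
 next
  case (3 m)
  thus ?thesis using p[OF 3(1)] by (simp add: sum_negf)
 qed simp
qed

lemma sum_pairs: "(\<Sum>k = 1..n. \<Sum>l = 1..n. (if k < l then f k else if l < k then f l else (0::rat))) = 2 * (\<Sum>k = 1..n. of_nat (n - k) * f k)"
proof (induction n)
 case (Suc n)
 have "(\<Sum>k = 1..Suc n. \<Sum>l = 1..Suc n. (if k < l then f k else if l < k then f l else 0))
  = (\<Sum>k = 1..n. (\<Sum>l = 1..n. (if k < l then f k else if l < k then f l else 0)) + f k) + (\<Sum>l = 1..n. f l)"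
  by simp
 also have "\<dots> = 2 * (\<Sum>k = 1..n. of_nat (n - k) * f k + f k)"
  using Suc.IH by (simp add: sum.distrib)
 also have "(\<Sum>k = 1..n. of_nat (n - k) * f k + f k) = (\<Sum>k = 1..n. of_nat (Suc n - k) * f k)"
  by (intro sum.cong) (auto simp: Suc_diff_le of_nat_Suc algebra_simps of_nat_diff)
 also have "\<dots> = (\<Sum>k = 1..Suc n. of_nat (Suc n - k) * f k)" by simp
 finally show ?case .
qed simp

lemma casimir_value:
 "(\<Sum>i\<in>idx X n. \<Sum>j\<in>idx X n. if i = j then ext \<mu> i * ext \<mu> i else if prec i j \<and> j \<noteq> - i then ext \<mu> i - ext \<mu> j else 0)
  = quad X n \<mu>" (is "(\<Sum>i\<in>_. \<Sum>j\<in>_. ?c i j) = _")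
proof -
 have "(\<Sum>i\<in>idx X n. \<Sum>j\<in>idx X n. ?c i j) = (\<Sum>k = 1..n. \<Sum>l = 1..n. ?c (int k) (int l) + ?c (int k) (- int l) + ?c (- int k) (int l) + ?c (- int k) (- int l))
   + (if X = TypeB then \<Sum>k = 1..n. ?c (int k) 0 + ?c (- int k) 0 + ?c 0 (int k) + ?c 0 (- int k) else 0)"
  unfolding sum_idx by (simp add: sum.distrib)
 also have "(\<Sum>k = 1..n. \<Sum>l = 1..n. ?c (int k) (int l) + ?c (int k) (- int l) + ?c (- int k) (int l) + ?c (- int k) (- int l))
  = (\<Sum>k = 1..n. \<Sum>l = 1..n. (if k = l then 2 * (\<mu> k * \<mu> k) else 0) + (if k < l then 2 * \<mu> k else if l < k then 2 * \<mu> l else 0))"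
  by (intro sum.cong refl) (auto simp: prec_def)
 also have "\<dots> = (\<Sum>k = 1..n. 2 * (\<mu> k * \<mu> k)) + 2 * (\<Sum>k = 1..n. of_nat (n - k) * (2 * \<mu> k))"
  unfolding sum.distrib sum_pairs by simp
 also have "(if X = TypeB then \<Sum>k = 1..n. ?c (int k) 0 + ?c (- int k) 0 + ?c 0 (int k) + ?c 0 (- int k) else 0)
  = (\<Sum>k = 1..n. 2 * (\<mu> k * of_bool (X = TypeB)))"
  by (cases X) (auto simp: prec_def intro!: sum.cong)
 finally show ?thesis
  unfolding quad_def delta_def sum_distrib_left sum.distrib[symmetric]
  by (simp add: algebra_simps)
qed

text \<open>Half the difference of the two values is (\<mu> + (\<mu> - \<gamma>) + 2 \<rho>,
  \<gamma>). The first argument is strictly positive on every positive root.\<close>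

lemma quad_strict:
 assumes g: "\<gamma> \<in> pos_cone (idx X n)" "quad X n \<mu> = quad X n (\<mu> - \<gamma>)"
  and d: "\<And>i j. i \<in> idx X n ==> j \<in> idx X n ==> prec i j ==> i \<noteq> - j ==> ext \<mu> j <= ext \<mu> i"
   "\<And>i j. i \<in> idx X n ==> j \<in> idx X n ==> prec i j ==> i \<noteq> - j ==> ext (\<mu> - \<gamma>) j <= ext (\<mu> - \<gamma>) i"
 shows "\<gamma> = 0"
proof -
 define w where "w = \<mu> + (\<mu> - \<gamma>) + delta X n"
 define \<phi> where "\<phi> = (%x::weight. \<Sum>i = 1..n. w i * x i)"
 have lin: "\<phi> 0 = 0" "\<And>x y. \<phi> (x + y) = \<phi> x + \<phi> y" "\<And>x y. \<phi> (x - y) = \<phi> x - \<phi> y"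
  by (simp_all add: \<phi>_def distrib_left right_diff_distrib sum.distrib sum_subtractf)
 have pos: "\<phi> (ev j) < \<phi> (ev i)" if ij: "i \<in> idx X n" "j \<in> idx X n" "prec i j" "i \<noteq> - j" for i j
 proof -
  have "\<bar>i\<bar> <= int n" "\<bar>j\<bar> <= int n" using ij idx_le by blast+
  hence "\<phi> (ev i) = ext w i" "\<phi> (ev j) = ext w j" unfolding \<phi>_def by (simp_all only: sum_ev)
  thus ?thesis
   using d(1)[OF ij] d(2)[OF ij] delta_prec[OF ij] unfolding w_def ext_add by linarith
 qed
 have ge: "\<phi> x \<ge> 0" if "x \<in> pos_cone (idx X n)" for x
  by (rule pos_cone_functional[OF that lin]) (use pos in \<open>simp add: less_imp_le\<close>)
 have "\<phi> \<gamma> = (\<Sum>k = 1..n. \<mu> k * (\<mu> k + delta X n k)) - (\<Sum>k = 1..n. (\<mu> - \<gamma>) k * ((\<mu> - \<gamma>) k + delta X n k))"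
  unfolding \<phi>_def w_def sum_subtractf[symmetric] by (intro sum.cong) (simp_all add: algebra_simps)
 hence z: "\<phi> \<gamma> = 0" using g(2) unfolding quad_def by simp
 from g(1) show ?thesis
 proof cases
  case (add \<gamma>' i j)
  have "\<phi> \<gamma> = \<phi> \<gamma>' + (\<phi> (ev i) - \<phi> (ev j))" unfolding add(1) lin ..
  hence "\<phi> \<gamma> > 0" using ge[OF add(2)] pos[OF add(3-6)] by simp
  thus ?thesis using z by simp
 qed
qed

context so_rep
begin

definition casimir :: "'v => 'v" where
 "casimir u = (\<Sum>i\<in>I. \<Sum>j\<in>I. F i j (F j i u))"

text \<open>Bracketing both factors produces eight families of terms, which cancel in pairs after
  summation over i and j.\<close>

lemma casimir_commutes:
 assumes kl: "k \<in> I" "l \<in> I"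
 shows "F k l (casimir u) = casimir (F k l u)"
proof -
 have kl': "- k \<in> I" "- l \<in> I" using kl by simp_all
 have e: "F k l (F i j (F j i u)) = F i j (F j i (F k l u))
   + ((if i = l then F k j (F j i u) else 0) - (if j = k then F i l (F j i u) else 0)
    - (if i = - k then F (- l) j (F j i u) else 0) + (if j = - l then F i (- k) (F j i u) else 0))
   + ((if j = l then F i j (F k i u) else 0) - (if i = k then F i j (F j l u) else 0)
    - (if j = - k then F i j (F (- l) i u) else 0) + (if i = - l then F i j (F j (- k) u) else 0))"
  if ij: "i \<in> I" "j \<in> I" for i j
 proof -
  have 1: "F k l (F i j w) = F i j (F k l w) + (if i = l then F k j w else 0) - (if j = k then F i l w else 0)
    - (if i = - k then F (- l) j w else 0) + (if j = - l then F i (- k) w else 0)" for w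
   using F_F[OF kl ij, of w] by (simp add: eq_commute[of k] eq_commute[of l] minus_equation_iff[of _ i] minus_equation_iff[of _ j] cong: if_cong)
  have 2: "F k l (F j i u) = F j i (F k l u) + (if j = l then F k i u else 0) - (if i = k then F j l u else 0)
    - (if j = - k then F (- l) i u else 0) + (if i = - l then F j (- k) u else 0)"
   using F_F[OF kl ij(2,1), of u] by (simp add: eq_commute[of k] eq_commute[of l] minus_equation_iff[of _ i] minus_equation_iff[of _ j] cong: if_cong)
  have p: "F i j (if P then w else 0) = (if P then F i j w else 0)" for P w using ij by simp
  show ?thesis unfolding 1 2 using ij by (simp add: F_add F_diff p algebra_simps)
 qed
 have s1: "(\<Sum>i\<in>I. \<Sum>j\<in>I. if i = a then f i j else 0) = (\<Sum>j\<in>I. f a j)" if "a \<in> I" for a and f :: "int => int => 'v"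
 proof -
  have "(\<Sum>i\<in>I. \<Sum>j\<in>I. if i = a then f i j else 0) = (\<Sum>i\<in>I. if i = a then \<Sum>j\<in>I. f i j else 0)"
   by (intro sum.cong) auto
  thus ?thesis using that by simp
 qed
 have s2: "(\<Sum>i\<in>I. \<Sum>j\<in>I. if j = a then f i j else 0) = (\<Sum>i\<in>I. f i a)" if "a \<in> I" for a and f :: "int => int => 'v"
  using that by simp
 have "F k l (casimir u) = (\<Sum>i\<in>I. \<Sum>j\<in>I. F k l (F i j (F j i u)))"
  unfolding casimir_def using kl by (simp add: F_sum)
 also have "\<dots> = (\<Sum>i\<in>I. \<Sum>j\<in>I. F i j (F j i (F k l u))
   + ((if i = l then F k j (F j i u) else 0) - (if j = k then F i l (F j i u) else 0)
    - (if i = - k then F (- l) j (F j i u) else 0) + (if j = - l then F i (- k) (F j i u) else 0))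
   + ((if j = l then F i j (F k i u) else 0) - (if i = k then F i j (F j l u) else 0)
    - (if j = - k then F i j (F (- l) i u) else 0) + (if i = - l then F i j (F j (- k) u) else 0)))"
  by (intro sum.cong refl e)
 also have "\<dots> = casimir (F k l u)"
  unfolding casimir_def sum.distrib sum_subtractf s1[OF kl(1)] s1[OF kl(2)] s1[OF kl'(1)] s1[OF kl'(2)]
   s2[OF kl(1)] s2[OF kl(2)] s2[OF kl'(1)] s2[OF kl'(2)] by simp
 finally show ?thesis .
qed

lemma casimir_linear: "casimir (u + w) = casimir u + casimir w" "casimir (sc c u) = sc c (casimir u)" "casimir 0 = 0"
 unfolding casimir_def scale_sum_right
 by (simp_all add: F_add F_scale sum.distrib cong: sum.cong)

lemma casimir_hw:
 assumes v: "hwX \<mu> {0} v"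
 shows "casimir v = sc (of_rat (quad X n \<mu>)) v"
proof -
 have wt: "wtv \<mu> v" and rv: "\<And>i j. i \<in> I ==> j \<in> I ==> prec i j ==> F i j v = 0"
  using v by (auto simp: hwX_def raises_into_def)
 have "F i j (F j i v) = sc (of_rat (if i = j then ext \<mu> i * ext \<mu> i else if prec i j \<and> j \<noteq> - i then ext \<mu> i - ext \<mu> j else 0)) v"
  if ij: "i \<in> I" "j \<in> I" for i j
 proof -
  consider "i = j" | "j = - i" "i \<noteq> j" | "prec j i" "j \<noteq> - i" "i \<noteq> j" | "prec i j" "j \<noteq> - i" "i \<noteq> j" using prec_total by blast
  thus ?thesis
  proof cases
   case 1
   thus ?thesis using wtv_ext[OF wt ij(1)] F_scale[OF ij(1) ij(1)] by (simp add: of_rat_mult)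
  next
   case 2
   hence "F j i v = 0" using F_anti_diag[OF ij(2), of v] by simp
   thus ?thesis using 2 ij by simp
  next
   case 3
   hence "\<not> prec i j" using prec_asym by blast
   thus ?thesis using rv[OF ij(2,1) 3(1)] 3 ij by simp
  next
   case 4
   have "F i j (F j i v) = F i i v - F j j v"
    using F_F[OF ij ij(2,1), of v] rv[OF ij 4(1)] 4 ij by (auto simp: minus_equation_iff)
   thus ?thesis using 4 wtv_ext[OF wt ij(1)] wtv_ext[OF wt ij(2)] by (simp add: of_rat_diff scale_left_diff_distrib)
  qed
 qed
 hence "casimir v = (\<Sum>i\<in>I. \<Sum>j\<in>I. sc (of_rat (if i = j then ext \<mu> i * ext \<mu> i else if prec i j \<and> j \<noteq> - i then ext \<mu> i - ext \<mu> j else 0)) v)"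
  unfolding casimir_def by (intro sum.cong) auto
 also have "\<dots> = sc (of_rat (quad X n \<mu>)) v"
  unfolding casimir_value[symmetric] of_rat_sum scale_sum_left ..
 finally show ?thesis .
qed

lemma casimir_clos:
 assumes "casimir v = sc c v" "u \<in> clos (I \<times> I) {v}"
 shows "casimir u = sc c u"
proof -
 have "stab (I \<times> I) {u. casimir u = sc c u}"
  by (auto simp: stab_def subspace_def casimir_linear scale_right_distrib scale_left_commute F_scale casimir_commutes[symmetric])
 from clos_min[OF assms(2) _ this] assms(1) show ?thesis by blast
qed

text \<open>Modulo multiples of \<open>v\<close>, the module only has weights \<mu> - \<gamma> with
  \<gamma> of positive height, so none equal to \<mu>.\<close>

lemma highest_weight_line:
 assumes v: "hwX \<mu> {0} v" and u: "u \<in> clos (I \<times> I) {v}" "wtv \<mu> u"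
 shows "\<exists>c. u = sc c v"
proof -
 let ?L = "{\<mu> - \<gamma> |\<gamma>. \<gamma> \<in> pos_cone I \<and> ht n \<gamma> > 0}" and ?Low = "{(i, j). i \<in> I \<and> j \<in> I \<and> prec j i}"
 have W: "stab G {0}" if "G \<subseteq> I \<times> I" for G using that by (auto simp: stab_def)
 note sub = stab_subspace[OF W[OF order_refl]]
 have wt: "wtv \<mu> v" and rv: "raises_into I {0} v" and s: "supp n \<mu>" using v by (auto simp: hwX_def)
 define Z where "Z = {u. \<exists>c. u - sc c v \<in> wspan {0} ?L}"
 note subL = subspace_wspan[OF sub, of ?L]
 have low: "\<nu> + (ev i - ev j) \<in> ?L" if ij: "i \<in> I" "j \<in> I" "prec j i" "i \<noteq> - j" and nu: "\<nu> = \<mu> - \<gamma>" "\<gamma> \<in> pos_cone I" for i j \<nu> \<gamma>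
 proof -
  have I: "I \<subseteq> {i. \<bar>i\<bar> <= int n}" using idx_le by blast
  have "\<gamma> + (ev j - ev i) \<in> pos_cone I"
   using nu(2) ij by (intro pos_cone.add) auto
  moreover have "\<nu> + (ev i - ev j) = \<mu> - (\<gamma> + (ev j - ev i))" unfolding nu by simp
  moreover have "ht n (ev i) + 1 <= ht n (ev j)" using ht_prec[OF _ _ ij(3)] I ij by blast
  hence "ht n (\<gamma> + (ev j - ev i)) > 0" using ht_pos_cone[OF nu(2) I] by (simp only: ht_linear)
  ultimately show ?thesis by blast
 qed
 have "subspace Z"
  unfolding subspace_def
 proof (intro conjI ballI allI)
  show "0 \<in> Z" unfolding Z_def using subspace_0[OF subL] by (intro CollectI exI[of _ 0]) simp
 next
  fix x y assume "x \<in> Z" "y \<in> Z"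
  then obtain a b where "x - sc a v \<in> wspan {0} ?L" "y - sc b v \<in> wspan {0} ?L" unfolding Z_def by blast
  from subspace_add[OF subL this] show "x + y \<in> Z"
   unfolding Z_def by (intro CollectI exI[of _ "a + b"]) (simp add: algebra_simps)
 next
  fix x c assume "x \<in> Z"
  then obtain a where "x - sc a v \<in> wspan {0} ?L" unfolding Z_def by blast
  from subspace_scale[OF subL this, of c] show "sc c x \<in> Z"
   unfolding Z_def by (intro CollectI exI[of _ "c * a"]) (simp add: scale_right_diff_distrib)
 qed
 moreover have "F i j x \<in> Z" if ij: "i \<in> I" "j \<in> I" "prec j i" and x: "x \<in> Z" for i j x
 proof (cases "i = - j")
  case True
  hence "F i j x = 0" using F_anti_diag[OF ij(1)] by simp
  thus ?thesis using subspace_0[OF \<open>subspace Z\<close>] by simp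
 next
  case False
  obtain a where a: "x - sc a v \<in> wspan {0} ?L" using x unfolding Z_def by blast
  have "F i j (x - sc a v) \<in> wspan {0} ?L"
  proof (rule wspan_F[OF W[of "{(i, j)}"] _ ij(1,2) a])
   fix \<nu> assume "\<nu> \<in> ?L"
   then obtain \<gamma> where "\<nu> = \<mu> - \<gamma>" "\<gamma> \<in> pos_cone I" by blast
   thus "\<nu> + (ev i - ev j) \<in> ?L" by (rule low[OF ij False])
  qed (use ij in auto)
  moreover have "F i j v \<in> wspan {0} ?L"
   by (rule wspan_wtv[OF sub F_wtv[OF wt ij(1,2)] low[OF ij False, of _ 0]]) (simp_all add: pos_cone.zero)
  ultimately have "F i j (x - sc a v) + sc a (F i j v) \<in> wspan {0} ?L"
   by (intro subspace_add[OF subL] subspace_scale[OF subL])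
  hence "F i j x \<in> wspan {0} ?L" using ij by (simp add: F_diff F_scale)
  thus ?thesis unfolding Z_def by (intro CollectI exI[of _ 0]) simp
 qed
 ultimately have Z: "stab ?Low Z" unfolding stab_def by auto
 have u': "u \<in> clos (I \<times> I) (insert v {0})" using clos_mono[of "{v}" "insert v {0}"] u(1) by blast
 have "clos ?Low (insert v {0}) \<subseteq> Z"
 proof (rule clos_least[OF _ Z])
  have "v \<in> Z" unfolding Z_def using subspace_0[OF subL] by (intro CollectI exI[of _ 1]) simp
  thus "insert v {0} \<subseteq> Z" using subspace_0[OF \<open>subspace Z\<close>] by simp
 qed
 hence "u \<in> Z" using highest_weight_lowering[OF order_refl _ W[OF order_refl] wt rv] u' by auto
 then obtain c where c: "u - sc c v \<in> wspan {0} ?L" unfolding Z_def by blast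
 have "u - sc c v \<in> {0}"
 proof (rule wspan_separate[OF W c _ s])
  show "wtv \<mu> (u - sc c v)" using wtv_add[OF u(2) wtv_scale[OF wt, of "- c"]] by simp
  show "supp n \<nu>" if L: "\<nu> \<in> ?L" for \<nu>
  proof -
   obtain \<gamma> where g: "\<nu> = \<mu> - \<gamma>" "\<gamma> \<in> pos_cone I" using L by blast
   show ?thesis unfolding g(1) by (rule supp_diff[OF s supp_pos_cone[OF g(2) order_refl]])
  qed
  show "\<mu> \<notin> ?L"
  proof
   assume "\<mu> \<in> ?L"
   then obtain \<gamma> where g: "\<mu> = \<mu> - \<gamma>" "ht n \<gamma> > 0" by blast
   have "\<gamma> = \<mu> - (\<mu> - \<gamma>)" by simp
   also have "\<dots> = 0" unfolding g(1)[symmetric] by simp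
   finally show False using g(2) ht_linear(1)[of n] by simp
  qed
 qed (use nat_idx in auto)
 thus ?thesis by auto
qed

text \<open>Bracketing with \<open>F i j\<close> moves the height of an operator in one direction,
  and heights are bounded. So a sufficiently high power of \<open>F i j\<close> can be moved past
  any operator.\<close>

lemma nil_stab:
 assumes ij: "i \<in> I" "j \<in> I" "i \<noteq> j"
 shows "stab (I \<times> I) {u. \<exists>N. (F i j ^^ N) u = 0}"
proof -
 let ?M = "{u. \<exists>N. (F i j ^^ N) u = 0}"
 have lin: "(F i j ^^ N) (u + w) = (F i j ^^ N) u + (F i j ^^ N) w" "(F i j ^^ N) (sc c u) = sc c ((F i j ^^ N) u)"
  "(F i j ^^ N) 0 = 0" for N u w c
  by (induction N) (use ij in \<open>simp_all add: F_add F_scale\<close>)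
 have up: "(F i j ^^ (M + N)) u = 0" if "(F i j ^^ N) u = 0" for M N u
  using that lin(3) by (simp add: funpow_add)
 have sub: "subspace ?M"
  unfolding subspace_def
 proof (intro conjI ballI allI)
  show "0 \<in> ?M" using lin(3) by blast
 next
  fix u w assume "u \<in> ?M" "w \<in> ?M"
  then obtain a b where "(F i j ^^ a) u = 0" "(F i j ^^ b) w = 0" by blast
  hence "(F i j ^^ (b + a)) u = 0" "(F i j ^^ (a + b)) w = 0" using up by blast+
  hence "(F i j ^^ (a + b)) (u + w) = 0" unfolding lin by (simp add: add.commute)
  thus "u + w \<in> ?M" by blast
 next
  fix c u assume "u \<in> ?M"
  thus "sc c u \<in> ?M" using lin(2) by auto
 qed
 have unshift: "u \<in> ?M" if fu: "F i j u \<in> ?M" for u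
 proof -
  obtain N where "(F i j ^^ N) (F i j u) = 0" using fu by blast
  hence "(F i j ^^ Suc N) u = 0" unfolding funpow_Suc_right o_apply .
  thus ?thesis by blast
 qed
 have b: "\<bar>i\<bar> <= int n" "\<bar>j\<bar> <= int n" using ij idx_le by blast+
 define s :: rat where "s = (if prec i j then 1 else - 1)"
 \<comment> \<open>The height of the root of \<open>F k l\<close>, with the sign chosen such that
   \<open>F i j\<close> has height at least 1.\<close>
 define h where "h = (%k l. s * (ht n (ev k) - ht n (ev l)))"
 have hij: "h i j \<ge> 1"
  using prec_total[of i j] ij(3) ht_prec[OF b] ht_prec[OF b(2,1)] unfolding h_def s_def by auto
 have hb: "- (2 * of_nat n) <= h k l \<and> h k l <= 2 * of_nat n" if "k \<in> I" "l \<in> I" for k l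
 proof -
  have "- of_nat n <= ht n (ev k) \<and> ht n (ev k) <= of_nat n" if "k \<in> I" for k
  proof -
   have k: "\<bar>k\<bar> <= int n" using idx_le[OF that] .
   have "- int n <= (if k = 0 then 0 else sgn k * (int n + 1 - \<bar>k\<bar>)) \<and> (if k = 0 then 0 else sgn k * (int n + 1 - \<bar>k\<bar>)) <= int n"
    using k by (auto simp: sgn_if)
   moreover have "ht n (ev k) = of_int (if k = 0 then 0 else sgn k * (int n + 1 - \<bar>k\<bar>))" unfolding ht_ev[OF k] by simp
   moreover have "(of_int (- int n) :: rat) = - of_nat n" "(of_int (int n) :: rat) = of_nat n" by simp_all
   ultimately show ?thesis by (metis of_int_le_iff)
  qed
  from this[OF that(1)] this[OF that(2)] show ?thesis unfolding h_def s_def by auto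
 qed
 have hm: "ht n (ev (- k)) = - ht n (ev k)" for k using ht_linear(3)[of n 0 "ev k"] ht_linear(1)[of n] by simp
 \<comment> \<open>The outer induction on t handles the bracket terms, whose height is larger by at
   least 1; the inner one on N handles \<open>F k l (F i j u)\<close>, where one power less is
   needed.\<close>
 have main: "F k l u \<in> ?M" if "k \<in> I" "l \<in> I" "2 * of_nat n - of_nat t < h k l" "(F i j ^^ N) u = 0" for t k l N u
  using that
 proof (induction t arbitrary: k l u N)
  case 0
  thus ?case using hb[of k l] by simp
 next
  case (Suc t)
  note outer = Suc.IH and k = Suc.prems(1) and l = Suc.prems(2) and hh = Suc.prems(3)
  show ?case using Suc.prems(4)
  proof (induction N arbitrary: u)
   case 0
   thus ?case using subspace_0[OF sub] k l by simp
  next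
   case (Suc N)
   have fu: "(F i j ^^ N) (F i j u) = 0" using Suc.prems unfolding funpow_Suc_right o_apply .
   have c: "(if P then F a b u else 0) \<in> ?M" if "P ==> a \<in> I \<and> b \<in> I \<and> h a b = h k l + h i j" for P a b
   proof (cases P)
    case True
    note ab = that[OF True]
    have "2 * of_nat n - of_nat t < h a b" using ab hh hij by (simp add: of_nat_Suc)
    thus ?thesis using outer[OF _ _ _ Suc.prems, of a b] ab True by simp
   qed (use subspace_0[OF sub] in simp)
   have "F k l (F i j u) + (if j = k then F i l u else 0) - (if i = l then F k j u else 0)
     - (if i = - k then F (- j) l u else 0) + (if j = - l then F k (- i) u else 0) \<in> ?M"
    by (intro subspace_add[OF sub] subspace_diff[OF sub] c Suc.IH[OF fu])
     (use ij k l in \<open>auto simp: h_def hm algebra_simps simp del: ev_uminus\<close>)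
   hence "F i j (F k l u) \<in> ?M" unfolding F_F[OF ij(1,2) k l] .
   thus ?case by (rule unshift)
  qed
 qed
 have "F k l u \<in> ?M" if kl: "k \<in> I" "l \<in> I" and u: "u \<in> ?M" for k l u
 proof -
  obtain N where "(F i j ^^ N) u = 0" using u by blast
  moreover have "2 * of_nat n - of_nat (4 * n + 1) < h k l" using hb[OF kl] by simp
  ultimately show ?thesis using main[OF kl] by blast
 qed
 thus ?thesis using sub unfolding stab_def by auto
qed

lemma hw_dominant:
 assumes v: "hwX \<mu> {0} v" "v \<noteq> 0" and nil: "\<exists>N. (F j i ^^ N) v = 0"
  and ij: "i \<in> I" "j \<in> I" "prec i j" "i \<noteq> - j"
 shows "ext \<mu> j <= ext \<mu> i"
proof -
 have ne: "i \<noteq> j" using ij(3) prec_asym by blast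
 have wt: "wtv \<mu> v" and 0: "F i j v \<in> {0}" using v ij by (auto simp: hwX_def raises_into_def)
 have st: "stab {(i, j), (j, i)} {0}" using ij by (auto simp: stab_def)
 obtain N :: nat where "2 * (ext \<mu> i - ext \<mu> j) = dbl i j * of_nat N"
  using sl2_dominant[OF ij(1,2) ne ij(4) wt st 0] nil v(2) by auto
 moreover have "0 <= dbl i j * of_nat N" by (simp add: dbl_def)
 ultimately have "0 <= 2 * (ext \<mu> i - ext \<mu> j)" by (simp only:)
 thus ?thesis by simp
qed

text \<open>The submodule of \<open>w\<close> contains a highest weight vector. Local nilpotency
  makes its weight dominant, the Casimir value identifies the weight with \<mu>, and the weight
  space of \<mu> is the line of \<open>v\<close>.\<close>

lemma hw_cyclic_irreducible:
 assumes v: "hwX \<mu> {0} v" "v \<noteq> 0" and w: "w \<in> clos (I \<times> I) {v}" "w \<noteq> 0"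
  and nil: "\<And>i j. i \<in> I ==> j \<in> I ==> i \<noteq> j ==> i \<noteq> - j ==> \<exists>N. (F i j ^^ N) v = 0"
 shows "v \<in> clos (I \<times> I) {w}"
proof -
 let ?N = "clos (I \<times> I) {w}" and ?V = "clos (I \<times> I) {v}"
 have W: "stab G {0}" if "G \<subseteq> I \<times> I" for G using that by (auto simp: stab_def)
 have T: "stab torus M" if "stab (I \<times> I) M" for M by (rule stab_mono[OF that]) (use nat_idx in auto)
 note sub = stab_subspace[OF W[OF order_refl]]
 have wt: "wtv \<mu> v" and rv: "raises_into I {0} v" and s: "supp n \<mu>" using v by (auto simp: hwX_def)
 have NV: "?N \<subseteq> ?V" by (rule clos_least[OF _ stab_clos]) (use w in simp)
 have V0: "?V \<subseteq> clos (I \<times> I) (insert v {0})" by (rule clos_mono) auto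
 have I: "I \<subseteq> {i. \<bar>i\<bar> <= int n}" using idx_le by blast
 let ?L = "{\<mu> - \<gamma> |\<gamma>. \<gamma> \<in> pos_cone I}"
 have "\<exists>\<nu>\<in>?L. \<exists>x\<in>?N. x \<noteq> 0 \<and> wtv \<nu> x"
 proof (rule wspan_nonzero_component[OF T[OF stab_clos] _ clos.base w(2)])
  show "w \<in> wspan {0} ?L"
   using highest_weight_span[OF order_refl _ W[OF order_refl] wt rv] V0 w(1) by auto
  show "supp n \<nu>" if L: "\<nu> \<in> ?L" for \<nu>
  proof -
   obtain \<gamma> where g: "\<nu> = \<mu> - \<gamma>" "\<gamma> \<in> pos_cone I" using L by blast
   show ?thesis unfolding g(1) by (rule supp_diff[OF s supp_pos_cone[OF g(2) order_refl]])
  qed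
 qed simp
 then obtain \<gamma>0 x0 where x0: "\<gamma>0 \<in> pos_cone I" "x0 \<in> ?N" "x0 \<noteq> 0" "wtv (\<mu> - \<gamma>0) x0" by blast
 \<comment> \<open>Iterated below. The height is nonnegative and decreases, so the process ends at a
   highest weight vector.\<close>
 have raise: "hwX (\<mu> - \<gamma>) {0} x \<or> (\<exists>\<gamma>' x'. \<gamma>' \<in> pos_cone I \<and> x' \<in> ?N \<and> x' \<noteq> 0 \<and> wtv (\<mu> - \<gamma>') x' \<and> ht n \<gamma>' + 1 <= ht n \<gamma>)"
  if x: "\<gamma> \<in> pos_cone I" "x \<in> ?N" "x \<noteq> 0" "wtv (\<mu> - \<gamma>) x" for \<gamma> x
 proof (cases "raises_into I {0} x")
  case True
  thus ?thesis
   using x(4) W[OF order_refl] supp_diff[OF s supp_pos_cone[OF x(1) order_refl]] unfolding hwX_def by blast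
 next
  case False
  then obtain i j where ij: "i \<in> I" "j \<in> I" "prec i j" "F i j x \<noteq> 0" unfolding raises_into_def by blast
  define \<gamma>' where "\<gamma>' = \<gamma> - (ev i - ev j)"
  have e: "\<mu> - \<gamma> + (ev i - ev j) = \<mu> - \<gamma>'" by (simp add: \<gamma>'_def)
  have m: "F i j x \<in> ?N" using x(2) ij by (intro clos.op) auto
  have wx: "wtv (\<mu> - \<gamma>') (F i j x)" using F_wtv[OF x(4) ij(1,2)] unfolding e .
  have bd: "\<bar>i\<bar> <= int n" "\<bar>j\<bar> <= int n" using ij idx_le by blast+
  have sg: "supp n (\<mu> - \<gamma>')"
   unfolding e[symmetric] by (rule supp_add[OF supp_diff[OF s supp_pos_cone[OF x(1) order_refl]] supp_diff[OF supp_ev supp_ev]]) (use bd in auto)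
  have "\<gamma>' \<in> pos_cone I"
  proof (rule ccontr)
   assume "\<gamma>' \<notin> pos_cone I"
   moreover have "\<mu> - (\<mu> - \<gamma>') = \<gamma>'" by simp
   ultimately have "\<mu> - (\<mu> - \<gamma>') \<notin> pos_cone I" by simp
   from highest_weight_separate[OF order_refl _ W[OF order_refl] T[OF W[OF order_refl]] wt rv s _ wx sg this]
   have "F i j x \<in> {0}" using m NV V0 by auto
   thus False using ij(4) by simp
  qed
  moreover have "ht n \<gamma>' + 1 <= ht n \<gamma>"
   using ht_prec[OF bd ij(3)] by (simp add: \<gamma>'_def ht_linear del: minus_apply)
  ultimately show ?thesis using m wx ij(4) by blast
 qed
 obtain N :: nat where "ht n \<gamma>0 <= of_nat N" using real_arch_simple[of "of_rat (ht n \<gamma>0)"]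
  by (metis of_rat_less_eq of_rat_of_nat_eq)
 hence "\<exists>\<gamma> x. \<gamma> \<in> pos_cone I \<and> x \<in> ?N \<and> x \<noteq> 0 \<and> hwX (\<mu> - \<gamma>) {0} x"
  using x0
 proof (induction N arbitrary: \<gamma>0 x0)
  case (0 \<gamma> x)
  from raise[OF 0(2-5)] show ?case
  proof (elim disjE exE conjE)
   fix \<gamma>' x' assume "\<gamma>' \<in> pos_cone I" "ht n \<gamma>' + 1 <= ht n \<gamma>"
   hence False using 0(1) ht_pos_cone[OF _ I, of \<gamma>'] by simp
   thus ?thesis ..
  qed (use 0 in blast)
 next
  case (Suc N \<gamma> x)
  from raise[OF Suc.prems(2-5)] show ?case
  proof (elim disjE exE conjE)
   fix \<gamma>' x' assume x': "\<gamma>' \<in> pos_cone I" "x' \<in> ?N" "x' \<noteq> 0" "wtv (\<mu> - \<gamma>') x'" "ht n \<gamma>' + 1 <= ht n \<gamma>"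
   hence "ht n \<gamma>' <= of_nat N" using Suc.prems(1) by (simp add: of_nat_Suc)
   thus ?thesis by (rule Suc.IH[OF _ x'(1-4)])
  qed (use Suc.prems in blast)
 qed
 then obtain \<gamma> x where x: "\<gamma> \<in> pos_cone I" "x \<in> ?N" "x \<noteq> 0" "hwX (\<mu> - \<gamma>) {0} x" by blast
 \<comment> \<open>The Casimir operator acts on the cyclic module by the scalar of \<open>v\<close>,
   and on \<open>x\<close> also by the scalar of its own weight.\<close>
 have "sc (of_rat (quad X n \<mu>)) x = sc (of_rat (quad X n (\<mu> - \<gamma>))) x"
  using casimir_hw[OF x(4)] casimir_clos[OF casimir_hw[OF v(1)]] x(2) NV by auto
 hence q: "quad X n \<mu> = quad X n (\<mu> - \<gamma>)" using x(3) by simp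
 have "\<gamma> = 0"
 proof (rule quad_strict[OF x(1) q])
  fix i j assume ij: "i \<in> I" "j \<in> I" "prec i j" "i \<noteq> - j"
  hence ji: "j \<in> I" "i \<in> I" "j \<noteq> i" "j \<noteq> - i" using prec_asym by auto
  show "ext \<mu> j <= ext \<mu> i" by (rule hw_dominant[OF v nil[OF ji] ij])
  have "?V \<subseteq> {u. \<exists>N. (F j i ^^ N) u = 0}" by (rule clos_least[OF _ nil_stab[OF ji(1-3)]]) (use nil[OF ji] in blast)
  hence "\<exists>N. (F j i ^^ N) x = 0" using x(2) NV by blast
  from hw_dominant[OF x(4,3) this ij] show "ext (\<mu> - \<gamma>) j <= ext (\<mu> - \<gamma>) i" .
 qed
 hence "wtv \<mu> x" using x(4) unfolding hwX_def by (metis diff_zero)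
 then obtain c where c: "x = sc c v" using highest_weight_line[OF v(1)] x(2) NV by blast
 hence "v = sc (1 / c) x" using x(3) by auto
 thus ?thesis using clos.scale[OF x(2)] by metis
qed

end

section \<open>Integrability\<close>

text \<open>The simple roots \<epsilon>_i - \<epsilon>_(i+1), together with \<epsilon>_n in type B
  and \<epsilon>_(n-1) + \<epsilon>_n in type D.\<close>

definition simple_pair :: "lie_type => nat => int => int => bool" where
 "simple_pair X n i j \<longleftrightarrow> i > 0 \<and> (i < int n \<and> j = i + 1 \<or> X = TypeB \<and> i = int n \<and> j = 0 \<or> X = TypeD \<and> i = int n - 1 \<and> j = - int n)"

lemma simple_pairD:
 assumes "simple_pair X n i j"
 shows "i \<in> idx X n" "j \<in> idx X n" "i \<noteq> j" "i \<noteq> - j" "prec i j" "i > 0"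
 using assms by (cases X; auto simp: simple_pair_def idx_def prec_def)+

text \<open>The two indices of a simple root are neighbours in the order, except that in type D the
  index n = - j lies between n - 1 and - n.\<close>

lemma simple_pair_below:
 assumes "simple_pair X n i j" "prec k j" "k \<in> idx X n" "k \<noteq> - j" "k \<noteq> i"
 shows "k = - i \<or> prec k i"
proof -
 have "k \<noteq> 0 \<or> X = TypeB" using assms(3) by (cases X) (auto simp: idx_def)
 thus ?thesis using assms idx_le[OF assms(3)] by (auto simp: simple_pair_def prec_def split: if_splits)
qed

lemma simple_pair_above:
 assumes "simple_pair X n i j" "prec i l" "l \<in> idx X n" "l \<noteq> - i" "l \<noteq> j"
 shows "l = - j \<or> prec j l"
proof -
 have "l \<noteq> 0 \<or> X = TypeB" using assms(3) by (cases X) (auto simp: idx_def)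
 thus ?thesis using assms idx_le[OF assms(3)] by (auto simp: simple_pair_def prec_def split: if_splits)
qed

context so_rep
begin

text \<open>The bracket of a simple lowering operator with a raising operator of another root is
  again a raising operator or zero.\<close>

lemma simple_lower_kill:
 assumes s: "simple_pair X n i j"
  and R: "\<And>k l. k \<in> I ==> l \<in> I ==> prec k l ==> k \<noteq> - l ==> (k, l) \<noteq> (i, j) ==> (k, l) \<noteq> (- j, - i) ==> F k l w = 0"
  and kl: "k \<in> I" "l \<in> I" "prec k l" "k \<noteq> - l" "(k, l) \<noteq> (i, j)" "(k, l) \<noteq> (- j, - i)"
 shows "F k l (F j i w) = 0"
proof -
 note sp = simple_pairD[OF s]
 have below: "F k i w = 0" if k: "k \<in> I" "prec k j" "k \<noteq> - j" "k \<noteq> i" for k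
  using simple_pair_below[OF s k(2,1,3,4)]
 proof
  assume "prec k i"
  thus ?thesis using R[OF k(1) sp(1)] F_anti_diag[OF k(1), of w] k sp by (cases "k = - i") auto
 qed (use F_anti_diag[OF k(1), of w] in simp)
 have above: "F j l w = 0" if l: "l \<in> I" "prec i l" "l \<noteq> - i" "l \<noteq> j" for l
  using simple_pair_above[OF s l(2,1,3,4)]
 proof
  assume "prec j l"
  thus ?thesis using R[OF sp(2) l(1)] F_anti_diag[OF sp(2), of w] l sp by (cases "l = - j") auto
 qed (use F_anti_diag[OF sp(2), of w] in simp)
 have z: "F k l w = 0" using R[OF kl] .
 have c1: "l = j ==> F k i w = 0" using below[of k] kl by auto
 have c2: "k = i ==> F j l w = 0" using above[of l] kl by auto
 have c3: "k = - j ==> F (- l) i w = 0" using below[of "- l"] kl prec_uminus[of l "- j"] by auto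
 have c4: "l = - i ==> F j (- k) w = 0" using above[of "- k"] kl prec_uminus[of "- i" k] by auto
 have "F k l (F j i w) = (if l = j then F k i w else 0) - (if k = i then F j l w else 0)
    - (if k = - j then F (- l) i w else 0) + (if l = - i then F j (- k) w else 0)"
  using F_F[OF kl(1,2) sp(2,1), of w] z sp(1,2) by simp
 moreover have "(if l = j then F k i w else 0) = 0" using c1 by (cases "l = j") simp_all
 moreover have "(if k = i then F j l w else 0) = 0" using c2 by (cases "k = i") simp_all
 moreover have "(if k = - j then F (- l) i w else 0) = 0" using c3 by (cases "k = - j") simp_all
 moreover have "(if l = - i then F j (- k) w else 0) = 0" using c4 by (cases "l = - i") simp_all
 ultimately show ?thesis by (simp only: diff_zero add_0_right)
qed

text \<open>Climb to the top of the root string through the weight and descend on the other side: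
  the string is symmetric under the reflection.\<close>

lemma reflect_weight:
 assumes ij: "i \<in> I" "j \<in> I" "i \<noteq> j" "i \<noteq> - j"
  and V: "stab (I \<times> I) V" "\<And>u. u \<in> V ==> \<exists>N. (F i j ^^ N) u = 0"
  and u: "u \<in> V" "u \<noteq> 0" "wtv \<kappa> u" and pos: "ext \<kappa> j <= ext \<kappa> i"
  and nil: "\<And>u. u \<in> V ==> \<exists>N. (F j i ^^ N) u = 0"
 shows "\<exists>u\<in>V. u \<noteq> 0 \<and> wtv (%k. \<kappa> k - 2 * (ext \<kappa> i - ext \<kappa> j) / dbl i j * (ev i k - ev j k)) u"
proof -
 define M where "M = (LEAST N. (F i j ^^ N) u = 0)"
 have M: "(F i j ^^ M) u = 0" using V(2)[OF u(1)] unfolding M_def by (rule LeastI_ex)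
 then obtain r where r: "M = Suc r" using u(2) by (cases M) auto
 have r0: "(F i j ^^ r) u \<noteq> 0" using not_less_Least[of r "%N. (F i j ^^ N) u = 0"] r unfolding M_def by auto
 define w where "w = (F i j ^^ r) u"
 define \<nu> where "\<nu> = \<kappa> + (%k. of_nat r * (ev i k - ev j k))"
 have wV: "w \<in> V" unfolding w_def by (rule stab_funpow[OF V(1) _ u(1)]) (use ij in simp)
 have wt: "wtv \<nu> w" unfolding w_def \<nu>_def by (rule funpow_wtv[OF u(3) ij(1,2)])
 have st: "stab {(i, j), (j, i)} {0}" using ij by (auto simp: stab_def)
 have w0: "F i j w \<in> {0}" "w \<notin> {0}" using M r0 unfolding r w_def by simp_all
 have e: "ext (%k. of_nat r * (ev i k - ev j k)) x = of_nat r * (ext (ev i) x - ext (ev j) x)" for x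
  by (auto simp: ext_def algebra_simps)
 have d: "dbl i j \<noteq> 0" by (simp add: dbl_def)
 have x: "ext \<nu> i - ext \<nu> j = ext \<kappa> i - ext \<kappa> j + of_nat r * dbl i j"
  using ij by (auto simp: \<nu>_def ext_add e ext_ev dbl_def)
 obtain N :: nat where N: "2 * (ext \<nu> i - ext \<nu> j) = dbl i j * of_nat N"
  using sl2_dominant[OF ij wt st w0(1) _ w0(2)] nil[OF wV] by auto
 define c where "c = 2 * (ext \<kappa> i - ext \<kappa> j) / dbl i j"
 have cN: "c + 2 * of_nat r = of_nat N" using N d unfolding c_def x by (simp add: field_simps)
 have c0: "c \<ge> 0" using pos unfolding c_def dbl_def by simp
 have "(of_nat (2 * r) :: rat) <= of_nat N" using cN c0 by simp
 hence rN: "2 * r <= N" unfolding of_nat_le_iff .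
 \<comment> \<open>From the top the string goes down at least N steps. The weight \<kappa> is
   reached after r of them, its mirror image after N - r.\<close>
 define k where "k = N - r"
 have ck: "of_nat k = c + of_nat r" using cN rN unfolding k_def by (simp add: of_nat_diff)
 have "(F j i ^^ k) w \<notin> {0}"
 proof (rule sl2_alive[OF ij wt st w0])
  fix m assume "m < k"
  thus "2 * (ext \<nu> i - ext \<nu> j) \<noteq> dbl i j * of_nat m" unfolding N using d rN by (simp add: k_def)
 qed
 moreover have "(F j i ^^ k) w \<in> V" by (rule stab_funpow[OF V(1) _ wV]) (use ij in simp)
 moreover have "\<nu> + (%l. of_nat k * (ev j l - ev i l)) = (%l. \<kappa> l - c * (ev i l - ev j l))"
  unfolding \<nu>_def ck by (simp add: fun_eq_iff algebra_simps)
 hence "wtv (%l. \<kappa> l - c * (ev i l - ev j l)) ((F j i ^^ k) w)"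
  using funpow_wtv[OF wt ij(2,1), of k] by simp
 ultimately show ?thesis unfolding c_def by blast
qed

end

locale irr_hw = so_rep sc X n F
 for sc :: "complex => 'v::ab_group_add => 'v" and X n F +
 fixes \<mu> :: weight and v :: 'v
 assumes hw: "hwX \<mu> {0} v" and v0: "v \<noteq> 0" and n2: "n \<ge> 2"
  and irr: "\<And>w. w \<in> clos (I \<times> I) {v} ==> w \<noteq> 0 ==> v \<in> clos (I \<times> I) {w}"
  and integral: "\<And>i j. simple_pair X n i j ==> \<exists>m::nat. 2 * (ext \<mu> i - ext \<mu> j) = dbl i j * of_nat m"
begin

abbreviation "V \<equiv> clos (I \<times> I) {v}"

lemma wt: "wtv \<mu> v" and raises: "i \<in> I ==> j \<in> I ==> prec i j ==> F i j v = 0" and s: "supp n \<mu>"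
 using hw by (auto simp: hwX_def raises_into_def)

lemma weights_V:
 assumes "u \<in> V" "u \<noteq> 0" "wtv \<kappa> u" "supp n \<kappa>"
 shows "\<mu> - \<kappa> \<in> pos_cone I"
proof (rule ccontr)
 assume "\<mu> - \<kappa> \<notin> pos_cone I"
 moreover have "raises_into I {0} v" using hw by (simp add: hwX_def)
 moreover have "V \<subseteq> clos (I \<times> I) (insert v {0})" by (rule clos_mono) auto
 moreover have "stab (I \<times> I) {0}" "stab torus {0}" using nat_idx by (auto simp: stab_def)
 ultimately have "u \<in> {0}" using highest_weight_separate[OF order_refl _ _ _ wt _ s _ assms(3,4), of "{0}"] assms(1) by auto
 thus False using assms(2) by simp
qed

text \<open>The power with exponent m + 1 gives a highest weight vector of smaller height. If it
  were nonzero, it would generate \<open>v\<close> by irreducibility, although \<open>v\<close> has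
  larger height.\<close>

lemma simple_nil_v:
 assumes sp: "simple_pair X n i j"
 shows "\<exists>N. (F j i ^^ N) v = 0"
proof -
 note ij = simple_pairD[OF sp]
 obtain m :: nat where m: "2 * (ext \<mu> i - ext \<mu> j) = dbl i j * of_nat m" using integral[OF sp] ..
 define x where "x = (F j i ^^ Suc m) v"
 define \<nu> where "\<nu> = \<mu> + (%k. of_nat (Suc m) * (ev j k - ev i k))"
 have wx: "wtv \<nu> x" unfolding x_def \<nu>_def by (rule funpow_wtv[OF wt ij(2,1)])
 have R: "F k l ((F j i ^^ t) v) = 0"
  if "k \<in> I" "l \<in> I" "prec k l" "k \<noteq> - l" "(k, l) \<noteq> (i, j)" "(k, l) \<noteq> (- j, - i)" for k l t
  using that
 proof (induction t arbitrary: k l)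
  case 0
  thus ?case by (simp add: raises)
 next
  case (Suc t)
  show ?case unfolding funpow.simps o_apply by (rule simple_lower_kill[OF sp Suc.IH Suc.prems])
 qed
 have "F i j x \<in> {0}"
 proof -
  have st: "stab {(i, j), (j, i)} {0}" using ij by (auto simp: stab_def)
  have "F i j v \<in> {0}" using raises ij by simp
  moreover have "ext \<mu> i - ext \<mu> j - dbl i j * of_nat m / 2 = 0" using m by simp
  ultimately show ?thesis using sl2_string[OF ij(1-4) wt st, of m] unfolding x_def by simp
 qed
 hence e: "F i j x = 0" by simp
 have "F (- j) (- i) x = 0" using F_swap[OF ij(1,2), of x] e by simp
 hence "raises_into I {0} x"
  unfolding raises_into_def using R[of _ _ "Suc m", folded x_def] e F_anti_diag[of _ x]
  by (metis minus_minus singleton_iff prod.inject)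
 moreover have sn: "supp n \<nu>"
  using s ij(1,2) idx_le[of i] idx_le[of j] supp_ev[of i n] supp_ev[of j n] by (auto simp: supp_def \<nu>_def)
 moreover have "stab (I \<times> I) {0}" by (auto simp: stab_def)
 ultimately have hx: "hwX \<nu> {0} x" using wx unfolding hwX_def by blast
 have "x = 0"
 proof (rule ccontr)
  assume x0: "x \<noteq> 0"
  have "x \<in> V" unfolding x_def by (rule stab_funpow[OF stab_clos _ clos.base]) (use ij in auto)
  hence "v \<in> clos (I \<times> I) {x}" using irr x0 by blast
  hence vx: "v \<in> clos (I \<times> I) (insert x {0})" using clos_mono[of "{x}" "insert x {0}"] by blast
  have "\<nu> - \<mu> \<in> pos_cone I"
  proof (rule ccontr)
   assume "\<nu> - \<mu> \<notin> pos_cone I"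
   moreover have "raises_into I {0} x" using hx by (simp add: hwX_def)
   moreover have "stab (I \<times> I) {0}" "stab torus {0}" using nat_idx by (auto simp: stab_def)
   ultimately have "v \<in> {0}" using highest_weight_separate[OF order_refl _ _ _ wx _ sn vx wt s] by auto
   thus False using v0 by simp
  qed
  hence "0 <= ht n (\<nu> - \<mu>)" by (rule ht_pos_cone) (use idx_le in blast)
  also have "\<nu> - \<mu> = (%k. of_nat (Suc m) * (ev j k - ev i k))" by (simp add: \<nu>_def)
  also have "ht n \<dots> = of_nat (Suc m) * (ht n (ev j) - ht n (ev i))"
   unfolding ht_linear(3)[symmetric] by (simp add: ht_def sum_distrib_left algebra_simps)
  also have "\<dots> < 0" using ht_prec[OF _ _ ij(5), of n] idx_le[OF ij(1)] idx_le[OF ij(2)] by (intro mult_pos_neg) simp_all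
  finally show False by simp
 qed
 thus ?thesis unfolding x_def by blast
qed

lemma nil_V:
 assumes ij: "i \<in> I" "j \<in> I" "i \<noteq> j" and "\<exists>N. (F i j ^^ N) v = 0" and "u \<in> V"
 shows "\<exists>N. (F i j ^^ N) u = 0"
 using clos_min[OF assms(5) _ nil_stab[OF ij]] assms(4) by auto

lemma raising_nil_V:
 assumes ij: "i \<in> I" "j \<in> I" "prec i j" and "u \<in> V"
 shows "\<exists>N. (F i j ^^ N) u = 0"
proof (rule nil_V[OF ij(1,2) _ _ assms(4)])
 show "i \<noteq> j" using ij(3) prec_asym by blast
 have "(F i j ^^ 1) v = 0" using raises[OF ij] by simp
 thus "\<exists>N. (F i j ^^ N) v = 0" by blast
qed

lemma simple_reflect:
 assumes sp: "simple_pair X n i j" and u: "u \<in> V" "u \<noteq> 0" "wtv \<kappa> u"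
 shows "\<exists>u\<in>V. u \<noteq> 0 \<and> wtv (%k. \<kappa> k - 2 * (ext \<kappa> i - ext \<kappa> j) / dbl i j * (ev i k - ev j k)) u"
proof -
 note ij = simple_pairD[OF sp]
 have e: "\<exists>N. (F i j ^^ N) u = 0" if "u \<in> V" for u by (rule raising_nil_V[OF ij(1,2,5) that])
 have f: "\<exists>N. (F j i ^^ N) u = 0" if "u \<in> V" for u
  by (rule nil_V[OF ij(2,1) ij(3)[symmetric] simple_nil_v[OF sp] that])
 show ?thesis
 proof (cases "ext \<kappa> j <= ext \<kappa> i")
  case True
  show ?thesis by (rule reflect_weight[OF ij(1-4) stab_clos e u True f])
 next
  case False
  have eq: "(%k. \<kappa> k - 2 * (ext \<kappa> j - ext \<kappa> i) / dbl j i * (ev j k - ev i k))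
   = (%k. \<kappa> k - 2 * (ext \<kappa> i - ext \<kappa> j) / dbl i j * (ev i k - ev j k))"
   by (auto simp: dbl_def fun_eq_iff field_simps)
  show ?thesis
   unfolding eq[symmetric]
   by (rule reflect_weight[OF ij(2,1) ij(3)[symmetric] _ stab_clos f u _ e]) (use False ij(4) in auto)
 qed
qed

section \<open>Weights under simple reflections and their bounds\<close>

definition is_weight :: "weight => bool" where
 "is_weight \<kappa> \<longleftrightarrow> supp n \<kappa> \<and> (\<exists>u\<in>V. u \<noteq> 0 \<and> wtv \<kappa> u)"

lemma is_weight_reflect:
 assumes "simple_pair X n i j" "is_weight \<kappa>"
 shows "is_weight (%k. \<kappa> k - 2 * (ext \<kappa> i - ext \<kappa> j) / dbl i j * (ev i k - ev j k))"
proof -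
 note ij = simple_pairD[OF assms(1)]
 have "supp n (ev i)" "supp n (ev j)" by (rule supp_ev[OF idx_le[OF ij(1)]], rule supp_ev[OF idx_le[OF ij(2)]])
 hence "supp n (%k. \<kappa> k - 2 * (ext \<kappa> i - ext \<kappa> j) / dbl i j * (ev i k - ev j k))"
  using assms(2) by (auto simp: is_weight_def supp_def)
 thus ?thesis using simple_reflect[OF assms(1)] assms(2) unfolding is_weight_def by blast
qed

lemma is_weight_swap:
 assumes "is_weight \<kappa>" "1 <= k" "k < n"
 shows "\<exists>\<kappa>'. is_weight \<kappa>' \<and> \<kappa>' k = \<kappa> (Suc k) \<and> \<kappa>' (Suc k) = \<kappa> k"
proof -
 have "simple_pair X n (int k) (int (Suc k))" using assms by (auto simp: simple_pair_def)
 note r = is_weight_reflect[OF this assms(1)]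
 show ?thesis by (rule exI, rule conjI[OF r]) (use assms(2) in \<open>auto simp: dbl_def ev_def ext_def field_simps\<close>)
qed

lemma is_weight_first: "is_weight \<kappa> ==> \<kappa> 1 <= \<mu> 1"
proof -
 assume "is_weight \<kappa>"
 hence g: "\<mu> - \<kappa> \<in> pos_cone I" using weights_V unfolding is_weight_def by blast
 have "0 <= (\<mu> - \<kappa>) 1"
  by (rule pos_cone_functional[where \<phi> = "%x. x 1", OF g]) (auto simp: ev_def prec_def split: if_splits)
 thus ?thesis by simp
qed

text \<open>Adjacent transpositions bring the coordinate k to position 1, where the cone of positive
  roots bounds it.\<close>

lemma is_weight_le:
 assumes "is_weight \<kappa>" "1 <= k" "k <= n"
 shows "\<kappa> k <= \<mu> 1"
 using assms(2,3,1)
proof (induction k arbitrary: \<kappa> rule: nat_induct_at_least)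
 case (Suc k)
 then obtain \<kappa>' where "is_weight \<kappa>'" "\<kappa>' k = \<kappa> (Suc k)" using is_weight_swap[of \<kappa> k] by auto
 thus ?case using Suc.IH[of \<kappa>'] Suc.prems by simp
qed (use is_weight_first in simp)

text \<open>Transpositions move the coordinate to position n. The last simple reflection negates it
  in type B and, in type D, exchanges it with its neighbour up to sign; then the upper bound
  applies.\<close>

lemma is_weight_ge:
 assumes "is_weight \<kappa>" "1 <= k" "k <= n"
 shows "- \<mu> 1 <= \<kappa> k"
 using assms(3,1,2)
proof (induction k arbitrary: \<kappa> rule: inc_induct)
 case base
 show ?case
 proof (cases X)
  case TypeB
  hence "simple_pair X n (int n) 0" using n2 by (auto simp: simple_pair_def)
  from is_weight_le[OF is_weight_reflect[OF this base(1)], of n] n2 show ?thesis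
   by (simp add: dbl_def ev_def)
 next
  case TypeD
  hence "simple_pair X n (int n - 1) (- int n)" using n2 by (auto simp: simple_pair_def)
  moreover have e: "ext \<kappa> (int n - 1) = \<kappa> (n - 1)" using n2 by (auto simp: ext_def nat_diff_distrib)
  moreover have "n - 1 \<noteq> n" "1 <= n - 1" using n2 by auto
  ultimately show ?thesis using is_weight_le[OF is_weight_reflect[OF _ base(1)], of "int n - 1" "- int n" "n - 1"] n2
   by (simp add: dbl_def ev_def of_nat_diff field_simps)
 qed
next
 case (step k)
 then obtain \<kappa>' where "is_weight \<kappa>'" "\<kappa>' (Suc k) = \<kappa> k" using is_weight_swap[of \<kappa> k] by auto
 thus ?case using step.IH[of \<kappa>'] step.prems by simp
qed

text \<open>Each application of \<open>F i j\<close> shifts some fixed coordinate by 1 in a fixed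
  direction, while all weights stay within distance \<open>2 * \<mu> 1\<close>.\<close>

lemma nilpotent_V:
 assumes ij: "i \<in> I" "j \<in> I" "i \<noteq> j" "i \<noteq> - j" and u: "u \<in> V"
 shows "\<exists>N. (F i j ^^ N) u = 0"
proof (rule nil_V[OF ij(1-3) _ u])
 obtain N :: nat where N: "2 * \<mu> 1 < of_nat N"
  using reals_Archimedean2[of "of_rat (2 * \<mu> 1)"] by (metis of_rat_less of_rat_of_nat_eq)
 define \<kappa> where "\<kappa> = \<mu> + (%k. of_nat N * (ev i k - ev j k))"
 have b: "\<bar>i\<bar> <= int n" "\<bar>j\<bar> <= int n" using ij idx_le by blast+
 have ab: "\<bar>i\<bar> \<noteq> \<bar>j\<bar>" using ij(3,4) by (auto simp: abs_if split: if_splits)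
 have "(F i j ^^ N) v = 0"
 proof (rule ccontr)
  assume n0: "(F i j ^^ N) v \<noteq> 0"
  have "(F i j ^^ N) v \<in> V" by (rule stab_funpow[OF stab_clos _ clos.base]) (use ij in auto)
  moreover have "wtv \<kappa> ((F i j ^^ N) v)" unfolding \<kappa>_def by (rule funpow_wtv[OF wt ij(1,2)])
  moreover have "supp n \<kappa>" using s supp_ev[OF b(1)] supp_ev[OF b(2)] by (auto simp: supp_def \<kappa>_def)
  ultimately have k: "is_weight \<kappa>" using n0 unfolding is_weight_def by blast
  have "is_weight \<mu>" using wt v0 s clos.base[of v "{v}"] unfolding is_weight_def by blast
  note bm = is_weight_le[OF this] is_weight_ge[OF this] and bk = is_weight_le[OF k] is_weight_ge[OF k]
  have "\<exists>t\<in>{1..n}. ev i t - ev j t = 1 \<or> ev i t - ev j t = - 1"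
  proof (cases "i = 0")
   case False
   thus ?thesis using b ab by (intro bexI[of _ "nat \<bar>i\<bar>"]) (auto simp: ev_def)
  next
   case True
   hence "j \<noteq> 0" using ij by simp
   thus ?thesis using True b ab by (intro bexI[of _ "nat \<bar>j\<bar>"]) (auto simp: ev_def)
  qed
  then obtain t where t: "t \<in> {1..n}" "ev i t - ev j t = 1 \<or> ev i t - ev j t = - 1" ..
  have "\<kappa> t = \<mu> t + of_nat N * (ev i t - ev j t)" by (simp add: \<kappa>_def)
  hence "\<kappa> t = \<mu> t + of_nat N \<or> \<kappa> t = \<mu> t - of_nat N" using t(2) by auto
  thus False using bm[of t] bk[of t] t(1) N by auto
 qed
 thus "\<exists>N. (F i j ^^ N) v = 0" ..
qed

end

section \<open>Tensor products\<close>

context vector_space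
begin

lemma leibniz_power:
 fixes y :: "'b => 'b" and x1 :: "'c => 'c" and x2 :: "'d => 'd"
 assumes y: "\<And>u w. y (u + w) = y u + y w" "\<And>c u. y (scale c u) = scale c (y u)"
  and t: "\<And>a b. y (tens a b) = tens (x1 a) b + tens a (x2 b)"
 shows "(y ^^ k) (tens a b) = (\<Sum>c\<le>k. scale (of_nat (k choose c)) (tens ((x1 ^^ c) a) ((x2 ^^ (k - c)) b)))"
proof (induction k)
 case (Suc k)
 define T where "T c d = tens ((x1 ^^ c) a) ((x2 ^^ d) b)" for c d
 have y0: "y 0 = 0" using y(2)[of 0 0] by simp
 have ys: "y (\<Sum>c\<in>S. f c) = (\<Sum>c\<in>S. y (f c))" for S and f :: "nat => 'b"
  by (induction S rule: infinite_finite_induct) (simp_all add: y y0)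
 have yT: "y (T c d) = T (Suc c) d + T c (Suc d)" for c d
  by (simp add: T_def t)
 have "(y ^^ Suc k) (tens a b) = (\<Sum>c\<le>k. scale (of_nat (k choose c)) (T (Suc c) (k - c) + T c (Suc k - c)))"
  unfolding funpow.simps o_apply Suc.IH T_def[symmetric] ys y yT by (intro sum.cong) (auto simp: Suc_diff_le)
 also have "\<dots> = (\<Sum>c\<le>k. scale (of_nat (k choose c)) (T (Suc c) (k - c))) + (\<Sum>c\<le>Suc k. scale (of_nat (k choose c)) (T c (Suc k - c)))"
  by (simp add: scale_right_distrib sum.distrib binomial_eq_0)
 also have "(\<Sum>c\<le>Suc k. scale (of_nat (k choose c)) (T c (Suc k - c)))
  = T 0 (Suc k) + (\<Sum>c\<le>k. scale (of_nat (k choose Suc c)) (T (Suc c) (k - c)))"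
  unfolding sum.atMost_Suc_shift by (simp add: of_nat_Suc)
 also have "(\<Sum>c\<le>k. scale (of_nat (k choose c)) (T (Suc c) (k - c))) + \<dots>
  = T 0 (Suc k) + (\<Sum>c\<le>k. scale (of_nat (Suc k choose Suc c)) (T (Suc c) (k - c)))"
  by (simp add: scale_left_distrib sum.distrib)
 also have "\<dots> = (\<Sum>c\<le>Suc k. scale (of_nat (Suc k choose c)) (T c (Suc k - c)))"
  unfolding sum.atMost_Suc_shift by (simp add: of_nat_Suc)
 finally show ?case unfolding T_def .
qed (simp add: of_nat_Suc)

end

text \<open>The ways to distribute the exponents over two tensor factors, normalised to 0 outside
  \<open>R\<close> so that the set is finite.\<close>

definition subexp :: "'r set => ('r => nat) => ('r => nat) set" where
 "subexp R q = {c. (\<forall>r\<in>R. c r <= q r) \<and> (\<forall>r. r \<notin> R --> c r = 0)}"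

lemma subexp_insert:
 assumes "r \<notin> R"
 shows "bij_betw (%(k, c). c(r := k)) ({..q r} \<times> subexp R q) (subexp (insert r R) q)"
 by (rule bij_betw_byWitness[where f' = "%c. (c r, c(r := 0))"])
  (use assms in \<open>auto simp: subexp_def fun_eq_iff\<close>)

lemma finite_subexp: "finite R ==> finite (subexp R q)"
proof (induction R rule: finite_induct)
 case empty
 have "subexp {} q = {%_. 0}" by (auto simp: subexp_def)
 thus ?case by simp
next
 case (insert r R)
 thus ?case using bij_betw_finite[OF subexp_insert[of r R q]] by simp
qed

definition pbw :: "('r => 'b => 'b) => 'r list => ('r => nat) => 'b => 'b" where
 "pbw x rs q v = foldr (%r. x r ^^ q r) rs v"

lemma pbw_simps [simp]: "pbw x [] q v = v" "pbw x (r # rs) q v = (x r ^^ q r) (pbw x rs q v)"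
 by (simp_all add: pbw_def)

lemma pbw_cong: "(\<And>r. r \<in> set rs ==> q r = q' r) ==> pbw x rs q v = pbw x rs q' v"
 by (induction rs) auto

text \<open>The binomial coefficients arise because the powers are not divided by
  factorials.\<close>

lemma (in vector_space) leibniz_pbw:
 fixes y :: "'r => 'b => 'b" and x1 :: "'r => 'c => 'c" and x2 :: "'r => 'd => 'd"
 assumes y: "\<And>r u w. r \<in> set rs ==> y r (u + w) = y r u + y r w"
   "\<And>r c u. r \<in> set rs ==> y r (scale c u) = scale c (y r u)"
  and t: "\<And>r a b. r \<in> set rs ==> y r (tens a b) = tens (x1 r a) b + tens a (x2 r b)"
  and d: "distinct rs"
 shows "pbw y rs q (tens a b) = (\<Sum>c\<in>subexp (set rs) q. scale (of_nat (\<Prod>r\<in>set rs. q r choose c r))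
  (tens (pbw x1 rs c a) (pbw x2 rs (%r. q r - c r) b)))"
 using assms
proof (induction rs)
 case Nil
 have "subexp {} q = {%_. 0}" by (auto simp: subexp_def)
 thus ?case by (simp add: of_nat_Suc)
next
 case (Cons r rs)
 let ?S = "subexp (set rs) q" and ?K = "%c. of_nat (\<Prod>r\<in>set rs. q r choose c r)"
 let ?f = "%c. scale (of_nat (\<Prod>r\<in>set (r # rs). q r choose c r)) (tens (pbw x1 (r # rs) c a) (pbw x2 (r # rs) (%r. q r - c r) b))"
 have r: "r \<notin> set rs" using Cons.prems(4) by simp
 have yk: "(y r ^^ k) (u + w) = (y r ^^ k) u + (y r ^^ k) w" "(y r ^^ k) (scale z u) = scale z ((y r ^^ k) u)" for k u w z
  by (induction k) (simp_all add: Cons.prems(1,2))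
 have y0: "(y r ^^ k) 0 = 0" for k using yk(2)[of k 0 0] by simp
 have ys: "(y r ^^ k) (\<Sum>c\<in>S. f c) = (\<Sum>c\<in>S. (y r ^^ k) (f c))" for k S and f :: "('r => nat) => 'b"
  by (induction S rule: infinite_finite_induct) (simp_all add: yk y0)
 have "pbw y (r # rs) q (tens a b) = (\<Sum>c\<in>?S. scale (?K c) ((y r ^^ q r) (tens (pbw x1 rs c a) (pbw x2 rs (%r. q r - c r) b))))"
  unfolding pbw_simps using Cons.IH Cons.prems by (simp add: ys yk)
 also have "\<dots> = (\<Sum>c\<in>?S. \<Sum>k\<le>q r. scale (?K c) (scale (of_nat (q r choose k))
   (tens ((x1 r ^^ k) (pbw x1 rs c a)) ((x2 r ^^ (q r - k)) (pbw x2 rs (%r. q r - c r) b)))))"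
  by (intro sum.cong refl, subst leibniz_power[where ?x1.0 = "x1 r" and ?x2.0 = "x2 r"]) (simp_all add: Cons.prems scale_sum_right)
 also have "\<dots> = (\<Sum>c\<in>?S. \<Sum>k\<le>q r. ?f (c(r := k)))"
 proof (intro sum.cong refl)
  fix c k
  have "pbw x1 rs (c(r := k)) a = pbw x1 rs c a"
   "pbw x2 rs (%s. q s - (c(r := k)) s) b = pbw x2 rs (%r. q r - c r) b"
   by (rule pbw_cong, use r in force)+
  moreover have "(\<Prod>s\<in>set rs. q s choose (c(r := k)) s) = (\<Prod>s\<in>set rs. q s choose c s)"
   by (rule prod.cong) (use r in auto)
  ultimately show "scale (?K c) (scale (of_nat (q r choose k)) (tens ((x1 r ^^ k) (pbw x1 rs c a)) ((x2 r ^^ (q r - k)) (pbw x2 rs (%r. q r - c r) b))))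
   = ?f (c(r := k))"
   using r by (simp add: mult.commute)
 qed
 also have "\<dots> = (\<Sum>(k, c)\<in>{..q r} \<times> ?S. ?f (c(r := k)))"
  unfolding sum.cartesian_product[symmetric] by (rule sum.swap)
 also have "\<dots> = (\<Sum>c\<in>subexp (insert r (set rs)) q. ?f c)"
  using sum.reindex_bij_betw[OF subexp_insert[OF r, of q], of ?f] by (simp add: case_prod_unfold)
 finally show ?case by simp
qed

text \<open>
 Evaluating the first factor by a functional which separates \<open>pbw q1 a\<close> from its predecessors
 leaves a single term outside the span of the predecessors of \<open>pbw q2 b\<close>.
\<close>

lemma tensor_not_in_span:
 fixes s1 :: "complex => 'c::ab_group_add => 'c" and s2 :: "complex => 'd::ab_group_add => 'd"
  and s3 :: "complex => 'b::ab_group_add => 'b" and y :: "'r => 'b => 'b"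
 assumes v: "vector_space s1" "vector_space s2" "vector_space s3"
  and y: "\<And>r u w. r \<in> set rs ==> y r (u + w) = y r u + y r w"
   "\<And>r c u. r \<in> set rs ==> y r (s3 c u) = s3 c (y r u)"
  and t: "\<And>r a b. r \<in> set rs ==> y r (tens a b) = tens (x1 r a) b + tens a (x2 r b)"
  and d: "distinct rs"
  and E: "\<And>\<phi>. Vector_Spaces.linear s1 (*) \<phi> ==> \<exists>E. Vector_Spaces.linear s3 s2 E \<and> (\<forall>a b. E (tens a b) = s2 (\<phi> a) b)"
  and q1: "pbw x1 rs q1 a \<notin> module.span s1 {pbw x1 rs q a |q. lt q q1}"
  and q2: "pbw x2 rs q2 b \<notin> module.span s2 {pbw x2 rs q b |q. lt q q2}"
  and lower: "\<And>q c. lt q (%r. q1 r + q2 r) ==> c \<in> subexp (set rs) q ==> lt c q1 \<or> lt (%r. q r - c r) q2"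
  and top: "\<And>c. c \<in> subexp (set rs) (%r. q1 r + q2 r) ==>
   lt c q1 \<or> lt (%r. q1 r + q2 r - c r) q2 \<or> (\<forall>r\<in>set rs. c r = q1 r)"
 shows "pbw y rs (%r. q1 r + q2 r) (tens a b) \<notin> module.span s3 {pbw y rs q (tens a b) |q. lt q (%r. q1 r + q2 r)}"
proof
 interpret v1: vector_space s1 by (rule v)
 interpret v2: vector_space s2 by (rule v)
 interpret v3: vector_space s3 by (rule v)
 interpret v13: vector_space_pair s1 "(*) :: complex => complex => complex"
  by (intro vector_space_pair.intro v1.vector_space_axioms vector_space.intro) (simp_all add: algebra_simps)
 let ?Q = "%r. q1 r + q2 r"
 let ?W1 = "v1.span {pbw x1 rs q a |q. lt q q1}" and ?W2 = "v2.span {pbw x2 rs q b |q. lt q q2}"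
 assume mem: "pbw y rs ?Q (tens a b) \<in> v3.span {pbw y rs q (tens a b) |q. lt q ?Q}"
 \<comment> \<open>A basis of the span of the predecessors is enlarged by the vector itself, and the
   functional is prescribed on this independent set.\<close>
 obtain \<phi> where lin: "Vector_Spaces.linear s1 (*) \<phi>" and p0: "\<And>u. u \<in> ?W1 ==> \<phi> u = 0" and p1: "\<phi> (pbw x1 rs q1 a) = 1"
 proof -
  obtain B where B: "B \<subseteq> ?W1" "v1.independent B" "?W1 \<subseteq> v1.span B"
   using v1.maximal_independent_subset[of ?W1] by blast
  have "v1.span B \<subseteq> ?W1" by (rule v1.span_minimal[OF B(1) v1.subspace_span])
  hence nB: "pbw x1 rs q1 a \<notin> v1.span B" using q1 by blast
  hence "v1.independent (insert (pbw x1 rs q1 a) B)" by (rule v1.independent_insertI[OF _ B(2)])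
  from v13.linear_independent_extend[OF this, of "%x. of_bool (x = pbw x1 rs q1 a)"]
  obtain g where g: "Vector_Spaces.linear s1 (*) g"
   "\<And>x. x \<in> insert (pbw x1 rs q1 a) B ==> g x = of_bool (x = pbw x1 rs q1 a)"
   by blast
  interpret g: Vector_Spaces.linear s1 "(*)" g by (rule g(1))
  have "g u = 0" if "u \<in> v1.span B" for u
  proof (rule g.eq_0_on_span[OF _ that])
   fix x assume "x \<in> B"
   thus "g x = 0" using g(2)[of x] nB v1.span_base[of x B] by auto
  qed
  thus thesis using that[OF g(1)] g(2) B(3) by auto
 qed
 obtain E where El: "Vector_Spaces.linear s3 s2 E" and Et: "\<And>a b. E (tens a b) = s2 (\<phi> a) b" using E[OF lin] by blast
 interpret E: Vector_Spaces.linear s3 s2 E by (rule El)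
 have eval: "E (pbw y rs q (tens a b)) = (\<Sum>c\<in>subexp (set rs) q. s2 (of_nat (\<Prod>r\<in>set rs. q r choose c r) * \<phi> (pbw x1 rs c a)) (pbw x2 rs (%r. q r - c r) b))" for q
 proof -
  have "pbw y rs q (tens a b) = (\<Sum>c\<in>subexp (set rs) q. s3 (of_nat (\<Prod>r\<in>set rs. q r choose c r))
    (tens (pbw x1 rs c a) (pbw x2 rs (%r. q r - c r) b)))"
   by (rule v3.leibniz_pbw) (use y t d in auto)
  thus ?thesis by (simp add: E.sum E.scale Et)
 qed
 have summand: "s2 (K * \<phi> (pbw x1 rs c a)) (pbw x2 rs q' b) \<in> ?W2" if "lt c q1 \<or> lt q' q2" for K c q'
  using that
 proof
  assume "lt c q1"
  hence "\<phi> (pbw x1 rs c a) = 0" by (intro p0 v1.span_base) blast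
  thus ?thesis by (simp add: v2.span_zero)
 next
  assume "lt q' q2"
  hence "pbw x2 rs q' b \<in> ?W2" by (intro v2.span_base) blast
  thus ?thesis by (rule v2.span_scale)
 qed
 have "E u \<in> ?W2" if "u \<in> v3.span {pbw y rs q (tens a b) |q. lt q ?Q}" for u
  using that
 proof (induction rule: v3.span_induct_alt)
  case base
  thus ?case by (simp add: E.zero v2.span_zero)
 next
  case (step z u w)
  then obtain q where q: "u = pbw y rs q (tens a b)" "lt q ?Q" by blast
  have "E u \<in> ?W2" unfolding q(1) eval by (intro v2.span_sum summand lower[OF q(2)])
  thus ?case using step by (simp add: E.add E.scale v2.span_add v2.span_scale)
 qed
 hence inW: "E (pbw y rs ?Q (tens a b)) \<in> ?W2" using mem by blast
 \<comment> \<open>The only distribution whose term survives modulo \<open>?W2\<close>: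
   \<open>q1\<close> for the first factor, \<open>q2\<close> for the second.\<close>
 define c0 where "c0 = (%r. if r \<in> set rs then q1 r else 0)"
 have c0: "c0 \<in> subexp (set rs) ?Q" by (auto simp: c0_def subexp_def)
 have fin: "finite (subexp (set rs) ?Q)" by (rule finite_subexp) simp
 let ?g = "%c. s2 (of_nat (\<Prod>r\<in>set rs. ?Q r choose c r) * \<phi> (pbw x1 rs c a)) (pbw x2 rs (%r. ?Q r - c r) b)"
 have "?g c \<in> ?W2" if c: "c \<in> subexp (set rs) ?Q - {c0}" for c
 proof -
  have "c \<noteq> c0" "\<And>r. r \<notin> set rs ==> c r = 0" using c by (auto simp: subexp_def)
  hence "\<not> (\<forall>r\<in>set rs. c r = q1 r)" unfolding c0_def fun_eq_iff by (metis (full_types))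
  thus ?thesis using top[of c] c by (intro summand) blast
 qed
 hence "sum ?g (subexp (set rs) ?Q - {c0}) \<in> ?W2" by (rule v2.span_sum)
 moreover have "sum ?g (subexp (set rs) ?Q) = ?g c0 + sum ?g (subexp (set rs) ?Q - {c0})"
  by (rule sum.remove[OF fin c0])
 ultimately have "?g c0 \<in> ?W2" using inW v2.span_diff[of "sum ?g (subexp (set rs) ?Q)" _ "sum ?g (subexp (set rs) ?Q - {c0})"] unfolding eval by simp
 moreover have "pbw x1 rs c0 a = pbw x1 rs q1 a" "pbw x2 rs (%r. ?Q r - c0 r) b = pbw x2 rs q2 b"
  by (rule pbw_cong, simp add: c0_def)+
 ultimately have m: "s2 (of_nat (\<Prod>r\<in>set rs. ?Q r choose c0 r)) (pbw x2 rs q2 b) \<in> ?W2" by (simp add: p1)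
 have "(\<Prod>r\<in>set rs. ?Q r choose c0 r) \<noteq> 0" by (simp add: c0_def)
 hence nz: "(of_nat (\<Prod>r\<in>set rs. ?Q r choose c0 r) :: complex) \<noteq> 0" by (simp only: of_nat_eq_0_iff not_False_eq_True)
 have "pbw x2 rs q2 b \<in> ?W2"
  using v2.span_scale[OF m, of "inverse (of_nat (\<Prod>r\<in>set rs. ?Q r choose c0 r))"]
  unfolding v2.scale_scale left_inverse[OF nz] v2.scale_one .
 thus False using q2 by contradiction
qed

section \<open>The monomial order and addition\<close>

lemma deglt_add: "deglt r (%i. b i + d i) (%i. c i + d i) = deglt r b c"
proof -
 have "(map (%i. b i + d i) L, map (%i. c i + d i) L) \<in> lexord less_than \<longleftrightarrow> (map b L, map c L) \<in> lexord less_than" for L :: "nat list"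
  by (induction L) auto
 thus ?thesis
  unfolding deglt_def deglex_def mem_Collect_eq prod.case by (simp only: sum_list_addf nat_add_left_cancel_less add_less_cancel_right add_right_cancel)
qed

definition agree :: "nat => (nat => nat) => (nat => nat) => bool" where
 "agree r b c \<longleftrightarrow> (\<forall>i\<in>{1..r}. b i = c i)"

lemma deglt_order:
 shows "deglt r b c \<or> deglt r c b \<or> agree r b c"
  and "agree r b b'==> deglt r b c = deglt r b' c" and "agree r c c' ==> deglt r b c = deglt r b c'"
  and "agree r b c ==> agree r c b" and "agree r b c ==> agree r c d ==> agree r b d"
  and "agree r (%i. b i + e i) (%i. c i + e i) = agree r b c"
 using deglt_total[of r b c] deglt_cong[of r b b' c c] deglt_cong[of r b b c c'] by (auto simp: agree_def)

fun qagree :: "nat => (nat => bool => nat => nat) => (nat => bool => nat => nat) => bool" where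
 "qagree 0 p q \<longleftrightarrow> True"
| "qagree (Suc r) p q \<longleftrightarrow> agree r (p (Suc r) True) (q (Suc r) True) \<and> agree r (p (Suc r) False) (q (Suc r) False) \<and> qagree r p q"

lemma qlt_Suc: "qlt (Suc r) p q \<longleftrightarrow> deglt r (p (Suc r) True) (q (Suc r) True) \<or> agree r (p (Suc r) True) (q (Suc r) True) \<and>
   (deglt r (p (Suc r) False) (q (Suc r) False) \<or> agree r (p (Suc r) False) (q (Suc r) False) \<and> qlt r p q)"
 by (simp add: agree_def)

lemma qlt_total: "qlt r p q \<or> qlt r q p \<or> qagree r p q"
proof (induction r)
 case (Suc r)
 thus ?case
  using deglt_order(1,4)[of r "p (Suc r) True" "q (Suc r) True"] deglt_order(1,4)[of r "p (Suc r) False" "q (Suc r) False"]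
  unfolding qlt_Suc qagree.simps by argo
qed simp

lemma qlt_agree: "qagree r p p' ==> qlt r p q = qlt r p' q" "qagree r q q' ==> qlt r p q = qlt r p q'"
proof (induction r)
 case (Suc r)
 { case 1 thus ?case using deglt_order(2,4,5) Suc.IH(1) unfolding qlt_Suc qagree.simps by meson }
 { case 2 thus ?case using deglt_order(3,4,5) Suc.IH(2) unfolding qlt_Suc qagree.simps by meson }
qed simp_all

lemma qlt_trans: "qlt r p q ==> qlt r q s ==> qlt r p s"
proof (induction r)
 case (Suc r)
 thus ?case using deglt_trans deglt_order(2-5) unfolding qlt_Suc by meson
qed simp

lemma qlt_irrefl: "\<not> qlt r p p"
 by (induction r) (simp_all add: deglt_irrefl)

lemma qlt_add: "qlt r (%m s i. p m s i + d m s i) (%m s i. q m s i + d m s i) = qlt r p q"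
 by (induction r) (simp_all add: deglt_add)

definition agreeX :: "lie_type => nat => (nat => bool => nat => nat) => (nat => bool => nat => nat) => bool" where
 "agreeX X n p q \<longleftrightarrow> (X = TypeB --> agree n (p 0 True) (q 0 True)) \<and> qagree n p q"

lemma ltX_iff: "ltX X n p q \<longleftrightarrow> (if X = TypeB then deglt n (p 0 True) (q 0 True) \<or> agree n (p 0 True) (q 0 True) \<and> qlt n p q else qlt n p q)"
 by (cases X) (simp_all add: agree_def)

lemma ltX_total: "ltX X n p q \<or> ltX X n q p \<or> agreeX X n p q"
proof (cases "X = TypeB")
 case True
 show ?thesis
  using qlt_total[of n p q] deglt_order(1)[of n "p 0 True" "q 0 True"] deglt_order(4)[of n "p 0 True" "q 0 True"]
  unfolding ltX_iff agreeX_def if_P[OF True] by blast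
next
 case False
 thus ?thesis using qlt_total[of n p q] by (simp add: ltX_iff agreeX_def)
qed

lemma ltX_agree:
 shows "agreeX X n p p' ==> ltX X n p q = ltX X n p' q" and "agreeX X n q q' ==> ltX X n p q = ltX X n p q'"
proof -
 show "ltX X n p q = ltX X n p' q" if a: "agreeX X n p p'"
 proof (cases "X = TypeB")
  case True
  hence 0: "agree n (p 0 True) (p' 0 True)" "qagree n p p'" using a by (simp_all add: agreeX_def)
  have "agree n (p 0 True) (q 0 True) = agree n (p' 0 True) (q 0 True)" using 0(1) by (auto simp: agree_def)
  thus ?thesis unfolding ltX_iff if_P[OF True] deglt_order(2)[OF 0(1)] qlt_agree(1)[OF 0(2)] by simp
 next
  case False
  thus ?thesis using a qlt_agree(1)[of n p p' q] by (simp add: ltX_iff agreeX_def)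
 qed
 show "ltX X n p q = ltX X n p q'" if a: "agreeX X n q q'"
 proof (cases "X = TypeB")
  case True
  hence 0: "agree n (q 0 True) (q' 0 True)" "qagree n q q'" using a by (simp_all add: agreeX_def)
  have "agree n (p 0 True) (q 0 True) = agree n (p 0 True) (q' 0 True)" using 0(1) by (auto simp: agree_def)
  thus ?thesis unfolding ltX_iff if_P[OF True] deglt_order(3)[OF 0(1)] qlt_agree(2)[OF 0(2)] by simp
 next
  case False
  thus ?thesis using a qlt_agree(2)[of n q q' p] by (simp add: ltX_iff agreeX_def)
 qed
qed

lemma ltX_trans:
 assumes "ltX X n p q" "ltX X n q s"
 shows "ltX X n p s"
proof (cases "X = TypeB")
 case True
 show ?thesis
  using assms qlt_trans[of n p q s] deglt_trans[of n "p 0 True" "q 0 True" "s 0 True"]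
   deglt_order(2)[of n "p 0 True" "q 0 True" "s 0 True"] deglt_order(3)[of n "q 0 True" "s 0 True" "p 0 True"]
   deglt_order(5)[of n "p 0 True" "q 0 True" "s 0 True"]
  unfolding ltX_iff if_P[OF True] by argo
next
 case False
 thus ?thesis using assms qlt_trans[of n p q s] by (simp add: ltX_iff)
qed

lemma ltX_irrefl: "\<not> ltX X n p p"
 using qlt_irrefl deglt_irrefl unfolding ltX_iff by auto

lemma ltX_add: "ltX X n (%m s i. p m s i + d m s i) (%m s i. q m s i + d m s i) = ltX X n p q"
 unfolding ltX_iff qlt_add deglt_add deglt_order(6) ..

lemma ltX_add_mono:
 assumes "ltX X n a b" "ltX X n c d \<or> agreeX X n c d"
 shows "ltX X n (%m s i. a m s i + c m s i) (%m s i. b m s i + d m s i)"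
proof -
 have 1: "ltX X n (%m s i. a m s i + c m s i) (%m s i. b m s i + c m s i)" using assms(1) by (simp only: ltX_add)
 have comm: "(%m s i. x m s i + y m s i) = (%m s i. y m s i + x m s i)" for x y :: "nat => bool => nat => nat"
  by (simp add: add.commute)
 from assms(2) show ?thesis
 proof
  assume "ltX X n c d"
  hence "ltX X n (%m s i. b m s i + c m s i) (%m s i. b m s i + d m s i)" unfolding comm[of b] by (simp only: ltX_add)
  with 1 show ?thesis by (rule ltX_trans)
 next
  assume ag: "agreeX X n c d"
  have "agreeX X n (%m s i. b m s i + c m s i) (%m s i. b m s i + d m s i)"
  proof -
   have "qagree r (%m s i. b m s i + c m s i) (%m s i. b m s i + d m s i)" if "qagree r c d" for r
    using that by (induction r) (auto simp: agree_def)
   thus ?thesis using ag by (auto simp: agreeX_def agree_def)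
  qed
  thus ?thesis using 1 ltX_agree(2) by blast
 qed
qed

text \<open>The roots in their numeration: \<open>(m, s, i)\<close> stands for \<epsilon>_i +
  \<epsilon>_m if s holds and \<epsilon>_i - \<epsilon>_m otherwise, and m = 0 marks the short root
  \<epsilon>_i. The value m = 1 contributes nothing but matches the recursion of
  \<open>sv\<close>.\<close>

definition tri_list :: "lie_type => nat => (nat \<times> bool \<times> nat) list" where
 "tri_list X n = concat (map (%m. map (%i. (m, False, i)) [1..<m] @ map (%i. (m, True, i)) [1..<m]) [1..<Suc n])
   @ (case X of TypeD => [] | TypeB => map (%i. (0, True, i)) [1..<Suc n])"

abbreviation "tris X n \<equiv> set (tri_list X n)"

abbreviation "sg s m \<equiv> if s then - int m else int m"

lemma set_tri_list: "tris X n = {(m, s, i). 1 <= m \<and> m <= n \<and> 1 <= i \<and> i < m} \<union>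
  (if X = TypeB then {(m, s, i). m = 0 \<and> s \<and> 1 <= i \<and> i <= n} else {})"
proof -
 have "set (concat (map (%m. map (%i. (m, False, i)) [1..<m] @ map (%i. (m, True, i)) [1..<m]) [1..<Suc n]))
   = {(m, s, i). 1 <= m \<and> m <= n \<and> 1 <= i \<and> i < m}" (is "?L = ?R")
 proof (rule Set.set_eqI)
  fix t :: "nat \<times> bool \<times> nat"
  obtain m s i where t: "t = (m, s, i)" by (cases t)
  show "t \<in> ?L \<longleftrightarrow> t \<in> ?R" unfolding t by (cases s) (auto simp del: upt_Suc intro!: bexI[of _ m])
 qed
 thus ?thesis unfolding tri_list_def set_append by (cases X) (auto simp del: upt_Suc)
qed

lemma in_tri_list: "(m, s, i) \<in> tris X n \<longleftrightarrow> 1 <= m \<and> m <= n \<and> 1 <= i \<and> i < m \<or> X = TypeB \<and> m = 0 \<and> s \<and> 1 <= i \<and> i <= n"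
 unfolding set_tri_list by auto

lemma distinct_tri_list: "distinct (tri_list X n)"
proof -
 have *: "distinct (concat (map (%m. map (%i. (m, False, i)) [1..<m] @ map (%i. (m, True, i)) [1..<m]) [1..<Suc n]))"
  by (induction n) (auto simp: distinct_map inj_on_def)
 show ?thesis
  unfolding tri_list_def using * by (cases X) (auto simp: distinct_map inj_on_def simp del: upt_Suc)
qed

lemma agreeX_iff: "agreeX X n p q \<longleftrightarrow> (\<forall>m s i. (m, s, i) \<in> tris X n --> p m s i = q m s i)"
proof -
 have *: "qagree r p q \<longleftrightarrow> (\<forall>m s i. 1 <= m \<and> m <= r \<and> 1 <= i \<and> i < m --> p m s i = q m s i)" for r
 proof (induction r)
  case (Suc r)
  have "(\<forall>s. \<forall>i\<in>{1..r}. p (Suc r) s i = q (Suc r) s i) \<longleftrightarrow> agree r (p (Suc r) True) (q (Suc r) True) \<and> agree r (p (Suc r) False) (q (Suc r) False)"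
   unfolding agree_def by (metis (full_types))
  thus ?case unfolding qagree.simps Suc.IH by (auto simp: le_Suc_eq less_Suc_eq_le)
 qed simp
 show ?thesis unfolding agreeX_def in_tri_list agree_def * by (cases X) auto
qed

definition cur :: "(nat \<times> bool \<times> nat => nat) => nat => bool => nat => nat" where
 "cur c = (%m s i. c (m, s, i))"

lemma tri_idx: "(m, s, i) \<in> tris X n ==> sg s m \<in> idx X n \<and> int i \<in> idx X n"
 unfolding in_tri_list by (cases X) (auto simp: idx_def)

definition trop :: "(int => int => 'a) => nat \<times> bool \<times> nat => 'a" where
 "trop F = (%(m, s, i). F (sg s m) (int i))"

text \<open>If neither part of the distribution precedes its target, both are at least as large, and
  by compatibility with addition so is their sum; equality requires agreement in both parts.\<close>

lemma ltX_sum_cases: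
 assumes c: "c \<in> subexp (tris X n) q"
 shows "ltX X n (cur q) (cur (%r. q1 r + q2 r)) ==> ltX X n (cur c) (cur q1) \<or> ltX X n (cur (%r. q r - c r)) (cur q2)"
  and "q = (%r. q1 r + q2 r) ==> ltX X n (cur c) (cur q1) \<or> ltX X n (cur (%r. q r - c r)) (cur q2) \<or> (\<forall>r\<in>tris X n. c r = q1 r)"
proof -
 let ?d = "%r. q r - c r" and ?L = "%a b. ltX X n (cur a) (cur b)" and ?A = "%a b. agreeX X n (cur a) (cur b)"
 have cq: "?A q (%r. c r + ?d r)"
  using c by (simp add: agreeX_iff cur_def subexp_def)
 have A: "?A a b \<longleftrightarrow> (\<forall>r\<in>tris X n. a r = b r)" for a b
  unfolding agreeX_iff cur_def by (simp add: split_paired_all split_paired_Ball_Sigma Ball_def)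
 have cc: "cur (%r. a r + b r) = (%m s i. cur a m s i + cur b m s i)" for a b by (simp add: cur_def)
 have mono: "?L (%r. a r + b r) (%r. a' r + b' r)" if "?L a a' \<and> (?L b b' \<or> ?A b b') \<or> ?L b b' \<and> (?L a a' \<or> ?A a a')" for a b a' b'
  using that
 proof (elim disjE[where P = "_ \<and> _"] conjE)
  assume "?L a a'" "?L b b' \<or> ?A b b'"
  thus ?thesis unfolding cc by (rule ltX_add_mono)
 next
  assume "?L b b'" "?L a a' \<or> ?A a a'"
  thus ?thesis unfolding cc add.commute[of "cur a _ _ _"] add.commute[of "cur a' _ _ _"] by (rule ltX_add_mono)
 qed
 have t1: "?L c q1 \<or> ?L q1 c \<or> ?A q1 c" using ltX_total[of X n "cur c" "cur q1"] by (auto simp: A)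
 have t2: "?L ?d q2 \<or> ?L q2 ?d \<or> ?A q2 ?d" using ltX_total[of X n "cur ?d" "cur q2"] by (auto simp: A)
 have step: "?L (%r. q1 r + q2 r) q" if n1: "\<not> ?L c q1" "\<not> ?L ?d q2" and n2: "\<not> (?A q1 c \<and> ?A q2 ?d)"
 proof -
  have "?L (%r. q1 r + q2 r) (%r. c r + ?d r)" by (rule mono) (use t1 t2 n1 n2 in blast)
  thus ?thesis using ltX_agree(2)[OF cq] by blast
 qed
 {
  assume l: "?L q (%r. q1 r + q2 r)"
  show "?L c q1 \<or> ?L ?d q2"
  proof (rule ccontr)
   assume n: "\<not> (?L c q1 \<or> ?L ?d q2)"
   have "\<not> (?A q1 c \<and> ?A q2 ?d)"
   proof
    assume ag: "?A q1 c \<and> ?A q2 ?d"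
    have "?A (%r. q1 r + q2 r) q" using ag cq unfolding A by simp
    thus False using l ltX_irrefl ltX_agree(2) by blast
   qed
   thus False using step n l ltX_trans ltX_irrefl by blast
  qed
 }
 {
  assume e: "q = (%r. q1 r + q2 r)"
  show "?L c q1 \<or> ?L ?d q2 \<or> (\<forall>r\<in>tris X n. c r = q1 r)"
  proof (rule ccontr)
   assume n: "\<not> (?L c q1 \<or> ?L ?d q2 \<or> (\<forall>r\<in>tris X n. c r = q1 r))"
   hence "\<not> (?A q1 c \<and> ?A q2 ?d)" unfolding A by auto
   hence "?L (%r. q1 r + q2 r) q" using step n by blast
   thus False unfolding e using ltX_irrefl by blast
  qed
 }
qed

context so_rep
begin

lemma svX_pbw: "svX q v = pbw (trop F) (tri_list X n) (%(m, s, i). q m s i) v"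
proof -
 have w: "foldr (F s) (expo_word r b) u = pbw (%i. F s (int i)) [1..<Suc r] b u" for s r b u
 proof -
  have "foldr (F s) (concat (map (%i. replicate (b i) (int i)) L)) u = pbw (%i. F s (int i)) L b u" for L :: "nat list"
   by (induction L) auto
  thus ?thesis unfolding expo_word_def .
 qed
 have m: "pbw x (map f L) q u = pbw (%i. x (f i)) L (%i. q (f i)) u" for x :: "'r => 'v => 'v" and f :: "nat => 'r" and L q u
  by (induction L) auto
 have ap: "pbw x (L @ M) q u = pbw x L q (pbw x M q u)" for x :: "'r => 'v => 'v" and L M q u
  by (simp add: pbw_def)
 have "sv r q u = pbw (trop F) (concat (map (%m. map (%i. (m, False, i)) [1..<m] @ map (%i. (m, True, i)) [1..<m]) [1..<Suc r]))
   (%(m, s, i). q m s i) u" for r u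
  by (induction r arbitrary: u) (simp_all add: ap m w trop_def del: upt_Suc add: upt_Suc_append)
 thus ?thesis unfolding svX_def tri_list_def
  by (cases X) (simp_all add: ap m w trop_def del: upt_Suc)
qed

end

section \<open>Construction of representations\<close>

lemma totalize:
 fixes sc :: "complex => 'v::ab_group_add => 'v" and G :: "int => int => 'v => 'v"
 assumes vs: "vector_space sc" and U: "module.subspace sc U"
  and G: "\<And>i j u. i \<in> idx X n ==> j \<in> idx X n ==> u \<in> U ==> G i j u \<in> U"
  and add: "\<And>i j u w. i \<in> idx X n ==> j \<in> idx X n ==> u \<in> U ==> w \<in> U ==> G i j (u + w) = G i j u + G i j w"
  and scale: "\<And>i j c u. i \<in> idx X n ==> j \<in> idx X n ==> u \<in> U ==> G i j (sc c u) = sc c (G i j u)"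
  and anti: "\<And>i j u. i \<in> idx X n ==> j \<in> idx X n ==> u \<in> U ==> G (- j) (- i) u = - G i j u"
  and comm: "\<And>i j k l u. i \<in> idx X n ==> j \<in> idx X n ==> k \<in> idx X n ==> l \<in> idx X n ==> u \<in> U ==>
   G i j (G k l u) - G k l (G i j u) =
    (if j = k then G i l u else 0) - (if i = l then G k j u else 0)
    - (if i = - k then G (- j) l u else 0) + (if j = - l then G k (- i) u else 0)"
 shows "\<exists>\<pi>. (\<forall>u\<in>U. \<pi> u = u) \<and> (\<forall>u. \<pi> u \<in> U) \<and> so_rep sc X n (%i j u. G i j (\<pi> u))"
proof -
 interpret vector_space sc by (rule vs)
 interpret p: vector_space_pair sc sc by (intro vector_space_pair.intro vs)
 obtain \<pi> where p: "\<pi> ` UNIV \<subseteq> U" "Vector_Spaces.linear sc sc \<pi>" "\<And>u. u \<in> U ==> \<pi> u = u"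
  using p.linear_exists_left_inverse_on[OF linear_id U] by auto
 interpret l: Vector_Spaces.linear sc sc \<pi> by (rule p(2))
 have pU: "\<pi> u \<in> U" for u using p(1) by auto
 have "so_rep sc X n (%i j u. G i j (\<pi> u))"
  by unfold_locales (simp_all add: l.add l.scale add scale anti G p(3) pU comm)
 thus ?thesis using p(3) pU by blast
qed

text \<open>
 The tensor product of two spaces, with the first factor represented by its linear functionals:
 pure tensors are maps from functionals to the second factor.
\<close>

abbreviation functional :: "(complex => 'c => 'c) => ('c::ab_group_add => complex) => bool" where
 "functional s1 \<phi> \<equiv> Vector_Spaces.linear s1 (*) \<phi>"

definition tens :: "(complex => 'c => 'c) => (complex => 'd => 'd) => 'c::ab_group_add => 'd::ab_group_add => ('c => complex) => 'd" where
 "tens s1 s2 a b = (%\<phi>. if functional s1 \<phi> then s2 (\<phi> a) b else 0)"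

definition fscale :: "(complex => 'd => 'd) => complex => ('a => 'd) => 'a => 'd" where
 "fscale s2 c T = (%\<phi>. s2 c (T \<phi>))"

lemma vector_space_fscale: "vector_space s2 ==> vector_space (fscale s2 :: complex => ('a => 'd::ab_group_add) => 'a => 'd)"
 by (auto simp: vector_space_def fscale_def fun_eq_iff)

text \<open>On maps from functionals to the second space, the algebra acts through the transpose on
  the functional plus its action on the values.\<close>

lemma tensor_rep:
 fixes s1 :: "complex => 'c::ab_group_add => 'c" and s2 :: "complex => 'd::ab_group_add => 'd"
 assumes r1: "so_rep s1 X n F1" and r2: "so_rep s2 X n F2"
 shows "\<exists>G. so_rep (fscale s2) X n G \<and> (\<forall>i\<in>idx X n. \<forall>j\<in>idx X n. \<forall>a b.
  G i j (tens s1 s2 a b) = tens s1 s2 (F1 i j a) b + tens s1 s2 a (F2 i j b))"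
proof -
 interpret r1: so_rep s1 X n F1 by (rule r1)
 interpret r2: so_rep s2 X n F2 by (rule r2)
 interpret v1: vector_space_pair s1 "(*) :: complex => complex => complex"
  by (intro vector_space_pair.intro r1.vector_space_axioms vector_space.intro) (simp_all add: algebra_simps)
 let ?I = "idx X n" and ?L = "functional s1" and ?t = "tens s1 s2"
 have fI: "?L \<phi> \<longleftrightarrow> (\<forall>a b. \<phi> (a + b) = \<phi> a + \<phi> b) \<and> (\<forall>c a. \<phi> (s1 c a) = c * \<phi> a)" for \<phi>
  unfolding Vector_Spaces.linear_iff by (simp add: r1.vector_space_axioms v1.vs2.vector_space_axioms)
 define G where "G = (%i j (T :: ('c => complex) => 'd) \<phi>. if ?L \<phi> then T (%a. \<phi> (F1 i j a)) + F2 i j (T \<phi>) else 0)"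
 \<comment> \<open>The bracket relation in the first factor evaluates \<open>T\<close> at
   differences of functionals, so only maps linear in the functional form a representation.\<close>
 define U :: "(('c => complex) => 'd) set" where "U = {T. (\<forall>\<phi>. \<not> ?L \<phi> --> T \<phi> = 0) \<and>
  (\<forall>\<phi> \<psi>. ?L \<phi> --> ?L \<psi> --> T (%a. \<phi> a + \<psi> a) = T \<phi> + T \<psi>) \<and> (\<forall>c \<phi>. ?L \<phi> --> T (%a. c * \<phi> a) = s2 c (T \<phi>))}"
 have comp: "?L (%a. \<phi> (F1 i j a))" if "?L \<phi>" "i \<in> ?I" "j \<in> ?I" for \<phi> i j
 proof -
  interpret f: Vector_Spaces.linear s1 "(*)" \<phi> by (rule that(1))
  show ?thesis unfolding fI by (simp only: r1.F_add[OF that(2,3)] r1.F_scale[OF that(2,3)] f.add f.scale simp_thms)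
 qed
 have Lc: "?L \<phi> ==> ?L \<psi> ==> ?L (%a. \<phi> a + \<psi> a)" "?L \<phi> ==> ?L (%a. c * \<phi> a)" for \<phi> \<psi> c
  unfolding fI by (simp_all add: distrib_left)
 have UI: "T (%a. \<phi> a + \<psi> a) = T \<phi> + T \<psi>" "T (%a. c * \<phi> a) = s2 c (T \<phi>)" "T (%a. \<phi> a - \<psi> a) = T \<phi> - T \<psi>"
   "T (%a. 0) = 0" "T (%a. - \<phi> a) = - T \<phi>"
  if "T \<in> U" "?L \<phi>" "?L \<psi>" for T \<phi> \<psi> c
 proof -
  show 1: "T (%a. \<phi> a + \<psi> a) = T \<phi> + T \<psi>" and 2: "T (%a. c * \<phi> a) = s2 c (T \<phi>)" for c
   using that unfolding U_def by blast+
  show "T (%a. 0) = 0" using 2[of 0] by simp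
  show "T (%a. - \<phi> a) = - T \<phi>" using 2[of "- 1"] by simp
  have "T (%a. \<phi> a + - 1 * \<psi> a) = T \<phi> + T (%a. - 1 * \<psi> a)" "T (%a. - 1 * \<psi> a) = s2 (- 1) (T \<psi>)"
   using that Lc(2)[of \<psi> "- 1"] unfolding U_def by blast+
  thus "T (%a. \<phi> a - \<psi> a) = T \<phi> - T \<psi>" by simp
 qed
 have sub: "module.subspace (fscale s2) U"
 proof -
  interpret vector_space "fscale s2 :: complex => (('c => complex) => 'd) => ('c => complex) => 'd"
   by (rule vector_space_fscale[OF r2.vector_space_axioms])
  show ?thesis
   unfolding subspace_def U_def fscale_def by (auto simp: r2.scale_right_distrib r2.scale_left_commute)
 qed
 have "\<exists>\<pi>. (\<forall>u\<in>U. \<pi> u = u) \<and> (\<forall>u. \<pi> u \<in> U) \<and> so_rep (fscale s2) X n (%i j u. G i j (\<pi> u))"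
 proof (rule totalize[OF vector_space_fscale[OF r2.vector_space_axioms] sub])
  fix i j assume ij: "i \<in> ?I" "j \<in> ?I"
  show "G i j T \<in> U" if T: "T \<in> U" for T
   unfolding U_def mem_Collect_eq
  proof (intro conjI allI impI)
   fix \<phi> \<psi> assume L: "?L \<phi>" "?L \<psi>"
   show "G i j T (%a. \<phi> a + \<psi> a) = G i j T \<phi> + G i j T \<psi>"
    using UI(1)[OF T L] UI(1)[OF T comp[OF L(1) ij] comp[OF L(2) ij]] Lc(1)[OF L] L ij
    by (simp add: G_def r2.F_add)
  next
   fix c \<phi> assume L: "?L \<phi>"
   show "G i j T (%a. c * \<phi> a) = s2 c (G i j T \<phi>)"
    using UI(2)[OF T L L] UI(2)[OF T comp[OF L ij] L] Lc(2)[OF L] L ij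
    by (simp add: G_def r2.F_scale r2.scale_right_distrib)
  qed (simp add: G_def)
  show "G i j (T + S) = G i j T + G i j S" for T S using ij by (auto simp: G_def fun_eq_iff r2.F_add)
  show "G i j (fscale s2 c T) = fscale s2 c (G i j T)" for c T
   using ij by (auto simp: G_def fscale_def fun_eq_iff r2.F_scale r2.scale_right_distrib)
  show "G (- j) (- i) T = - G i j T" if T: "T \<in> U" for T
  proof (rule ext)
   fix \<phi>
   show "G (- j) (- i) T \<phi> = (- G i j T) \<phi>"
   proof (cases "?L \<phi>")
    case True
    interpret f: Vector_Spaces.linear s1 "(*)" \<phi> by (rule True)
    have "T (%a. \<phi> (F1 (- j) (- i) a)) = - T (%a. \<phi> (F1 i j a))"
     using UI(5)[OF T comp[OF True ij] True] ij by (simp add: r1.F_anti f.neg)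
    thus ?thesis using True ij by (simp add: G_def r2.F_anti)
   qed (simp add: G_def)
  qed
  fix k l assume kl: "k \<in> ?I" "l \<in> ?I"
  show "G i j (G k l T) - G k l (G i j T) =
    (if j = k then G i l T else 0) - (if i = l then G k j T else 0)
    - (if i = - k then G (- j) l T else 0) + (if j = - l then G k (- i) T else 0)" if T: "T \<in> U" for T
  proof (rule ext)
   fix \<phi>
   show "(G i j (G k l T) - G k l (G i j T)) \<phi> =
    ((if j = k then G i l T else 0) - (if i = l then G k j T else 0)
    - (if i = - k then G (- j) l T else 0) + (if j = - l then G k (- i) T else 0)) \<phi>"
   proof (cases "?L \<phi>")
    case True
    interpret f: Vector_Spaces.linear s1 "(*)" \<phi> by (rule True)
    let ?f = "%i j a. \<phi> (F1 i j a)" and ?c = "%i j k l a. \<phi> (F1 i j (F1 k l a))"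
    have ex: "G i j (G k l T) \<phi> = T (?c i j k l) + F2 k l (T (?f i j))
      + F2 i j (T (?f k l)) + F2 i j (F2 k l (T \<phi>))"
     if "i \<in> ?I" "j \<in> ?I" "k \<in> ?I" "l \<in> ?I" for i j k l
     using that comp[OF True] True by (simp add: G_def r2.F_add)
    have c2: "?L (?c i j k l)" if "i \<in> ?I" "j \<in> ?I" "k \<in> ?I" "l \<in> ?I" for i j k l
     by (rule comp[OF comp[OF True that(1,2)] that(3,4)])
    have cif: "?L (%a. \<phi> (if P then F1 i j a else 0))" if "i \<in> ?I" "j \<in> ?I" for P i j
     using comp[OF True that] Lc(2)[OF True, of 0] by (cases P) (simp_all add: f.zero)
    have Tif: "T (%a. \<phi> (if P then F1 i j a else 0)) = (if P then T (?f i j) else 0)" for P i j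
     using UI(4)[OF T True True] by (simp add: f.zero)
    have neg: "- j \<in> ?I" "- i \<in> ?I" using ij by simp_all
    have L1: "?L (%a. \<phi> (if j = k then F1 i l a else 0) - \<phi> (if i = l then F1 k j a else 0))"
     and L2: "?L (%a. \<phi> (if j = k then F1 i l a else 0) - \<phi> (if i = l then F1 k j a else 0) - \<phi> (if i = - k then F1 (- j) l a else 0))"
     using cif[OF ij(1) kl(2), of "j = k"] cif[OF kl(1) ij(2), of "i = l"] cif[OF neg(1) kl(2), of "i = - k"]
     unfolding fI by (simp_all add: right_diff_distrib)
    have "T (?c i j k l) - T (?c k l i j)
     = T (%a. \<phi> (F1 i j (F1 k l a)) - \<phi> (F1 k l (F1 i j a)))"
     using UI(3)[OF T c2[OF ij kl] c2[OF kl ij]] by simp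
    also have "\<dots> = T (%a. \<phi> (if j = k then F1 i l a else 0) - \<phi> (if i = l then F1 k j a else 0)
      - \<phi> (if i = - k then F1 (- j) l a else 0) + \<phi> (if j = - l then F1 k (- i) a else 0))"
     unfolding f.diff[symmetric] f.add[symmetric] r1.F_comm[OF ij kl] ..
    also have "\<dots> = (if j = k then T (?f i l) else 0) - (if i = l then T (?f k j) else 0)
      - (if i = - k then T (?f (- j) l) else 0) + (if j = - l then T (?f k (- i)) else 0)"
     unfolding UI(1)[OF T L2 cif[OF kl(1) neg(2)]] UI(3)[OF T L1 cif[OF neg(1) kl(2)]]
      UI(3)[OF T cif[OF ij(1) kl(2)] cif[OF kl(1) ij(2)]] Tif ..
    finally have Tc: "T (?c i j k l) - T (?c k l i j) = \<dots>" .
    have "(G i j (G k l T) - G k l (G i j T)) \<phi> = (T (?c i j k l) - T (?c k l i j))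
      + (F2 i j (F2 k l (T \<phi>)) - F2 k l (F2 i j (T \<phi>)))"
     using ex[OF ij kl] ex[OF kl ij] by simp
    thus ?thesis unfolding Tc r2.F_comm[OF ij kl] using True by (simp add: G_def)
   qed (simp add: G_def)
  qed
 qed
 then obtain \<pi> where p: "\<And>u. u \<in> U ==> \<pi> u = u" "so_rep (fscale s2) X n (%i j u. G i j (\<pi> u))" by blast
 have tU: "?t a b \<in> U" for a b
  unfolding U_def mem_Collect_eq
 proof (intro conjI allI impI)
  fix \<phi> \<psi> assume L: "?L \<phi>" "?L \<psi>"
  show "?t a b (%a. \<phi> a + \<psi> a) = ?t a b \<phi> + ?t a b \<psi>"
   using Lc(1)[OF L] L by (simp add: tens_def r2.scale_left_distrib)
 next
  fix c \<phi> assume L: "?L \<phi>"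
  show "?t a b (%a. c * \<phi> a) = s2 c (?t a b \<phi>)"
   using Lc(2)[OF L] L by (simp add: tens_def)
 qed (simp add: tens_def)
 have "G i j (\<pi> (?t a b)) = ?t (F1 i j a) b + ?t a (F2 i j b)" if ij: "i \<in> ?I" "j \<in> ?I" for i j a b
 proof (rule ext)
  fix \<phi>
  show "G i j (\<pi> (?t a b)) \<phi> = (?t (F1 i j a) b + ?t a (F2 i j b)) \<phi>"
   using ij comp[OF _ ij, of \<phi>] unfolding p(1)[OF tU] by (simp add: G_def tens_def r2.F_scale)
 qed
 thus ?thesis using p(2) by blast
qed

lemma product_rep:
 assumes r1: "so_rep s1 X n F1" and r2: "so_rep s2 X n F2"
 shows "so_rep (%c (T, w). (s1 c T, s2 c w)) X n (%i j (T, w). (F1 i j T, F2 i j w))"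
proof -
 interpret r1: so_rep s1 X n F1 by (rule r1)
 interpret r2: so_rep s2 X n F2 by (rule r2)
 have if_pair: "(if P then (x, y) else 0) = (if P then x else 0, if P then y else 0)" for P and x :: 'a and y :: 'b
  by (simp add: zero_prod_def)
 show ?thesis
 proof (unfold_locales, goal_cases)
  case (8 i j k l u)
  obtain a b where u: "u = (a, b)" by (cases u)
  show ?case unfolding u using r1.F_comm[OF 8, of a] r2.F_comm[OF 8, of b] by (simp only: prod.case if_pair diff_Pair add_Pair)
 qed (auto simp: r1.scale_right_distrib r1.scale_left_distrib r2.scale_right_distrib r2.scale_left_distrib
   r1.F_add r1.F_scale r1.F_anti r2.F_add r2.F_scale r2.F_anti)
qed

context so_rep
begin

lemma funpow_zero:
 assumes "i \<in> I" "j \<in> I" "(F i j ^^ N) v = 0" "N <= c"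
 shows "(F i j ^^ c) v = 0"
 using assms(4) by (induction c rule: dec_induct) (simp_all add: assms)

lemma stab_zero: "stab (I \<times> I) {0}"
 by (auto simp: stab_def)

definition nil_vec :: "'v => bool" where
 "nil_vec v \<longleftrightarrow> (\<forall>i\<in>I. \<forall>j\<in>I. i \<noteq> j --> i \<noteq> - j --> (\<exists>N. (F i j ^^ N) v = 0))"

definition ess :: "(nat => bool => nat => nat) => 'v => bool" where
 "ess q v \<longleftrightarrow> svX q v \<notin> span {svX q' v |q'. ltX X n q' q}"

lemma ess_pbw:
 "ess q v \<longleftrightarrow> pbw (trop F) (tri_list X n) (%(m, s, i). q m s i) v \<notin>
   span {pbw (trop F) (tri_list X n) q' v |q'. ltX X n (cur q') q}"
proof -
 have "{svX q' v |q'. ltX X n q' q} = {pbw (trop F) (tri_list X n) q' v |q'. ltX X n (cur q') q}"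
 proof safe
  fix q' assume l: "ltX X n q' q"
  have "cur (%(m, s, i). q' m s i) = q'" by (simp add: cur_def)
  thus "\<exists>q''. svX q' v = pbw (trop F) (tri_list X n) q'' v \<and> ltX X n (cur q'') q"
   using l by (intro exI[of _ "%(m, s, i). q' m s i"]) (simp add: svX_pbw)
 next
  fix q' assume l: "ltX X n (cur q') q"
  have "(%(m, s, i). cur q' m s i) = q'" by (auto simp: cur_def)
  thus "\<exists>q''. pbw (trop F) (tri_list X n) q' v = svX q'' v \<and> ltX X n q'' q"
   using l by (intro exI[of _ "cur q'"]) (simp add: svX_pbw)
 qed
 thus ?thesis unfolding ess_def svX_pbw by simp
qed

lemma trop_idx: "t \<in> tris X n ==> \<exists>i\<in>I. \<exists>j\<in>I. \<forall>u. trop F t u = F i j u"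
 using tri_idx[of "fst t" "fst (snd t)" "snd (snd t)" X n] by (force simp: trop_def split: prod.splits)

end

text \<open>
 The tensor product of the first two modules contains a highest weight vector of the weight of
 the third one, and by the irreducibility of cyclic modules both satisfy the same relations.
\<close>

lemma ess_add:
 fixes s1 :: "complex => 'c::ab_group_add => 'c" and s2 :: "complex => 'd::ab_group_add => 'd"
  and s3 :: "complex => 'e::ab_group_add => 'e"
 assumes r: "so_rep s1 X n F1" "so_rep s2 X n F2" "so_rep s3 X n F3"
  and v1: "so_rep.hwX s1 X n F1 \<mu>1 {0} v1" "so_rep.nil_vec X n F1 v1"
  and v2: "so_rep.hwX s2 X n F2 \<mu>2 {0} v2" "so_rep.nil_vec X n F2 v2"
  and v3: "so_rep.hwX s3 X n F3 (\<mu>1 + \<mu>2) {0} v3" "so_rep.nil_vec X n F3 v3" "v3 \<noteq> 0"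
  and q: "so_rep.ess s1 X n F1 q1 v1" "so_rep.ess s2 X n F2 q2 v2"
 shows "so_rep.ess s3 X n F3 (%m s i. q1 m s i + q2 m s i) v3"
proof -
 interpret r1: so_rep s1 X n F1 by (rule r)
 interpret r2: so_rep s2 X n F2 by (rule r)
 interpret r3: so_rep s3 X n F3 by (rule r)
 let ?t = "tens s1 s2" and ?I = "idx X n"
 obtain G where G: "so_rep (fscale s2) X n G"
  and Gt: "\<And>i j a b. i \<in> ?I ==> j \<in> ?I ==> G i j (?t a b) = ?t (F1 i j a) b + ?t a (F2 i j b)"
  using tensor_rep[OF r(1,2)] by blast
 interpret g: so_rep "fscale s2" X n G by (rule G)
 have t0: "?t 0 b = 0" "?t a 0 = 0" and tsc: "?t (s1 c a) b = fscale s2 c (?t a b)" "?t a (s2 c b) = fscale s2 c (?t a b)" for a b c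
 proof -
  have "\<phi> 0 = 0" "\<phi> (s1 c a) = c * \<phi> a" if "functional s1 \<phi>" for \<phi>
  proof -
   interpret f: Vector_Spaces.linear s1 "(*)" \<phi> by (rule that)
   show "\<phi> 0 = 0" "\<phi> (s1 c a) = c * \<phi> a" by (rule f.zero, rule f.scale)
  qed
  thus "?t 0 b = 0" "?t a 0 = 0" "?t (s1 c a) b = fscale s2 c (?t a b)" "?t a (s2 c b) = fscale s2 c (?t a b)"
   by (auto simp: tens_def fscale_def fun_eq_iff mult.commute)
 qed
 let ?sp = "%c (T, w). (fscale s2 c T, s3 c w)" and ?P = "%i j (T, w). (G i j T, F3 i j w)"
 interpret p: so_rep ?sp X n ?P by (rule product_rep[OF G r(3)])
 let ?tv = "?t v1 v2" and ?Q = "%m s i. q1 m s i + q2 m s i"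
 let ?u = "(?tv, v3)"
 have pw: "(?P i j ^^ N) (T, w) = ((G i j ^^ N) T, (F3 i j ^^ N) w)" for i j N T w
  by (induction N) auto
 have "p.nil_vec ?u"
  unfolding p.nil_vec_def
 proof (intro ballI impI)
  fix i j assume ij: "i \<in> ?I" "j \<in> ?I" "i \<noteq> j" "i \<noteq> - j"
  obtain N1 N2 N3 where N: "(F1 i j ^^ N1) v1 = 0" "(F2 i j ^^ N2) v2 = 0" "(F3 i j ^^ N3) v3 = 0"
   using v1(2) v2(2) v3(2) ij unfolding r1.nil_vec_def r2.nil_vec_def r3.nil_vec_def by meson
  note z1 = r1.funpow_zero[OF ij(1,2) N(1)] and z2 = r2.funpow_zero[OF ij(1,2) N(2)]
   and z3 = r3.funpow_zero[OF ij(1,2) N(3)]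
  let ?N = "N1 + N2 + N3"
  have "(G i j ^^ ?N) ?tv = (\<Sum>c\<le>?N. fscale s2 (of_nat (?N choose c))
    (?t ((F1 i j ^^ c) v1) ((F2 i j ^^ (?N - c)) v2)))"
   by (rule g.leibniz_power; rule g.F_add[OF ij(1,2)] g.F_scale[OF ij(1,2)] Gt[OF ij(1,2)])
  also have "\<dots> = 0"
  proof (rule sum.neutral, intro ballI)
   fix c
   have "N1 <= c \<or> N2 <= ?N - c" by linarith
   thus "fscale s2 (of_nat (?N choose c)) (?t ((F1 i j ^^ c) v1) ((F2 i j ^^ (?N - c)) v2)) = 0"
    by (elim disjE) (simp_all only: z1 z2 t0 g.scale_zero_right)
  qed
  finally have "(?P i j ^^ ?N) ?u = 0" using z3[of "?N"] by (simp add: pw zero_prod_def)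
  thus "\<exists>N. (?P i j ^^ N) ?u = 0" ..
 qed
 hence nil: "\<And>i j. i \<in> ?I ==> j \<in> ?I ==> i \<noteq> j ==> i \<noteq> - j ==> \<exists>N. (?P i j ^^ N) ?u = 0"
  unfolding p.nil_vec_def by blast
 have hw: "p.hwX (\<mu>1 + \<mu>2) {0} ?u"
  unfolding p.hwX_def
 proof (intro conjI)
  show "p.stab (?I \<times> ?I) {0}" by (rule p.stab_zero)
  show "supp n (\<mu>1 + \<mu>2)" using v3(1) by (simp add: r3.hwX_def)
  show "p.raises_into ?I {0} ?u"
   unfolding p.raises_into_def
  proof (intro ballI impI)
   fix i j assume ij: "i \<in> ?I" "j \<in> ?I" "prec i j"
   have "F1 i j v1 = 0" "F2 i j v2 = 0" "F3 i j v3 = 0"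
    using v1(1) v2(1) v3(1) ij unfolding r1.hwX_def r2.hwX_def r3.hwX_def r1.raises_into_def r2.raises_into_def r3.raises_into_def by blast+
   thus "?P i j ?u \<in> {0}" using ij by (simp add: Gt t0 zero_prod_def)
  qed
  show "p.wtv (\<mu>1 + \<mu>2) ?u"
   unfolding p.wtv_def
  proof
   fix i assume i: "i \<in> {1..n}"
   have "F1 (int i) (int i) v1 = s1 (of_rat (\<mu>1 i)) v1" "F2 (int i) (int i) v2 = s2 (of_rat (\<mu>2 i)) v2"
    "F3 (int i) (int i) v3 = s3 (of_rat ((\<mu>1 + \<mu>2) i)) v3"
    using v1(1) v2(1) v3(1) i unfolding r1.hwX_def r2.hwX_def r3.hwX_def r1.wtv_def r2.wtv_def r3.wtv_def by blast+
   thus "?P (int i) (int i) ?u = ?sp (of_rat ((\<mu>1 + \<mu>2) i)) ?u"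
    using r1.nat_idx[OF i] by (simp add: Gt tsc g.scale_left_distrib of_rat_add)
  qed
 qed
 let ?tr = "tri_list X n" and ?q1 = "%(m, s, i). q1 m s i" and ?q2 = "%(m, s, i). q2 m s i"
 have c12: "cur ?q1 = q1" "cur ?q2 = q2" "cur (%r. ?q1 r + ?q2 r) = ?Q" by (simp_all add: cur_def)
 have tn: "pbw (trop G) ?tr (%r. ?q1 r + ?q2 r) ?tv \<notin> g.span {pbw (trop G) ?tr q ?tv |q. ltX X n (cur q) (cur (%r. ?q1 r + ?q2 r))}"
 proof (rule tensor_not_in_span[OF r1.vector_space_axioms r2.vector_space_axioms g.vector_space_axioms _ _ _ distinct_tri_list])
  fix r u w c assume r: "r \<in> set ?tr"
  show "trop G r (u + w) = trop G r u + trop G r w" using g.trop_idx[OF r] by (auto simp: g.F_add)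
  show "trop G r (fscale s2 c u) = fscale s2 c (trop G r u)" using g.trop_idx[OF r] by (auto simp: g.F_scale)
 next
  fix r a b assume r: "r \<in> set ?tr"
  obtain m s i where e: "r = (m, s, i)" by (cases r)
  show "trop G r (?t a b) = ?t (trop F1 r a) b + ?t a (trop F2 r b)" using tri_idx[OF r[unfolded e]] unfolding e trop_def prod.case by (intro Gt) auto
 next
  fix \<phi> assume L: "functional s1 \<phi>"
  have "Vector_Spaces.linear (fscale s2) s2 (%T. T \<phi>)"
   unfolding Vector_Spaces.linear_iff by (simp add: g.vector_space_axioms r2.vector_space_axioms) (simp add: fscale_def)
  moreover have "\<forall>a b. ?t a b \<phi> = s2 (\<phi> a) b" using L by (simp add: tens_def)
  ultimately show "\<exists>E. Vector_Spaces.linear (fscale s2) s2 E \<and> (\<forall>a b. E (?t a b) = s2 (\<phi> a) b)" by blast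
 next
  show "pbw (trop F1) ?tr ?q1 v1 \<notin> r1.span {pbw (trop F1) ?tr q v1 |q. ltX X n (cur q) (cur ?q1)}"
   using q(1) unfolding r1.ess_pbw c12 .
  show "pbw (trop F2) ?tr ?q2 v2 \<notin> r2.span {pbw (trop F2) ?tr q v2 |q. ltX X n (cur q) (cur ?q2)}"
   using q(2) unfolding r2.ess_pbw c12 .
 qed (use ltX_sum_cases in blast)+
 have ti: "(%(m, s, i). ?Q m s i) = (%r. ?q1 r + ?q2 r)" by auto
 have et: "g.ess ?Q ?tv" unfolding g.ess_pbw ti using tn unfolding c12 .
 have sp: "p.svX q (T, w) = (g.svX q T, r3.svX q w)" for q T w
 proof -
  have "pbw (trop ?P) L q (T, w) = (pbw (trop G) L q T, pbw (trop F3) L q w)" for L q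
   by (induction L) (auto simp: trop_def pw)
  thus ?thesis unfolding p.svX_pbw g.svX_pbw r3.svX_pbw .
 qed
 let ?PS = "p.span {p.svX q' ?u |q'. ltX X n q' ?Q}" and ?GS = "g.span {g.svX q' ?tv |q'. ltX X n q' ?Q}"
  and ?RS = "r3.span {r3.svX q' v3 |q'. ltX X n q' ?Q}"
 show ?thesis
  unfolding r3.ess_def
 proof
  assume mem: "r3.svX ?Q v3 \<in> ?RS"
  \<comment> \<open>A combination of smaller monomials of \<open>v3\<close> is lifted, with the same
    coefficients, to the product and to the tensor.\<close>
  have "\<exists>x. x \<in> ?PS \<and> snd x = w \<and> fst x \<in> ?GS"
   if "w \<in> ?RS" for w
   using that
  proof (induction rule: r3.span_induct_alt)
   case base
   show ?case using p.span_zero g.span_zero by (intro exI[of _ 0] conjI) (simp_all only: fst_zero snd_zero)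
  next
   case (step c y w)
   then obtain x where x: "x \<in> ?PS" "snd x = w" "fst x \<in> ?GS" by blast
   from step obtain q' where q': "y = r3.svX q' v3" "ltX X n q' ?Q" by blast
   have "p.svX q' ?u \<in> ?PS" "g.svX q' ?tv \<in> ?GS"
    using q'(2) by (intro p.span_base g.span_base, blast)+
   hence "?sp c (p.svX q' ?u) + x \<in> ?PS"
    "fscale s2 c (g.svX q' ?tv) + fst x \<in> ?GS"
    using x by (intro p.span_add p.span_scale g.span_add g.span_scale; blast)+
   moreover have "fst (?sp c (p.svX q' ?u) + x) = fscale s2 c (g.svX q' ?tv) + fst x" "snd (?sp c (p.svX q' ?u) + x) = s3 c y + w"
    by (simp_all only: sp prod.case fst_add snd_add fst_conv snd_conv x(2) q'(1))
   ultimately show ?case by (intro exI[of _ "?sp c (p.svX q' ?u) + x"] conjI) (simp_all only:)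
  qed
  from this[OF mem] obtain x where x: "x \<in> ?PS" "snd x = r3.svX ?Q v3"
   "fst x \<in> ?GS" by blast
  define w where "w = p.svX ?Q ?u - x"
  have svc: "p.svX q ?u \<in> p.clos (?I \<times> ?I) {?u}" for q
  proof -
   have "pbw (trop ?P) L q ?u \<in> p.clos (?I \<times> ?I) {?u}" if "set L \<subseteq> set ?tr" for L q
    using that
   proof (induction L)
    case Nil
    thus ?case by (simp add: p.clos.base)
   next
    case (Cons r L)
    then obtain i j where ij: "i \<in> ?I" "j \<in> ?I" "\<And>u. trop ?P r u = ?P i j u" using p.trop_idx[of r] by auto
    have "trop ?P r = ?P i j" using ij(3) by (rule ext)
    thus ?case using Cons p.stab_funpow[OF p.stab_clos, of i j "?I \<times> ?I" _ "{?u}" "q r"] ij(1,2) by simp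
   qed
   thus ?thesis unfolding p.svX_pbw by blast
  qed
  have "?PS \<subseteq> p.clos (?I \<times> ?I) {?u}"
   by (rule p.span_minimal[OF _ p.subspace_clos]) (use svc in blast)
  hence wc: "w \<in> p.clos (?I \<times> ?I) {?u}" unfolding w_def using x(1) svc by (intro p.subspace_diff[OF p.subspace_clos]) auto
  have w3: "snd w = 0" unfolding w_def using x(2) by (simp add: sp)
  \<comment> \<open>Otherwise irreducibility would put \<open>?u\<close> into the module generated
    by \<open>w\<close>, all of whose second components vanish.\<close>
  have "w = 0"
  proof (rule ccontr)
   assume "w \<noteq> 0"
   moreover have "?u \<noteq> 0" using v3(3) by (simp add: zero_prod_def)
   ultimately have uw: "?u \<in> p.clos (?I \<times> ?I) {w}" using p.hw_cyclic_irreducible[OF hw _ wc _ nil] by blast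
   have "p.stab (?I \<times> ?I) {x. snd x = 0}"
    by (auto simp: p.stab_def p.subspace_def)
   hence "p.clos (?I \<times> ?I) {w} \<subseteq> {x. snd x = 0}" using w3 by (intro p.clos_least) auto
   thus False using uw v3(3) by auto
  qed
  hence "x = p.svX ?Q ?u" unfolding w_def by simp
  hence "fst x = g.svX ?Q ?tv" by (simp only: sp fst_conv)
  thus False using x(3) et unfolding g.ess_def by simp
 qed
qed

section \<open>The cone of patterns\<close>

lemma relD_add: "relD r \<mu> a b ==> relD r \<nu> c d ==> relD r (%k. \<mu> k + \<nu> k) (%k. a k + c k) (%k. b k + d k)"
 unfolding relD_def by (elim conjE, intro conjI allI impI; (drule spec, drule (1) mp)+; linarith)

lemma relB_add: "relB r \<mu> a ==> relB r \<nu> c ==> relB r (%k. \<mu> k + \<nu> k) (%k. a k + c k)"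
 unfolding relB_def by (elim conjE, intro conjI allI impI; fastforce)

lemma patD_zero [simp]: "patD r \<mu> (q(0 := z)) = patD r \<mu> q"
 by (induction r arbitrary: \<mu>) simp_all

lemma patD_add: "patD r \<mu> p ==> patD r \<nu> q ==> patD r (%k. \<mu> k + \<nu> k) (%m s i. p m s i + q m s i)"
proof (induction r arbitrary: \<mu> \<nu>)
 case (Suc r)
 have "patD r (%j. (\<mu> j - p (Suc r) False j - p (Suc r) True j) + (\<nu> j - q (Suc r) False j - q (Suc r) True j)) (%m s i. p m s i + q m s i)"
  by (rule Suc.IH) (use Suc.prems in simp_all)
 thus ?case using Suc.prems relD_add by (simp add: algebra_simps)
qed simp

lemma relD_scale: "c \<ge> 0 ==> relD r \<mu> a b ==> relD r (%k. c * \<mu> k) (%k. c * a k) (%k. c * b k)"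
 unfolding relD_def by (simp add: right_diff_distrib[symmetric] distrib_left[symmetric] mult_left_mono)

lemma patD_scale: "c \<ge> 0 ==> patD r \<mu> q ==> patD r (%k. c * \<mu> k) (%m s i. c * q m s i)"
proof (induction r arbitrary: \<mu>)
 case (Suc r)
 have "patD r (%j. c * (\<mu> j - q (Suc r) False j - q (Suc r) True j)) (%m s i. c * q m s i)"
  by (rule Suc.IH) (use Suc.prems in simp_all)
 thus ?case using Suc.prems relD_scale by (simp add: algebra_simps)
qed simp

lemma patX_add:
 assumes "patX X n \<mu> p" "patX X n \<nu> q"
 shows "patX X n (%k. \<mu> k + \<nu> k) (%m s i. p m s i + q m s i)"
proof (cases X)
 case TypeB
 have "patD n (%j. (\<mu> j - p 0 True j) + (\<nu> j - q 0 True j)) (%m s i. p m s i + q m s i)"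
  by (rule patD_add) (use assms TypeB in simp_all)
 moreover have "relB n (%k. \<mu> k + \<nu> k) (%i. p 0 True i + q 0 True i)"
  using assms by (intro relB_add) (simp_all add: TypeB)
 ultimately show ?thesis by (simp add: TypeB algebra_simps)
qed (use assms patD_add in simp)

lemma patX_scale:
 assumes "c \<ge> 0" "patX X n \<mu> q"
 shows "patX X n (%k. c * \<mu> k) (%m s i. c * q m s i)"
proof (cases X)
 case TypeB
 have "patD n (%j. c * (\<mu> j - q 0 True j)) (%m s i. c * q m s i)"
  by (rule patD_scale) (use assms TypeB in simp_all)
 moreover have "relB n (%k. c * \<mu> k) (%i. c * q 0 True i)"
 proof -
  have rel: "relB n \<mu> (q 0 True)" using assms(2) by (simp add: TypeB)
  have "c * q 0 True n <= c * (2 * \<mu> n)" using rel assms(1) unfolding relB_def by (intro mult_left_mono) auto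
  hence "c * q 0 True n <= 2 * (c * \<mu> n)" by simp
  thus ?thesis using rel assms(1) unfolding relB_def right_diff_distrib[symmetric] by (simp add: mult_left_mono)
 qed
 ultimately show ?thesis by (simp add: TypeB right_diff_distrib)
qed (use assms patD_scale in simp)

text \<open>
 A row \<open>\<mu>\<close> and the row \<open>\<kappa>\<close> below it, with \<open>\<nu>\<close> between them.
\<close>

definition inter :: "nat => (nat => rat) => (nat => rat) => (nat => rat) => bool" where
 "inter r \<mu> \<nu> \<kappa> \<longleftrightarrow> (\<forall>k. 1 <= k \<and> k <= r --> \<kappa> k <= \<nu> k \<and> \<nu> k <= \<mu> k) \<and>
   (\<forall>k. 1 <= k \<and> k < r --> \<mu> (Suc k) <= \<nu> k \<and> \<nu> (Suc k) <= \<kappa> k) \<and>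
   (1 <= r --> - \<mu> (Suc r) <= \<nu> r \<and> \<nu> r - \<kappa> r <= \<mu> r - \<mu> (Suc r)) \<and>
   (2 <= r --> \<mu> (Suc r) + \<nu> r - \<kappa> r <= \<kappa> (r - 1))"

lemma relD_inter: "relD r \<mu> (%k. \<nu> k - \<kappa> k) (%k. \<mu> k - \<nu> k) \<longleftrightarrow> inter r \<mu> \<nu> \<kappa>"
 unfolding relD_def inter_def by (auto simp: algebra_simps)

text \<open>A monotone map preserves the comparisons of single entries. The conditions on the last
  entry of the middle row involve a negative or a sum of entries, so this entry is chosen
  separately, with \<open>M\<close> as its upper bound.\<close>

lemma inter_map:
 fixes \<phi> :: "rat => rat"
 assumes i: "inter r \<mu> \<nu> \<kappa>" and m: "\<And>x y. x <= y ==> \<phi> x <= \<phi> y"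
  and n: "\<And>k. 1 <= k ==> k < r ==> \<nu>' k = \<phi> (\<nu> k)"
  and y: "1 <= r ==> - \<phi> (\<mu> (Suc r)) <= \<nu>' r" "1 <= r ==> \<phi> (\<kappa> r) <= \<nu>' r"
   "1 <= r ==> \<nu>' r <= \<phi> M" "1 <= r ==> \<nu>' r <= \<phi> M + \<phi> (\<kappa> r) - \<phi> (\<mu> (Suc r))"
  and M: "M <= \<mu> r" "2 <= r ==> M <= \<kappa> (r - 1)"
 shows "inter r (%k. \<phi> (\<mu> k)) \<nu>' (%k. \<phi> (\<kappa> k))"
 unfolding inter_def
proof (intro conjI allI impI; (elim conjE)?)
 fix k assume k: "1 <= k" "k <= r"
 show "\<phi> (\<kappa> k) <= \<nu>' k" and "\<nu>' k <= \<phi> (\<mu> k)"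
  using k i n[of k] m y m[OF M(1)] by (cases "k = r"; force simp: inter_def)+
next
 fix k assume k: "1 <= k" "k < r"
 show "\<phi> (\<mu> (Suc k)) <= \<nu>' k" using k i n[of k] m by (simp add: inter_def)
 show "\<nu>' (Suc k) <= \<phi> (\<kappa> k)"
 proof (cases "Suc k = r")
  case True
  hence "M <= \<kappa> k" using M(2) k by auto
  thus ?thesis using m[of M "\<kappa> k"] y(3) True by force
 next
  case False
  thus ?thesis using k i n[of "Suc k"] m by (simp add: inter_def)
 qed
next
 assume "1 <= r"
 thus "- \<phi> (\<mu> (Suc r)) <= \<nu>' r" "\<nu>' r - \<phi> (\<kappa> r) <= \<phi> (\<mu> r) - \<phi> (\<mu> (Suc r))"
  using y(1,4) m[OF M(1)] by auto
next
 assume "2 <= r"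
 thus "\<phi> (\<mu> (Suc r)) + \<nu>' r - \<phi> (\<kappa> r) <= \<phi> (\<kappa> (r - 1))"
  using y(4) m[OF M(2)] by auto
qed

text \<open>Monotone and odd, because rows are compared with entries and with negatives of entries.
  For entries in h plus the integers, \<open>f\<close> stays in this class and \<open>g\<close>
  becomes integral.\<close>

locale row_split =
 fixes f g :: "rat => rat" and h :: rat
 assumes fm: "x <= y ==> f x <= f y" and gm: "x <= y ==> g x <= g y"
  and fo: "f (- x) = - f x" and go: "g (- x) = - g x" and fg: "f x + g x = x"
  and h: "2 * h \<in> \<int>" and fh: "x - h \<in> \<int> ==> f x - h \<in> \<int>"
begin

lemma gh: "x - h \<in> \<int> ==> g x \<in> \<int>"
 using Ints_diff[OF _ fh[of x], of "x - h"] fg[of x] by (simp add: add_diff_eq[symmetric] eq_diff_eq[symmetric] add.commute)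

text \<open>The interval conditions on the last entry of the middle row are compatible with the splitting.\<close>

lemma split_last:
 assumes x: "- p <= x" "R <= x" "x <= M" "x <= M + R - p"
  and i: "x - h \<in> \<int>" "p - h \<in> \<int>" "R - h \<in> \<int>" "M - h \<in> \<int>"
 shows "\<exists>y. y - h \<in> \<int> \<and> - f p <= y \<and> f R <= y \<and> y <= f M \<and> y <= f M + f R - f p \<and>
  - g p <= x - y \<and> g R <= x - y \<and> x - y <= g M \<and> x - y <= g M + g R - g p"
proof -
 \<comment> \<open>The least value allowed by the lower bounds of the first part and the upper
   bounds of the second.\<close>
 define y where "y = max (max (- f p) (f R)) (x - min (g M) (g M + g R - g p))"
 have sp: "p = f p + g p" and sR: "R = f R + g R" and sM: "M = f M + g M" using fg by simp_all
 have a: "- f p <= f M" "- g p <= g M" using fm[of "- p" M] gm[of "- p" M] x by (simp_all add: fo go)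
 have b: "f R <= f M" "g R <= g M" using fm[of R M] gm[of R M] x by simp_all
 have c: "- f R <= f M" "- g R <= g M" using fm[of "- R" M] gm[of "- R" M] x by (simp_all add: fo go)
 have d: "f p <= f M" "g p <= g M" using fm[of p M] gm[of p M] x by simp_all
 \<comment> \<open>Both parts order \<open>- p\<close> and \<open>R\<close> in the same way as the
   originals, so a mixed lower bound is dominated by - p or by R.\<close>
 have e: "- f p + g R <= x \<and> f R - g p <= x"
 proof (cases "- p <= R")
  case True
  hence "- f p <= f R" "- g p <= g R" using fm[OF True] gm[OF True] by (simp_all add: fo go)
  thus ?thesis using x sR by linarith
 next
  case False
  hence "f R <= - f p" "g R <= - g p" using fm[of R "- p"] gm[of R "- p"] by (simp_all add: fo go)
  thus ?thesis using x sp by linarith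
 qed
 have e': "x <= M + g R - g p \<and> x <= M + f R - f p"
 proof (cases "p <= R")
  case True
  thus ?thesis using fm[OF True] gm[OF True] x by linarith
 next
  case False
  hence "f R <= f p" "g R <= g p" using fm[of R p] gm[of R p] by simp_all
  thus ?thesis using x sp sR by linarith
 qed
 have "y - h \<in> \<int>"
 proof -
  have "- (f p - h) - 2 * h = - f p - h" by simp
  hence "- f p - h \<in> \<int>" using Ints_diff[OF Ints_minus[OF fh[OF i(2)]] h] by (simp only:)
  moreover have "f R - h \<in> \<int>" using fh[OF i(3)] .
  moreover have "min (g M) (g M + g R - g p) \<in> \<int>" using gh[OF i(2)] gh[OF i(3)] gh[OF i(4)] by (simp add: min_def)
  hence "x - h - min (g M) (g M + g R - g p) \<in> \<int>" by (rule Ints_diff[OF i(1)])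
  moreover have "x - h - min (g M) (g M + g R - g p) = x - min (g M) (g M + g R - g p) - h" by simp
  ultimately show ?thesis unfolding y_def by (simp only: max_def split: if_split) blast
 qed
 moreover have lo: "- f p <= y" "f R <= y" "x - min (g M) (g M + g R - g p) <= y"
  unfolding y_def by (simp_all only: max.cobounded2 le_max_iff_disj order_refl simp_thms)
 moreover have up: "y <= z" if "- f p <= z" "f R <= z" "x - g M <= z" "x - (g M + g R - g p) <= z" for z
  using that unfolding y_def by (simp add: min_def)
 have "y <= f M" "y <= f M + f R - f p" "y <= x + g p" "y <= x - g R"
  by (rule up; use a b c d e e' x sp sR sM in linarith)+
 moreover have "x - y <= g M" "x - y <= g M + g R - g p"
  using lo(3) min.cobounded1[of "g M" "g M + g R - g p"] min.cobounded2[of "g M" "g M + g R - g p"] by linarith+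
 moreover have "- g p <= x - y" "g R <= x - y" using \<open>y <= x + g p\<close> \<open>y <= x - g R\<close> by linarith+
 ultimately show ?thesis by blast
qed

text \<open>With the middle row \<nu> and the next row \<kappa> the inequalities become interlacing
  conditions. The rows \<mu> and \<kappa> are split by \<open>f\<close> itself, so the splitting
  continues with the next row; only the last entry of \<nu> is adjusted.\<close>

lemma split_relD:
 assumes rel: "relD r \<mu> a b" and i: "\<And>k. 1 <= k ==> k <= Suc r ==> \<mu> k - h \<in> \<int>"
  "\<And>k. 1 <= k ==> k <= r ==> a k \<in> \<int> \<and> b k \<in> \<int>"
 shows "\<exists>a' b'. relD r (%k. f (\<mu> k)) a' b' \<and> relD r (%k. g (\<mu> k)) (%k. a k - a' k) (%k. b k - b' k) \<and>
  (\<forall>k. 1 <= k \<and> k <= r --> a' k \<in> \<int> \<and> b' k \<in> \<int> \<and> f (\<mu> k) - a' k - b' k = f (\<mu> k - a k - b k))"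
proof -
 define \<nu> where "\<nu> = (%k. \<mu> k - b k)"
 define \<kappa> where "\<kappa> = (%k. \<mu> k - a k - b k)"
 have ab: "a = (%k. \<nu> k - \<kappa> k)" "b = (%k. \<mu> k - \<nu> k)" by (simp_all add: \<nu>_def \<kappa>_def)
 have it: "inter r \<mu> \<nu> \<kappa>" using rel unfolding ab relD_inter .
 have in\<nu>: "\<nu> k - h \<in> \<int>" and in\<kappa>: "\<kappa> k - h \<in> \<int>" if "1 <= k" "k <= r" for k
 proof -
  have 1: "\<mu> k - h \<in> \<int>" "a k \<in> \<int>" "b k \<in> \<int>" using i that by auto
  have 2: "\<mu> k - h - b k \<in> \<int>" by (rule Ints_diff[OF 1(1,3)])
  have 3: "\<mu> k - h - b k - a k \<in> \<int>" by (rule Ints_diff[OF 2 1(2)])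
  have "\<mu> k - h - b k = \<nu> k - h" "\<mu> k - h - b k - a k = \<kappa> k - h" by (simp_all add: \<nu>_def \<kappa>_def)
  thus "\<nu> k - h \<in> \<int>" "\<kappa> k - h \<in> \<int>" using 2 3 by (simp_all only:)
 qed
 \<comment> \<open>The conditions bound the last entry of \<nu> by M and by M + \<kappa>_r -
   \<mu>_(r+1).\<close>
 define M where "M = (if 2 <= r then min (\<mu> r) (\<kappa> (r - 1)) else \<mu> r)"
 have M: "M <= \<mu> r" "2 <= r ==> M <= \<kappa> (r - 1)" by (simp_all add: M_def)
 have "\<exists>y. 1 <= r --> y - h \<in> \<int> \<and> - f (\<mu> (Suc r)) <= y \<and> f (\<kappa> r) <= y \<and> y <= f M \<and> y <= f M + f (\<kappa> r) - f (\<mu> (Suc r)) \<and>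
  - g (\<mu> (Suc r)) <= \<nu> r - y \<and> g (\<kappa> r) <= \<nu> r - y \<and> \<nu> r - y <= g M \<and> \<nu> r - y <= g M + g (\<kappa> r) - g (\<mu> (Suc r))"
 proof (cases "1 <= r")
  case True
  have "M - h \<in> \<int>" using i(1)[of r] in\<kappa>[of "r - 1"] True by (auto simp: M_def min_def)
  moreover have "\<nu> r <= M \<and> \<nu> r <= M + \<kappa> r - \<mu> (Suc r)"
  proof (cases "2 <= r")
   case r2: True
   have "\<forall>k. 1 <= k \<and> k < r --> \<nu> (Suc k) <= \<kappa> k" using it unfolding inter_def by blast
   from spec[OF this, of "r - 1"] have "\<nu> r <= \<kappa> (r - 1)" using r2 by simp
   moreover have "\<nu> r <= \<mu> r" "\<nu> r - \<kappa> r <= \<mu> r - \<mu> (Suc r)" "\<mu> (Suc r) + \<nu> r - \<kappa> r <= \<kappa> (r - 1)"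
    using it True r2 unfolding inter_def by auto
   ultimately show ?thesis using r2 unfolding M_def by simp
  next
   case False
   have "\<nu> r <= \<mu> r" "\<nu> r - \<kappa> r <= \<mu> r - \<mu> (Suc r)" using it True unfolding inter_def by auto
   thus ?thesis using False unfolding M_def by simp
  qed
  moreover have "- \<mu> (Suc r) <= \<nu> r" "\<kappa> r <= \<nu> r" using it True unfolding inter_def by auto
  moreover have "\<nu> r - h \<in> \<int>" "\<kappa> r - h \<in> \<int>" "\<mu> (Suc r) - h \<in> \<int>" using in\<nu> in\<kappa> i(1) True by auto
  ultimately show ?thesis using split_last[of "\<mu> (Suc r)" "\<nu> r" "\<kappa> r" M] by blast
 qed simp
 then obtain y where y: "1 <= r ==> y - h \<in> \<int>"
  "1 <= r ==> - f (\<mu> (Suc r)) <= y" "1 <= r ==> f (\<kappa> r) <= y" "1 <= r ==> y <= f M" "1 <= r ==> y <= f M + f (\<kappa> r) - f (\<mu> (Suc r))"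
  "1 <= r ==> - g (\<mu> (Suc r)) <= \<nu> r - y" "1 <= r ==> g (\<kappa> r) <= \<nu> r - y" "1 <= r ==> \<nu> r - y <= g M"
  "1 <= r ==> \<nu> r - y <= g M + g (\<kappa> r) - g (\<mu> (Suc r))" by blast
 define \<nu>' where "\<nu>' = (%k. if k = r then y else f (\<nu> k))"
 have gs: "g x = x - f x" for x using fg[of x] by linarith
 have "inter r (%k. f (\<mu> k)) \<nu>' (%k. f (\<kappa> k))"
  by (rule inter_map[OF it fm _ _ _ _ _ M]) (use y(2-5) in \<open>simp_all add: \<nu>'_def\<close>)
 hence 1: "relD r (%k. f (\<mu> k)) (%k. \<nu>' k - f (\<kappa> k)) (%k. f (\<mu> k) - \<nu>' k)" unfolding relD_inter .
 have "inter r (%k. g (\<mu> k)) (%k. \<nu> k - \<nu>' k) (%k. g (\<kappa> k))"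
  by (rule inter_map[OF it gm _ _ _ _ _ M]) (use y(6-9) in \<open>simp_all add: \<nu>'_def gs\<close>)
 hence "relD r (%k. g (\<mu> k)) (%k. (\<nu> k - \<nu>' k) - g (\<kappa> k)) (%k. g (\<mu> k) - (\<nu> k - \<nu>' k))" unfolding relD_inter .
 moreover have "(%k. (\<nu> k - \<nu>' k) - g (\<kappa> k)) = (%k. a k - (\<nu>' k - f (\<kappa> k)))" "(%k. g (\<mu> k) - (\<nu> k - \<nu>' k)) = (%k. b k - (f (\<mu> k) - \<nu>' k))"
  unfolding ab gs by auto
 ultimately have 2: "relD r (%k. g (\<mu> k)) (%k. a k - (\<nu>' k - f (\<kappa> k))) (%k. b k - (f (\<mu> k) - \<nu>' k))" by simp
 have "\<nu>' k - f (\<kappa> k) \<in> \<int> \<and> f (\<mu> k) - \<nu>' k \<in> \<int>" if k: "1 <= k" "k <= r" for k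
 proof -
  have "\<nu>' k - h \<in> \<int>" using y(1) fh[OF in\<nu>[OF k]] k by (auto simp: \<nu>'_def)
  moreover have "f (\<kappa> k) - h \<in> \<int>" "f (\<mu> k) - h \<in> \<int>" using fh in\<kappa>[OF k] i(1)[of k] k by auto
  ultimately have "(\<nu>' k - h) - (f (\<kappa> k) - h) \<in> \<int>" "(f (\<mu> k) - h) - (\<nu>' k - h) \<in> \<int>" by (blast intro: Ints_diff)+
  thus ?thesis by simp
 qed
 thus ?thesis using 1 2 by (intro exI conjI) (auto simp: \<kappa>_def)
qed

lemma split_patD:
 assumes "patD m \<mu> q" "\<And>k. 1 <= k ==> k <= m ==> \<mu> k - h \<in> \<int>"
  "\<And>j s k. 1 <= j ==> j <= m ==> 1 <= k ==> k < j ==> q j s k \<in> \<int>"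
 shows "\<exists>q'. patD m (%k. f (\<mu> k)) q' \<and> patD m (%k. g (\<mu> k)) (%j s k. q j s k - q' j s k) \<and>
  (\<forall>j s k. 1 <= j \<and> j <= m \<and> 1 <= k \<and> k < j --> q' j s k \<in> \<int>)"
 using assms
proof (induction m arbitrary: \<mu>)
 case (Suc r)
 let ?a = "q (Suc r) False" and ?b = "q (Suc r) True"
 let ?\<kappa> = "%k. \<mu> k - ?a k - ?b k"
 have rel: "relD r \<mu> ?a ?b" and pat: "patD r ?\<kappa> q" using Suc.prems(1) by simp_all
 have qi: "?a k \<in> \<int> \<and> ?b k \<in> \<int>" if "1 <= k" "k <= r" for k using Suc.prems(3) that by simp
 obtain a' b' where ab: "relD r (%k. f (\<mu> k)) a' b'" "relD r (%k. g (\<mu> k)) (%k. ?a k - a' k) (%k. ?b k - b' k)"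
  "\<And>k. 1 <= k ==> k <= r ==> a' k \<in> \<int> \<and> b' k \<in> \<int> \<and> f (\<mu> k) - a' k - b' k = f (?\<kappa> k)"
  using split_relD[OF rel Suc.prems(2) qi] by blast
 have ki: "?\<kappa> k - h \<in> \<int>" if k: "1 <= k" "k <= r" for k
 proof -
  have "\<mu> k - h - ?a k - ?b k \<in> \<int>" using qi[OF k] Suc.prems(2)[of k] k by (intro Ints_diff[of "_ - _"]) auto
  moreover have "\<mu> k - h - ?a k - ?b k = ?\<kappa> k - h" by simp
  ultimately show ?thesis by (simp only:)
 qed
 have qr: "q j s k \<in> \<int>" if "1 <= j" "j <= r" "1 <= k" "k < j" for j s k
  by (rule Suc.prems(3)) (use that in auto)
 obtain q' where q': "patD r (%k. f (?\<kappa> k)) q'"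
  "patD r (%k. g (?\<kappa> k)) (%j s k. q j s k - q' j s k)"
  "\<And>j s k. 1 <= j ==> j <= r ==> 1 <= k ==> k < j ==> q' j s k \<in> \<int>"
  using Suc.IH[OF pat ki qr] by blast
 define p where "p = q'(Suc r := %s. if s then b' else a')"
 have pS: "p (Suc r) False = a'" "p (Suc r) True = b'" and pr: "j <= r ==> p j = q' j" for j by (simp_all add: p_def)
 have gs: "g x = x - f x" for x using fg[of x] by linarith
 have "patD r (%j. f (\<mu> j) - a' j - b' j) p = patD r (%k. f (?\<kappa> k)) q'"
  by (rule patD_cong) (use ab(3) pr in simp_all)
 hence "patD (Suc r) (%k. f (\<mu> k)) p" using ab(1) q'(1) by (simp add: pS)
 moreover have "patD r (%j. g (\<mu> j) - (?a j - a' j) - (?b j - b' j)) (%j s k. q j s k - p j s k) = patD r (%k. g (?\<kappa> k)) (%j s k. q j s k - q' j s k)"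
  by (rule patD_cong) (use ab(3) pr in \<open>simp_all add: gs\<close>, force)
 hence "patD (Suc r) (%k. g (\<mu> k)) (%j s k. q j s k - p j s k)" using ab(2) q'(2) by (simp add: pS)
 moreover have "p j s k \<in> \<int>" if "1 <= j \<and> j <= Suc r \<and> 1 <= k \<and> k < j" for j s k
 proof (cases "j = Suc r")
  case True
  thus ?thesis using ab(3)[of k] that by (simp add: p_def)
 next
  case False
  thus ?thesis using q'(3) that by (simp add: p_def)
 qed
 ultimately show ?case by blast
qed simp

lemma split_patX:
 assumes p: "patX X n \<mu> q" and i: "\<And>k. 1 <= k ==> k <= n ==> \<mu> k - h \<in> \<int>"
  "\<And>j s k. (j, s, k) \<in> tris X n ==> q j s k \<in> \<int>"
 shows "\<exists>q'. patX X n (%k. f (\<mu> k)) q' \<and> patX X n (%k. g (\<mu> k)) (%j s k. q j s k - q' j s k) \<and>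
  (\<forall>j s k. (j, s, k) \<in> tris X n --> q' j s k \<in> \<int>)"
proof (cases X)
 case TypeD
 thus ?thesis using split_patD[of n \<mu> q] p i by (simp add: in_tri_list)
next
 case TypeB
 let ?c = "q 0 True"
 let ?\<kappa> = "%j. \<mu> j - ?c j"
 have rel: "relB n \<mu> ?c" and pat: "patD n ?\<kappa> q" using p by (simp_all add: TypeB)
 have ci: "?c k \<in> \<int>" if "1 <= k" "k <= n" for k using i(2) that by (simp add: in_tri_list TypeB)
 have ki: "?\<kappa> k - h \<in> \<int>" if k: "1 <= k" "k <= n" for k
 proof -
  have "\<mu> k - h - ?c k = ?\<kappa> k - h" by simp
  thus ?thesis using Ints_diff[OF i(1)[OF k] ci[OF k]] by (simp only:)
 qed
 have qr: "q j s k \<in> \<int>" if "1 <= j" "j <= n" "1 <= k" "k < j" for j s k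
  by (rule i(2)) (use that in \<open>simp add: in_tri_list\<close>)
 obtain q' where q': "patD n (%k. f (?\<kappa> k)) q'"
  "patD n (%k. g (?\<kappa> k)) (%j s k. q j s k - q' j s k)"
  "\<And>j s k. 1 <= j ==> j <= n ==> 1 <= k ==> k < j ==> q' j s k \<in> \<int>"
  using split_patD[OF pat ki qr] by blast
 have gs: "g x = x - f x" for x using fg[of x] by linarith
 define c' where "c' = (%k. f (\<mu> k) - f (?\<kappa> k))"
 define p where "p = q'(0 := %_. c')"
 \<comment> \<open>Here nothing has to be chosen: there is no middle row, and interlacing is
   preserved by monotone odd maps.\<close>
 have rB: "relB n (%k. \<phi> (\<mu> k)) (%k. \<phi> (\<mu> k) - \<phi> (?\<kappa> k))" if m: "\<And>x y. x <= y ==> \<phi> x <= \<phi> y" and o: "\<And>x. \<phi> (- x) = - \<phi> x" for \<phi> :: "rat => rat"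
 proof -
  have "\<phi> (?\<kappa> k) <= \<phi> (\<mu> k)" if "1 <= k" "k <= n" for k using rel that by (intro m) (simp add: relB_def)
  moreover have "\<phi> (\<mu> (Suc k)) <= \<phi> (?\<kappa> k)" if "1 <= k" "k < n" for k
   using rel that unfolding relB_def by (intro m) force
  moreover have "\<phi> (- \<mu> n) <= \<phi> (?\<kappa> n)" using rel by (intro m) (simp add: relB_def)
  ultimately show ?thesis unfolding relB_def o by (auto simp: algebra_simps)
 qed
 have ep: "patD n (%j. f (\<mu> j) - p 0 True j) p = patD n (%k. f (?\<kappa> k)) q'"
  unfolding p_def patD_zero by (rule patD_cong) (simp_all add: c'_def)
 have pf: "patX X n (%k. f (\<mu> k)) p"
 proof -
  have "relB n (%k. f (\<mu> k)) (p 0 True)" using rB[of f, OF fm fo] by (simp add: p_def c'_def)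
  thus ?thesis unfolding TypeB patX.simps ep using q'(1) by blast
 qed
 have pd: "(%j s k. q j s k - p j s k) = (%j s k. q j s k - q' j s k)(0 := %s k. q 0 s k - c' k)"
  by (auto simp: fun_eq_iff p_def)
 have eg: "patD n (%j. g (\<mu> j) - (?c j - p 0 True j)) (%j s k. q j s k - p j s k) = patD n (%k. g (?\<kappa> k)) (%j s k. q j s k - q' j s k)"
  unfolding pd patD_zero by (rule patD_cong) (simp_all add: p_def c'_def gs)
 have pg: "patX X n (%k. g (\<mu> k)) (%j s k. q j s k - p j s k)"
 proof -
  have "(%k. ?c k - p 0 True k) = (%k. g (\<mu> k) - g (?\<kappa> k))" by (simp add: p_def c'_def gs fun_eq_iff)
  hence "relB n (%k. g (\<mu> k)) (%k. ?c k - p 0 True k)" using rB[of g, OF gm go] by simp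
  thus ?thesis unfolding TypeB patX.simps eg using q'(2) by blast
 qed
 have "p j s k \<in> \<int>" if "(j, s, k) \<in> tris X n" for j s k
 proof (cases "j = 0")
  case True
  hence k: "1 <= k" "k <= n" using that by (auto simp: in_tri_list)
  have "(f (\<mu> k) - h) - (f (?\<kappa> k) - h) \<in> \<int>"
   by (rule Ints_diff[OF fh[OF i(1)[OF k]] fh[OF ki[OF k]]])
  thus ?thesis by (simp add: p_def c'_def True)
 next
  case False
  thus ?thesis using q'(3) that by (auto simp: in_tri_list p_def)
 qed
 with pf pg show ?thesis by blast
qed

end

definition clamp :: "rat => rat => rat" where
 "clamp h x = max (- h) (min h x)"

lemma row_split_clamp:
 assumes "h = 1 \<or> h = 1/2"
 shows "row_split (clamp h) (%x. x - clamp h x) h"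
proof
 have h: "h \<ge> 0" using assms by auto
 show h2: "2 * h \<in> \<int>" using assms by (elim disjE; hypsubst; simp)
 fix x y :: rat
 show "x <= y ==> clamp h x <= clamp h y" "x <= y ==> x - clamp h x <= y - clamp h y"
  "clamp h (- x) = - clamp h x" "- x - clamp h (- x) = - (x - clamp h x)" "clamp h x + (x - clamp h x) = x"
  using h by (auto simp: clamp_def max_def min_def)
 assume x: "x - h \<in> \<int>"
 have "- h - h \<in> \<int>" using Ints_minus[OF h2] by simp
 thus "clamp h x - h \<in> \<int>" using x by (auto simp: clamp_def max_def min_def)
qed

lemma patX_zero:
 assumes "patX X n \<mu> q" "\<And>k. 1 <= k ==> k <= n ==> \<mu> k = 0" "(j, s, k) \<in> tris X n"
 shows "q j s k = 0"
proof -
 have D: "q j s k = 0" if "patD m \<mu> q" "\<And>k. 1 <= k ==> k <= m ==> \<mu> k = 0" "1 <= j" "j <= m" "1 <= k" "k < j" for m \<mu> and j k :: nat and s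
  using that
 proof (induction m arbitrary: \<mu>)
  case (Suc r)
  let ?a = "q (Suc r) False" and ?b = "q (Suc r) True"
  have rel: "relD r \<mu> ?a ?b" using Suc.prems(1) by simp
  have mu: "\<mu> k = 0" if "1 <= k" "k <= Suc r" for k using Suc.prems(2) that by blast
  have b0: "?b k = 0" if k: "1 <= k" "k <= r" for k
   using rel k mu[of k] mu[of "Suc k"] unfolding relD_def by (cases "k = r") force+
  have a0: "?a k = 0" if k: "1 <= k" "k <= r" for k
   using rel k mu[of k] mu[of "Suc k"] b0[of k] b0[of "Suc k"] unfolding relD_def by (cases "k = r") force+
  show ?case
  proof (cases "j = Suc r")
   case True
   thus ?thesis using a0[of k] b0[of k] Suc.prems(5,6) by (cases s) auto
  next
   case False
   have "patD r (%j. \<mu> j - ?a j - ?b j) q" using Suc.prems(1) by simp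
   thus ?thesis by (rule Suc.IH) (use Suc.prems False mu a0 b0 in auto)
  qed
 qed simp
 show ?thesis
 proof (cases X)
  case TypeD
  thus ?thesis using D[of n \<mu> j k s] assms by (simp add: in_tri_list)
 next
  case TypeB
  have rel: "relB n \<mu> (q 0 True)" using assms(1) by (simp add: TypeB)
  have c0: "q 0 True k = 0" if k: "1 <= k" "k <= n" for k
   using rel k assms(2)[of k] assms(2)[of "Suc k"] unfolding relB_def by (cases "k = n") force+
  show ?thesis
  proof (cases "j = 0")
   case True
   thus ?thesis using c0 assms(3) by (auto simp: in_tri_list)
  next
   case False
   have "patD n (%j. \<mu> j - q 0 True j) q" using assms(1) by (simp add: TypeB)
   thus ?thesis by (rule D) (use assms(2,3) c0 False in \<open>auto simp: in_tri_list\<close>)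
  qed
 qed
qed

section \<open>The matrix Lie algebras\<close>

text \<open>The row or column of the matrices that belongs to an index.\<close>

definition pos :: "lie_type => nat => int => nat" where
 "pos X n i = (if i > 0 then nat i - 1 else if i = 0 then n else so_dim X n - nat (- i))"

text \<open>The matrix E(i,j) - E(-j,-i).\<close>

definition Fm :: "lie_type => nat => int => int => complex mat" where
 "Fm X n i j = mat (so_dim X n) (so_dim X n) (%(x, y). of_bool (x = pos X n i \<and> y = pos X n j) - of_bool (x = pos X n (- j) \<and> y = pos X n (- i)))"

context
 fixes X :: lie_type and n :: nat
begin

abbreviation "Ix \<equiv> idx X n"
abbreviation "Mx \<equiv> carrier_mat (so_dim X n) (so_dim X n)"
abbreviation "Fx \<equiv> Fm X n"
abbreviation "ent A i j \<equiv> A $$ (pos X n i, pos X n j)"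

lemma bij_pos: "bij_betw (pos X n) (Ix) {0..<so_dim X n}"
proof (rule bij_betw_byWitness[where f' = "%x. if x < n then int x + 1 else if X = TypeB \<and> x = n then 0 else int x - int (so_dim X n)"])
 show "\<forall>i\<in>Ix. (if pos X n i < n then int (pos X n i) + 1 else if X = TypeB \<and> pos X n i = n then 0 else int (pos X n i) - int (so_dim X n)) = i"
  by (cases X) (auto simp: idx_def pos_def so_dim_def)
 show "\<forall>x\<in>{0..<so_dim X n}. pos X n (if x < n then int x + 1 else if X = TypeB \<and> x = n then 0 else int x - int (so_dim X n)) = x"
  by (cases X) (auto simp: pos_def so_dim_def nat_add_distrib nat_diff_distrib)
 show "pos X n ` Ix \<subseteq> {0..<so_dim X n}"
  by (cases X) (auto simp: idx_def pos_def so_dim_def)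
 show "(%x. if x < n then int x + 1 else if X = TypeB \<and> x = n then 0 else int x - int (so_dim X n)) ` {0..<so_dim X n} \<subseteq> Ix"
  by (cases X) (auto simp: idx_def so_dim_def)
qed

lemma pos_less: "i \<in> Ix ==> pos X n i < so_dim X n"
 using bij_pos by (auto simp: bij_betw_def)

lemma pos_eq: "i \<in> Ix ==> j \<in> Ix ==> pos X n i = pos X n j \<longleftrightarrow> i = j"
 using bij_pos by (auto simp: bij_betw_def inj_on_def)

lemma pos_uminus: "i \<in> Ix ==> pos X n (- i) = so_dim X n - 1 - pos X n i"
 by (cases X) (auto simp: idx_def pos_def so_dim_def)

lemma sum_pos: "(\<Sum>x = 0..<so_dim X n. f x) = (\<Sum>i\<in>Ix. f (pos X n i))"
 by (rule sum.reindex_bij_betw[OF bij_pos, symmetric])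

lemma mat_eqI:
 assumes "A \<in> Mx" "B \<in> Mx"
  and e: "\<And>i j. i \<in> Ix ==> j \<in> Ix ==> ent A i j = ent B i j"
 shows "A = B"
proof (rule eq_matI)
 fix x y assume "x < dim_row B" "y < dim_col B"
 hence "x \<in> pos X n ` Ix" "y \<in> pos X n ` Ix"
  using assms(2) bij_pos by (auto simp: bij_betw_def)
 thus "A $$ (x, y) = B $$ (x, y)" using e by auto
qed (use assms in auto)

lemma mult_entry:
 assumes "A \<in> Mx" "B \<in> Mx" "i \<in> Ix" "j \<in> Ix"
 shows "ent (A * B) i j = (\<Sum>k\<in>Ix. ent A i k * ent B k j)"
 using assms pos_less[OF assms(3)] pos_less[OF assms(4)] by (simp add: scalar_prod_def sum_pos)

text \<open>The antidiagonal form pairs the index i with - i, so the condition is skew symmetry with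
  respect to the antidiagonal.\<close>

lemma so_alg_iff:
 "A \<in> so_alg X n \<longleftrightarrow> A \<in> Mx \<and>
  (\<forall>i\<in>Ix. \<forall>j\<in>Ix. ent A (- j) (- i) = - ent A i j)"
proof (cases "A \<in> Mx")
 case A: True
 let ?d = "so_dim X n" and ?J = "antidiag_mat (so_dim X n)"
 have J: "?J \<in> Mx" by (simp add: antidiag_mat_def)
 have T: "transpose_mat A \<in> Mx" using A by simp
 have Je: "ent ?J i j = of_bool (j = - i)" if "i \<in> Ix" "j \<in> Ix" for i j
 proof -
  have "pos X n i + pos X n j + 1 = ?d \<longleftrightarrow> pos X n j = pos X n (- i)"
   using pos_uminus[OF that(1)] pos_less[OF that(1)] pos_less[OF that(2)] by linarith
  thus ?thesis using that pos_less[OF that(1)] pos_less[OF that(2)] pos_eq[OF that(2), of "- i"] by (simp add: antidiag_mat_def)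
 qed
 have e: "ent (transpose_mat A * ?J + ?J * A) (- i) j = ent A (- j) (- i) + ent A i j"
  if ij: "i \<in> Ix" "j \<in> Ix" for i j
 proof -
  have mi: "- i \<in> Ix" using ij by simp
  have "ent (transpose_mat A * ?J) (- i) j = (\<Sum>k\<in>Ix. ent A k (- i) * of_bool (k = - j))"
   unfolding mult_entry[OF T J mi ij(2)]
  proof (intro sum.cong refl)
   fix k assume k: "k \<in> Ix"
   have "of_bool (j = - k) = (of_bool (k = - j) :: complex)" by auto
   thus "ent (transpose_mat A) (- i) k * ent ?J k j = ent A k (- i) * of_bool (k = - j)"
    using A pos_less[OF mi] pos_less[OF k] by (simp add: Je[OF k ij(2)])
  qed
  also have "\<dots> = ent A (- j) (- i)"
   using ij by (simp add: of_bool_def if_distrib[of "(*) _"] cong: if_cong)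
  finally have 1: "ent (transpose_mat A * ?J) (- i) j = ent A (- j) (- i)" .
  have "ent (?J * A) (- i) j = (\<Sum>k\<in>Ix. if k = i then ent A k j else 0)"
   unfolding mult_entry[OF J A mi ij(2)] by (intro sum.cong refl) (use ij in \<open>simp add: Je\<close>)
  hence 2: "ent (?J * A) (- i) j = ent A i j" using ij by simp
  show ?thesis using A T J pos_less[OF mi] pos_less[OF ij(2)] 1 2 by simp
 qed
 have c: "transpose_mat A * ?J + ?J * A \<in> Mx" using A J by simp
 have "transpose_mat A * ?J + ?J * A = 0\<^sub>m ?d ?d \<longleftrightarrow>
  (\<forall>i\<in>Ix. \<forall>j\<in>Ix. ent (transpose_mat A * ?J + ?J * A) (- i) j = 0)"
 proof
  assume r: "\<forall>i\<in>Ix. \<forall>j\<in>Ix. ent (transpose_mat A * ?J + ?J * A) (- i) j = 0"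
  show "transpose_mat A * ?J + ?J * A = 0\<^sub>m ?d ?d"
  proof (rule mat_eqI[OF c zero_carrier_mat])
   fix i j assume ij: "i \<in> Ix" "j \<in> Ix"
   hence "ent (transpose_mat A * ?J + ?J * A) (- (- i)) j = 0" using r idx_uminus by blast
   thus "ent (transpose_mat A * ?J + ?J * A) i j = ent (0\<^sub>m ?d ?d) i j"
    using pos_less[OF ij(1)] pos_less[OF ij(2)] by simp
  qed
 next
  assume r: "transpose_mat A * ?J + ?J * A = 0\<^sub>m ?d ?d"
  show "\<forall>i\<in>Ix. \<forall>j\<in>Ix. ent (transpose_mat A * ?J + ?J * A) (- i) j = 0"
  proof (intro ballI)
   fix i j assume "i \<in> Ix" "j \<in> Ix"
   hence "pos X n (- i) < ?d" "pos X n j < ?d" using pos_less idx_uminus by blast+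
   thus "ent (transpose_mat A * ?J + ?J * A) (- i) j = 0" unfolding r by simp
  qed
 qed
 also have "\<dots> \<longleftrightarrow> (\<forall>i\<in>Ix. \<forall>j\<in>Ix. ent A (- j) (- i) = - ent A i j)"
  unfolding eq_neg_iff_add_eq_0 by (intro ball_cong refl) (simp only: e)
 finally show ?thesis using A unfolding so_alg_def Let_def by blast
qed (simp add: so_alg_def Let_def)

lemma Fm_carrier [simp]: "Fx i j \<in> Mx"
 by (simp add: Fm_def)

lemma Fm_entry:
 assumes "i \<in> Ix" "j \<in> Ix" "k \<in> Ix" "l \<in> Ix"
 shows "ent (Fx i j) k l = of_bool (k = i) * of_bool (l = j) - of_bool (k = - j) * of_bool (l = - i)"
proof -
 have m: "- i \<in> Ix" "- j \<in> Ix" using assms by simp_all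
 show ?thesis
  unfolding Fm_def index_mat(1)[OF pos_less[OF assms(3)] pos_less[OF assms(4)]] prod.case
   pos_eq[OF assms(3,1)] pos_eq[OF assms(4,2)] pos_eq[OF assms(3) m(2)] pos_eq[OF assms(4) m(1)] of_bool_conj ..
qed

lemma Fm_so: "i \<in> Ix ==> j \<in> Ix ==> Fx i j \<in> so_alg X n"
 unfolding so_alg_iff by (auto simp: Fm_entry minus_equation_iff)

lemma Fm_swap: "i \<in> Ix ==> j \<in> Ix ==> Fx (- j) (- i) = (- 1) \<cdot>\<^sub>m Fx i j"
 by (rule mat_eqI) (simp_all add: Fm_entry pos_less carrier_matD[OF Fm_carrier])

lemma Fm_mult:
 assumes A: "A \<in> Mx" and ij: "i \<in> Ix" "j \<in> Ix" "p \<in> Ix" "q \<in> Ix"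
 shows "ent (Fx i j * A) p q = of_bool (p = i) * ent A j q - of_bool (p = - j) * ent A (- i) q"
  and "ent (A * Fx i j) p q = of_bool (q = j) * ent A p i - of_bool (q = - i) * ent A p (- j)"
proof -
 have d: "(\<Sum>k\<in>Ix. of_bool (k = a) * f k) = (f a :: complex)" if "a \<in> Ix" for a f
  using that by (simp add: of_bool_def if_distrib[of "%x. x * _"] cong: if_cong)
 have m: "- i \<in> Ix" "- j \<in> Ix" using ij by simp_all
 have "ent (Fx i j * A) p q = (\<Sum>k\<in>Ix. of_bool (k = j) * (of_bool (p = i) * ent A k q) - of_bool (k = - i) * (of_bool (p = - j) * ent A k q))"
  unfolding mult_entry[OF Fm_carrier A ij(3,4)] by (intro sum.cong refl) (use ij in \<open>simp add: Fm_entry algebra_simps\<close>)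
 thus "ent (Fx i j * A) p q = of_bool (p = i) * ent A j q - of_bool (p = - j) * ent A (- i) q"
  unfolding sum_subtractf d[OF ij(2)] d[OF m(1)] .
 have "ent (A * Fx i j) p q = (\<Sum>k\<in>Ix. of_bool (k = i) * (of_bool (q = j) * ent A p k) - of_bool (k = - j) * (of_bool (q = - i) * ent A p k))"
  unfolding mult_entry[OF A Fm_carrier ij(3,4)] by (intro sum.cong refl) (use ij in \<open>simp add: Fm_entry algebra_simps\<close>)
 thus "ent (A * Fx i j) p q = of_bool (q = j) * ent A p i - of_bool (q = - i) * ent A p (- j)"
  unfolding sum_subtractf d[OF ij(1)] d[OF m(2)] .
qed

lemma Fm_bracket:
 assumes ij: "i \<in> Ix" "j \<in> Ix" "k \<in> Ix" "l \<in> Ix"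
 shows "lie_bracket (Fx i j) (Fx k l) = (of_bool (j = k) \<cdot>\<^sub>m Fx i l + (- of_bool (i = l)) \<cdot>\<^sub>m Fx k j)
  + ((- of_bool (i = - k)) \<cdot>\<^sub>m Fx (- j) l + of_bool (j = - l) \<cdot>\<^sub>m Fx k (- i))" (is "?L = ?R")
proof (rule mat_eqI)
 show "?L \<in> Mx" "?R \<in> Mx"
  unfolding lie_bracket_def by (simp_all add: carrier_matI carrier_matD[OF Fm_carrier])
 fix p q assume pq: "p \<in> Ix" "q \<in> Ix"
 note l = pos_less[OF pq(1)] pos_less[OF pq(2)]
 have L: "ent ?L p q = ent (Fx i j * Fx k l) p q - ent (Fx k l * Fx i j) p q"
  unfolding lie_bracket_def using l by (simp add: carrier_matD[OF Fm_carrier])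
 have R: "ent ?R p q = of_bool (j = k) * ent (Fx i l) p q - of_bool (i = l) * ent (Fx k j) p q
   - of_bool (i = - k) * ent (Fx (- j) l) p q + of_bool (j = - l) * ent (Fx k (- i)) p q"
  using l by (simp add: carrier_matD[OF Fm_carrier])
 have n: "(- j = l) = (j = - l)" "(- i = k) = (i = - k)" "(l = i) = (i = l)" "(k = j) = (j = k)" by auto
 show "ent ?L p q = ent ?R p q"
  unfolding L R Fm_mult[OF Fm_carrier ij(1,2) pq] using ij pq by (simp add: Fm_entry n algebra_simps)
qed

lemma so_alg_induct:
 assumes A: "A \<in> so_alg X n" and 0: "P (0\<^sub>m (so_dim X n) (so_dim X n))"
  and step: "\<And>i j c B. i \<in> Ix ==> j \<in> Ix ==> B \<in> so_alg X n ==> P B ==> P (c \<cdot>\<^sub>m Fx i j + B)"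
 shows "P A"
proof -
 let ?d = "so_dim X n"
 define a where "a i j = ent A i j" for i j
 have neg: "a (- j) (- i) = - a i j" if "i \<in> Ix" "j \<in> Ix" for i j
  using A that unfolding so_alg_iff a_def by blast
 have Ac: "A \<in> Mx" using A by (simp add: so_alg_iff)
 \<comment> \<open>\<open>A\<close> is built as the sum of \<open>a i j / 2\<close> times
   \<open>Fx i j\<close> over all pairs. The factor 1/2 compensates that (i, j) and (-j, -i) give
   the same contribution.\<close>
 have "\<exists>B. B \<in> so_alg X n \<and> P B \<and> (\<forall>p\<in>Ix. \<forall>q\<in>Ix. ent B p q =
   (\<Sum>(i, j)\<in>S. a i j / 2 * (of_bool (p = i) * of_bool (q = j) - of_bool (p = - j) * of_bool (q = - i))))"
  if "S \<subseteq> Ix \<times> Ix" for S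
 proof -
  have "finite S" by (rule finite_subset[OF that]) simp
  thus ?thesis using that
 proof (induction S rule: finite_induct)
  case empty
  have "0\<^sub>m ?d ?d \<in> so_alg X n" by (auto simp: so_alg_iff pos_less)
  thus ?case using 0 by (intro exI[of _ "0\<^sub>m ?d ?d"]) (simp add: pos_less)
 next
  case (insert ij S)
  obtain i j where e: "ij = (i, j)" "i \<in> Ix" "j \<in> Ix" using insert.prems by auto
  from insert obtain B where B: "B \<in> so_alg X n" "P B" "\<And>p q. p \<in> Ix ==> q \<in> Ix ==> ent B p q =
   (\<Sum>(i, j)\<in>S. a i j / 2 * (of_bool (p = i) * of_bool (q = j) - of_bool (p = - j) * of_bool (q = - i)))" by blast
  let ?B = "(a i j / 2) \<cdot>\<^sub>m Fx i j + B"
  have Bc: "B \<in> Mx" using B(1) by (simp add: so_alg_iff)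
  have ent: "ent ?B p q = a i j / 2 * ent (Fx i j) p q + ent B p q"
   if "p \<in> Ix" "q \<in> Ix" for p q
   using pos_less[OF that(1)] pos_less[OF that(2)] Bc by (simp add: carrier_matD[OF Fm_carrier])
  have "?B \<in> so_alg X n"
   using B(1) Fm_so[OF e(2,3)] unfolding so_alg_iff by (simp add: ent)
  moreover have "P ?B" by (rule step[OF e(2,3) B(1,2)])
  moreover have "ent ?B p q = (\<Sum>(i, j)\<in>insert ij S. a i j / 2 * (of_bool (p = i) * of_bool (q = j) - of_bool (p = - j) * of_bool (q = - i)))"
   if "p \<in> Ix" "q \<in> Ix" for p q
   unfolding sum.insert[OF insert.hyps] unfolding e(1) prod.case ent[OF that] B(3)[OF that] Fm_entry[OF e(2,3) that] ..
  ultimately show ?case by (intro exI[of _ ?B] conjI ballI) assumption+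
 qed
 qed
 from this[OF order_refl] obtain B where B: "B \<in> so_alg X n" "P B" "\<And>p q. p \<in> Ix ==> q \<in> Ix ==> ent B p q =
  (\<Sum>(i, j)\<in>Ix \<times> Ix. a i j / 2 * (of_bool (p = i) * of_bool (q = j) - of_bool (p = - j) * of_bool (q = - i)))"
  by blast
 have "B = A"
 proof (rule mat_eqI[OF _ Ac])
  show "B \<in> Mx" using B(1) by (simp add: so_alg_iff)
  fix p q assume pq: "p \<in> Ix" "q \<in> Ix"
  have d: "(\<Sum>(i, j)\<in>Ix \<times> Ix. f i j * (of_bool (x = i) * of_bool (y = j))) = (f x y :: complex)" if "x \<in> Ix" "y \<in> Ix" for x y f
  proof -
   have "(\<Sum>(i, j)\<in>Ix \<times> Ix. f i j * (of_bool (x = i) * of_bool (y = j))) = (\<Sum>z\<in>Ix \<times> Ix. if z = (x, y) then f x y else 0)"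
    by (intro sum.cong) auto
   thus ?thesis using that by simp
  qed
  have "ent B p q = (\<Sum>(i, j)\<in>Ix \<times> Ix. a i j / 2 * (of_bool (p = i) * of_bool (q = j)))
    - (\<Sum>(i, j)\<in>Ix \<times> Ix. a i j / 2 * (of_bool (- q = i) * of_bool (- p = j)))"
   unfolding B(3)[OF pq] sum_subtractf[symmetric]
   by (intro sum.cong refl) (auto simp: minus_equation_iff of_bool_def)
  also have "\<dots> = a p q / 2 - a (- q) (- p) / 2"
   using d[OF pq, of "%i j. a i j / 2"] d[of "- q" "- p" "%i j. a i j / 2"] pq by (simp only: idx_uminus)
  also have "\<dots> = a p q" using neg[OF pq] by simp
  finally show "ent B p q = ent A p q" by (simp add: a_def)
 qed
 with B(2) show ?thesis by simp
qed

lemma Fm_cartan: "k \<in> {1..n} ==> Fx (int k) (int k) \<in> cartan X n"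
proof -
 assume k: "k \<in> {1..n}"
 hence i: "int k \<in> Ix" by (intro idx_nonzero) auto
 have "diagonal_mat (Fx (int k) (int k))"
  unfolding diagonal_mat_def Fm_def using pos_uminus[OF i] by auto
 thus ?thesis using Fm_so[OF i i] by (simp add: cartan_def)
qed

lemma diag_pos: "i \<in> {1..n} ==> i - 1 = pos X n (int i)"
 by (simp add: pos_def)

lemma weight_eval_pos: "weight_eval n \<mu> H = (\<Sum>i = 1..n. of_rat (\<mu> i) * ent H (int i) (int i))"
 unfolding weight_eval_def by (intro sum.cong refl) (simp only: diag_pos)

lemma lie_bracket_carrier: "A \<in> carrier_mat d d ==> B \<in> carrier_mat d d ==> lie_bracket A B \<in> carrier_mat d d"
 unfolding lie_bracket_def by (intro minus_carrier_mat mult_carrier_mat)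

lemma weight_eval_Fm: "k \<in> {1..n} ==> weight_eval n \<mu> (Fx (int k) (int k)) = of_rat (\<mu> k)"
proof -
 assume k: "k \<in> {1..n}"
 have I: "int i \<in> Ix" if "i \<in> {1..n}" for i using that by (intro idx_nonzero) auto
 have "weight_eval n \<mu> (Fx (int k) (int k)) = (\<Sum>i = 1..n. if i = k then of_rat (\<mu> i) else 0)"
  unfolding weight_eval_pos
  by (intro sum.cong refl) (use k in \<open>auto simp: Fm_entry[OF I[OF k] I[OF k] I I]\<close>)
 thus ?thesis using k by simp
qed

lemma root_space_entry:
 assumes A: "A \<in> root_space X n \<alpha>" and k: "k \<in> {1..n}" and ij: "i \<in> Ix" "j \<in> Ix"
  and ne: "ent A i j \<noteq> 0"
 shows "\<alpha> k = ev i k - ev j k"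
proof -
 have Ac: "A \<in> Mx" using A by (simp add: root_space_def so_alg_iff)
 have kI: "int k \<in> Ix" using k by (intro idx_nonzero) auto
 let ?H = "Fx (int k) (int k)"
 have "lie_bracket ?H A = of_rat (\<alpha> k) \<cdot>\<^sub>m A"
  using A Fm_cartan[OF k] weight_eval_Fm[OF k] unfolding root_space_def by auto
 hence "ent (lie_bracket ?H A) i j = of_rat (\<alpha> k) * ent A i j"
  using Ac pos_less[OF ij(1)] pos_less[OF ij(2)] by simp
 moreover have "ent (lie_bracket ?H A) i j = ent (?H * A) i j - ent (A * ?H) i j"
  unfolding lie_bracket_def using Ac pos_less[OF ij(1)] pos_less[OF ij(2)] by (simp add: carrier_matD[OF Fm_carrier])
 moreover have "ent (?H * A) i j = of_rat (ev i k) * ent A i j"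
  unfolding Fm_mult(1)[OF Ac kI kI ij] by (auto simp: ev_def of_bool_def of_rat_diff)
 moreover have "ent (A * ?H) i j = of_rat (ev j k) * ent A i j"
  unfolding Fm_mult(2)[OF Ac kI kI ij] by (auto simp: ev_def of_bool_def of_rat_diff)
 ultimately have "(of_rat (ev i k) - of_rat (ev j k)) * ent A i j = of_rat (\<alpha> k) * ent A i j"
  by (simp add: left_diff_distrib)
 hence "(of_rat (ev i k - ev j k) :: complex) = of_rat (\<alpha> k)" using ne by (simp add: of_rat_diff)
 thus ?thesis by (simp only: of_rat_eq_iff)
qed

lemma ev_diff_inj:
 assumes eq: "ev a - ev b = ev i - ev j" and ab: "a \<noteq> b" "a \<noteq> - b"
 shows "i = a \<and> j = b \<or> i = - b \<and> j = - a"
proof -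
 have ext: "of_bool (a = x \<and> a \<noteq> 0) - of_bool (a = - x \<and> a \<noteq> 0) - (of_bool (b = x \<and> b \<noteq> 0) - of_bool (b = - x \<and> b \<noteq> 0)) =
   (of_bool (i = x \<and> i \<noteq> 0) - of_bool (i = - x \<and> i \<noteq> 0) - (of_bool (j = x \<and> j \<noteq> 0) - of_bool (j = - x \<and> j \<noteq> 0)) :: rat)" for x
  unfolding ext_ev[symmetric] ext_diff[symmetric] eq ..
 have A: "i = a \<or> j = - a" if "a \<noteq> 0"
  using ext[of a] ab that by (auto simp: of_bool_def split: if_splits)
 have B: "j = b \<or> i = - b" if "b \<noteq> 0"
  using ext[of b] ab that by (auto simp: of_bool_def split: if_splits)
 show ?thesis
 proof (cases "a = 0")
  case a0: True
  hence b0: "b \<noteq> 0" using ab by simp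
  from B[OF b0] show ?thesis
  proof
   assume "j = b"
   thus ?thesis using ext[of i] a0 b0 by (cases "i = 0") (auto simp: of_bool_def split: if_splits)
  next
   assume "i = - b"
   thus ?thesis using ext[of j] a0 b0 by (cases "j = 0") (auto simp: of_bool_def split: if_splits)
  qed
 next
  case a0: False
  show ?thesis
  proof (cases "b = 0")
   case True
   from A[OF a0] show ?thesis
   proof
    assume "i = a"
    thus ?thesis using ext[of j] a0 True by (cases "j = 0") (auto simp: of_bool_def split: if_splits)
   next
    assume "j = - a"
    thus ?thesis using ext[of i] a0 True by (cases "i = 0") (auto simp: of_bool_def split: if_splits)
   qed
  next
   case False
   thus ?thesis using A[OF a0] B ab by auto
  qed
 qed
qed

text \<open>Root spaces are lines because the indices of a root are determined up to (i, j) and (-j,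
  -i). Arbitrary root vectors are therefore multiples of the standard ones.\<close>

lemma root_space_Fm:
 assumes A: "A \<in> root_space X n (ev a - ev b)" and ab: "a \<in> Ix" "b \<in> Ix" "a \<noteq> b" "a \<noteq> - b"
 shows "A = ent A a b \<cdot>\<^sub>m Fx a b"
proof (rule mat_eqI)
 have so: "A \<in> so_alg X n" using A by (simp add: root_space_def)
 thus "A \<in> Mx" by (simp add: so_alg_iff)
 show "ent A a b \<cdot>\<^sub>m Fx a b \<in> Mx" by simp
 fix i j assume ij: "i \<in> Ix" "j \<in> Ix"
 have H: "i = a \<and> j = b \<or> i = - b \<and> j = - a" if ne: "ent A i j \<noteq> 0"
 proof -
  have e: "ev a k - ev b k = ev i k - ev j k" if "k \<in> {1..n}" for k
   using root_space_entry[OF A that ij ne] by simp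
  have eq: "ev a - ev b = ev i - ev j"
   by (rule supp_eqI[of n]) (use e idx_le ab ij in \<open>auto intro!: supp_diff supp_ev\<close>)
  show ?thesis by (rule ev_diff_inj[OF eq ab(3,4)])
 qed
 have an: "ent A (- b) (- a) = - ent A a b" using so ab unfolding so_alg_iff by blast
 have "- b \<noteq> a" using ab(4) by auto
 consider "i = a \<and> j = b" | "i = - b \<and> j = - a"
  | "ent A i j = 0" "\<not> (i = a \<and> j = b)" "\<not> (i = - b \<and> j = - a)" using H by blast
 thus "ent A i j = ent (A $$ (pos X n a, pos X n b) \<cdot>\<^sub>m Fx a b) i j"
  using ab ij pos_less[OF ij(1)] pos_less[OF ij(2)] an \<open>- b \<noteq> a\<close>
  by cases (auto simp: Fm_entry carrier_matD[OF Fm_carrier])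
qed

lemma Fm_root_space:
 assumes ab: "a \<in> Ix" "b \<in> Ix"
 shows "Fx a b \<in> root_space X n (ev a - ev b)"
 unfolding root_space_def mem_Collect_eq
proof (intro conjI ballI Fm_so[OF ab])
 fix H assume H: "H \<in> cartan X n"
 hence so: "H \<in> so_alg X n" and dg: "diagonal_mat H" by (simp_all add: cartan_def)
 have Hc: "H \<in> Mx" using so by (simp add: so_alg_iff)
 define h where "h i = ent H i i" for i
 have hm: "h (- i) = - h i" if "i \<in> Ix" for i using so that unfolding so_alg_iff h_def by blast
 have H0: "ent H i j = of_bool (i = j) * h i" if "i \<in> Ix" "j \<in> Ix" for i j
  using dg Hc that pos_less[OF that(1)] pos_less[OF that(2)] pos_eq[OF that] unfolding diagonal_mat_def h_def by auto
 have we: "weight_eval n (ev a) H = h a" if a: "a \<in> Ix" for a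
 proof -
  have p: "weight_eval n (ev (int m)) H = h (int m)" if "m \<in> {1..n}" for m
  proof -
   have "weight_eval n (ev (int m)) H = (\<Sum>i = 1..n. if i = m then h (int i) else 0)"
    unfolding weight_eval_pos by (intro sum.cong refl) (use that in \<open>auto simp: h_def ev_def\<close>)
   thus ?thesis using that by simp
  qed
  have bd: "\<bar>a\<bar> <= int n" using a idx_le by blast
  consider "a = 0" | m where "m \<in> {1..n}" "a = int m" | m where "m \<in> {1..n}" "a = - int m"
   using int_index_cases[OF bd] by blast
  thus ?thesis
  proof cases
   case 1
   thus ?thesis using hm[OF a] by (simp add: weight_eval_def)
  next
   case (3 m)
   have "weight_eval n (ev (- int m)) H = - weight_eval n (ev (int m)) H"
    by (simp add: weight_eval_def of_rat_minus sum_negf)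
   thus ?thesis using p[OF 3(1)] hm[OF a] 3 by simp
  qed (use p in simp)
 qed
 have wd: "weight_eval n (ev a - ev b) H = h a - h b"
  using we[OF ab(1)] we[OF ab(2)] by (simp add: weight_eval_def of_rat_diff left_diff_distrib sum_subtractf)
 show "lie_bracket H (Fx a b) = weight_eval n (ev a - ev b) H \<cdot>\<^sub>m Fx a b"
 proof (rule mat_eqI)
  show "lie_bracket H (Fx a b) \<in> Mx"
   by (rule lie_bracket_carrier[OF Hc Fm_carrier])
  show "weight_eval n (ev a - ev b) H \<cdot>\<^sub>m Fx a b \<in> Mx" by simp
  fix p q assume pq: "p \<in> Ix" "q \<in> Ix"
  have "ent (lie_bracket H (Fx a b)) p q = ent (H * Fx a b) p q - ent (Fx a b * H) p q"
   unfolding lie_bracket_def using Hc pos_less[OF pq(1)] pos_less[OF pq(2)] by (simp add: carrier_matD[OF Fm_carrier])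
  also have "\<dots> = (h a - h b) * (of_bool (p = a) * of_bool (q = b) - of_bool (p = - b) * of_bool (q = - a))"
   unfolding Fm_mult[OF Hc ab pq] using ab pq hm[OF ab(1)] hm[OF ab(2)] by (auto simp: H0 of_bool_def)
  finally show "ent (lie_bracket H (Fx a b)) p q = ent (weight_eval n (ev a - ev b) H \<cdot>\<^sub>m Fx a b) p q"
   using pos_less[OF pq(1)] pos_less[OF pq(2)] ab pq by (simp add: wd Fm_entry carrier_matD[OF Fm_carrier])
 qed
qed

end

section \<open>Essential signatures in terms of the orthogonal operators\<close>

text \<open>The case m = 0 is separate since \<open>eps 0\<close> is not the zero weight.\<close>

definition rt :: "nat \<times> bool \<times> nat => weight" where
 "rt = (%(m, s, i). eps i + (if m = 0 then 0 else if s then eps m else - eps m))"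

definition qp :: "(weight => 'a) => nat => bool => nat => 'a" where
 "qp p = (%m s i. p (rt (m, s, i)))"

lemma pos_root_list_rt:
 assumes "n \<ge> 1"
 shows "pos_root_list X n = map rt (tri_list X n)"
proof -
 have 1: "[1..<Suc n] = 1 # [2..<Suc n]" using assms by (simp add: upt_conv_Cons numeral_2_eq_2 del: upt_Suc)
 let ?f = "%m. map (%i. (m, False, i)) [1..<m] @ map (%i. (m, True, i)) [1..<m]"
 have "map rt (concat (map ?f [2..<Suc n])) = concat (map (%m. minus_block m @ plus_block m) [2..<Suc n])"
  unfolding map_concat map_map
  by (intro arg_cong[of _ _ concat] map_cong refl) (auto simp: rt_def minus_block_def plus_block_def)
 moreover have "concat (map ?f [1..<Suc n]) = concat (map ?f [2..<Suc n])" unfolding 1 by (simp del: upt_Suc)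
 ultimately have "map rt (concat (map ?f [1..<Suc n])) = concat (map (%m. minus_block m @ plus_block m) [2..<Suc n])"
  by (simp only:)
 moreover have "map rt (map (%i. (0, True, i)) [1..<Suc n]) = short_block n"
  by (simp add: rt_def short_block_def comp_def zero_fun_def[symmetric] del: upt_Suc)
 ultimately show ?thesis
  unfolding pos_root_list_def tri_list_def map_append by (cases X) (simp_all del: upt_Suc)
qed

lemma rt_ev:
 assumes "(m, s, i) \<in> tris X n"
 shows "rt (m, s, i) = ev (int i) - ev (sg s m)"
  and "int i \<in> idx X n" "sg s m \<in> idx X n"
  and "int i \<noteq> sg s m" "int i \<noteq> - sg s m"
proof -
 have c: "1 <= m \<and> m <= n \<and> 1 <= i \<and> i < m \<or> X = TypeB \<and> m = 0 \<and> s \<and> 1 <= i \<and> i <= n" using assms by (simp only: in_tri_list)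
 show "int i \<in> idx X n" "sg s m \<in> idx X n" using tri_idx[OF assms] by simp_all
 show "int i \<noteq> sg s m" "int i \<noteq> - sg s m" using c by auto
 have "ev (int i) = eps i" "m > 0 ==> ev (int m) = eps m" using c by (auto intro!: ev_pos)
 thus "rt (m, s, i) = ev (int i) - ev (sg s m)"
  using c by (auto simp: rt_def)
qed

lemma inj_rt: "inj_on rt (tris X n)"
proof (rule inj_onI)
 fix t t' assume t: "t \<in> tris X n" "t' \<in> tris X n" "rt t = rt t'"
 obtain m s i m' s' i' where e: "t = (m, s, i)" "t' = (m', s', i')" by (cases t, cases t')
 let ?x = "sg s m" and ?x' = "sg s' m'"
 note r = rt_ev[OF t(1)[unfolded e]] and r' = rt_ev[OF t(2)[unfolded e]]
 have "ev (int i) - ev ?x = ev (int i') - ev ?x'" using t(3) unfolding e r(1) r'(1) .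
 from ev_diff_inj[OF this r(4,5)]
 have "int i' = int i \<and> ?x' = ?x \<or> int i' = - ?x \<and> ?x' = - int i" .
 thus "t = t'" using t(1,2) unfolding e in_tri_list by (auto split: if_splits)
qed

lemma pos_roots_rt: "n \<ge> 1 ==> pos_roots X n = rt ` tris X n"
 by (simp add: pos_roots_def pos_root_list_rt)

lemma raising_root:
 assumes "i \<in> idx X n" "j \<in> idx X n" "prec i j" "i \<noteq> - j"
 shows "\<exists>t\<in>tris X n. ev i - ev j = rt t"
proof -
 have T: "?thesis" if "t \<in> tris X n" "ev i - ev j = rt t" for t using that by blast
 have b: "\<bar>i\<bar> <= int n" "\<bar>j\<bar> <= int n" using assms idx_le by blast+
 have e: "ev k = eps (nat k)" if "k > 0" for k using that ev_pos[of "nat k"] by simp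
 have e': "ev k = - eps (nat (- k))" if "k < 0" for k using arg_cong[OF e[of "- k"], of uminus] that by simp
 have z: "i = 0 \<or> j = 0 ==> X = TypeB" using assms by (cases X) (auto simp: idx_def)
 consider "i > 0" "j > 0" | "i > 0" "j < 0" "i < - j" | "i > 0" "j < 0" "- j < i" | "i > 0" "j = 0" | "i = 0" "j < 0" | "i < 0" "j < 0"
  using assms(3,4) by (auto simp: prec_def split: if_splits) linarith
 thus ?thesis
 proof cases
  case 1
  thus ?thesis using assms b by (intro T[of "(nat j, False, nat i)"]) (auto simp: in_tri_list rt_def e prec_def)
 next
  case 2
  thus ?thesis using assms b by (intro T[of "(nat (- j), True, nat i)"]) (auto simp: in_tri_list rt_def e e')
 next
  case 3
  thus ?thesis using assms b by (intro T[of "(nat i, True, nat (- j))"]) (auto simp: in_tri_list rt_def e e')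
 next
  case 4
  thus ?thesis using assms b z by (intro T[of "(0, True, nat i)"]) (auto simp: in_tri_list rt_def e)
 next
  case 5
  thus ?thesis using assms b z by (intro T[of "(0, True, nat (- j))"]) (auto simp: in_tri_list rt_def e')
 next
  case 6
  thus ?thesis using assms b by (intro T[of "(nat (- i), False, nat (- j))"]) (auto simp: in_tri_list rt_def e' prec_def)
 qed
qed

lemma exponents_less_iff:
 assumes "n \<ge> 1"
 shows "exponents_less X n p q \<longleftrightarrow> ltX X n (qp p) (qp q)"
proof -
 have block: "map p (plus_block (Suc r)) = map (qp p (Suc r) True) [1..<Suc r]" "map p (minus_block (Suc r)) = map (qp p (Suc r) False) [1..<Suc r]"
  for p :: "weight => nat" and r
  by (simp_all add: plus_block_def minus_block_def qp_def rt_def)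
 have short: "map p (short_block n) = map (qp p 0 True) [1..<Suc n]" for p :: "weight => nat"
  by (simp add: short_block_def qp_def rt_def comp_def zero_fun_def[symmetric] del: upt_Suc)
 let ?B = "%r. concat (map (%m. [plus_block m, minus_block m]) (rev [2..<Suc r]))"
 have D: "(map (map p) (?B r), map (map q) (?B r)) \<in> lexord deglex \<longleftrightarrow> qlt r (qp p) (qp q)" for r
 proof (induction r)
  case (Suc r)
  show ?case
  proof (cases "r = 0")
   case True
   thus ?thesis by (simp add: deglt_irrefl deglt_def deglex_def)
  next
   case False
   hence "[2..<Suc (Suc r)] = [2..<Suc r] @ [Suc r]" by simp
   thus ?thesis
    using Suc.IH by (simp add: block deglt_def atLeastLessThanSuc_atLeastAtMost del: upt_Suc)
  qed
 qed simp
 show ?thesis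
  unfolding exponents_less_def order_blocks_def
  by (cases X) (simp_all add: D short deglt_def atLeastLessThanSuc_atLeastAtMost del: upt_Suc)
qed

text \<open>The inverse of \<open>qp\<close> on the index set, extended by 0 as required of
  exponents.\<close>

definition of_tri :: "lie_type => nat => (nat \<times> bool \<times> nat => 'a::zero) => weight => 'a" where
 "of_tri X n z \<alpha> = (if \<alpha> \<in> rt ` tris X n then z (inv_into (tris X n) rt \<alpha>) else 0)"

lemma of_tri_rt: "t \<in> tris X n ==> of_tri X n z (rt t) = z t"
 by (simp add: of_tri_def inv_into_f_f[OF inj_rt])

lemma pairing_ev:
 assumes "a \<in> idx X n" "b \<in> idx X n" "a \<noteq> b" "a \<noteq> - b"
 shows "coroot_pairing n \<mu> (ev a - ev b) = 2 * (ext \<mu> a - ext \<mu> b) / (if a = 0 \<or> b = 0 then 1 else 2)"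
proof -
 have b: "\<bar>a\<bar> <= int n" "\<bar>b\<bar> <= int n" using assms idx_le by blast+
 have w: "weight_inner n \<nu> (ev a - ev b) = ext \<nu> a - ext \<nu> b" for \<nu>
  unfolding weight_inner_def minus_apply right_diff_distrib sum_subtractf sum_ev[OF b(1)] sum_ev[OF b(2)] ..
 have "weight_inner n (ev a - ev b) (ev a - ev b) = (if a = 0 \<or> b = 0 then 1 else 2)"
  unfolding w ext_diff ext_ev using assms by auto
 thus ?thesis unfolding coroot_pairing_def w by simp
qed

lemma pairing_uminus: "coroot_pairing n \<mu> (- \<alpha>) = - coroot_pairing n \<mu> \<alpha>"
 by (simp add: coroot_pairing_def weight_inner_def sum_negf)

lemma pairing_rt:
 assumes "(m, s, i) \<in> tris X n"
 shows "coroot_pairing n \<mu> (rt (m, s, i)) = (if m = 0 then 2 * \<mu> i else if s then \<mu> i + \<mu> m else \<mu> i - \<mu> m)"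
proof -
 note r = rt_ev[OF assms]
 have "i > 0" using assms by (auto simp: in_tri_list)
 thus ?thesis unfolding r(1) pairing_ev[OF r(2-5)] by (auto simp: ext_def)
qed

lemma lattice_iff:
 assumes "n \<ge> 1"
 shows "\<mu> \<in> weight_lattice X n \<longleftrightarrow> supp n \<mu> \<and> (\<forall>t\<in>tris X n. coroot_pairing n \<mu> (rt t) \<in> \<int>)"
 unfolding weight_lattice_def roots_def pos_roots_rt[OF assms] supp_def by (auto simp: pairing_uminus)

lemma dominant_iff:
 assumes "n \<ge> 1"
 shows "\<mu> \<in> dominant_weights X n \<longleftrightarrow> supp n \<mu> \<and>
  (\<forall>i j. 1 <= i \<and> i < j \<and> j <= n --> \<mu> i - \<mu> j \<in> \<int> \<and> \<mu> i + \<mu> j \<in> \<int> \<and> \<mu> j <= \<mu> i \<and> - \<mu> j <= \<mu> i) \<and>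
  (X = TypeB --> (\<forall>i. 1 <= i \<and> i <= n --> 2 * \<mu> i \<in> \<int> \<and> 0 <= \<mu> i))"
proof -
 let ?w = "%m s i. if m = 0 then 2 * \<mu> i else if s then \<mu> i + \<mu> m else \<mu> i - \<mu> m"
 have "\<mu> \<in> dominant_weights X n \<longleftrightarrow> supp n \<mu> \<and> (\<forall>t\<in>tris X n. coroot_pairing n \<mu> (rt t) \<in> \<int> \<and> 0 <= coroot_pairing n \<mu> (rt t))"
  unfolding dominant_weights_def mem_Collect_eq lattice_iff[OF assms] pos_roots_rt[OF assms] by auto
 also have "(\<forall>t\<in>tris X n. coroot_pairing n \<mu> (rt t) \<in> \<int> \<and> 0 <= coroot_pairing n \<mu> (rt t)) \<longleftrightarrow>
  (\<forall>m s i. (m, s, i) \<in> tris X n --> ?w m s i \<in> \<int> \<and>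
   0 <= ?w m s i)"
  using pairing_rt[where \<mu> = \<mu> and X = X and n = n] by auto
 also have "\<dots> \<longleftrightarrow> (\<forall>i j. 1 <= i \<and> i < j \<and> j <= n --> \<mu> i - \<mu> j \<in> \<int> \<and> \<mu> i + \<mu> j \<in> \<int> \<and> \<mu> j <= \<mu> i \<and> - \<mu> j <= \<mu> i) \<and>
  (X = TypeB --> (\<forall>i. 1 <= i \<and> i <= n --> 2 * \<mu> i \<in> \<int> \<and> 0 <= \<mu> i))" (is "?L \<longleftrightarrow> ?R")
 proof
  assume L: ?L
  have "\<mu> i - \<mu> j \<in> \<int> \<and> \<mu> i + \<mu> j \<in> \<int> \<and> \<mu> j <= \<mu> i \<and> - \<mu> j <= \<mu> i" if "1 <= i" "i < j" "j <= n" for i j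
   using L[rule_format, of j False i] L[rule_format, of j True i] that by (simp add: in_tri_list)
  moreover have "2 * \<mu> i \<in> \<int> \<and> 0 <= \<mu> i" if "X = TypeB" "1 <= i" "i <= n" for i
   using L[rule_format, of 0 True i] that by (simp add: in_tri_list)
  ultimately show ?R by blast
 next
  assume R: ?R
  show ?L
  proof (intro allI impI)
   fix m s i assume t: "(m, s, i) \<in> tris X n"
   show "?w m s i \<in> \<int> \<and>
    0 <= ?w m s i"
   proof (cases "m = 0")
    case True
    thus ?thesis using R t by (auto simp: in_tri_list)
   next
    case False
    hence "1 <= i \<and> i < m \<and> m <= n" using t by (auto simp: in_tri_list)
    hence "\<mu> i - \<mu> m \<in> \<int> \<and> \<mu> i + \<mu> m \<in> \<int> \<and> \<mu> m <= \<mu> i \<and> - \<mu> m <= \<mu> i" using R by blast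
    thus ?thesis using False by auto
   qed
  qed
 qed
 finally show ?thesis .
qed

lemma dominant_simple:
 assumes "n \<ge> 1" "\<mu> \<in> dominant_weights X n" "simple_pair X n i j"
 shows "\<exists>m::nat. 2 * (ext \<mu> i - ext \<mu> j) = (if i = 0 \<or> j = 0 then 1 else 2) * of_nat m"
proof -
 note ij = simple_pairD[OF assms(3)]
 obtain t where t: "t \<in> tris X n" "ev i - ev j = rt t" using raising_root[OF ij(1,2,5,4)] by blast
 have "rt t \<in> pos_roots X n" using t(1) pos_roots_rt[OF assms(1)] by blast
 hence "coroot_pairing n \<mu> (rt t) \<in> \<int>" "0 <= coroot_pairing n \<mu> (rt t)"
  using assms(2) by (auto simp: dominant_weights_def weight_lattice_def roots_def)
 hence "coroot_pairing n \<mu> (rt t) \<in> \<nat>" by (simp add: Nats_altdef2)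
 then obtain m where "coroot_pairing n \<mu> (rt t) = of_nat m" by (auto simp: Nats_def)
 hence "2 * (ext \<mu> i - ext \<mu> j) / (if i = 0 \<or> j = 0 then 1 else 2) = of_nat m" using pairing_ev[OF ij(1-4), of \<mu>] t(2) by simp
 thus ?thesis by (intro exI[of _ m]) (auto simp: field_simps split: if_splits)
qed

text \<open>Connects the given module and its root vectors with the operator formalism; afterwards
  only \<open>F\<close> and \<open>ess\<close> are used.\<close>

lemma module_operators:
 assumes n: "n \<ge> 2" and e: "root_vectors X n e" and vs: "vector_space sc" and dom: "\<mu> \<in> dominant_weights X n"
  and irr: "irreducible_highest_weight_module X n sc V act \<mu> v"
 shows "\<exists>F. int_rep sc X n F \<and> so_rep.hwX sc X n F \<mu> {0} v \<and> v \<noteq> 0 \<and> so_rep.nil_vec X n F v \<and>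
  (\<forall>p. essential X n e sc act v p \<longleftrightarrow> so_rep.ess sc X n F (qp p) v)"
proof -
 interpret vector_space sc by (rule vs)
 let ?I = "idx X n" and ?L = "so_alg X n"
 have n1: "n \<ge> 1" using n by simp
 have mod: "lie_module ?L sc V act" and simple: "\<And>W. subspace W ==> W \<subseteq> V ==> (\<And>x w. x \<in> ?L ==> w \<in> W ==> act x w \<in> W) ==> W = {0} \<or> W = V"
  and hv: "highest_weight_vector X n sc V act \<mu> v"
  using irr unfolding irreducible_highest_weight_module_def irreducible_module_def by blast+
 have subV: "subspace V" and stV: "\<And>x u. x \<in> ?L ==> u \<in> V ==> act x u \<in> V"
  and lin: "\<And>x u w. x \<in> ?L ==> u \<in> V ==> w \<in> V ==> act x (u + w) = act x u + act x w"
  "\<And>x c u. x \<in> ?L ==> u \<in> V ==> act x (sc c u) = sc c (act x u)"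
  "\<And>x y u. x \<in> ?L ==> y \<in> ?L ==> u \<in> V ==> act (x + y) u = act x u + act y u"
  "\<And>x c u. x \<in> ?L ==> u \<in> V ==> act (c \<cdot>\<^sub>m x) u = sc c (act x u)"
  "\<And>x y u. x \<in> ?L ==> y \<in> ?L ==> u \<in> V ==> act (lie_bracket x y) u = act x (act y u) - act y (act x u)"
  using mod unfolding lie_module_def by blast+
 have vV: "v \<in> V" and v0: "v \<noteq> 0"
  and raise: "\<And>\<alpha> x. \<alpha> \<in> pos_roots X n ==> x \<in> root_space X n \<alpha> ==> act x v = 0"
  and wt: "\<And>H. H \<in> cartan X n ==> act H v = sc (weight_eval n \<mu> H) v"
  using hv unfolding highest_weight_vector_def by blast+
 have smL: "c \<cdot>\<^sub>m x \<in> ?L" if "x \<in> ?L" for c x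
  using that pos_less unfolding so_alg_iff by auto
 have adL: "x + y \<in> ?L" if "x \<in> ?L" "y \<in> ?L" for x y
  using that pos_less unfolding so_alg_iff by auto
 define G where "G = (%i j u. act (Fm X n i j) u)"
 have FL: "Fm X n i j \<in> ?L" if "i \<in> ?I" "j \<in> ?I" for i j by (rule Fm_so[OF that])
 have "\<exists>\<pi>. (\<forall>u\<in>V. \<pi> u = u) \<and> (\<forall>u. \<pi> u \<in> V) \<and> so_rep sc X n (%i j u. G i j (\<pi> u))"
 proof (rule totalize[OF vs subV])
  fix i j assume ij: "i \<in> ?I" "j \<in> ?I"
  show "G i j u \<in> V" "G i j (sc c u) = sc c (G i j u)" if "u \<in> V" for u c
   unfolding G_def using stV[OF FL[OF ij] that] lin(2)[OF FL[OF ij] that] by blast+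
  show "G i j (u + w) = G i j u + G i j w" if "u \<in> V" "w \<in> V" for u w
   unfolding G_def by (rule lin(1)[OF FL[OF ij] that])
  show "G (- j) (- i) u = - G i j u" if "u \<in> V" for u
   unfolding G_def Fm_swap[OF ij] lin(4)[OF FL[OF ij] that] by simp
  fix k l u assume kl: "k \<in> ?I" "l \<in> ?I" and u: "u \<in> V"
  have b: "sc (of_bool P) w = (if P then w else 0)" "sc (- of_bool P) w = - (if P then w else 0)" for P w by simp_all
  have L: "Fm X n i l \<in> ?L" "Fm X n k j \<in> ?L" "Fm X n (- j) l \<in> ?L" "Fm X n k (- i) \<in> ?L" using ij kl by (simp_all add: FL)
  show "G i j (G k l u) - G k l (G i j u) = (if j = k then G i l u else 0) - (if i = l then G k j u else 0)
    - (if i = - k then G (- j) l u else 0) + (if j = - l then G k (- i) u else 0)"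
   unfolding G_def lin(5)[OF FL[OF ij] FL[OF kl] u, symmetric] Fm_bracket[OF ij kl]
    lin(3)[OF adL[OF smL[OF L(1)] smL[OF L(2)]] adL[OF smL[OF L(3)] smL[OF L(4)]] u]
    lin(3)[OF smL[OF L(1)] smL[OF L(2)] u] lin(3)[OF smL[OF L(3)] smL[OF L(4)] u]
    lin(4)[OF L(1) u] lin(4)[OF L(2) u] lin(4)[OF L(3) u] lin(4)[OF L(4) u] b by simp
 qed
 then obtain \<pi> where p: "\<And>u. u \<in> V ==> \<pi> u = u" "\<And>u. \<pi> u \<in> V" and rep: "so_rep sc X n (%i j u. G i j (\<pi> u))" by blast
 define F where "F = (%i j u. G i j (\<pi> u))"
 interpret r: so_rep sc X n F unfolding F_def by (rule rep)
 have FV: "F i j u = act (Fm X n i j) u" if "u \<in> V" for i j u using p(1)[OF that] by (simp add: F_def G_def)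
 have FinV: "F i j u \<in> V" if "i \<in> ?I" "j \<in> ?I" for i j u
  unfolding F_def G_def by (rule stV[OF FL[OF that] p(2)])
 have sV: "r.stab (?I \<times> ?I) V" using subV FinV by (auto simp: r.stab_def)
 have hw: "r.hwX \<mu> {0} v"
  unfolding r.hwX_def r.wtv_def r.raises_into_def
 proof (intro conjI ballI impI r.stab_zero)
  show "F (int i) (int i) v = sc (of_rat (\<mu> i)) v" if "i \<in> {1..n}" for i
   using wt[OF Fm_cartan[OF that]] by (simp add: FV[OF vV] weight_eval_Fm[OF that])
  show "supp n \<mu>" using dom dominant_iff[OF n1] by blast
  fix i j assume ij: "i \<in> ?I" "j \<in> ?I" "prec i j"
  show "F i j v \<in> {0}"
  proof (cases "i = - j")
   case True
   thus ?thesis using r.F_anti_diag[OF ij(1), of v] by simp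
  next
   case False
   obtain t where "t \<in> tris X n" "ev i - ev j = rt t" using raising_root[OF ij False] by blast
   hence "ev i - ev j \<in> pos_roots X n" using pos_roots_rt[OF n1] by auto
   thus ?thesis using raise[OF _ Fm_root_space[OF ij(1,2)]] by (simp add: FV[OF vV])
  qed
 qed
 \<comment> \<open>Stability under the operators \<open>F\<close> implies stability under the whole
   Lie algebra by \<open>so_alg_induct\<close>, so irreducibility applies.\<close>
 have full: "r.clos (?I \<times> ?I) {w} = V" if w: "w \<in> V" "w \<noteq> 0" for w
 proof -
  let ?W = "r.clos (?I \<times> ?I) {w}"
  have WV: "?W \<subseteq> V" by (rule r.clos_least[OF _ sV]) (use w in simp)
  have "act A u \<in> ?W" if A: "A \<in> ?L" and u: "u \<in> ?W" for A u
  proof (rule so_alg_induct[OF A])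
   have uV: "u \<in> V" using u WV by blast
   have one: "Fm X n 1 1 \<in> ?L" using FL[of 1 1] n idx_nonzero[of 1 n X] by simp
   have "0\<^sub>m (so_dim X n) (so_dim X n) = 0 \<cdot>\<^sub>m Fm X n 1 1" by (rule eq_matI) (simp_all add: Fm_def)
   hence "act (0\<^sub>m (so_dim X n) (so_dim X n)) u = 0" using lin(4)[OF one uV, of 0] by simp
   thus "act (0\<^sub>m (so_dim X n) (so_dim X n)) u \<in> ?W" by (simp add: r.clos.zero)
   fix i j c B assume ij: "i \<in> ?I" "j \<in> ?I" and B: "B \<in> ?L" "act B u \<in> ?W"
   have "act (c \<cdot>\<^sub>m Fm X n i j + B) u = sc c (F i j u) + act B u"
    unfolding lin(3)[OF smL[OF FL[OF ij]] B(1) uV] lin(4)[OF FL[OF ij] uV] FV[OF uV] ..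
   also have "\<dots> \<in> ?W" using ij by (intro r.clos.add r.clos.scale r.clos.op[OF _ u] B(2)) simp
   finally show "act (c \<cdot>\<^sub>m Fm X n i j + B) u \<in> ?W" .
  qed
  hence "?W = {0} \<or> ?W = V" by (intro simple[OF r.subspace_clos WV])
  moreover have "w \<in> ?W" by (simp add: r.clos.base)
  ultimately show ?thesis using w(2) by auto
 qed
 interpret h: irr_hw sc X n F \<mu> v
 proof
  show "v \<in> r.clos (?I \<times> ?I) {w}" if "w \<in> r.clos (?I \<times> ?I) {v}" "w \<noteq> 0" for w
   using full[of w] full[OF vV v0] that vV by simp
  show "\<exists>m::nat. 2 * (ext \<mu> i - ext \<mu> j) = r.dbl i j * of_nat m" if "simple_pair X n i j" for i j
   unfolding r.dbl_def by (rule dominant_simple[OF n1 dom that])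
 qed (use hw v0 n in auto)
 have nil: "\<exists>N. (F i j ^^ N) u = 0" if "i \<in> ?I" "j \<in> ?I" "i \<noteq> j" "i \<noteq> - j" "u \<in> V" for i j u
  by (rule h.nilpotent_V[OF that(1-4)]) (use full[OF vV v0] that(5) in simp)
 \<comment> \<open>One application of \<open>F i j\<close> maps any vector into \<open>V\<close>,
   where nilpotency is known.\<close>
 have int: "int_rep sc X n F"
 proof
  fix i j assume ij: "i \<in> ?I" "j \<in> ?I" "i \<noteq> j" "i \<noteq> - j"
  show "r.nilp i j"
   unfolding r.nilp_def
  proof
   fix u
   obtain N where "(F i j ^^ N) (F i j u) = 0" using nil[OF ij FinV[OF ij(1,2)]] by blast
   hence "(F i j ^^ Suc N) u = 0" unfolding funpow_Suc_right o_apply .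
   thus "\<exists>N. (F i j ^^ N) u = 0" ..
  qed
 qed
 have rootop: "\<exists>a. a \<noteq> 0 \<and> (\<forall>u\<in>V. act (e (- rt t)) u = sc a (trop F t u))" if t: "t \<in> tris X n" for t
 proof -
  obtain m s i where ms: "t = (m, s, i)" by (cases t)
  let ?x = "sg s m"
  note rr = rt_ev[OF t[unfolded ms]]
  have "- rt t \<in> roots X n" using t pos_roots_rt[OF n1] by (auto simp: roots_def)
  hence ers: "e (- rt t) \<in> root_space X n (ev ?x - ev (int i))" and ne: "e (- rt t) \<noteq> 0\<^sub>m (so_dim X n) (so_dim X n)"
   using e unfolding root_vectors_def ms rr(1) by auto
  define a where "a = e (- rt t) $$ (pos X n ?x, pos X n (int i))"
  have eq: "e (- rt t) = a \<cdot>\<^sub>m Fm X n ?x (int i)"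
   unfolding a_def by (rule root_space_Fm[OF ers rr(3,2)]) (use rr(4,5) in auto)
  have "a \<noteq> 0"
  proof
   assume "a = 0"
   hence "e (- rt t) = 0\<^sub>m (so_dim X n) (so_dim X n)" unfolding eq by (intro eq_matI) (simp_all add: Fm_def)
   thus False using ne by simp
  qed
  moreover have "act (e (- rt t)) u = sc a (trop F t u)" if "u \<in> V" for u
   unfolding eq lin(4)[OF FL[OF rr(3,2)] that] unfolding ms trop_def prod.case FV[OF that] ..
  ultimately show ?thesis by blast
 qed
 let ?sv = "signature_vector X n e sc act v" and ?x = "%p. r.svX (qp p) v"
 \<comment> \<open>The factorials and the choice of root vectors only contribute a nonzero
   scalar.\<close>
 have sig: "\<exists>c. c \<noteq> 0 \<and> ?sv q = sc c (?x q)" for q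
 proof -
  let ?f = "foldr (%\<alpha> u. sc (1 / fact (q \<alpha>)) ((act (e (- \<alpha>)) ^^ q \<alpha>) u))"
   and ?p = "%L. pbw (trop F) L (%t. q (rt t)) v"
  have "\<exists>c. c \<noteq> 0 \<and> ?f (map rt L) v = sc c (?p L) \<and> ?p L \<in> V" if "set L \<subseteq> tris X n" for L
   using that
  proof (induction L)
   case Nil
   thus ?case using vV by (intro exI[of _ 1]) simp
  next
   case (Cons t L)
   have "set L \<subseteq> tris X n" using Cons.prems by simp
   from Cons.IH[OF this] obtain c where c: "c \<noteq> 0" "?f (map rt L) v = sc c (?p L)" "?p L \<in> V" by (elim exE conjE)
   have tt: "t \<in> tris X n" using Cons.prems by simp
   obtain a where a: "a \<noteq> 0" "\<And>u. u \<in> V ==> act (e (- rt t)) u = sc a (trop F t u)" using rootop[OF tt] by blast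
   obtain i j where ij: "i \<in> ?I" "j \<in> ?I" "\<And>u. trop F t u = F i j u" using r.trop_idx[OF tt] by blast
   let ?w = "?p L"
   define E where "E = act (e (- rt t))"
   have aE: "E u = sc a (F i j u)" if "u \<in> V" for u using a(2)[OF that] ij(3) by (simp only: E_def)
   have tF: "trop F t = F i j" using ij(3) by (rule ext)
   have pw: "(E ^^ k) (sc c ?w) = sc (a ^ k * c) ((F i j ^^ k) ?w) \<and> (F i j ^^ k) ?w \<in> V" for k
   proof (induction k)
    case (Suc k)
    have "sc (a ^ k * c) ((F i j ^^ k) ?w) \<in> V" using Suc by (intro subspace_scale[OF subV]) blast
    thus ?case using Suc FinV[OF ij(1,2)] by (simp add: aE r.F_scale[OF ij(1,2)] mult.assoc)
   qed (use c(3) in simp)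
   show ?case
    unfolding list.map foldr.simps o_apply c(2) E_def[symmetric] pbw_simps tF
    using c(1) a(1) pw[of "q (rt t)"] by (intro exI[of _ "1 / fact (q (rt t)) * (a ^ q (rt t) * c)"]) simp
  qed
  from this[OF order_refl] obtain c where c: "c \<noteq> 0" "?f (map rt (tri_list X n)) v = sc c (?p (tri_list X n))" by (elim exE conjE)
  have "(%t. q (rt t)) = (%(m, s, i). qp q m s i)" by (auto simp: qp_def)
  hence "?sv q = sc c (?x q)"
   unfolding signature_vector_def pos_root_list_rt[OF n1] r.svX_pbw c(2) by (simp only:)
  thus ?thesis using c(1) by (intro exI conjI)
 qed
 have ess: "essential X n e sc act v p \<longleftrightarrow> r.ess (qp p) v" for p
 proof -
  let ?A = "{?sv q |q. q \<in> exponents X n \<and> exponents_less X n q p}"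
   and ?B = "{r.svX q' v |q'. ltX X n q' (qp p)}"
  have "span ?A \<subseteq> span ?B"
  proof (rule span_minimal[OF _ subspace_span], clarify)
   fix q assume "exponents_less X n q p"
   hence "?x q \<in> span ?B" unfolding exponents_less_iff[OF n1] by (intro span_base) blast
   moreover obtain c where "?sv q = sc c (?x q)" using sig[of q] by blast
   ultimately show "?sv q \<in> span ?B" by (simp only: span_scale)
  qed
  moreover have "span ?B \<subseteq> span ?A"
  proof (rule span_minimal[OF _ subspace_span], clarify)
   fix q' assume l: "ltX X n q' (qp p)"
   \<comment> \<open>\<open>q'\<close> may take any values outside the index set, but the monomial
     and the order only see the index set.\<close>
   define q where "q = of_tri X n (%(m, s, i). q' m s i)"
   have qe: "q \<in> exponents X n" by (auto simp: exponents_def q_def of_tri_def pos_roots_rt[OF n1])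
   have ag: "qp q m s i = q' m s i" if "(m, s, i) \<in> tris X n" for m s i
    unfolding qp_def q_def of_tri_rt[OF that] prod.case ..
   have "ltX X n (qp q) (qp p)" using l ltX_agree(1)[of X n "qp q" q' "qp p"] ag by (simp add: agreeX_iff)
   hence mem: "?sv q \<in> span ?A" using qe exponents_less_iff[OF n1] by (intro span_base) blast
   obtain c where c: "c \<noteq> 0" "?sv q = sc c (?x q)" using sig by blast
   have "r.svX q' v = ?x q" unfolding r.svX_pbw by (rule pbw_cong) (use ag in auto)
   also have "\<dots> = sc (1 / c) (?sv q)" unfolding c(2) using c(1) by simp
   finally show "r.svX q' v \<in> span ?A" using mem by (simp only: span_scale)
  qed
  ultimately have AB: "span ?A = span ?B" by blast
  obtain c where c: "c \<noteq> 0" "?sv p = sc c (?x p)" using sig by blast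
  have "?sv p \<in> span ?B \<longleftrightarrow> ?x p \<in> span ?B"
   unfolding c(2) using c(1) span_scale[of "?x p" ?B c] span_scale[of "sc c (?x p)" ?B "1 / c"] by auto
  thus ?thesis unfolding essential_def r.ess_def AB by blast
 qed
 have "r.nil_vec v" unfolding r.nil_vec_def using nil vV by blast
 thus ?thesis using int hw v0 ess by blast
qed

section \<open>Generators and saturation\<close>

lemma patX_agree:
 assumes "\<And>m s i. (m, s, i) \<in> tris X n ==> q m s i = q' m s i" and n: "n \<ge> 1"
 shows "patX X n \<mu> q = patX X n \<mu> q'"
proof (cases X)
 case TypeB
 have c: "q 0 True k = q' 0 True k" if "1 <= k" "k <= n" for k using assms(1)[of 0 True k] that TypeB by (simp add: in_tri_list)
 have "relB n \<mu> (q 0 True) = relB n \<mu> (q' 0 True)" unfolding relB_def using c n by auto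
 moreover have "patD n (%j. \<mu> j - q 0 True j) q = patD n (%j. \<mu> j - q' 0 True j) q'"
  by (rule patD_cong) (use assms(1) c in \<open>auto simp: in_tri_list\<close>)
 ultimately show ?thesis by (simp add: TypeB)
next
 case TypeD
 thus ?thesis using patD_cong[of n \<mu> \<mu> q q'] assms(1) by (simp add: in_tri_list)
qed

lemma patX_nonneg:
 assumes "patX X n \<mu> q" "(m, s, i) \<in> tris X n"
 shows "0 <= q m s i"
proof -
 have D: "0 <= q m s i" if "patD r \<mu> q" "1 <= i" "i < m" "m <= r" for r \<mu>
  using that
 proof (induction r arbitrary: \<mu>)
  case (Suc r)
  show ?case
  proof (cases "m = Suc r")
   case True
   thus ?thesis using Suc.prems by (cases s) (auto simp: relD_def)
  next
   case False
   thus ?thesis using Suc by auto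
  qed
 qed simp
 show ?thesis using assms D by (cases X) (auto simp: in_tri_list relB_def)
qed

lemma generator_gtype:
 assumes n: "n \<ge> 2" and g: "\<mu> \<in> generator_weights X n"
 shows "gtype n \<mu>"
proof -
 have a: ?thesis if "k < n" "\<And>j. 1 <= j ==> j <= n ==> \<mu> j = of_bool (j <= k)" for k
  using that unfolding gtype_def by blast
 have b: ?thesis if "d = 1 \<or> d = 1/2" "e = d \<or> e = - d" "\<And>j. 1 <= j ==> j <= n ==> \<mu> j = (if j < n then d else e)" for d e
  unfolding gtype_def using that by (intro disjI2 bexI[of _ d] bexI[of _ e]) auto
 let ?w = "fund_weight X n"
 have f: ?thesis if i: "i \<in> {1..n}" "\<mu> = ?w i" for i
 proof (cases X)
  case TypeB
  show ?thesis
  proof (cases "i < n")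
   case True
   thus ?thesis by (intro a[of i]) (auto simp: fund_weight_def i TypeB)
  qed (rule b[of "1/2" "1/2"], auto simp: fund_weight_def i(2) TypeB)
 next
  case TypeD
  consider "i + 2 <= n" | "i + 1 = n" | "i = n" using i by fastforce
  thus ?thesis
  proof cases
   case 1
   thus ?thesis by (intro a[of i]) (auto simp: fund_weight_def i TypeD)
  next
   case 2
   thus ?thesis by (intro b[of "1/2" "- (1/2)"]) (auto simp: fund_weight_def i(2) TypeD)
  next
   case 3
   thus ?thesis by (intro b[of "1/2" "1/2"]) (auto simp: fund_weight_def i(2) TypeD)
  qed
 qed
 consider i where "i \<in> {1..n}" "\<mu> = ?w i" | "\<mu> = ?w n + ?w n" | "X = TypeD" "\<mu> = ?w (n - 1) + ?w (n - 1)" | "X = TypeD" "\<mu> = ?w (n - 1) + ?w n"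
  using g by (cases X) (auto simp: generator_weights_def Let_def)
 thus ?thesis
 proof cases
  case 2
  show ?thesis by (rule b[of 1 1]) (cases X; auto simp: 2 fund_weight_def)+
 next
  case 3
  show ?thesis using n by (intro b[of 1 "- 1"]) (auto simp: 3 fund_weight_def)
 next
  case 4
  show ?thesis using n by (intro a[of "n - 1"]) (auto simp: 4 fund_weight_def)
 qed (use f in blast)
qed

lemma small_dominant_generator:
 assumes n: "n \<ge> 2" and dom: "\<mu> \<in> dominant_weights X n" and pos: "\<mu> 1 > 0"
  and small: "(\<forall>k. 1 <= k \<and> k <= n --> \<mu> k = 1 \<or> \<mu> k = 0 \<or> \<mu> k = - 1) \<or> (\<forall>k. 1 <= k \<and> k <= n --> \<mu> k = 1/2 \<or> \<mu> k = - (1/2))"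
 shows "\<mu> \<in> generator_weights X n"
proof -
 have n1: "n \<ge> 1" using n by simp
 note D = dom[unfolded dominant_iff[OF n1]]
 have sup: "\<mu> j = 0" if "j \<notin> {1..n}" for j using D that unfolding supp_def by blast
 have dec: "\<mu> j <= \<mu> i" "- \<mu> j <= \<mu> i" if "1 <= i" "i < j" "j <= n" for i j using D that by blast+
 have Bp: "0 <= \<mu> n" if "X = TypeB" using D that n1 by blast
 have nn: "0 <= \<mu> j" if "1 <= j" "j < n" for j using dec[of j n] that by simp
 let ?w = "fund_weight X n"
 have G: "?w i \<in> generator_weights X n" if "i \<in> {1..n}" for i using that by (auto simp: generator_weights_def Let_def)
 have Gn: "?w n + ?w n \<in> generator_weights X n"
  and GD: "X = TypeD ==> ?w (n - 1) + ?w (n - 1) \<in> generator_weights X n" "X = TypeD ==> ?w (n - 1) + ?w n \<in> generator_weights X n"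
  by (cases X; simp add: generator_weights_def Let_def)+
 have eqI: "\<mu> = w" if "\<And>j. j \<notin> {1..n} ==> w j = 0" "\<And>j. 1 <= j ==> j < n ==> \<mu> j = w j" "\<mu> n = w n" for w
 proof (rule ext)
  fix j
  show "\<mu> j = w j"
  proof (cases "j \<in> {1..n}")
   case True
   thus ?thesis using that(2)[of j] that(3) by (cases "j = n") auto
  qed (use sup that(1) in simp)
 qed
 have w0: "?w i j = 0" if "j \<notin> {1..n}" for i j using that by (auto simp: fund_weight_def)
 from small show ?thesis
 proof
  assume h: "\<forall>k. 1 <= k \<and> k <= n --> \<mu> k = 1/2 \<or> \<mu> k = - (1/2)"
  have lt: "\<mu> j = 1/2" if "1 <= j" "j < n" for j using h nn[OF that] that by (auto dest: spec[of _ j])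
  have "\<mu> n = 1/2 \<or> \<mu> n = - (1/2)" using h n1 by simp
  thus ?thesis
  proof
   assume "\<mu> n = 1/2"
   hence "\<mu> = ?w n" by (intro eqI w0) (use lt n in \<open>cases X; simp add: fund_weight_def\<close>)+
   thus ?thesis using G[of n] n1 by simp
  next
   assume e: "\<mu> n = - (1/2)"
   hence X: "X = TypeD" using Bp by (cases X) auto
   have "\<mu> = ?w (n - 1)" by (intro eqI w0) (use lt n e X in \<open>simp_all add: fund_weight_def\<close>)
   thus ?thesis using G[of "n - 1"] n by simp
  qed
 next
  assume h: "\<forall>k. 1 <= k \<and> k <= n --> \<mu> k = 1 \<or> \<mu> k = 0 \<or> \<mu> k = - 1"
  define m where "m = Max {k \<in> {1..n}. \<mu> k = 1}"
  have "\<mu> 1 = 1" using h pos n1 by force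
  hence "1 \<in> {k \<in> {1..n}. \<mu> k = 1}" using n1 by simp
  hence "m \<in> {k \<in> {1..n}. \<mu> k = 1}" unfolding m_def by (intro Max_in) auto
  hence m: "1 <= m" "m <= n" "\<mu> m = 1" by auto
  have above: "\<mu> j \<noteq> 1" if "m < j" "j <= n" for j
   using Max_ge[of "{k \<in> {1..n}. \<mu> k = 1}" j] that m unfolding m_def[symmetric] by fastforce
  have one: "\<mu> j = 1" if "1 <= j" "j <= m" for j
  proof (cases "j = m")
   case False
   hence "\<mu> m <= \<mu> j" using dec(1)[of j m] that m by simp
   moreover have "\<mu> j = 1 \<or> \<mu> j = 0 \<or> \<mu> j = - 1" using h that m by simp
   ultimately show ?thesis using m(3) by auto
  qed (use m in simp)
  have zero: "\<mu> j = 0" if "m < j" "j < n" for j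
  proof -
   have "\<mu> j = 1 \<or> \<mu> j = 0 \<or> \<mu> j = - 1" using h that m by simp
   thus ?thesis using nn[of j] above[of j] that m by auto
  qed
  show ?thesis
  proof (cases "m = n")
   case True
   have "\<mu> = ?w n + ?w n" by (intro eqI) (use one True n w0 in \<open>cases X; simp add: fund_weight_def\<close>)+
   thus ?thesis using Gn by simp
  next
   case False
   hence mn: "m < n" using m by simp
   have "\<mu> n = 0 \<or> \<mu> n = - 1" using h above[OF mn] n1 by auto
   thus ?thesis
   proof
    assume e: "\<mu> n = 0"
    have b: "\<mu> j = of_bool (j <= m)" if "1 <= j" "j <= n" for j
     using one[of j] zero[of j] e mn that by (cases "j <= m"; cases "j = n") auto
    show ?thesis
    proof (cases "X = TypeD \<and> m + 1 = n")
     case True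
     hence "\<mu> = ?w (n - 1) + ?w n" by (intro eqI) (use b n w0 in \<open>auto simp: fund_weight_def\<close>)
     thus ?thesis using GD(2) True by simp
    next
     case False
     hence "\<mu> = ?w m" by (intro eqI w0) (use b mn n in \<open>cases X; auto simp: fund_weight_def\<close>)+
     thus ?thesis using G[of m] m by simp
    qed
   next
    assume e: "\<mu> n = - 1"
    hence X: "X = TypeD" using Bp by (cases X) auto
    have "\<mu> j = 1" if "1 <= j" "j < n" for j
    proof -
     have "\<mu> j = 1 \<or> \<mu> j = 0 \<or> \<mu> j = - 1" using h that by simp
     thus ?thesis using dec(2)[of j n] e that by auto
    qed
    hence "\<mu> = ?w (n - 1) + ?w (n - 1)" by (intro eqI) (use e X n w0 in \<open>auto simp: fund_weight_def\<close>)
    thus ?thesis using GD(1) X by simp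
   qed
  qed
 qed
qed

definition pattern_signatures :: "lie_type => nat => signature set" where
 "pattern_signatures X n = {(\<mu>, x). \<mu> \<in> dominant_weights X n \<and> (\<forall>\<alpha>. \<alpha> \<notin> pos_roots X n --> x \<alpha> = 0) \<and>
   (\<forall>\<alpha>\<in>pos_roots X n. x \<alpha> \<in> \<int>) \<and> patX X n \<mu> (qp x)}"

text \<open>The first entry of the split off part is at least 1/2, which makes the repeated
  splitting terminate.\<close>

lemma pattern_signatures_peel:
 assumes n: "n \<ge> 2" and p: "(\<mu>, x) \<in> pattern_signatures X n" and pos: "\<mu> 1 > 0"
 shows "\<exists>\<nu> y. (\<nu>, y) \<in> pattern_signatures X n \<and> \<nu> \<in> generator_weights X n \<and> (\<mu> - \<nu>, x - y) \<in> pattern_signatures X n \<and> 1/2 <= \<nu> 1"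
proof -
 have n1: "n \<ge> 1" using n by simp
 have dom: "\<mu> \<in> dominant_weights X n" and x0: "\<And>\<alpha>. \<alpha> \<notin> pos_roots X n ==> x \<alpha> = 0" and xi: "\<And>\<alpha>. \<alpha> \<in> pos_roots X n ==> x \<alpha> \<in> \<int>"
  and pat: "patX X n \<mu> (qp x)" using p by (auto simp: pattern_signatures_def)
 note D = dom[unfolded dominant_iff[OF n1]]
 have "\<mu> 1 - \<mu> 2 \<in> \<int>" "\<mu> 1 + \<mu> 2 \<in> \<int>" using D n by auto
 hence "(\<mu> 1 - \<mu> 2) + (\<mu> 1 + \<mu> 2) \<in> \<int>" by (rule Ints_add)
 then obtain z where z: "2 * \<mu> 1 = of_int z" by (auto elim: Ints_cases)
 \<comment> \<open>The entries of a dominant weight are either all integers or all proper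
   half-integers; the parity of \<open>2 * \<mu> 1\<close> tells which, and h is taken from the same
   class.\<close>
 define h :: rat where "h = (if even z then 1 else 1/2)"
 have hc: "h = 1 \<or> h = 1/2" by (simp add: h_def)
 have h1: "\<mu> 1 - h \<in> \<int>"
 proof (cases "even z")
  case True
  then obtain w where "z = 2 * w" by (elim evenE)
  hence "\<mu> 1 - h = of_int (w - 1)" using z by (simp add: h_def)
  thus ?thesis by simp
 next
  case False
  then obtain w where "z = 2 * w + 1" by (elim oddE)
  hence "\<mu> 1 - h = of_int w" using z by (simp add: h_def field_simps)
  thus ?thesis by simp
 qed
 have "of_int z > (0::rat)" using z pos by linarith
 hence "1 <= z" by simp
 hence "(1::rat) <= of_int z" by simp
 hence half: "1/2 <= \<mu> 1" using z by linarith
 have hk: "\<mu> k - h \<in> \<int>" if "1 <= k" "k <= n" for k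
 proof (cases "k = 1")
  case False
  hence "\<mu> 1 - \<mu> k \<in> \<int>" using D that by simp
  hence "(\<mu> 1 - h) - (\<mu> 1 - \<mu> k) \<in> \<int>" by (rule Ints_diff[OF h1])
  thus ?thesis by simp
 qed (use h1 in simp)
 interpret row_split "clamp h" "%x. x - clamp h x" h by (rule row_split_clamp[OF hc])
 have qi: "qp x m s i \<in> \<int>" if "(m, s, i) \<in> tris X n" for m s i
  unfolding qp_def by (rule xi) (use that pos_roots_rt[OF n1] in blast)
 obtain q' where q': "patX X n (%k. clamp h (\<mu> k)) q'" "patX X n (%k. \<mu> k - clamp h (\<mu> k)) (%m s i. qp x m s i - q' m s i)"
  "\<And>m s i. (m, s, i) \<in> tris X n ==> q' m s i \<in> \<int>"
  using split_patX[OF pat hk qi] by blast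
 define \<nu> where "\<nu> = (%k. clamp h (\<mu> k))"
 define y where "y = of_tri X n (%(m, s, i). q' m s i)"
 have yq: "qp y m s i = q' m s i" if "(m, s, i) \<in> tris X n" for m s i
  unfolding qp_def y_def of_tri_rt[OF that] prod.case ..
 have y0: "y \<alpha> = 0" if "\<alpha> \<notin> pos_roots X n" for \<alpha> using that by (simp add: y_def of_tri_def pos_roots_rt[OF n1])
 have yi: "y \<alpha> \<in> \<int>" if al: "\<alpha> \<in> pos_roots X n" for \<alpha>
 proof -
  obtain t where t: "t \<in> tris X n" "\<alpha> = rt t" using al pos_roots_rt[OF n1] by auto
  obtain m s i where ms: "t = (m, s, i)" by (cases t)
  show ?thesis using yq[OF t(1)[unfolded ms]] q'(3)[OF t(1)[unfolded ms]] unfolding t(2) ms qp_def by simp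
 qed
 \<comment> \<open>Used for both parts, with c = h for the clamped part and c = 0 for the
   remainder.\<close>
 have dm: "(%k. \<phi> (\<mu> k)) \<in> dominant_weights X n"
  if m: "\<And>x y. x <= y ==> \<phi> x <= \<phi> y" and o: "\<And>x. \<phi> (- x) = - \<phi> x" and i: "\<And>x. x - h \<in> \<int> ==> \<phi> x - c \<in> \<int>" and c: "2 * c \<in> \<int>" for \<phi> :: "rat => rat" and c
  unfolding dominant_iff[OF n1]
 proof (intro conjI allI impI; (elim conjE)?)
  have z: "\<phi> 0 = 0" using o[of 0] by simp
  show "supp n (%k. \<phi> (\<mu> k))" using D z unfolding supp_def by simp
  have ii: "\<phi> (\<mu> k) - c \<in> \<int>" if "1 <= k" "k <= n" for k by (rule i[OF hk[OF that]])
  fix i j assume ij: "1 <= i" "i < j" "j <= n"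
  have 1: "(\<phi> (\<mu> i) - c) - (\<phi> (\<mu> j) - c) \<in> \<int>" by (intro Ints_diff ii) (use ij in auto)
  have 2: "(\<phi> (\<mu> i) - c) + (\<phi> (\<mu> j) - c) + 2 * c \<in> \<int>" by (intro Ints_add ii c) (use ij in auto)
  show "\<phi> (\<mu> i) - \<phi> (\<mu> j) \<in> \<int>" "\<phi> (\<mu> i) + \<phi> (\<mu> j) \<in> \<int>" using 1 2 by simp_all
  have "\<mu> j <= \<mu> i" "- \<mu> j <= \<mu> i" using D ij by blast+
  thus "\<phi> (\<mu> j) <= \<phi> (\<mu> i)" "- \<phi> (\<mu> j) <= \<phi> (\<mu> i)" using m o by metis+
 next
  fix i assume B: "X = TypeB" and i: "1 <= i" "i <= n"
  have "2 * (\<phi> (\<mu> i) - c) + 2 * c \<in> \<int>" by (intro Ints_add Ints_mult c that(3) hk i) simp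
  thus "2 * \<phi> (\<mu> i) \<in> \<int>" by simp
  have "0 <= \<mu> i" using D B i by blast
  thus "0 <= \<phi> (\<mu> i)" using m[of 0 "\<mu> i"] o[of 0] by simp
 qed
 have \<nu>d: "\<nu> \<in> dominant_weights X n" unfolding \<nu>_def by (rule dm[of "clamp h" h, OF fm fo fh h])
 have gd: "(%k. \<mu> k - clamp h (\<mu> k)) \<in> dominant_weights X n"
  by (rule dm[of "%x. x - clamp h x" 0, OF gm go]) (use gh in simp_all)
 have "patX X n \<nu> (qp y) = patX X n \<nu> q'" by (rule patX_agree[OF yq n1])
 hence \<nu>p: "(\<nu>, y) \<in> pattern_signatures X n"
  unfolding pattern_signatures_def using \<nu>d y0 yi q'(1) by (simp add: \<nu>_def)
 have "patX X n (%k. \<mu> k - clamp h (\<mu> k)) (qp (x - y)) = patX X n (%k. \<mu> k - clamp h (\<mu> k)) (%m s i. qp x m s i - q' m s i)"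
  by (rule patX_agree[OF _ n1]) (use yq in \<open>simp add: qp_def\<close>)
 moreover have "\<mu> - \<nu> = (%k. \<mu> k - clamp h (\<mu> k))" by (simp add: \<nu>_def fun_eq_iff)
 ultimately have rp: "(\<mu> - \<nu>, x - y) \<in> pattern_signatures X n"
  unfolding pattern_signatures_def using gd q'(2) x0 y0 xi yi by (auto intro: Ints_diff)
 have \<nu>1: "1/2 <= \<nu> 1" using half hc by (auto simp: \<nu>_def clamp_def)
 have "\<nu> \<in> generator_weights X n"
 proof (rule small_dominant_generator[OF n \<nu>d])
  show "\<nu> 1 > 0" using \<nu>1 by simp
  have bd: "- h <= \<nu> k \<and> \<nu> k <= h" for k using hc by (auto simp: \<nu>_def clamp_def)
  have int: "\<nu> k - h \<in> \<int>" if "1 <= k" "k <= n" for k unfolding \<nu>_def by (rule fh[OF hk[OF that]])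
  \<comment> \<open>Clamped entries lie in [-h, h] and differ from h by an integer; the length of
    the interval is at most 2.\<close>
  have V: "\<nu> k = h \<or> \<nu> k = h - 1 \<or> \<nu> k = h - 2" if k: "1 <= k" "k <= n" for k
  proof -
   obtain w where w: "\<nu> k - h = of_int w" using int[OF k] by (auto elim: Ints_cases)
   hence "- (2 * h) <= of_int w" "of_int w <= (0::rat)" using bd[of k] by linarith+
   hence "of_int (- 2) <= (of_int w :: rat)" "w <= 0" using hc by auto
   hence "w = 0 \<or> w = - 1 \<or> w = - 2" unfolding of_int_le_iff by auto
   thus ?thesis using w by auto
  qed
  from hc show "(\<forall>k. 1 <= k \<and> k <= n --> \<nu> k = 1 \<or> \<nu> k = 0 \<or> \<nu> k = - 1) \<or> (\<forall>k. 1 <= k \<and> k <= n --> \<nu> k = 1/2 \<or> \<nu> k = - (1/2))"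
  proof
   assume h1: "h = 1"
   have "\<nu> k = 1 \<or> \<nu> k = 0 \<or> \<nu> k = - 1" if "1 <= k" "k <= n" for k using V[OF that] unfolding h1 by linarith
   thus ?thesis by blast
  next
   assume h2: "h = 1/2"
   have "\<nu> k = 1/2 \<or> \<nu> k = - (1/2)" if "1 <= k" "k <= n" for k using V[OF that] bd[of k] unfolding h2 by linarith
   thus ?thesis by blast
  qed
 qed
 with \<nu>p rp \<nu>1 show ?thesis by (intro exI[of _ \<nu>] exI[of _ y] conjI)
qed

text \<open>Induction on a bound for \<open>2 * \<mu> 1\<close>, which drops by at least 1 with
  every summand. When the first entry is 0, dominance and the inequalities make the whole signature
  0.\<close>

lemma pattern_signatures_generated:
 assumes n: "n \<ge> 2" and p: "\<sigma> \<in> pattern_signatures X n"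
 shows "\<exists>\<sigma>s. set \<sigma>s \<subseteq> {\<sigma> \<in> pattern_signatures X n. fst \<sigma> \<in> generator_weights X n} \<and> sum_list \<sigma>s = \<sigma>"
proof -
 have n1: "n \<ge> 1" using n by simp
 have zero: "\<mu> = 0 \<and> x = 0" if p: "(\<mu>, x) \<in> pattern_signatures X n" and np: "\<mu> 1 <= 0" for \<mu> x
 proof -
  have "\<mu> \<in> dominant_weights X n" using p by (simp add: pattern_signatures_def)
  note D = this[unfolded dominant_iff[OF n1]]
  have "\<mu> j <= \<mu> 1 \<and> - \<mu> j <= \<mu> 1" if "1 < j" "j <= n" for j using D that by simp
  hence z: "\<mu> j = 0" if "1 <= j" "j <= n" for j
   using that np n by (cases "j = 1") (fastforce dest: spec[of _ 2] spec[of _ j])+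
  have "x \<alpha> = 0" for \<alpha>
  proof (cases "\<alpha> \<in> pos_roots X n")
   case True
   then obtain t where t: "t \<in> tris X n" "\<alpha> = rt t" using pos_roots_rt[OF n1] by auto
   obtain m s i where ms: "t = (m, s, i)" by (cases t)
   have "patX X n \<mu> (qp x)" using p by (simp add: pattern_signatures_def)
   from patX_zero[OF this z t(1)[unfolded ms]] show ?thesis unfolding t(2) ms qp_def by simp
  qed (use p in \<open>simp add: pattern_signatures_def\<close>)
  moreover have "\<mu> j = 0" for j using z[of j] D by (cases "j \<in> {1..n}") (auto simp: supp_def)
  ultimately show ?thesis by (simp add: fun_eq_iff)
 qed
 obtain \<mu> x where s: "\<sigma> = (\<mu>, x)" by (cases \<sigma>)
 obtain K :: nat where "2 * \<mu> 1 <= of_nat K"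
  using real_arch_simple[of "of_rat (2 * \<mu> 1)"] by (metis of_rat_less_eq of_rat_of_nat_eq)
 thus ?thesis using p unfolding s
 proof (induction K arbitrary: \<mu> x)
  case (0 \<mu> x)
  hence "\<mu> = 0 \<and> x = 0" using zero[of \<mu> x] by simp
  thus ?case by (intro exI[of _ "[]"]) (auto simp: zero_prod_def zero_fun_def)
 next
  case (Suc K \<mu> x)
  show ?case
  proof (cases "\<mu> 1 > 0")
   case False
   hence "\<mu> = 0 \<and> x = 0" using Suc.prems zero[of \<mu> x] by simp
   thus ?thesis by (intro exI[of _ "[]"]) (auto simp: zero_prod_def zero_fun_def)
  next
   case True
   obtain \<nu> y where y: "(\<nu>, y) \<in> pattern_signatures X n" "\<nu> \<in> generator_weights X n" "(\<mu> - \<nu>, x - y) \<in> pattern_signatures X n" "1/2 <= \<nu> 1"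
    using pattern_signatures_peel[OF n Suc.prems(2) True] by blast
   have "2 * (\<mu> - \<nu>) 1 <= of_nat K" using Suc.prems(1) y(4) by (simp add: of_nat_Suc)
   from Suc.IH[OF this y(3)] obtain \<sigma>s where
    t: "set \<sigma>s \<subseteq> {\<sigma> \<in> pattern_signatures X n. fst \<sigma> \<in> generator_weights X n}" "sum_list \<sigma>s = (\<mu> - \<nu>, x - y)" by blast
   show ?thesis using t y(1,2) by (intro exI[of _ "(\<nu>, y) # \<sigma>s"]) simp
  qed
 qed
qed

lemma coroot_pairing_add: "coroot_pairing n (\<mu> + \<nu>) \<alpha> = coroot_pairing n \<mu> \<alpha> + coroot_pairing n \<nu> \<alpha>"
 and coroot_pairing_scale: "coroot_pairing n (%i. c * \<mu> i) \<alpha> = c * coroot_pairing n \<mu> \<alpha>"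
 by (simp_all add: coroot_pairing_def weight_inner_def distrib_left distrib_right sum.distrib add_divide_distrib sum_distrib_left mult.assoc mult.left_commute)

lemma dominant_add:
 assumes "\<mu> \<in> dominant_weights X n" "\<nu> \<in> dominant_weights X n"
 shows "\<mu> + \<nu> \<in> dominant_weights X n"
 using assms by (auto simp: dominant_weights_def weight_lattice_def coroot_pairing_add)

text \<open>The property \<open>Q\<close>, dominance and the inequalities without integrality, is
  closed under sums and nonnegative multiples; integrality is then supplied by the lattice.\<close>

lemma pattern_cone:
 assumes n: "n \<ge> 1"
 shows "rational_cone (pattern_signatures X n) \<inter> signature_lattice X n \<subseteq> pattern_signatures X n"
proof
 fix \<sigma> assume s: "\<sigma> \<in> rational_cone (pattern_signatures X n) \<inter> signature_lattice X n"
 then obtain A c where A: "finite A" "A \<subseteq> pattern_signatures X n" "\<forall>\<tau>\<in>A. 0 <= c \<tau>" "\<sigma> = (\<Sum>\<tau>\<in>A. signature_scale (c \<tau>) \<tau>)"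
  by (auto simp: rational_cone_def)
 define Q :: "signature => bool" where "Q \<tau> \<longleftrightarrow> (\<forall>\<alpha>\<in>pos_roots X n. 0 <= coroot_pairing n (fst \<tau>) \<alpha>) \<and> patX X n (fst \<tau>) (qp (snd \<tau>))" for \<tau>
 have pat0: "patD r (%_. 0) (%m s i. 0)" for r by (induction r) (simp_all add: relD_def)
 have "Q (\<Sum>\<tau>\<in>A. signature_scale (c \<tau>) \<tau>)"
  using A(1-3)
 proof (induction A rule: finite_induct)
  case empty
  have "patX X n (%_. 0) (%m s i. 0)" by (cases X) (simp_all add: pat0 relB_def)
  thus ?case by (simp add: Q_def qp_def zero_fun_def coroot_pairing_def weight_inner_def)
 next
  case (insert \<tau> A)
  obtain \<mu> x where t: "\<tau> = (\<mu>, x)" by (cases \<tau>)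
  have "Q (signature_scale (c \<tau>) \<tau>)"
   using insert.prems patX_scale[of "c \<tau>" X n \<mu> "qp x"] unfolding t
   by (auto simp: Q_def signature_scale_def coroot_pairing_scale qp_def pattern_signatures_def dominant_weights_def)
  moreover have "Q (\<Sum>\<tau>\<in>A. signature_scale (c \<tau>) \<tau>)" using insert by simp
  moreover have "Q (\<rho> + \<rho>')" if "Q \<rho>" "Q \<rho>'" for \<rho> \<rho>'
  proof -
   have "patX X n (%k. fst \<rho> k + fst \<rho>' k) (%m s i. qp (snd \<rho>) m s i + qp (snd \<rho>') m s i)"
    using that by (intro patX_add) (simp_all add: Q_def)
   moreover have "(%k. fst \<rho> k + fst \<rho>' k) = fst (\<rho> + \<rho>')" "(%m s i. qp (snd \<rho>) m s i + qp (snd \<rho>') m s i) = qp (snd (\<rho> + \<rho>'))"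
    by (simp_all add: fun_eq_iff qp_def)
   ultimately show ?thesis using that unfolding Q_def fst_add coroot_pairing_add by simp
  qed
  ultimately show ?case using insert.hyps by simp
 qed
 hence "Q \<sigma>" unfolding A(4) .
 moreover have "\<sigma> \<in> signature_lattice X n" using s by simp
 ultimately show "\<sigma> \<in> pattern_signatures X n"
  by (cases \<sigma>) (auto simp: Q_def signature_lattice_def pattern_signatures_def dominant_weights_def)
qed

theorem theorem2:
  fixes X :: lie_type and n :: nat
    and e :: "weight \<Rightarrow> complex mat"
    and sc :: "complex \<Rightarrow> 'v \<Rightarrow> 'v::ab_group_add"
    and V :: "weight \<Rightarrow> 'v set"
    and act :: "weight \<Rightarrow> complex mat \<Rightarrow> 'v \<Rightarrow> 'v"
    and v :: "weight \<Rightarrow> 'v"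
  assumes "n \<ge> 2"
    and "root_vectors X n e"
    and "vector_space sc"
    and "\<And>\<mu>. \<mu> \<in> dominant_weights X n \<Longrightarrow>
           irreducible_highest_weight_module X n sc (V \<mu>) (act \<mu>) \<mu> (v \<mu>)"
  shows "let S = essential_signatures X n e sc act v in
           saturated X n S \<and>
           S = generated_semigroup {\<sigma> \<in> S. fst \<sigma> \<in> generator_weights X n}"
proof -
 let ?S = "essential_signatures X n e sc act v" and ?P = "pattern_signatures X n" and ?G = "generator_weights X n"
 have n1: "n \<ge> 1" using assms(1) by simp
 have mo: "\<exists>F. int_rep sc X n F \<and> so_rep.hwX sc X n F \<mu> {0} (v \<mu>) \<and> v \<mu> \<noteq> 0 \<and> so_rep.nil_vec X n F (v \<mu>) \<and>
   (\<forall>p. essential X n e sc (act \<mu>) (v \<mu>) p \<longleftrightarrow> so_rep.ess sc X n F (qp p) (v \<mu>))"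
  if "\<mu> \<in> dominant_weights X n" for \<mu>
  by (rule module_operators[OF assms(1-3) that assms(4)[OF that]])
 have qr: "qp (%\<alpha>. of_nat (p \<alpha>)) = rats (qp p)" for p by (simp add: qp_def)
 have SE: "\<sigma> \<in> ?S \<longleftrightarrow> (\<exists>\<mu> p. \<sigma> = (\<mu>, %\<alpha>. of_nat (p \<alpha>)) \<and> \<mu> \<in> dominant_weights X n \<and> p \<in> exponents X n \<and> essential X n e sc (act \<mu>) (v \<mu>) p)"
  for \<sigma> by (simp only: essential_signatures_def mem_Collect_eq)
 have SP: "\<sigma> \<in> ?P" if S: "\<sigma> \<in> ?S" for \<sigma>
 proof -
  obtain \<mu> p where s: "\<sigma> = (\<mu>, %\<alpha>. of_nat (p \<alpha>))" "\<mu> \<in> dominant_weights X n" "p \<in> exponents X n" "essential X n e sc (act \<mu>) (v \<mu>) p"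
   using S[unfolded SE] by auto
  obtain F where F: "int_rep sc X n F" "so_rep.hwX sc X n F \<mu> {0} (v \<mu>)" "so_rep.ess sc X n F (qp p) (v \<mu>)"
   using mo[OF s(2)] s(4) by blast
  interpret f: int_rep sc X n F by (rule F(1))
  have "patX X n \<mu> (rats (qp p))"
  proof (rule ccontr)
   assume "\<not> ?thesis"
   from f.upperX[OF F(2) n1 this] show False using F(3) by (simp add: f.ess_def)
  qed
  thus ?thesis using s(2,3) unfolding s(1) pattern_signatures_def mem_Collect_eq prod.case qr by (simp add: exponents_def)
 qed
 \<comment> \<open>The monomials are shown to be essential directly only for generator rows; all
   other patterns are reached through \<open>add\<close>.\<close>
 have PS: "\<sigma> \<in> ?S" if p: "\<sigma> \<in> ?P" and g: "gtype n (fst \<sigma>)" for \<sigma>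
 proof -
  obtain \<mu> x where s: "\<sigma> = (\<mu>, x)" "\<mu> \<in> dominant_weights X n" "\<And>\<alpha>. \<alpha> \<notin> pos_roots X n ==> x \<alpha> = 0"
   "\<And>\<alpha>. \<alpha> \<in> pos_roots X n ==> x \<alpha> \<in> \<int>" "patX X n \<mu> (qp x)"
   using p by (auto simp: pattern_signatures_def)
  define p where "p \<alpha> = nat \<lfloor>x \<alpha>\<rfloor>" for \<alpha>
  have "of_nat (p \<alpha>) = x \<alpha>" for \<alpha>
  proof (cases "\<alpha> \<in> pos_roots X n")
   case True
   then obtain t where t: "t \<in> tris X n" "\<alpha> = rt t" using pos_roots_rt[OF n1] by auto
   obtain m s i where ms: "t = (m, s, i)" by (cases t)
   have "0 <= x \<alpha>" using patX_nonneg[OF s(5) t(1)[unfolded ms]] unfolding t(2) ms qp_def .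
   moreover obtain z where "x \<alpha> = of_int z" using s(4)[OF True] by (auto elim: Ints_cases)
   ultimately show ?thesis by (simp add: p_def)
  qed (simp add: p_def s(3))
  hence x: "x = (%\<alpha>. of_nat (p \<alpha>))" by (simp add: fun_eq_iff)
  have pe: "p \<in> exponents X n" using s(3) by (simp add: exponents_def p_def)
  obtain F where F: "int_rep sc X n F" "so_rep.hwX sc X n F \<mu> {0} (v \<mu>)" "v \<mu> \<noteq> 0"
   "essential X n e sc (act \<mu>) (v \<mu>) p \<longleftrightarrow> so_rep.ess sc X n F (qp p) (v \<mu>)" using mo[OF s(2)] by blast
  interpret f: int_rep sc X n F by (rule F(1))
  have "patX X n \<mu> (rats (qp p))" using s(5) unfolding x qr .
  moreover have "gtype n \<mu>" using g s(1) by simp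
  ultimately have "f.ess (qp p) (v \<mu>)" using f.lowerX[OF F(2) n1] F(3) by (simp add: f.ess_def)
  thus ?thesis using F(4) s(2) pe unfolding s(1) x essential_signatures_def by blast
 qed
 have add: "\<sigma> + \<tau> \<in> ?S" if st: "\<sigma> \<in> ?S" "\<tau> \<in> ?S" for \<sigma> \<tau>
 proof -
  obtain \<mu> p where s: "\<sigma> = (\<mu>, %\<alpha>. of_nat (p \<alpha>))" "\<mu> \<in> dominant_weights X n" "p \<in> exponents X n" "essential X n e sc (act \<mu>) (v \<mu>) p"
   using st(1)[unfolded SE] by auto
  obtain \<nu> q where t: "\<tau> = (\<nu>, %\<alpha>. of_nat (q \<alpha>))" "\<nu> \<in> dominant_weights X n" "q \<in> exponents X n" "essential X n e sc (act \<nu>) (v \<nu>) q"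
   using st(2)[unfolded SE] by auto
  have d: "\<mu> + \<nu> \<in> dominant_weights X n" by (rule dominant_add[OF s(2) t(2)])
  obtain F1 where F1: "int_rep sc X n F1" "so_rep.hwX sc X n F1 \<mu> {0} (v \<mu>)" "so_rep.nil_vec X n F1 (v \<mu>)" "so_rep.ess sc X n F1 (qp p) (v \<mu>)"
   using mo[OF s(2)] s(4) by blast
  obtain F2 where F2: "int_rep sc X n F2" "so_rep.hwX sc X n F2 \<nu> {0} (v \<nu>)" "so_rep.nil_vec X n F2 (v \<nu>)" "so_rep.ess sc X n F2 (qp q) (v \<nu>)"
   using mo[OF t(2)] t(4) by blast
  obtain F3 where F3: "int_rep sc X n F3" "so_rep.hwX sc X n F3 (\<mu> + \<nu>) {0} (v (\<mu> + \<nu>))" "so_rep.nil_vec X n F3 (v (\<mu> + \<nu>))" "v (\<mu> + \<nu>) \<noteq> 0"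
   "\<And>p. essential X n e sc (act (\<mu> + \<nu>)) (v (\<mu> + \<nu>)) p \<longleftrightarrow> so_rep.ess sc X n F3 (qp p) (v (\<mu> + \<nu>))"
   using mo[OF d] by blast
  have "so_rep.ess sc X n F3 (%m s i. qp p m s i + qp q m s i) (v (\<mu> + \<nu>))"
   by (rule ess_add[OF int_rep.axioms(1)[OF F1(1)] int_rep.axioms(1)[OF F2(1)] int_rep.axioms(1)[OF F3(1)] F1(2,3) F2(2,3) F3(2-4) F1(4) F2(4)])
  moreover have "(%m s i. qp p m s i + qp q m s i) = qp (%\<alpha>. p \<alpha> + q \<alpha>)" by (simp add: qp_def)
  ultimately have "essential X n e sc (act (\<mu> + \<nu>)) (v (\<mu> + \<nu>)) (%\<alpha>. p \<alpha> + q \<alpha>)" using F3(5) by simp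
  moreover have "(%\<alpha>. p \<alpha> + q \<alpha>) \<in> exponents X n" using s(3) t(3) by (simp add: exponents_def)
  moreover have "\<sigma> + \<tau> = (\<mu> + \<nu>, %\<alpha>. of_nat (p \<alpha> + q \<alpha>))" by (simp add: s(1) t(1) fun_eq_iff)
  ultimately show ?thesis using d unfolding SE by (intro exI conjI)
 qed
 have zero: "0 \<in> ?S"
 proof (rule PS)
  have "patD r (%_. 0) (%m s i. 0)" for r by (induction r) (simp_all add: relD_def)
  hence "patX X n 0 (qp 0)" by (cases X) (simp_all add: relB_def qp_def zero_fun_def)
  moreover have "(0::weight) \<in> dominant_weights X n" unfolding dominant_iff[OF n1] by (simp add: supp_0)
  ultimately show "0 \<in> ?P" by (simp add: pattern_signatures_def zero_prod_def)
  show "gtype n (fst 0)" unfolding gtype_def using n1 by (intro disjI1 exI[of _ 0]) auto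
 qed
 have sum: "sum_list \<sigma>s \<in> ?S" if "set \<sigma>s \<subseteq> ?S" for \<sigma>s
  using that by (induction \<sigma>s) (use zero add in auto)
 have GP: "{\<sigma> \<in> ?P. fst \<sigma> \<in> ?G} \<subseteq> ?S" using PS generator_gtype[OF assms(1)] by blast
 have eq: "?S = ?P"
 proof
  show "?P \<subseteq> ?S"
  proof
   fix \<sigma> assume "\<sigma> \<in> ?P"
   then obtain \<sigma>s where "set \<sigma>s \<subseteq> {\<sigma> \<in> ?P. fst \<sigma> \<in> ?G}" "sum_list \<sigma>s = \<sigma>" using pattern_signatures_generated[OF assms(1)] by blast
   thus "\<sigma> \<in> ?S" using sum[of \<sigma>s] GP by auto
  qed
 qed (use SP in blast)
 have "\<sigma> \<in> rational_cone ?P \<inter> signature_lattice X n" if s: "\<sigma> \<in> ?P" for \<sigma>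
 proof
  have "signature_scale 1 \<sigma> = \<sigma>" by (simp add: signature_scale_def)
  thus "\<sigma> \<in> rational_cone ?P"
   unfolding rational_cone_def using s by (intro CollectI exI[of _ "{\<sigma>}"] exI[of _ "%_. 1"]) simp
  show "\<sigma> \<in> signature_lattice X n" using s by (auto simp: pattern_signatures_def signature_lattice_def dominant_weights_def)
 qed
 hence "saturated X n ?S" unfolding saturated_def eq using pattern_cone[OF n1] by blast
 moreover have "?S = generated_semigroup {\<sigma> \<in> ?S. fst \<sigma> \<in> ?G}"
 proof
  show "?S \<subseteq> generated_semigroup {\<sigma> \<in> ?S. fst \<sigma> \<in> ?G}"
   unfolding eq generated_semigroup_def using pattern_signatures_generated[OF assms(1)] by blast
  show "generated_semigroup {\<sigma> \<in> ?S. fst \<sigma> \<in> ?G} \<subseteq> ?S"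
   unfolding generated_semigroup_def using sum by blast
 qed
 ultimately show ?thesis unfolding Let_def by blast
qed

end
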